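(* Fix a (possibly empty) set of primes $\Sigma$ with formal product $p=\prod_{\ell\in\Sigma}\ell$. Let $V$ be a valuative monoid and let $\vartheta\colon V\to P$ be an sfp map of saturated monoids. Suppose that either $p=1$ (i.e. $\Sigma=\varnothing$) or $V\to P$ is étale. Then there exists a Kummer étale map $V\to W$ such that the saturated base change $W\to Q=(W\oplus_V P)^{\mathrm{sat}}$ is a saturated morphism of finite presentation.
   Context: All monoids are commutative, written additively. For a monoid $P$, $P^{\mathrm{gp}}$ is its group completion; $P$ is integral if $P\to P^{\mathrm{gp}}$ is injective, and saturated if it is integral and $np\in P$ with $p\in P^{\mathrm{gp}}$, $n\ge1$ implies $p\in P$. $P^{\mathrm{int}}$ and $P^{\mathrm{sat}}$ denote integralisation and saturation (left adjoints to the inclusions of integral, resp. saturated monoids into monoids). $\oplus$ denotes pushout in the category of monoids. A monoid $V$ is valuative if it is integral and for every $x\in V^{\mathrm{gp}}$ either $x\in V$ or $-x\in V$ (it is then saturated). A monoid homomorphism $P\to Q$ is of finite presentation if $Q$ is isomorphic over $P$ to the quotient of some $P\oplus\mathbb{N}^r$ by the congruence generated by finitely many pairs. A morphism of saturated monoids $P\to Q$ is sfp if it factors as $P\to Q'\to Q$ with $P\to Q'$ of finite presentation and $(Q')^{\mathrm{sat}}\cong Q$ induced by $Q'\to Q$. It is smooth (relative to $\Sigma$) if it is sfp and the kernel and the torsion part of the cokernel of $P^{\mathrm{gp}}\to Q^{\mathrm{gp}}$ are finite of order prime to all $\ell\in\Sigma$; étale if it is smooth and the cokernel of $P^{\mathrm{gp}}\to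 Q^{\mathrm{gp}}$ is torsion; Kummer étale if it is injective, étale, and exact, where $\vartheta\colon P\to Q$ is exact if $P=(\vartheta^{\mathrm{gp}})^{-1}(Q)$. A homomorphism $P\to Q$ of integral monoids is integral if for every homomorphism $P\to P'$ into an integral monoid, $P'\oplus_PQ=(P'\oplus_PQ)^{\mathrm{int}}$. It is saturated if it is integral, $P$ and $Q$ are saturated, and for every homomorphism $P\to P'$ into a saturated monoid, $P'\oplus_PQ=(P'\oplus_PQ)^{\mathrm{sat}}$. *)

theory Defs
  imports "HOL-Algebra.Coset" "HOL-Algebra.FiniteProduct" "HOL-Computational_Algebra.Primes"
begin

text \<open>
  Commutative monoids are records of type \<^typ>\<open>'a monoid\<close>, hence written multiplicatively:
  the additive multiple \<open>n p\<close> is the power \<open>p [^] n\<close>, and \<open>0\<close> is \<open>\<one>\<close>.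
\<close>

section \<open>Monoid homomorphisms, congruences and quotients\<close>

text \<open>For monoids, \<^const>\<open>hom\<close> does not imply that the unit is preserved.\<close>

definition mhom :: "'a monoid \<Rightarrow> 'b monoid \<Rightarrow> ('a \<Rightarrow> 'b) set" where
  "mhom M N = {f \<in> hom M N. f \<one>\<^bsub>M\<^esub> = \<one>\<^bsub>N\<^esub>}"

inductive_set gen_cong :: "'a monoid \<Rightarrow> ('a \<times> 'a) set \<Rightarrow> ('a \<times> 'a) set"
  for M :: "'a monoid" and S :: "('a \<times> 'a) set" where
  gen_cong_base: "(x, y) \<in> S \<Longrightarrow> x \<in> carrier M \<Longrightarrow> y \<in> carrier M \<Longrightarrow> (x, y) \<in> gen_cong M S"
| gen_cong_refl: "x \<in> carrier M \<Longrightarrow> (x, x) \<in> gen_cong M S"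
| gen_cong_sym: "(x, y) \<in> gen_cong M S \<Longrightarrow> (y, x) \<in> gen_cong M S"
| gen_cong_trans: "(x, y) \<in> gen_cong M S \<Longrightarrow> (y, z) \<in> gen_cong M S \<Longrightarrow> (x, z) \<in> gen_cong M S"
| gen_cong_mult: "(x, y) \<in> gen_cong M S \<Longrightarrow> (x', y') \<in> gen_cong M S \<Longrightarrow>
    (x \<otimes>\<^bsub>M\<^esub> x', y \<otimes>\<^bsub>M\<^esub> y') \<in> gen_cong M S"

definition quotient_monoid :: "'a monoid \<Rightarrow> ('a \<times> 'a) set \<Rightarrow> 'a set monoid" where
  "quotient_monoid M R =
    \<lparr>carrier = carrier M // R,
     monoid.mult = (\<lambda>A B. \<Union>a\<in>A. \<Union>b\<in>B. R `` {a \<otimes>\<^bsub>M\<^esub> b}),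
     monoid.one = R `` {\<one>\<^bsub>M\<^esub>}\<rparr>"

section \<open>Pushouts\<close>

text \<open>The pushout of \<open>A \<leftarrow> P \<rightarrow> B\<close> along \<open>f\<close> and \<open>g\<close>: the quotient of the product (which is the
  coproduct of commutative monoids) identifying \<open>(f p, 1)\<close> with \<open>(1, g p)\<close>.\<close>

definition pushout_cong ::
  "'p monoid \<Rightarrow> 'a monoid \<Rightarrow> 'b monoid \<Rightarrow> ('p \<Rightarrow> 'a) \<Rightarrow> ('p \<Rightarrow> 'b) \<Rightarrow> (('a \<times> 'b) \<times> ('a \<times> 'b)) set"
where
  "pushout_cong P A B f g =
    gen_cong (A \<times>\<times> B) ((\<lambda>p. ((f p, \<one>\<^bsub>B\<^esub>), (\<one>\<^bsub>A\<^esub>, g p))) ` carrier P)"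

definition pushout ::
  "'p monoid \<Rightarrow> 'a monoid \<Rightarrow> 'b monoid \<Rightarrow> ('p \<Rightarrow> 'a) \<Rightarrow> ('p \<Rightarrow> 'b) \<Rightarrow> ('a \<times> 'b) set monoid" where
  "pushout P A B f g = quotient_monoid (A \<times>\<times> B) (pushout_cong P A B f g)"

definition pushout_inl ::
  "'p monoid \<Rightarrow> 'a monoid \<Rightarrow> 'b monoid \<Rightarrow> ('p \<Rightarrow> 'a) \<Rightarrow> ('p \<Rightarrow> 'b) \<Rightarrow> 'a \<Rightarrow> ('a \<times> 'b) set" where
  "pushout_inl P A B f g a = pushout_cong P A B f g `` {(a, \<one>\<^bsub>B\<^esub>)}"

definition pushout_inr ::
  "'p monoid \<Rightarrow> 'a monoid \<Rightarrow> 'b monoid \<Rightarrow> ('p \<Rightarrow> 'a) \<Rightarrow> ('p \<Rightarrow> 'b) \<Rightarrow> 'b \<Rightarrow> ('a \<times> 'b) set" where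
  "pushout_inr P A B f g b = pushout_cong P A B f g `` {(\<one>\<^bsub>A\<^esub>, b)}"

section \<open>Group completion, integralisation, saturation\<close>

text \<open>Group completion as classes of pairs \<open>(a, b)\<close>, standing for the difference of \<open>a\<close> and \<open>b\<close>.\<close>

definition gp_rel :: "'a monoid \<Rightarrow> (('a \<times> 'a) \<times> ('a \<times> 'a)) set" where
  "gp_rel M = {((a, b), (c, d)) | a b c d. a \<in> carrier M \<and> b \<in> carrier M \<and> c \<in> carrier M \<and>
     d \<in> carrier M \<and> (\<exists>t\<in>carrier M. a \<otimes>\<^bsub>M\<^esub> d \<otimes>\<^bsub>M\<^esub> t = c \<otimes>\<^bsub>M\<^esub> b \<otimes>\<^bsub>M\<^esub> t)}"

definition gp :: "'a monoid \<Rightarrow> ('a \<times> 'a) set monoid" where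
  "gp M = quotient_monoid (M \<times>\<times> M) (gp_rel M)"

definition gp_of :: "'a monoid \<Rightarrow> 'a \<Rightarrow> ('a \<times> 'a) set" where
  "gp_of M a = gp_rel M `` {(a, \<one>\<^bsub>M\<^esub>)}"

definition gp_map :: "'b monoid \<Rightarrow> ('a \<Rightarrow> 'b) \<Rightarrow> ('a \<times> 'a) set \<Rightarrow> ('b \<times> 'b) set" where
  "gp_map N f X = (\<Union>(a, b)\<in>X. gp_rel N `` {(f a, f b)})"

definition integralisation :: "'a monoid \<Rightarrow> ('a \<times> 'a) set monoid" where
  "integralisation M = (gp M)\<lparr>carrier := gp_of M ` carrier M\<rparr>"

definition saturation :: "'a monoid \<Rightarrow> ('a \<times> 'a) set monoid" where
  "saturation M = (gp M)\<lparr>carrier :=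
     {x \<in> carrier (gp M). \<exists>n::nat. n \<ge> 1 \<and> x [^]\<^bsub>gp M\<^esub> n \<in> gp_of M ` carrier M}\<rparr>"

text \<open>The units \<open>M \<rightarrow> integralisation M\<close> and \<open>M \<rightarrow> saturation M\<close> are both given by \<^const>\<open>gp_of\<close>.
  The universal properties are \<open>gp_universal\<close>, \<open>integralisation_universal\<close> and
  \<open>saturation_universal\<close> below (and \<open>pushout_universal\<close> for pushouts).\<close>

definition integral_monoid :: "'a monoid \<Rightarrow> bool" where
  "integral_monoid M \<longleftrightarrow> comm_monoid M \<and> inj_on (gp_of M) (carrier M)"

definition saturated_monoid :: "'a monoid \<Rightarrow> bool" where
  "saturated_monoid M \<longleftrightarrow> integral_monoid M \<and>
     (\<forall>x\<in>carrier (gp M). \<forall>n::nat. n \<ge> 1 \<longrightarrow> x [^]\<^bsub>gp M\<^esub> n \<in> gp_of M ` carrier M \<longrightarrow>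
        x \<in> gp_of M ` carrier M)"

definition valuative_monoid :: "'a monoid \<Rightarrow> bool" where
  "valuative_monoid M \<longleftrightarrow> integral_monoid M \<and>
     (\<forall>x\<in>carrier (gp M). x \<in> gp_of M ` carrier M \<or> inv\<^bsub>gp M\<^esub> x \<in> gp_of M ` carrier M)"

section \<open>Finiteness conditions, smooth and etale homomorphisms\<close>

text \<open>\<open>free_cmonoid r\<close> is the free commutative monoid of rank \<open>r\<close>, written multiplicatively.\<close>

definition free_cmonoid :: "nat \<Rightarrow> (nat \<Rightarrow> nat) monoid" where
  "free_cmonoid r = \<lparr>carrier = {m. \<forall>i\<ge>r. m i = 0}, monoid.mult = (\<lambda>m n i. m i + n i), monoid.one = (\<lambda>_. 0)\<rparr>"

definition finitely_presented_hom :: "'a monoid \<Rightarrow> 'b monoid \<Rightarrow> ('a \<Rightarrow> 'b) \<Rightarrow> bool" where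
  "finitely_presented_hom P Q f \<longleftrightarrow> comm_monoid P \<and> comm_monoid Q \<and> f \<in> mhom P Q \<and>
    (\<exists>r S \<phi>. finite S \<and>
       S \<subseteq> carrier (P \<times>\<times> free_cmonoid r) \<times> carrier (P \<times>\<times> free_cmonoid r) \<and>
       \<phi> \<in> iso (quotient_monoid (P \<times>\<times> free_cmonoid r) (gen_cong (P \<times>\<times> free_cmonoid r) S)) Q \<and>
       (\<forall>p\<in>carrier P. \<phi> (gen_cong (P \<times>\<times> free_cmonoid r) S `` {(p, \<one>\<^bsub>free_cmonoid r\<^esub>)}) = f p))"

text \<open>Every monoid finitely presented over \<open>P :: 'a monoid\<close> has, by definition, an isomorphic copy
  \<open>Q' :: 'a fg_alg monoid\<close>, and the saturation of the latter has type \<open>'a sat_alg monoid\<close>.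
  Existential quantification over these types is therefore no restriction: see
  \<open>sfp_hom_any_type\<close> for the intermediate monoid of \<open>sfp_hom\<close>, and \<open>sfp_hom_copy\<close> for the
  codomain of an sfp homomorphism.\<close>

type_synonym 'a fg_alg = "('a \<times> (nat \<Rightarrow> nat)) set"
type_synonym 'a sat_alg = "('a fg_alg \<times> 'a fg_alg) set"

definition sfp_hom :: "'a monoid \<Rightarrow> 'b monoid \<Rightarrow> ('a \<Rightarrow> 'b) \<Rightarrow> bool" where
  "sfp_hom P Q f \<longleftrightarrow> saturated_monoid P \<and> saturated_monoid Q \<and> f \<in> mhom P Q \<and>
    (\<exists>(Q' :: 'a fg_alg monoid) g h. finitely_presented_hom P Q' g \<and> h \<in> mhom Q' Q \<and>
       (\<forall>p\<in>carrier P. h (g p) = f p) \<and>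
       (\<exists>\<phi> \<in> iso (saturation Q') Q. \<forall>x\<in>carrier Q'. \<phi> (gp_of Q' x) = h x))"

definition torsion_part :: "'a monoid \<Rightarrow> 'a set" where
  "torsion_part G = {x \<in> carrier G. \<exists>n::nat. n \<ge> 1 \<and> x [^]\<^bsub>G\<^esub> n = \<one>\<^bsub>G\<^esub>}"

definition gp_kernel :: "'a monoid \<Rightarrow> 'b monoid \<Rightarrow> ('a \<Rightarrow> 'b) \<Rightarrow> ('a \<times> 'a) set set" where
  "gp_kernel P Q f = kernel (gp P) (gp Q) (gp_map Q f)"

definition gp_cokernel ::
  "'a monoid \<Rightarrow> 'b monoid \<Rightarrow> ('a \<Rightarrow> 'b) \<Rightarrow> ('b \<times> 'b) set set monoid" where
  "gp_cokernel P Q f = gp Q Mod (gp_map Q f ` carrier (gp P))"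

definition finite_order_prime_to :: "nat set \<Rightarrow> 'a set \<Rightarrow> bool" where
  "finite_order_prime_to \<Sigma> A \<longleftrightarrow> finite A \<and> (\<forall>l\<in>\<Sigma>. coprime (card A) l)"

definition smooth_hom :: "nat set \<Rightarrow> 'a monoid \<Rightarrow> 'b monoid \<Rightarrow> ('a \<Rightarrow> 'b) \<Rightarrow> bool" where
  "smooth_hom \<Sigma> P Q f \<longleftrightarrow> sfp_hom P Q f \<and>
     finite_order_prime_to \<Sigma> (gp_kernel P Q f) \<and>
     finite_order_prime_to \<Sigma> (torsion_part (gp_cokernel P Q f))"

definition etale_hom :: "nat set \<Rightarrow> 'a monoid \<Rightarrow> 'b monoid \<Rightarrow> ('a \<Rightarrow> 'b) \<Rightarrow> bool" where
  "etale_hom \<Sigma> P Q f \<longleftrightarrow> smooth_hom \<Sigma> P Q f \<and>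
     torsion_part (gp_cokernel P Q f) = carrier (gp_cokernel P Q f)"

definition exact_hom :: "'a monoid \<Rightarrow> 'b monoid \<Rightarrow> ('a \<Rightarrow> 'b) \<Rightarrow> bool" where
  "exact_hom P Q f \<longleftrightarrow>
     gp_of P ` carrier P = {x \<in> carrier (gp P). gp_map Q f x \<in> gp_of Q ` carrier Q}"

definition kummer_etale_hom :: "nat set \<Rightarrow> 'a monoid \<Rightarrow> 'b monoid \<Rightarrow> ('a \<Rightarrow> 'b) \<Rightarrow> bool" where
  "kummer_etale_hom \<Sigma> P Q f \<longleftrightarrow>
     inj_on f (carrier P) \<and> etale_hom \<Sigma> P Q f \<and> exact_hom P Q f"

section \<open>Integral and saturated homomorphisms\<close>

text \<open>The test monoids \<open>P'\<close> range over the type \<open>'a sat_alg\<close>. This is no restriction: by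
  \<open>integral_hom_all_types\<close> and \<open>saturated_hom_all_types\<close> below, the conditions then hold
  for test monoids over every type.\<close>

definition integral_hom :: "'a monoid \<Rightarrow> 'b monoid \<Rightarrow> ('a \<Rightarrow> 'b) \<Rightarrow> bool" where
  "integral_hom P Q f \<longleftrightarrow> integral_monoid P \<and> integral_monoid Q \<and> f \<in> mhom P Q \<and>
    (\<forall>(P' :: 'a sat_alg monoid) g. integral_monoid P' \<and> g \<in> mhom P P' \<longrightarrow>
       gp_of (pushout P P' Q g f) \<in> iso (pushout P P' Q g f) (integralisation (pushout P P' Q g f)))"

definition saturated_hom :: "'a monoid \<Rightarrow> 'b monoid \<Rightarrow> ('a \<Rightarrow> 'b) \<Rightarrow> bool" where
  "saturated_hom P Q f \<longleftrightarrow> integral_hom P Q f \<and> saturated_monoid P \<and> saturated_monoid Q \<and>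
    (\<forall>(P' :: 'a sat_alg monoid) g. saturated_monoid P' \<and> g \<in> mhom P P' \<longrightarrow>
       gp_of (pushout P P' Q g f) \<in> iso (pushout P P' Q g f) (saturation (pushout P P' Q g f)))"

section \<open>Basic facts\<close>

lemma pow_rec:
  "x [^]\<^bsub>M\<^esub> (0::nat) = \<one>\<^bsub>M\<^esub>" "x [^]\<^bsub>M\<^esub> Suc n = x [^]\<^bsub>M\<^esub> n \<otimes>\<^bsub>M\<^esub> x"
  by (simp_all add: nat_pow_def)

definition mcong :: "'a monoid \<Rightarrow> ('a \<times> 'a) set \<Rightarrow> bool" where
  "mcong M R \<longleftrightarrow> equiv (carrier M) R \<and>
    (\<forall>x y x' y'. (x, y) \<in> R \<longrightarrow> (x', y') \<in> R \<longrightarrow> (x \<otimes>\<^bsub>M\<^esub> x', y \<otimes>\<^bsub>M\<^esub> y') \<in> R)"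

lemma gen_cong_carrier:
  assumes "comm_monoid M" and "(x, y) \<in> gen_cong M S"
  shows "x \<in> carrier M \<and> y \<in> carrier M"
proof -
  interpret comm_monoid M by fact
  show ?thesis using assms(2) by induction auto
qed

lemma mcong_gen_cong:
  assumes "comm_monoid M" shows "mcong M (gen_cong M S)"
proof -
  have "equiv (carrier M) (gen_cong M S)"
    unfolding equiv_def refl_on_def sym_def trans_def
    using gen_cong_carrier[OF assms] by (auto intro: gen_cong_refl gen_cong_sym gen_cong_trans)
  then show ?thesis unfolding mcong_def by (auto intro: gen_cong_mult)
qed

lemma gen_cong_least:
  assumes "mcong M R" and "S \<subseteq> R" and "(x, y) \<in> gen_cong M S"
  shows "(x, y) \<in> R"
  using assms(3)
proof induction
  case (gen_cong_refl x)
  then show ?case using assms(1) unfolding mcong_def equiv_def refl_on_def by blast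
next
  case (gen_cong_sym x y)
  then show ?case using assms(1) unfolding mcong_def equiv_def sym_def by blast
next
  case (gen_cong_trans x y z)
  then show ?case using assms(1) unfolding mcong_def equiv_def trans_def by blast
next
  case (gen_cong_mult x y x' y')
  then show ?case using assms(1) unfolding mcong_def by blast
qed (use assms in auto)

context
  fixes M :: "'a monoid" and R :: "('a \<times> 'a) set"
  assumes cm: "comm_monoid M" and mc: "mcong M R"
begin

interpretation comm_monoid M by (fact cm)

lemma eqv: "equiv (carrier M) R" using mc by (simp add: mcong_def)

lemma quot_class_in: "a \<in> carrier M \<Longrightarrow> R `` {a} \<in> carrier (quotient_monoid M R)"
  by (simp add: quotient_monoid_def quotientI)

lemma quot_obtain:
  assumes "X \<in> carrier (quotient_monoid M R)"
  obtains a where "a \<in> carrier M" "X = R `` {a}"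
  using assms by (auto simp: quotient_monoid_def elim: quotientE)

lemma quot_class_eq:
  "a \<in> carrier M \<Longrightarrow> b \<in> carrier M \<Longrightarrow> R `` {a} = R `` {b} \<longleftrightarrow> (a, b) \<in> R"
  using eqv by (meson eq_equiv_class equiv_class_eq)

lemma quot_mult:
  assumes "a \<in> carrier M" "b \<in> carrier M"
  shows "R `` {a} \<otimes>\<^bsub>quotient_monoid M R\<^esub> R `` {b} = R `` {a \<otimes>\<^bsub>M\<^esub> b}"
proof -
  have "R `` {x \<otimes>\<^bsub>M\<^esub> y} = R `` {a \<otimes>\<^bsub>M\<^esub> b}" if "x \<in> R `` {a}" "y \<in> R `` {b}" for x y
  proof -
    have "(a \<otimes>\<^bsub>M\<^esub> b, x \<otimes>\<^bsub>M\<^esub> y) \<in> R" using that mc by (auto simp: mcong_def)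
    then show ?thesis by (metis equiv_class_eq eqv)
  qed
  moreover have "a \<in> R `` {a}" "b \<in> R `` {b}" using assms equiv_class_self[OF eqv] by blast+
  ultimately have "(\<Union>x\<in>R `` {a}. \<Union>y\<in>R `` {b}. R `` {x \<otimes>\<^bsub>M\<^esub> y}) = R `` {a \<otimes>\<^bsub>M\<^esub> b}"
    by (metis (no_types, lifting) UN_constant_eq[of a "R `` {a}"] UN_constant_eq[of b "R `` {b}"])
  then show ?thesis by (simp add: quotient_monoid_def)
qed

lemma quot_one: "\<one>\<^bsub>quotient_monoid M R\<^esub> = R `` {\<one>\<^bsub>M\<^esub>}"
  by (simp add: quotient_monoid_def)

lemma quot_comm_monoid: "comm_monoid (quotient_monoid M R)"
proof (rule comm_monoidI)
  fix x y assume "x \<in> carrier (quotient_monoid M R)" "y \<in> carrier (quotient_monoid M R)"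
  then show "x \<otimes>\<^bsub>quotient_monoid M R\<^esub> y \<in> carrier (quotient_monoid M R)"
    and "x \<otimes>\<^bsub>quotient_monoid M R\<^esub> y = y \<otimes>\<^bsub>quotient_monoid M R\<^esub> x"
    by (auto elim!: quot_obtain simp: quot_mult quot_class_in m_comm)
next
  fix x y z assume "x \<in> carrier (quotient_monoid M R)" "y \<in> carrier (quotient_monoid M R)"
    "z \<in> carrier (quotient_monoid M R)"
  then show "x \<otimes>\<^bsub>quotient_monoid M R\<^esub> y \<otimes>\<^bsub>quotient_monoid M R\<^esub> z =
    x \<otimes>\<^bsub>quotient_monoid M R\<^esub> (y \<otimes>\<^bsub>quotient_monoid M R\<^esub> z)"
    by (auto elim!: quot_obtain simp: quot_mult m_assoc)
qed (auto elim!: quot_obtain simp: quot_mult quot_one quot_class_in)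

lemma quot_pow:
  assumes "a \<in> carrier M"
  shows "R `` {a} [^]\<^bsub>quotient_monoid M R\<^esub> (n::nat) = R `` {a [^]\<^bsub>M\<^esub> n}"
  by (induction n) (simp_all add: pow_rec quot_one quot_mult assms)

end

lemma comm_monoid_DirProd:
  assumes "comm_monoid M" "comm_monoid N" shows "comm_monoid (M \<times>\<times> N)"
proof -
  interpret M: comm_monoid M by fact
  interpret N: comm_monoid N by fact
  show ?thesis
    by (rule comm_monoidI) (auto simp: DirProd_def M.m_ac N.m_ac)
qed

lemma DirProd_pow: "(a, b) [^]\<^bsub>M \<times>\<times> N\<^esub> (n::nat) = (a [^]\<^bsub>M\<^esub> n, b [^]\<^bsub>N\<^esub> n)"
  by (induction n) (simp_all add: pow_rec DirProd_def)

lemma mcong_gp_rel: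
  assumes "comm_monoid M" shows "mcong (M \<times>\<times> M) (gp_rel M)"
proof -
  interpret comm_monoid M by fact
  have "trans (gp_rel M)"
  proof (rule transI)
    fix x y z assume "(x, y) \<in> gp_rel M" "(y, z) \<in> gp_rel M"
    then obtain a b c d e f t s where eq: "x = (a, b)" "y = (c, d)" "z = (e, f)"
      and C: "a \<in> carrier M" "b \<in> carrier M" "c \<in> carrier M" "d \<in> carrier M"
        "e \<in> carrier M" "f \<in> carrier M" "t \<in> carrier M" "s \<in> carrier M"
      and 1: "a \<otimes>\<^bsub>M\<^esub> d \<otimes>\<^bsub>M\<^esub> t = c \<otimes>\<^bsub>M\<^esub> b \<otimes>\<^bsub>M\<^esub> t" and 2: "c \<otimes>\<^bsub>M\<^esub> f \<otimes>\<^bsub>M\<^esub> s = e \<otimes>\<^bsub>M\<^esub> d \<otimes>\<^bsub>M\<^esub> s"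
      by (auto simp: gp_rel_def)
    have "a \<otimes>\<^bsub>M\<^esub> f \<otimes>\<^bsub>M\<^esub> (d \<otimes>\<^bsub>M\<^esub> t \<otimes>\<^bsub>M\<^esub> s) = (a \<otimes>\<^bsub>M\<^esub> d \<otimes>\<^bsub>M\<^esub> t) \<otimes>\<^bsub>M\<^esub> (f \<otimes>\<^bsub>M\<^esub> s)"
      using C by (simp add: m_ac)
    also have "\<dots> = (c \<otimes>\<^bsub>M\<^esub> f \<otimes>\<^bsub>M\<^esub> s) \<otimes>\<^bsub>M\<^esub> (b \<otimes>\<^bsub>M\<^esub> t)"
      unfolding 1 using C by (simp add: m_ac)
    also have "\<dots> = e \<otimes>\<^bsub>M\<^esub> b \<otimes>\<^bsub>M\<^esub> (d \<otimes>\<^bsub>M\<^esub> t \<otimes>\<^bsub>M\<^esub> s)"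
      unfolding 2 using C by (simp add: m_ac)
    finally show "(x, z) \<in> gp_rel M" using C unfolding eq gp_rel_def by blast
  qed
  moreover have "sym (gp_rel M)"
    unfolding sym_def gp_rel_def by (auto intro: HOL.sym)
  moreover have "refl_on (carrier (M \<times>\<times> M)) (gp_rel M)"
    by (auto simp: refl_on_def gp_rel_def DirProd_def intro: exI[of _ "\<one>\<^bsub>M\<^esub>"])
  moreover have "gp_rel M \<subseteq> carrier (M \<times>\<times> M) \<times> carrier (M \<times>\<times> M)"
    by (auto simp: gp_rel_def DirProd_def)
  moreover have "(x \<otimes>\<^bsub>M \<times>\<times> M\<^esub> x', y \<otimes>\<^bsub>M \<times>\<times> M\<^esub> y') \<in> gp_rel M"
    if xy: "(x, y) \<in> gp_rel M" "(x', y') \<in> gp_rel M" for x y x' y'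
  proof -
    obtain a b c d t where eq: "x = (a, b)" "y = (c, d)"
      and C: "a \<in> carrier M" "b \<in> carrier M" "c \<in> carrier M" "d \<in> carrier M" "t \<in> carrier M"
      and 1: "a \<otimes>\<^bsub>M\<^esub> d \<otimes>\<^bsub>M\<^esub> t = c \<otimes>\<^bsub>M\<^esub> b \<otimes>\<^bsub>M\<^esub> t"
      using xy by (auto simp: gp_rel_def)
    obtain a' b' c' d' t' where eq': "x' = (a', b')" "y' = (c', d')"
      and C': "a' \<in> carrier M" "b' \<in> carrier M" "c' \<in> carrier M" "d' \<in> carrier M" "t' \<in> carrier M"
      and 2: "a' \<otimes>\<^bsub>M\<^esub> d' \<otimes>\<^bsub>M\<^esub> t' = c' \<otimes>\<^bsub>M\<^esub> b' \<otimes>\<^bsub>M\<^esub> t'"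
      using xy by (auto simp: gp_rel_def)
    have "(a \<otimes>\<^bsub>M\<^esub> a') \<otimes>\<^bsub>M\<^esub> (d \<otimes>\<^bsub>M\<^esub> d') \<otimes>\<^bsub>M\<^esub> (t \<otimes>\<^bsub>M\<^esub> t') =
      (a \<otimes>\<^bsub>M\<^esub> d \<otimes>\<^bsub>M\<^esub> t) \<otimes>\<^bsub>M\<^esub> (a' \<otimes>\<^bsub>M\<^esub> d' \<otimes>\<^bsub>M\<^esub> t')" using C C' by (simp add: m_ac)
    also have "\<dots> = (c \<otimes>\<^bsub>M\<^esub> c') \<otimes>\<^bsub>M\<^esub> (b \<otimes>\<^bsub>M\<^esub> b') \<otimes>\<^bsub>M\<^esub> (t \<otimes>\<^bsub>M\<^esub> t')"
      unfolding 1 2 using C C' by (simp add: m_ac)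
    finally show ?thesis using C C' unfolding eq eq' gp_rel_def DirProd_def
      by (auto intro!: bexI[of _ "t \<otimes>\<^bsub>M\<^esub> t'"])
  qed
  ultimately show ?thesis unfolding mcong_def equiv_def by blast
qed

abbreviation gp_frac :: "'a monoid \<Rightarrow> 'a \<Rightarrow> 'a \<Rightarrow> ('a \<times> 'a) set" where
  "gp_frac M a b \<equiv> gp_rel M `` {(a, b)}"

context
  fixes M :: "'a monoid"
  assumes cm: "comm_monoid M"
begin

interpretation comm_monoid M by (fact cm)

lemma cm2: "comm_monoid (M \<times>\<times> M)" by (rule comm_monoid_DirProd[OF cm cm])

lemma frac_in: "a \<in> carrier M \<Longrightarrow> b \<in> carrier M \<Longrightarrow> gp_frac M a b \<in> carrier (gp M)"
  unfolding gp_def by (rule quot_class_in[OF cm2 mcong_gp_rel[OF cm]]) (simp add: DirProd_def)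

lemma gp_obtain:
  assumes "X \<in> carrier (gp M)"
  obtains a b where "a \<in> carrier M" "b \<in> carrier M" "X = gp_frac M a b"
  using assms unfolding gp_def
  by (rule quot_obtain[OF cm2 mcong_gp_rel[OF cm]]) (auto simp: DirProd_def)

lemma frac_eq:
  assumes "a \<in> carrier M" "b \<in> carrier M" "c \<in> carrier M" "d \<in> carrier M"
  shows "gp_frac M a b = gp_frac M c d \<longleftrightarrow> (\<exists>t\<in>carrier M. a \<otimes>\<^bsub>M\<^esub> d \<otimes>\<^bsub>M\<^esub> t = c \<otimes>\<^bsub>M\<^esub> b \<otimes>\<^bsub>M\<^esub> t)"
  using assms by (subst quot_class_eq[OF cm2 mcong_gp_rel[OF cm]]) (auto simp: DirProd_def gp_rel_def)

lemma frac_mult: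
  assumes "a \<in> carrier M" "b \<in> carrier M" "c \<in> carrier M" "d \<in> carrier M"
  shows "gp_frac M a b \<otimes>\<^bsub>gp M\<^esub> gp_frac M c d = gp_frac M (a \<otimes>\<^bsub>M\<^esub> c) (b \<otimes>\<^bsub>M\<^esub> d)"
  using assms unfolding gp_def
  by (subst quot_mult[OF cm2 mcong_gp_rel[OF cm]]) (auto simp: DirProd_def)

lemma frac_pow:
  assumes "a \<in> carrier M" "b \<in> carrier M"
  shows "gp_frac M a b [^]\<^bsub>gp M\<^esub> (n::nat) = gp_frac M (a [^]\<^bsub>M\<^esub> n) (b [^]\<^bsub>M\<^esub> n)"
  using quot_pow[OF cm2 mcong_gp_rel[OF cm], of "(a, b)" n] assms
  by (simp add: gp_def DirProd_pow DirProd_def[of M M, THEN arg_cong[where f = carrier]])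

lemma gp_one: "\<one>\<^bsub>gp M\<^esub> = gp_frac M \<one>\<^bsub>M\<^esub> \<one>\<^bsub>M\<^esub>"
  by (simp add: gp_def quot_one DirProd_def quotient_monoid_def)

lemma gp_comm_group: "comm_group (gp M)"
proof -
  have m: "comm_monoid (gp M)" unfolding gp_def
    by (rule quot_comm_monoid[OF cm2 mcong_gp_rel[OF cm]])
  have "\<exists>y\<in>carrier (gp M). y \<otimes>\<^bsub>gp M\<^esub> x = \<one>\<^bsub>gp M\<^esub>" if x: "x \<in> carrier (gp M)" for x
  proof -
    obtain a b where C: "a \<in> carrier M" "b \<in> carrier M" and X: "x = gp_frac M a b"
      using x by (rule gp_obtain)
    have "gp_frac M b a \<otimes>\<^bsub>gp M\<^esub> x = \<one>\<^bsub>gp M\<^esub>"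
      using C unfolding X by (auto simp: frac_mult gp_one frac_eq m_comm)
    then show ?thesis using C frac_in by blast
  qed
  then show ?thesis
    using comm_monoid.axioms(1)[OF m] comm_monoid.m_comm[OF m]
    by (intro comm_groupI)
      (simp_all add: monoid.m_closed monoid.one_closed monoid.m_assoc monoid.l_one)
qed

lemma gp_of_hom: "gp_of M \<in> mhom M (gp M)"
  by (auto simp: mhom_def hom_def gp_of_def frac_in frac_mult gp_one)

lemma gp_of_eq:
  assumes "a \<in> carrier M" "b \<in> carrier M"
  shows "gp_of M a = gp_of M b \<longleftrightarrow> (\<exists>t\<in>carrier M. a \<otimes>\<^bsub>M\<^esub> t = b \<otimes>\<^bsub>M\<^esub> t)"
  using assms by (auto simp: gp_of_def frac_eq)

lemma frac_pow_in:
  assumes "a \<in> carrier M" "b \<in> carrier M"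
  shows "gp_frac M a b [^]\<^bsub>gp M\<^esub> (n::nat) \<in> gp_of M ` carrier M \<longleftrightarrow>
    (\<exists>z\<in>carrier M. \<exists>t\<in>carrier M. a [^]\<^bsub>M\<^esub> n \<otimes>\<^bsub>M\<^esub> t = z \<otimes>\<^bsub>M\<^esub> b [^]\<^bsub>M\<^esub> n \<otimes>\<^bsub>M\<^esub> t)"
  using assms by (auto simp: image_iff gp_of_def frac_pow frac_eq)

end

lemma integral_monoid_iff:
  "integral_monoid M \<longleftrightarrow> comm_monoid M \<and>
    (\<forall>a\<in>carrier M. \<forall>b\<in>carrier M. \<forall>t\<in>carrier M. a \<otimes>\<^bsub>M\<^esub> t = b \<otimes>\<^bsub>M\<^esub> t \<longrightarrow> a = b)"
  unfolding integral_monoid_def inj_on_def by (metis gp_of_eq)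

lemma saturated_monoid_iff:
  "saturated_monoid M \<longleftrightarrow> integral_monoid M \<and>
    (\<forall>a\<in>carrier M. \<forall>b\<in>carrier M. \<forall>z\<in>carrier M. \<forall>n::nat. n \<ge> 1 \<longrightarrow>
       a [^]\<^bsub>M\<^esub> n = z \<otimes>\<^bsub>M\<^esub> b [^]\<^bsub>M\<^esub> n \<longrightarrow> (\<exists>w\<in>carrier M. a = w \<otimes>\<^bsub>M\<^esub> b))" (is "_ \<longleftrightarrow> _ \<and> ?R")
proof (cases "integral_monoid M")
  case True
  then have cm: "comm_monoid M" by (simp add: integral_monoid_def)
  interpret comm_monoid M by fact
  have canc: "a \<otimes>\<^bsub>M\<^esub> t = b \<otimes>\<^bsub>M\<^esub> t \<longleftrightarrow> a = b"
    if "a \<in> carrier M" "b \<in> carrier M" "t \<in> carrier M" for a b t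
    using True that unfolding integral_monoid_iff by blast
  have 1: "gp_frac M a b [^]\<^bsub>gp M\<^esub> (n::nat) \<in> gp_of M ` carrier M \<longleftrightarrow>
    (\<exists>z\<in>carrier M. a [^]\<^bsub>M\<^esub> n = z \<otimes>\<^bsub>M\<^esub> b [^]\<^bsub>M\<^esub> n)"
    if "a \<in> carrier M" "b \<in> carrier M" for a b n
    using that by (subst frac_pow_in[OF cm]) (auto simp: canc)
  have 2: "gp_frac M a b \<in> gp_of M ` carrier M \<longleftrightarrow> (\<exists>z\<in>carrier M. a = z \<otimes>\<^bsub>M\<^esub> b)"
    if "a \<in> carrier M" "b \<in> carrier M" for a b
    using that by (auto simp: image_iff gp_of_def frac_eq[OF cm] canc)
  have "(\<forall>x\<in>carrier (gp M). \<forall>n::nat. n \<ge> 1 \<longrightarrow> x [^]\<^bsub>gp M\<^esub> n \<in> gp_of M ` carrier M \<longrightarrow>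
        x \<in> gp_of M ` carrier M) \<longleftrightarrow>
    (\<forall>a\<in>carrier M. \<forall>b\<in>carrier M. \<forall>n::nat. n \<ge> 1 \<longrightarrow>
      gp_frac M a b [^]\<^bsub>gp M\<^esub> n \<in> gp_of M ` carrier M \<longrightarrow> gp_frac M a b \<in> gp_of M ` carrier M)"
    using gp_obtain[OF cm] frac_in[OF cm] by metis
  also have "\<dots> \<longleftrightarrow> (\<forall>a\<in>carrier M. \<forall>b\<in>carrier M. \<forall>n::nat. n \<ge> 1 \<longrightarrow>
      (\<exists>z\<in>carrier M. a [^]\<^bsub>M\<^esub> n = z \<otimes>\<^bsub>M\<^esub> b [^]\<^bsub>M\<^esub> n) \<longrightarrow> (\<exists>z\<in>carrier M. a = z \<otimes>\<^bsub>M\<^esub> b))"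
    by (simp only: 1 2 cong: ball_cong)
  also have "\<dots> \<longleftrightarrow> ?R" by blast
  finally show ?thesis unfolding saturated_monoid_def by simp
qed (simp add: saturated_monoid_def)

lemma gp_of_iso_integralisation_iff:
  assumes "comm_monoid M"
  shows "gp_of M \<in> iso M (integralisation M) \<longleftrightarrow> integral_monoid M"
  using gp_of_hom[OF assms] assms
  by (auto simp: iso_def hom_def mhom_def bij_betw_def integral_monoid_def integralisation_def)

lemma gp_of_in_saturation:
  assumes "comm_monoid M" "a \<in> carrier M"
  shows "gp_of M a \<in> carrier (saturation M)"
proof -
  interpret G: comm_group "gp M" by (rule gp_comm_group[OF assms(1)])
  have "gp_of M a \<in> carrier (gp M)" using gp_of_hom[OF assms(1)] assms(2) by (auto simp: mhom_def hom_def)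
  then show ?thesis unfolding saturation_def using assms(2)
    by (auto intro!: exI[of _ "1::nat"])
qed

lemma gp_of_iso_saturation_iff:
  assumes "comm_monoid M"
  shows "gp_of M \<in> iso M (saturation M) \<longleftrightarrow> saturated_monoid M"
proof -
  have "gp_of M \<in> hom M (saturation M)"
    using gp_of_hom[OF assms] gp_of_in_saturation[OF assms]
    by (auto simp: hom_def mhom_def saturation_def)
  moreover have "gp_of M ` carrier M = carrier (saturation M) \<longleftrightarrow>
    carrier (saturation M) \<subseteq> gp_of M ` carrier M"
    using gp_of_in_saturation[OF assms] by blast
  ultimately have "gp_of M \<in> iso M (saturation M) \<longleftrightarrow>
      integral_monoid M \<and> carrier (saturation M) \<subseteq> gp_of M ` carrier M"
    using assms by (simp add: iso_def bij_betw_def integral_monoid_def)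
  then show ?thesis
    unfolding saturated_monoid_def by (fastforce simp: saturation_def)
qed

section \<open>Universal properties\<close>

lemma mhom_pow:
  assumes "f \<in> mhom M N" "comm_monoid M" "comm_monoid N" "x \<in> carrier M"
  shows "f (x [^]\<^bsub>M\<^esub> (n::nat)) = f x [^]\<^bsub>N\<^esub> n"
proof -
  interpret M: comm_monoid M by fact
  show ?thesis using assms by (induction n) (auto simp: mhom_def hom_def)
qed

lemma mhom_closed: "f \<in> mhom M N \<Longrightarrow> x \<in> carrier M \<Longrightarrow> f x \<in> carrier N"
  and mhom_mult: "f \<in> mhom M N \<Longrightarrow> x \<in> carrier M \<Longrightarrow> y \<in> carrier M \<Longrightarrow>
    f (x \<otimes>\<^bsub>M\<^esub> y) = f x \<otimes>\<^bsub>N\<^esub> f y"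
  and mhom_one: "f \<in> mhom M N \<Longrightarrow> f \<one>\<^bsub>M\<^esub> = \<one>\<^bsub>N\<^esub>"
  by (auto simp: mhom_def hom_def)

lemma quot_universal:
  assumes "comm_monoid M" "mcong M R" "comm_monoid T" "k \<in> mhom M T"
    and resp: "\<And>x y. (x, y) \<in> R \<Longrightarrow> k x = k y"
  shows "\<exists>k' \<in> mhom (quotient_monoid M R) T. \<forall>x\<in>carrier M. k' (R `` {x}) = k x"
proof -
  interpret M: comm_monoid M by fact
  define k' where "k' X = k (SOME x. x \<in> X)" for X
  have k': "k' (R `` {x}) = k x" if "x \<in> carrier M" for x
  proof -
    have "x \<in> R `` {x}" using that eqv[OF assms(1,2)] by (rule equiv_class_self[rotated])
    then have "(SOME y. y \<in> R `` {x}) \<in> R `` {x}" by (rule someI)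
    then show ?thesis unfolding k'_def using resp by fastforce
  qed
  have "k' \<in> mhom (quotient_monoid M R) T"
    unfolding mhom_def hom_def
    using assms(4)
    by (auto elim!: quot_obtain[OF assms(1,2)]
        simp: quot_mult[OF assms(1,2)] quot_one[OF assms(1,2)] k' mhom_closed mhom_mult mhom_one)
  then show ?thesis using k' by blast
qed

lemma comm_monoid_pushout:
  assumes "comm_monoid A" "comm_monoid B"
  shows "comm_monoid (pushout P A B f g)"
  unfolding pushout_def pushout_cong_def
  by (intro quot_comm_monoid mcong_gen_cong comm_monoid_DirProd assms)

theorem pushout_universal:
  assumes P: "comm_monoid P" and A: "comm_monoid A" and B: "comm_monoid B" and T: "comm_monoid T"
    and f: "f \<in> mhom P A" and g: "g \<in> mhom P B"
    and u: "u \<in> mhom A T" and w: "w \<in> mhom B T"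
    and uw: "\<And>p. p \<in> carrier P \<Longrightarrow> u (f p) = w (g p)"
  shows "\<exists>k \<in> mhom (pushout P A B f g) T.
      (\<forall>a\<in>carrier A. k (pushout_inl P A B f g a) = u a) \<and>
      (\<forall>b\<in>carrier B. k (pushout_inr P A B f g b) = w b) \<and>
      (\<forall>k' \<in> mhom (pushout P A B f g) T.
         (\<forall>a\<in>carrier A. k' (pushout_inl P A B f g a) = u a) \<longrightarrow>
         (\<forall>b\<in>carrier B. k' (pushout_inr P A B f g b) = w b) \<longrightarrow>
         (\<forall>x\<in>carrier (pushout P A B f g). k' x = k x))"
    and "\<forall>p\<in>carrier P. pushout_inl P A B f g (f p) = pushout_inr P A B f g (g p)"
    and "pushout_inl P A B f g \<in> mhom A (pushout P A B f g)"
    and "pushout_inr P A B f g \<in> mhom B (pushout P A B f g)"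
proof -
  interpret A: comm_monoid A by fact
  interpret B: comm_monoid B by fact
  interpret T: comm_monoid T by fact
  let ?R = "pushout_cong P A B f g"
  have cm: "comm_monoid (A \<times>\<times> B)" by (rule comm_monoid_DirProd[OF A B])
  have mc: "mcong (A \<times>\<times> B) ?R" unfolding pushout_cong_def by (rule mcong_gen_cong[OF cm])
  show inl: "pushout_inl P A B f g \<in> mhom A (pushout P A B f g)"
    unfolding mhom_def hom_def pushout_def pushout_inl_def
    by (auto simp: quot_class_in[OF cm mc] quot_mult[OF cm mc] quot_one[OF cm mc])
  show inr: "pushout_inr P A B f g \<in> mhom B (pushout P A B f g)"
    unfolding mhom_def hom_def pushout_def pushout_inr_def
    by (auto simp: quot_class_in[OF cm mc] quot_mult[OF cm mc] quot_one[OF cm mc])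
  have "((f p, \<one>\<^bsub>B\<^esub>), (\<one>\<^bsub>A\<^esub>, g p)) \<in> ?R" if "p \<in> carrier P" for p
    unfolding pushout_cong_def using that f g
    by (intro gen_cong_base) (auto simp: DirProd_def mhom_closed)
  then show "\<forall>p\<in>carrier P. pushout_inl P A B f g (f p) = pushout_inr P A B f g (g p)"
    unfolding pushout_inl_def pushout_inr_def using equiv_class_eq[OF eqv[OF cm mc]] by blast
  define k where "k = (\<lambda>(a, b). u a \<otimes>\<^bsub>T\<^esub> w b)"
  have kh: "k \<in> mhom (A \<times>\<times> B) T"
    using u w by (auto simp: mhom_def hom_def DirProd_def k_def Pi_iff T.m_ac)
  have resp: "k x = k y" if "(x, y) \<in> ?R" for x y
    using that unfolding pushout_cong_def
  proof induction
    case (gen_cong_base x y)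
    then show ?case using u w uw f g by (auto simp: k_def mhom_one mhom_closed)
  next
    case (gen_cong_mult x y x' y')
    have C: "x \<in> carrier (A \<times>\<times> B)" "y \<in> carrier (A \<times>\<times> B)"
      "x' \<in> carrier (A \<times>\<times> B)" "y' \<in> carrier (A \<times>\<times> B)"
      using gen_cong_carrier[OF cm gen_cong_mult.hyps(1)] gen_cong_carrier[OF cm gen_cong_mult.hyps(2)]
      by blast+
    show ?case unfolding mhom_mult[OF kh C(1,3)] mhom_mult[OF kh C(2,4)] gen_cong_mult.IH ..
  qed auto
  obtain k' where k'h: "k' \<in> mhom (pushout P A B f g) T"
    and k': "\<And>x. x \<in> carrier (A \<times>\<times> B) \<Longrightarrow> k' (?R `` {x}) = k x"
    using quot_universal[OF cm mc T kh resp] unfolding pushout_def by blast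
  have rep: "\<exists>a\<in>carrier A. \<exists>b\<in>carrier B. x = pushout_inl P A B f g a \<otimes>\<^bsub>pushout P A B f g\<^esub> pushout_inr P A B f g b"
    if x: "x \<in> carrier (pushout P A B f g)" for x
  proof -
    obtain z where "z \<in> carrier (A \<times>\<times> B)" "x = ?R `` {z}"
      using x unfolding pushout_def by (rule quot_obtain[OF cm mc])
    then obtain a b where ab: "a \<in> carrier A" "b \<in> carrier B" "x = ?R `` {(a, b)}"
      by (cases z) auto
    have "pushout_inl P A B f g a \<otimes>\<^bsub>pushout P A B f g\<^esub> pushout_inr P A B f g b = x"
      unfolding pushout_def pushout_inl_def pushout_inr_def ab(3)
      using ab by (subst quot_mult[OF cm mc]) (auto simp: DirProd_def)
    then show ?thesis using ab by blast
  qed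
  have 1: "\<forall>a\<in>carrier A. k' (pushout_inl P A B f g a) = u a"
    using u w by (auto simp: pushout_inl_def k' DirProd_def k_def mhom_one mhom_closed)
  have 2: "\<forall>b\<in>carrier B. k' (pushout_inr P A B f g b) = w b"
    using u w by (auto simp: pushout_inr_def k' DirProd_def k_def mhom_one mhom_closed)
  have uq: "k'' x = k' x" if "k'' \<in> mhom (pushout P A B f g) T"
    "\<forall>a\<in>carrier A. k'' (pushout_inl P A B f g a) = u a"
    "\<forall>b\<in>carrier B. k'' (pushout_inr P A B f g b) = w b"
    "x \<in> carrier (pushout P A B f g)" for k'' x
    using rep[OF that(4)] that(1-3) k'h 1 2 by (auto simp: mhom_mult mhom_closed[OF inl] mhom_closed[OF inr])
  show "\<exists>k \<in> mhom (pushout P A B f g) T.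
      (\<forall>a\<in>carrier A. k (pushout_inl P A B f g a) = u a) \<and>
      (\<forall>b\<in>carrier B. k (pushout_inr P A B f g b) = w b) \<and>
      (\<forall>k' \<in> mhom (pushout P A B f g) T.
         (\<forall>a\<in>carrier A. k' (pushout_inl P A B f g a) = u a) \<longrightarrow>
         (\<forall>b\<in>carrier B. k' (pushout_inr P A B f g b) = w b) \<longrightarrow>
         (\<forall>x\<in>carrier (pushout P A B f g). k' x = k x))"
    by (intro bexI[OF _ k'h] conjI 1 2) (blast intro: uq)
qed

lemma gp_map_frac:
  assumes M: "comm_monoid M" and N: "comm_monoid N" and g: "g \<in> mhom M N"
    and a: "a \<in> carrier M" "b \<in> carrier M"
  shows "gp_map N g (gp_frac M a b) = gp_frac N (g a) (g b)"
proof -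
  have "gp_frac N (g x) (g y) = gp_frac N (g a) (g b)" if "(x, y) \<in> gp_frac M a b" for x y
  proof -
    have xy: "x \<in> carrier M" "y \<in> carrier M" and "((a, b), (x, y)) \<in> gp_rel M"
      using that by (auto simp: gp_rel_def)
    then obtain t where t: "t \<in> carrier M" "a \<otimes>\<^bsub>M\<^esub> y \<otimes>\<^bsub>M\<^esub> t = x \<otimes>\<^bsub>M\<^esub> b \<otimes>\<^bsub>M\<^esub> t"
      by (auto simp: gp_rel_def)
    have "g a \<otimes>\<^bsub>N\<^esub> g y \<otimes>\<^bsub>N\<^esub> g t = g (a \<otimes>\<^bsub>M\<^esub> y \<otimes>\<^bsub>M\<^esub> t)"
      using M a xy t(1) g by (simp add: mhom_mult monoid.m_closed comm_monoid.axioms(1))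
    also have "\<dots> = g x \<otimes>\<^bsub>N\<^esub> g b \<otimes>\<^bsub>N\<^esub> g t"
      unfolding t(2) using M a xy t(1) g by (simp add: mhom_mult monoid.m_closed comm_monoid.axioms(1))
    finally have "gp_frac N (g a) (g b) = gp_frac N (g x) (g y)"
      using a xy t(1) g by (subst frac_eq[OF N]) (auto intro: mhom_closed)
    then show ?thesis by simp
  qed
  moreover have "(a, b) \<in> gp_frac M a b"
    using equiv_class_self[OF eqv[OF comm_monoid_DirProd[OF M M] mcong_gp_rel[OF M]]] a by simp
  ultimately have "(\<Union>z\<in>gp_frac M a b. case z of (x, y) \<Rightarrow> gp_frac N (g x) (g y)) = gp_frac N (g a) (g b)"
    by blast
  then show ?thesis unfolding gp_map_def .
qed

lemma gp_map_hom:
  assumes M: "comm_monoid M" and N: "comm_monoid N" and g: "g \<in> mhom M N"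
  shows "gp_map N g \<in> mhom (gp M) (gp N)"
    and "x \<in> carrier M \<Longrightarrow> gp_map N g (gp_of M x) = gp_of N (g x)"
proof -
  interpret M: comm_monoid M by fact
  show "gp_map N g \<in> mhom (gp M) (gp N)"
    unfolding mhom_def hom_def using g
    by (auto elim!: gp_obtain[OF M] simp: frac_mult[OF M] frac_mult[OF N] gp_one[OF M] gp_one[OF N]
        gp_map_frac[OF M N g] frac_in[OF N] mhom_closed mhom_mult mhom_one)
  show "x \<in> carrier M \<Longrightarrow> gp_map N g (gp_of M x) = gp_of N (g x)"
    unfolding gp_of_def using g by (simp add: gp_map_frac[OF M N g] mhom_one)
qed

text \<open>Homomorphisms to an abelian group factor uniquely through the group completion.\<close>

theorem gp_universal:
  assumes M: "comm_monoid M" and G: "comm_group G" and g: "g \<in> mhom M G"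
  shows "\<exists>k \<in> mhom (gp M) G. (\<forall>x\<in>carrier M. k (gp_of M x) = g x) \<and>
    (\<forall>k' \<in> mhom (gp M) G. (\<forall>x\<in>carrier M. k' (gp_of M x) = g x) \<longrightarrow>
      (\<forall>x\<in>carrier (gp M). k' x = k x))"
proof -
  interpret M: comm_monoid M by fact
  interpret G: comm_group G by fact
  have cm: "comm_monoid (M \<times>\<times> M)" by (rule comm_monoid_DirProd[OF M M])
  define k where "k = (\<lambda>(a, b). g a \<otimes>\<^bsub>G\<^esub> inv\<^bsub>G\<^esub> g b)"
  have kh: "k \<in> mhom (M \<times>\<times> M) G"
    using g by (auto simp: mhom_def hom_def k_def Pi_iff G.inv_mult_group G.m_ac)
  have resp: "k x = k y" if xy: "(x, y) \<in> gp_rel M" for x y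
  proof -
    obtain a b c d t where eq: "x = (a, b)" "y = (c, d)"
      and C: "a \<in> carrier M" "b \<in> carrier M" "c \<in> carrier M" "d \<in> carrier M" "t \<in> carrier M"
      and 1: "a \<otimes>\<^bsub>M\<^esub> d \<otimes>\<^bsub>M\<^esub> t = c \<otimes>\<^bsub>M\<^esub> b \<otimes>\<^bsub>M\<^esub> t"
      using xy by (auto simp: gp_rel_def)
    note gC = C[THEN mhom_closed[OF g]]
    have "g a \<otimes>\<^bsub>G\<^esub> g d \<otimes>\<^bsub>G\<^esub> g t = g c \<otimes>\<^bsub>G\<^esub> g b \<otimes>\<^bsub>G\<^esub> g t"
      using arg_cong[OF 1, of g] C by (simp add: mhom_mult[OF g])
    then have 2: "g a \<otimes>\<^bsub>G\<^esub> g d = g c \<otimes>\<^bsub>G\<^esub> g b" using gC by simp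
    have "g a \<otimes>\<^bsub>G\<^esub> inv\<^bsub>G\<^esub> g b = (g a \<otimes>\<^bsub>G\<^esub> g d) \<otimes>\<^bsub>G\<^esub> inv\<^bsub>G\<^esub> g d \<otimes>\<^bsub>G\<^esub> inv\<^bsub>G\<^esub> g b"
      using gC by (simp add: G.m_assoc)
    also have "\<dots> = g c \<otimes>\<^bsub>G\<^esub> inv\<^bsub>G\<^esub> g d \<otimes>\<^bsub>G\<^esub> g b \<otimes>\<^bsub>G\<^esub> inv\<^bsub>G\<^esub> g b"
      unfolding 2 using gC by (simp only: G.m_ac G.m_closed G.inv_closed)
    also have "\<dots> = g c \<otimes>\<^bsub>G\<^esub> inv\<^bsub>G\<^esub> g d" using gC by (simp add: G.m_assoc)
    finally show ?thesis by (simp add: eq k_def)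
  qed
  obtain k' where k'h: "k' \<in> mhom (gp M) G"
    and k': "\<And>x. x \<in> carrier (M \<times>\<times> M) \<Longrightarrow> k' (gp_rel M `` {x}) = k x"
    using quot_universal[OF cm mcong_gp_rel[OF M] G.comm_monoid_axioms kh resp] unfolding gp_def
    by blast
  have 1: "\<forall>x\<in>carrier M. k' (gp_of M x) = g x"
    using g by (auto simp: gp_of_def k' k_def mhom_one mhom_closed)
  have gh: "gp_of M \<in> mhom M (gp M)" by (rule gp_of_hom[OF M])
  have u: "k1 x = k2 x" if k12: "k1 \<in> mhom (gp M) G" "k2 \<in> mhom (gp M) G"
    and e1: "\<forall>x\<in>carrier M. k1 (gp_of M x) = g x" and e2: "\<forall>x\<in>carrier M. k2 (gp_of M x) = g x"
    and x: "x \<in> carrier (gp M)" for k1 k2 x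
  proof -
    obtain a b where ab: "a \<in> carrier M" "b \<in> carrier M" "x = gp_frac M a b"
      using x by (rule gp_obtain[OF M])
    have "x \<otimes>\<^bsub>gp M\<^esub> gp_of M b = gp_of M a"
      using ab by (auto simp: gp_of_def frac_mult[OF M] frac_eq[OF M])
    then have "k1 x \<otimes>\<^bsub>G\<^esub> g b = g a" "k2 x \<otimes>\<^bsub>G\<^esub> g b = g a"
      using ab x e1 e2 mhom_mult[OF k12(1) x, of "gp_of M b"] mhom_mult[OF k12(2) x, of "gp_of M b"]
      by (auto simp: mhom_closed[OF gh])
    then show ?thesis
      using G.right_cancel[of "g b" "k1 x" "k2 x"] mhom_closed[OF g ab(2)] mhom_closed[OF k12(1) x]
        mhom_closed[OF k12(2) x] by simp
  qed
  show ?thesis by (intro bexI[OF _ k'h] conjI 1) (blast intro: u[OF _ k'h _ 1])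
qed

lemma gp_pow_consistent: "x [^]\<^bsub>(gp M)\<lparr>carrier := C\<rparr>\<^esub> (n::nat) = x [^]\<^bsub>gp M\<^esub> n"
  by (induction n) (simp_all add: pow_rec)

lemma sub_gp_universal:
  assumes M: "comm_monoid M" and N: "integral_monoid N" and g: "g \<in> mhom M N"
    and C: "C \<subseteq> carrier (gp M)" "gp_of M ` carrier M \<subseteq> C"
    and im: "gp_map N g ` C \<subseteq> gp_of N ` carrier N"
  shows "\<exists>k \<in> mhom ((gp M)\<lparr>carrier := C\<rparr>) N. (\<forall>x\<in>carrier M. k (gp_of M x) = g x) \<and>
    (\<forall>k' \<in> mhom ((gp M)\<lparr>carrier := C\<rparr>) N. (\<forall>x\<in>carrier M. k' (gp_of M x) = g x) \<longrightarrow>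
      (\<forall>x\<in>C. k' x = k x))"
proof -
  have cN: "comm_monoid N" and inj: "inj_on (gp_of N) (carrier N)"
    using N by (auto simp: integral_monoid_def)
  interpret M: comm_monoid M by fact
  interpret N: comm_monoid N by fact
  define k where "k X = the_inv_into (carrier N) (gp_of N) (gp_map N g X)" for X
  have k: "k X \<in> carrier N \<and> gp_of N (k X) = gp_map N g X" if "X \<in> C" for X
    using im that the_inv_into_into[OF inj _ subset_refl] f_the_inv_into_f[OF inj]
    unfolding k_def by blast
  have keq: "k X = y" if "y \<in> carrier N" "gp_map N g X = gp_of N y" for X y
    unfolding k_def that(2) using that(1) inj by (simp add: the_inv_into_f_f)
  note gm = gp_map_hom[OF M cN g]
  have "k \<in> mhom ((gp M)\<lparr>carrier := C\<rparr>) N"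
    unfolding mhom_def hom_def
  proof (safe, goal_cases)
    case (1 x)
    then show ?case using k by simp
  next
    case (2 x y)
    then have "x \<in> C" "y \<in> C" "x \<in> carrier (gp M)" "y \<in> carrier (gp M)" using C by auto
    then show ?case using k[of x] k[of y]
      by (intro keq) (simp_all add: mhom_mult[OF gm(1)] mhom_mult[OF gp_of_hom[OF cN]])
  next
    case 3
    show ?case
      by (intro keq) (simp_all add: mhom_one[OF gm(1)] mhom_one[OF gp_of_hom[OF cN]])
  qed
  moreover have 1: "\<forall>x\<in>carrier M. k (gp_of M x) = g x"
    by (auto intro!: keq simp: gm(2) mhom_closed[OF g])
  moreover have "k1 x = k2 x" if k12: "k1 \<in> mhom ((gp M)\<lparr>carrier := C\<rparr>) N" "k2 \<in> mhom ((gp M)\<lparr>carrier := C\<rparr>) N"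
    and e1: "\<forall>x\<in>carrier M. k1 (gp_of M x) = g x" and e2: "\<forall>x\<in>carrier M. k2 (gp_of M x) = g x"
    and x: "x \<in> C" for k1 k2 x
  proof -
    have "x \<in> carrier (gp M)" using x C by auto
    then obtain a b where ab: "a \<in> carrier M" "b \<in> carrier M" "x = gp_frac M a b"
      by (rule gp_obtain[OF M])
    have xb: "x \<otimes>\<^bsub>gp M\<^esub> gp_of M b = gp_of M a"
      using ab by (auto simp: gp_of_def frac_mult[OF M] frac_eq[OF M])
    have b: "gp_of M b \<in> C" using ab C by auto
    have "k1 x \<otimes>\<^bsub>N\<^esub> g b = g a" "k2 x \<otimes>\<^bsub>N\<^esub> g b = g a"
      using mhom_mult[OF k12(1), of x "gp_of M b"] mhom_mult[OF k12(2), of x "gp_of M b"] x b e1 e2 ab(1,2)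
      by (simp_all add: xb)
    then have "k1 x \<otimes>\<^bsub>N\<^esub> g b = k2 x \<otimes>\<^bsub>N\<^esub> g b" by simp
    moreover have "k1 x \<in> carrier N" "k2 x \<in> carrier N"
      using mhom_closed[OF k12(1), of x] mhom_closed[OF k12(2), of x] x by simp_all
    ultimately show ?thesis
      using N mhom_closed[OF g ab(2)] unfolding integral_monoid_iff by blast
  qed
  ultimately show ?thesis by blast
qed

theorem integralisation_universal:
  assumes M: "comm_monoid M" and N: "integral_monoid N" and g: "g \<in> mhom M N"
  shows "\<exists>k \<in> mhom (integralisation M) N. (\<forall>x\<in>carrier M. k (gp_of M x) = g x) \<and>
    (\<forall>k' \<in> mhom (integralisation M) N. (\<forall>x\<in>carrier M. k' (gp_of M x) = g x) \<longrightarrow>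
      (\<forall>x\<in>carrier (integralisation M). k' x = k x))"
proof -
  have cN: "comm_monoid N" using N by (simp add: integral_monoid_def)
  have "gp_map N g ` gp_of M ` carrier M \<subseteq> gp_of N ` carrier N"
    using gp_map_hom(2)[OF M cN g] mhom_closed[OF g] by auto
  moreover have "gp_of M ` carrier M \<subseteq> carrier (gp M)"
    using mhom_closed[OF gp_of_hom[OF M]] by auto
  ultimately show ?thesis
    using sub_gp_universal[OF M N g, of "gp_of M ` carrier M"] by (simp add: integralisation_def)
qed

theorem integral_monoid_integralisation:
  assumes M: "comm_monoid M" shows "integral_monoid (integralisation M)"
proof -
  interpret M: comm_monoid M by fact
  interpret G: comm_group "gp M" by (rule gp_comm_group[OF M])
  note h = gp_of_hom[OF M]
  have in_G: "gp_of M x \<in> carrier (gp M)" if "x \<in> carrier M" for x by (rule mhom_closed[OF h that])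
  have "comm_monoid (integralisation M)"
    by (rule comm_monoidI)
      (auto simp: integralisation_def mhom_mult[OF h, symmetric] mhom_one[OF h, symmetric]
        M.m_ac simp del: G.m_closed)
  then show ?thesis unfolding integral_monoid_iff
    by (auto simp: integralisation_def in_G)
qed

theorem saturated_monoid_saturation:
  assumes M: "comm_monoid M" shows "saturated_monoid (saturation M)"
proof -
  interpret M: comm_monoid M by fact
  interpret G: comm_group "gp M" by (rule gp_comm_group[OF M])
  note h = gp_of_hom[OF M]
  let ?I = "gp_of M ` carrier M" and ?S = "saturation M"
  have I_mult: "x \<otimes>\<^bsub>gp M\<^esub> y \<in> ?I" if "x \<in> ?I" "y \<in> ?I" for x y
    using that by (auto simp: mhom_mult[OF h, symmetric])
  have I_pow: "x [^]\<^bsub>gp M\<^esub> (n::nat) \<in> ?I" if "x \<in> ?I" for x n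
    using that by (auto simp: mhom_pow[OF h M G.comm_monoid_axioms, symmetric])
  have S: "x \<in> carrier ?S \<longleftrightarrow> x \<in> carrier (gp M) \<and> (\<exists>n::nat. n \<ge> 1 \<and> x [^]\<^bsub>gp M\<^esub> n \<in> ?I)" for x
    by (simp add: saturation_def)
  have S_mult: "x \<otimes>\<^bsub>gp M\<^esub> y \<in> carrier ?S" if xy: "x \<in> carrier ?S" "y \<in> carrier ?S" for x y
  proof -
    obtain n m :: nat where nm: "n \<ge> 1" "m \<ge> 1" "x [^]\<^bsub>gp M\<^esub> n \<in> ?I" "y [^]\<^bsub>gp M\<^esub> m \<in> ?I"
      and G: "x \<in> carrier (gp M)" "y \<in> carrier (gp M)"
      using xy unfolding S by blast
    have "(x \<otimes>\<^bsub>gp M\<^esub> y) [^]\<^bsub>gp M\<^esub> (n * m) =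
      (x [^]\<^bsub>gp M\<^esub> n) [^]\<^bsub>gp M\<^esub> m \<otimes>\<^bsub>gp M\<^esub> (y [^]\<^bsub>gp M\<^esub> m) [^]\<^bsub>gp M\<^esub> n"
      using G by (simp add: G.nat_pow_distrib G.nat_pow_pow mult.commute)
    also have "\<dots> \<in> ?I" by (intro I_mult I_pow nm)
    finally show ?thesis unfolding S using G nm by (auto intro!: exI[of _ "n * m"])
  qed
  have one: "\<one>\<^bsub>gp M\<^esub> \<in> carrier ?S"
    using gp_of_in_saturation[OF M M.one_closed] by (simp add: mhom_one[OF h])
  have G: "x \<in> carrier (gp M)" if "x \<in> carrier ?S" for x using that S by blast
  have m: "x \<otimes>\<^bsub>?S\<^esub> y = x \<otimes>\<^bsub>gp M\<^esub> y" "\<one>\<^bsub>?S\<^esub> = \<one>\<^bsub>gp M\<^esub>"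
    "x [^]\<^bsub>?S\<^esub> (n::nat) = x [^]\<^bsub>gp M\<^esub> n" for x y n
    by (simp_all add: saturation_def gp_pow_consistent)
  have "comm_monoid ?S"
    by (rule comm_monoidI) (simp_all add: m S_mult one G G.m_assoc, simp add: G G.m_comm)
  then have int: "integral_monoid ?S" unfolding integral_monoid_iff by (auto simp: m G)
  have "\<exists>w\<in>carrier ?S. a = w \<otimes>\<^bsub>gp M\<^esub> b"
    if ab: "a \<in> carrier ?S" "b \<in> carrier ?S" "z \<in> carrier ?S" and n: "n \<ge> 1"
      and eq: "a [^]\<^bsub>gp M\<^esub> n = z \<otimes>\<^bsub>gp M\<^esub> b [^]\<^bsub>gp M\<^esub> n" for a b z and n :: nat
  proof -
    note C = ab[THEN G]
    let ?w = "a \<otimes>\<^bsub>gp M\<^esub> inv\<^bsub>gp M\<^esub> b"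
    have "?w [^]\<^bsub>gp M\<^esub> n = z"
      using C by (simp add: G.nat_pow_distrib eq G.nat_pow_inv G.m_assoc)
    moreover obtain m :: nat where m: "m \<ge> 1" "z [^]\<^bsub>gp M\<^esub> m \<in> ?I" using ab(3) unfolding S by blast
    ultimately have "?w [^]\<^bsub>gp M\<^esub> (n * m) \<in> ?I" using C by (simp add: G.nat_pow_pow[symmetric])
    then have "?w \<in> carrier ?S" unfolding S using C n m by (auto intro!: exI[of _ "n * m"])
    moreover have "a = ?w \<otimes>\<^bsub>gp M\<^esub> b" using C by (simp add: G.m_assoc)
    ultimately show ?thesis by blast
  qed
  then show ?thesis unfolding saturated_monoid_iff m using int by blast
qed

theorem saturation_universal:
  assumes M: "comm_monoid M" and N: "saturated_monoid N" and g: "g \<in> mhom M N"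
  shows "\<exists>k \<in> mhom (saturation M) N. (\<forall>x\<in>carrier M. k (gp_of M x) = g x) \<and>
    (\<forall>k' \<in> mhom (saturation M) N. (\<forall>x\<in>carrier M. k' (gp_of M x) = g x) \<longrightarrow>
      (\<forall>x\<in>carrier (saturation M). k' x = k x))"
proof -
  have iN: "integral_monoid N" and cN: "comm_monoid N"
    using N by (simp_all add: saturated_monoid_def integral_monoid_def)
  interpret GM: comm_group "gp M" by (rule gp_comm_group[OF M])
  interpret GN: comm_group "gp N" by (rule gp_comm_group[OF cN])
  note gm = gp_map_hom[OF M cN g]
  have "gp_map N g x \<in> gp_of N ` carrier N" if x: "x \<in> carrier (saturation M)" for x
  proof -
    obtain n :: nat and y where n: "n \<ge> 1" "y \<in> carrier M" "x [^]\<^bsub>gp M\<^esub> n = gp_of M y"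
      and xG: "x \<in> carrier (gp M)"
      using x unfolding saturation_def by auto
    have "gp_map N g x [^]\<^bsub>gp N\<^esub> n = gp_of N (g y)"
      using n gm(2)[of y] by (simp add: mhom_pow[OF gm(1) GM.comm_monoid_axioms GN.comm_monoid_axioms xG, symmetric])
    then show ?thesis
      using N n mhom_closed[OF gm(1) xG] mhom_closed[OF g n(2)] unfolding saturated_monoid_def by blast
  qed
  moreover have "carrier (saturation M) \<subseteq> carrier (gp M)" by (auto simp: saturation_def)
  moreover have "(gp M)\<lparr>carrier := carrier (saturation M)\<rparr> = saturation M"
    by (simp add: saturation_def)
  ultimately show ?thesis
    using sub_gp_universal[OF M iN g, of "carrier (saturation M)"] gp_of_in_saturation[OF M]
    by (simp add: image_subset_iff)
qed

section \<open>Integral and saturated homomorphisms: independence of the type of test monoids\<close>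

lemma pushout_cong_mono:
  assumes A: "comm_monoid A" and B: "comm_monoid B" and A': "comm_monoid A'"
    and \<pi>: "\<pi> \<in> mhom A A'" and g: "g \<in> mhom P A"
    and g': "\<And>p. p \<in> carrier P \<Longrightarrow> \<pi> (g p) = g' p"
    and x: "(x, y) \<in> pushout_cong P A B g f"
  shows "((\<pi> (fst x), snd x), (\<pi> (fst y), snd y)) \<in> pushout_cong P A' B g' f"
  using x unfolding pushout_cong_def
proof induction
  case (gen_cong_base x y)
  then obtain p where p: "p \<in> carrier P" "x = (g p, \<one>\<^bsub>B\<^esub>)" "y = (\<one>\<^bsub>A\<^esub>, f p)" by auto
  then show ?case using gen_cong_base(2,3)
    using mhom_closed[OF \<pi>, of "fst x"] mhom_closed[OF \<pi>, of "fst y"]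
    by (intro gen_cong.gen_cong_base) (auto simp: mhom_one[OF \<pi>] g')
next
  case (gen_cong_refl x)
  then show ?case by (intro gen_cong.gen_cong_refl) (auto intro: mhom_closed[OF \<pi>])
next
  case (gen_cong_mult x y x' y')
  note C = gen_cong_carrier[OF comm_monoid_DirProd[OF A B] gen_cong_mult.hyps(1)]
    gen_cong_carrier[OF comm_monoid_DirProd[OF A B] gen_cong_mult.hyps(2)]
  show ?case using gen_cong.gen_cong_mult[OF gen_cong_mult.IH] C
    by (auto simp: mult_DirProd' mhom_mult[OF \<pi>])
qed (auto intro: gen_cong.gen_cong_sym gen_cong.gen_cong_trans)

text \<open>An identity in \<open>A' \<oplus>\<^sub>P B\<close> only involves finitely many elements of \<open>A'\<close>.\<close>

lemma pushout_cong_finitary: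
  fixes A' :: "'z monoid"
  assumes A': "comm_monoid A'" and B: "comm_monoid B" and f: "f \<in> mhom P B" and g': "g' \<in> mhom P A'"
    and x: "(x, y) \<in> pushout_cong P A' B g' f"
  shows "\<exists>F. finite F \<and> F \<subseteq> carrier A' \<and> (\<forall>(A :: 'c monoid) \<pi> g.
    comm_monoid A \<longrightarrow> \<pi> \<in> mhom A A' \<longrightarrow> inj_on \<pi> (carrier A) \<longrightarrow> g \<in> mhom P A \<longrightarrow>
    (\<forall>p\<in>carrier P. \<pi> (g p) = g' p) \<longrightarrow> F \<subseteq> \<pi> ` carrier A \<longrightarrow>
    (\<forall>a\<in>carrier A. \<forall>b\<in>carrier A. \<pi> a = fst x \<longrightarrow> \<pi> b = fst y \<longrightarrow>
      ((a, snd x), (b, snd y)) \<in> pushout_cong P A B g f))" (is "\<exists>F. ?ok F \<and> ?sub F \<and> ?Q F x y")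
  using x unfolding pushout_cong_def[of P A']
proof induction
  case (gen_cong_base x y)
  then obtain p where p: "p \<in> carrier P" "x = (g' p, \<one>\<^bsub>B\<^esub>)" "y = (\<one>\<^bsub>A'\<^esub>, f p)" by auto
  have "?Q {} x y"
  proof (intro allI impI ballI)
    fix A :: "'c monoid" and \<pi> g a b
    assume *: "comm_monoid A" "\<pi> \<in> mhom A A'" "inj_on \<pi> (carrier A)" "g \<in> mhom P A"
      "\<forall>p\<in>carrier P. \<pi> (g p) = g' p" "a \<in> carrier A" "b \<in> carrier A" "\<pi> a = fst x" "\<pi> b = fst y"
    interpret A: comm_monoid A by fact
    interpret B: comm_monoid B by fact
    have "\<pi> a = \<pi> (g p)" "\<pi> b = \<pi> \<one>\<^bsub>A\<^esub>" using * p by (auto simp: mhom_one)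
    then have "a = g p" "b = \<one>\<^bsub>A\<^esub>"
      using inj_onD[OF *(3)] * p by (auto simp: mhom_closed)
    then show "((a, snd x), (b, snd y)) \<in> pushout_cong P A B g f"
      unfolding pushout_cong_def using p * f
      by (intro gen_cong.gen_cong_base) (auto simp: mhom_closed)
  qed
  then show ?case by (intro exI[of _ "{}"]) simp
next
  case (gen_cong_refl x)
  have "?Q {} x x"
  proof (intro allI impI ballI)
    fix A :: "'c monoid" and \<pi> g a b
    assume *: "comm_monoid A" "\<pi> \<in> mhom A A'" "inj_on \<pi> (carrier A)" "g \<in> mhom P A"
      "\<forall>p\<in>carrier P. \<pi> (g p) = g' p" "a \<in> carrier A" "b \<in> carrier A" "\<pi> a = fst x" "\<pi> b = fst x"
    then have "a = b" using inj_onD[OF *(3)] by auto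
    then show "((a, snd x), (b, snd x)) \<in> pushout_cong P A B g f"
      unfolding pushout_cong_def using gen_cong_refl *
      by (auto intro!: gen_cong.gen_cong_refl)
  qed
  then show ?case by (intro exI[of _ "{}"]) simp
next
  case (gen_cong_sym x y)
  from gen_cong_sym.IH obtain F where F: "?ok F \<and> ?sub F \<and> ?Q F x y" by (rule exE)
  note FQ = F[THEN conjunct2, THEN conjunct2, rule_format]
  have "?Q F y x"
    by (intro allI impI ballI, unfold pushout_cong_def, rule gen_cong.gen_cong_sym,
      fold pushout_cong_def, rule FQ) (assumption | blast)+
  then show ?case using F by (intro exI[of _ F]) simp
next
  case (gen_cong_trans x y z)
  from gen_cong_trans.IH(1) obtain F1 where F1: "?ok F1 \<and> ?sub F1 \<and> ?Q F1 x y" by (rule exE)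
  from gen_cong_trans.IH(2) obtain F2 where F2: "?ok F2 \<and> ?sub F2 \<and> ?Q F2 y z" by (rule exE)
  note F = F1[THEN conjunct2, THEN conjunct2, THEN spec, THEN spec, THEN spec, THEN mp, THEN mp,
      THEN mp, THEN mp, THEN mp, THEN mp, THEN bspec, THEN bspec, THEN mp, THEN mp]
    F2[THEN conjunct2, THEN conjunct2, THEN spec, THEN spec, THEN spec, THEN mp, THEN mp,
      THEN mp, THEN mp, THEN mp, THEN mp, THEN bspec, THEN bspec, THEN mp, THEN mp]
  have y: "fst y \<in> carrier A'"
    using gen_cong_carrier[OF comm_monoid_DirProd[OF A' B] gen_cong_trans.hyps(1)] by auto
  have "?Q (insert (fst y) (F1 \<union> F2)) x z"
  proof (intro allI impI ballI)
    fix A :: "'c monoid" and \<pi> g a b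
    assume *: "comm_monoid A" "\<pi> \<in> mhom A A'" "inj_on \<pi> (carrier A)" "g \<in> mhom P A"
      "\<forall>p\<in>carrier P. \<pi> (g p) = g' p" and s: "insert (fst y) (F1 \<union> F2) \<subseteq> \<pi> ` carrier A"
      and ab: "a \<in> carrier A" "b \<in> carrier A" "\<pi> a = fst x" "\<pi> b = fst z"
    from s obtain c where c: "c \<in> carrier A" "\<pi> c = fst y" by auto
    have "((a, snd x), (c, snd y)) \<in> pushout_cong P A B g f"
      by (rule F(1)[OF * _ ab(1) c(1) ab(3) c(2)]) (use s in auto)
    moreover have "((c, snd y), (b, snd z)) \<in> pushout_cong P A B g f"
      by (rule F(2)[OF * _ c(1) ab(2) c(2) ab(4)]) (use s in auto)
    ultimately show "((a, snd x), (b, snd z)) \<in> pushout_cong P A B g f"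
      unfolding pushout_cong_def by (rule gen_cong.gen_cong_trans)
  qed
  then show ?case using F1 F2 y by (intro exI[of _ "insert (fst y) (F1 \<union> F2)"]) simp
next
  case (gen_cong_mult x y x' y')
  from gen_cong_mult.IH(1) obtain F1 where F1: "?ok F1 \<and> ?sub F1 \<and> ?Q F1 x y" by (rule exE)
  from gen_cong_mult.IH(2) obtain F2 where F2: "?ok F2 \<and> ?sub F2 \<and> ?Q F2 x' y'" by (rule exE)
  note F = F1[THEN conjunct2, THEN conjunct2, THEN spec, THEN spec, THEN spec, THEN mp, THEN mp,
      THEN mp, THEN mp, THEN mp, THEN mp, THEN bspec, THEN bspec, THEN mp, THEN mp]
    F2[THEN conjunct2, THEN conjunct2, THEN spec, THEN spec, THEN spec, THEN mp, THEN mp,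
      THEN mp, THEN mp, THEN mp, THEN mp, THEN bspec, THEN bspec, THEN mp, THEN mp]
  have C: "fst x \<in> carrier A'" "fst y \<in> carrier A'" "fst x' \<in> carrier A'" "fst y' \<in> carrier A'"
    using gen_cong_carrier[OF comm_monoid_DirProd[OF A' B] gen_cong_mult.hyps(1)]
      gen_cong_carrier[OF comm_monoid_DirProd[OF A' B] gen_cong_mult.hyps(2)] by auto
  let ?F = "{fst x, fst y, fst x', fst y'} \<union> (F1 \<union> F2)"
  have "?Q ?F (x \<otimes>\<^bsub>A' \<times>\<times> B\<^esub> x') (y \<otimes>\<^bsub>A' \<times>\<times> B\<^esub> y')"
  proof (intro allI impI ballI)
    fix A :: "'c monoid" and \<pi> g a b
    assume *: "comm_monoid A" "\<pi> \<in> mhom A A'" "inj_on \<pi> (carrier A)" "g \<in> mhom P A"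
      "\<forall>p\<in>carrier P. \<pi> (g p) = g' p" and s: "?F \<subseteq> \<pi> ` carrier A"
      and ab: "a \<in> carrier A" "b \<in> carrier A" "\<pi> a = fst (x \<otimes>\<^bsub>A' \<times>\<times> B\<^esub> x')" "\<pi> b = fst (y \<otimes>\<^bsub>A' \<times>\<times> B\<^esub> y')"
    interpret A: comm_monoid A by fact
    obtain c d c' d' where c: "c \<in> carrier A" "d \<in> carrier A" "c' \<in> carrier A" "d' \<in> carrier A"
      "\<pi> c = fst x" "\<pi> d = fst y" "\<pi> c' = fst x'" "\<pi> d' = fst y'" using s by auto
    have "\<pi> a = \<pi> (c \<otimes>\<^bsub>A\<^esub> c')" "\<pi> b = \<pi> (d \<otimes>\<^bsub>A\<^esub> d')"
      using c ab by (simp_all add: mult_DirProd' mhom_mult[OF *(2)])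
    then have eq: "a = c \<otimes>\<^bsub>A\<^esub> c'" "b = d \<otimes>\<^bsub>A\<^esub> d'"
      using inj_onD[OF *(3)] ab c by auto
    have "((c, snd x), (d, snd y)) \<in> pushout_cong P A B g f"
      by (rule F(1)[OF * _ c(1,2,5,6)]) (use s in auto)
    moreover have "((c', snd x'), (d', snd y')) \<in> pushout_cong P A B g f"
      by (rule F(2)[OF * _ c(3,4,7,8)]) (use s in auto)
    ultimately have "((c, snd x) \<otimes>\<^bsub>A \<times>\<times> B\<^esub> (c', snd x'), (d, snd y) \<otimes>\<^bsub>A \<times>\<times> B\<^esub> (d', snd y'))
        \<in> pushout_cong P A B g f"
      unfolding pushout_cong_def by (rule gen_cong.gen_cong_mult)
    then show "((a, snd (x \<otimes>\<^bsub>A' \<times>\<times> B\<^esub> x')), (b, snd (y \<otimes>\<^bsub>A' \<times>\<times> B\<^esub> y'))) \<in> pushout_cong P A B g f"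
      by (simp add: mult_DirProd' eq)
  qed
  then show ?case using F1 F2 C by (intro exI[of _ ?F]) simp
qed

text \<open>A finite subset of an integral (saturated) monoid \<open>A'\<close> over \<open>P\<close> lies in an integral
  (saturated) submonoid over \<open>P\<close> that has a copy over the type \<^typ>\<open>'p sat_alg\<close>: the elements
  of \<open>A'\<close> in the group generated by \<open>P\<close> and that subset.\<close>

lemma small_submonoid:
  fixes P :: "'p monoid" and A' :: "'z monoid"
  assumes P: "comm_monoid P" and A': "integral_monoid A'" and g': "g' \<in> mhom P A'"
    and F: "finite F" "F \<subseteq> carrier A'"
  shows "\<exists>(A :: 'p sat_alg monoid) \<pi> g. integral_monoid A \<and> (saturated_monoid A' \<longrightarrow> saturated_monoid A) \<and>
    \<pi> \<in> mhom A A' \<and> inj_on \<pi> (carrier A) \<and> g \<in> mhom P A \<and>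
    (\<forall>p\<in>carrier P. \<pi> (g p) = g' p) \<and> F \<subseteq> \<pi> ` carrier A"
proof -
  have cA': "comm_monoid A'" using A' by (simp add: integral_monoid_def)
  interpret P: comm_monoid P by fact
  interpret A': comm_monoid A' by fact
  have canc: "a = b" if "a \<otimes>\<^bsub>A'\<^esub> t = b \<otimes>\<^bsub>A'\<^esub> t" "a \<in> carrier A'" "b \<in> carrier A'" "t \<in> carrier A'" for a b t
    using A' that unfolding integral_monoid_iff by blast
  obtain e :: "nat \<Rightarrow> 'z" and r where e: "F = e ` {..<r}"
    using F(1) finite_imp_nat_seg_image_inj_on[of F] by (auto simp: lessThan_def)
  have eC: "e i \<in> carrier A'" if "i < r" for i using that F(2) e by auto
  define ev where "ev = (\<lambda>(p, m). g' p \<otimes>\<^bsub>A'\<^esub> (\<Otimes>\<^bsub>A'\<^esub>i\<in>{..<r}. e i [^]\<^bsub>A'\<^esub> (m i :: nat)))"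
  let ?N = "P \<times>\<times> free_cmonoid r"
  have fin_C: "(\<Otimes>\<^bsub>A'\<^esub>i\<in>{..<r}. e i [^]\<^bsub>A'\<^esub> (m i :: nat)) \<in> carrier A'" for m
    by (rule A'.finprod_closed) (auto intro: eC)
  have ev_C: "ev u \<in> carrier A'" if "u \<in> carrier ?N" for u
    using that fin_C by (auto simp: ev_def intro!: mhom_closed[OF g'])
  have N_mult: "u \<otimes>\<^bsub>?N\<^esub> v \<in> carrier ?N" if "u \<in> carrier ?N" "v \<in> carrier ?N" for u v
    using that by (auto simp: mult_DirProd' free_cmonoid_def)
  have ev_mult: "ev (u \<otimes>\<^bsub>?N\<^esub> v) = ev u \<otimes>\<^bsub>A'\<^esub> ev v" if uv: "u \<in> carrier ?N" "v \<in> carrier ?N" for u v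
  proof -
    obtain p m q n where eq: "u = (p, m)" "v = (q, n)" by (cases u, cases v)
    have C: "g' p \<in> carrier A'" "g' q \<in> carrier A'" "p \<in> carrier P" "q \<in> carrier P"
      using uv by (auto simp: eq intro: mhom_closed[OF g'])
    have "(\<Otimes>\<^bsub>A'\<^esub>i\<in>{..<r}. e i [^]\<^bsub>A'\<^esub> (m i + n i)) =
      (\<Otimes>\<^bsub>A'\<^esub>i\<in>{..<r}. e i [^]\<^bsub>A'\<^esub> m i \<otimes>\<^bsub>A'\<^esub> e i [^]\<^bsub>A'\<^esub> n i)"
      by (rule A'.finprod_cong') (auto simp: A'.nat_pow_mult eC)
    also have "\<dots> = (\<Otimes>\<^bsub>A'\<^esub>i\<in>{..<r}. e i [^]\<^bsub>A'\<^esub> m i) \<otimes>\<^bsub>A'\<^esub> (\<Otimes>\<^bsub>A'\<^esub>i\<in>{..<r}. e i [^]\<^bsub>A'\<^esub> n i)"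
      by (rule A'.finprod_multf) (auto simp: eC)
    finally show ?thesis using C fin_C
      by (simp add: eq ev_def free_cmonoid_def mhom_mult[OF g'] A'.m_ac)
  qed
  define one where "one = (\<one>\<^bsub>P\<^esub>, \<lambda>_::nat. 0::nat)"
  have one_C: "one \<in> carrier ?N" by (simp add: one_def free_cmonoid_def)
  have fin_0: "(\<Otimes>\<^bsub>A'\<^esub>i\<in>{..<r}. e i [^]\<^bsub>A'\<^esub> (0::nat)) = \<one>\<^bsub>A'\<^esub>"
    by (simp add: A'.finprod_one_eqI)
  have ev_one: "ev one = \<one>\<^bsub>A'\<^esub>" by (simp add: one_def ev_def fin_0 mhom_one[OF g'])
  define D where "D = {x \<in> carrier A'. \<exists>u\<in>carrier ?N. \<exists>v\<in>carrier ?N. x \<otimes>\<^bsub>A'\<^esub> ev v = ev u}"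
  have D_C: "x \<in> carrier A'" if "x \<in> D" for x using that by (simp add: D_def)
  have D_I: "x \<in> D" if "x \<in> carrier A'" "u \<in> carrier ?N" "v \<in> carrier ?N" "x \<otimes>\<^bsub>A'\<^esub> ev v = ev u" for x u v
    unfolding D_def using that by blast
  have ev_D: "ev u \<in> D" if "u \<in> carrier ?N" for u
    by (rule D_I[OF ev_C[OF that] that one_C]) (simp add: ev_one ev_C[OF that])
  have D_mult: "x \<otimes>\<^bsub>A'\<^esub> y \<in> D" if xy: "x \<in> D" "y \<in> D" for x y
  proof -
    obtain u v where u: "u \<in> carrier ?N" "v \<in> carrier ?N" "x \<otimes>\<^bsub>A'\<^esub> ev v = ev u" using xy unfolding D_def by blast
    obtain u' v' where u': "u' \<in> carrier ?N" "v' \<in> carrier ?N" "y \<otimes>\<^bsub>A'\<^esub> ev v' = ev u'"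
      using xy unfolding D_def by blast
    note C = D_C[OF xy(1)] D_C[OF xy(2)] u(1,2)[THEN ev_C] u'(1,2)[THEN ev_C]
    have "(x \<otimes>\<^bsub>A'\<^esub> y) \<otimes>\<^bsub>A'\<^esub> ev (v \<otimes>\<^bsub>?N\<^esub> v') = (x \<otimes>\<^bsub>A'\<^esub> ev v) \<otimes>\<^bsub>A'\<^esub> (y \<otimes>\<^bsub>A'\<^esub> ev v')"
      unfolding ev_mult[OF u(2) u'(2)] using C by (simp only: A'.m_ac A'.m_closed)
    also have "\<dots> = ev (u \<otimes>\<^bsub>?N\<^esub> u')" unfolding u u' ev_mult[OF u(1) u'(1)] ..
    finally show ?thesis using C by (intro D_I[OF _ N_mult[OF u(1) u'(1)] N_mult[OF u(2) u'(2)]]) auto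
  qed
  have D_div: "w \<in> D" if w: "w \<in> carrier A'" "a \<in> D" "b \<in> D" "a = w \<otimes>\<^bsub>A'\<^esub> b" for w a b
  proof -
    obtain u v where u: "u \<in> carrier ?N" "v \<in> carrier ?N" "a \<otimes>\<^bsub>A'\<^esub> ev v = ev u" using w unfolding D_def by blast
    obtain u' v' where u': "u' \<in> carrier ?N" "v' \<in> carrier ?N" "b \<otimes>\<^bsub>A'\<^esub> ev v' = ev u'"
      using w unfolding D_def by blast
    note C = w(1) D_C[OF w(2)] D_C[OF w(3)] u(1,2)[THEN ev_C] u'(1,2)[THEN ev_C]
    have "w \<otimes>\<^bsub>A'\<^esub> ev (u' \<otimes>\<^bsub>?N\<^esub> v) = w \<otimes>\<^bsub>A'\<^esub> ((b \<otimes>\<^bsub>A'\<^esub> ev v') \<otimes>\<^bsub>A'\<^esub> ev v)"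
      unfolding ev_mult[OF u'(1) u(2)] u' ..
    also have "\<dots> = ((w \<otimes>\<^bsub>A'\<^esub> b) \<otimes>\<^bsub>A'\<^esub> ev v) \<otimes>\<^bsub>A'\<^esub> ev v'"
      using C by (simp only: A'.m_ac A'.m_closed)
    also have "\<dots> = ev (u \<otimes>\<^bsub>?N\<^esub> v')" unfolding w(4)[symmetric] u ev_mult[OF u(1) u'(2)] ..
    finally show ?thesis by (rule D_I[OF w(1) N_mult[OF u(1) u'(2)] N_mult[OF u'(1) u(2)]])
  qed
  have D_one: "\<one>\<^bsub>A'\<^esub> \<in> D" using ev_D[OF one_C] by (simp add: ev_one)
  define c :: "'z \<Rightarrow> 'p sat_alg" where
    "c x = {({u}, {v}) | u v. u \<in> carrier ?N \<and> v \<in> carrier ?N \<and> x \<otimes>\<^bsub>A'\<^esub> ev v = ev u}" for x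
  have inj_c: "inj_on c D"
  proof (rule inj_onI)
    fix x y assume xy: "x \<in> D" "y \<in> D" "c x = c y"
    obtain u v where u: "u \<in> carrier ?N" "v \<in> carrier ?N" "x \<otimes>\<^bsub>A'\<^esub> ev v = ev u"
      using xy(1) unfolding D_def by blast
    then have "({u}, {v}) \<in> c x" unfolding c_def by blast
    then have "({u}, {v}) \<in> c y" using xy(3) by simp
    then have "y \<otimes>\<^bsub>A'\<^esub> ev v = ev u" unfolding c_def by blast
    then have "x \<otimes>\<^bsub>A'\<^esub> ev v = y \<otimes>\<^bsub>A'\<^esub> ev v" using u(3) by simp
    then show "x = y" using canc D_C[OF xy(1)] D_C[OF xy(2)] ev_C[OF u(2)] by blast
  qed
  define \<pi> where "\<pi> = the_inv_into D c"
  have \<pi>: "\<pi> (c x) = x" if "x \<in> D" for x using that inj_c by (simp add: \<pi>_def the_inv_into_f_f)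
  define A :: "'p sat_alg monoid" where
    "A = \<lparr>carrier = c ` D, monoid.mult = (\<lambda>X Y. c (\<pi> X \<otimes>\<^bsub>A'\<^esub> \<pi> Y)), monoid.one = c \<one>\<^bsub>A'\<^esub>\<rparr>"
  have A_simps: "carrier A = c ` D" "X \<otimes>\<^bsub>A\<^esub> Y = c (\<pi> X \<otimes>\<^bsub>A'\<^esub> \<pi> Y)" "\<one>\<^bsub>A\<^esub> = c \<one>\<^bsub>A'\<^esub>" for X Y
    by (simp_all add: A_def)
  have cA: "comm_monoid A"
    by (rule comm_monoidI) (auto simp: A_simps \<pi> D_mult D_one D_C A'.m_ac)
  have c_eq: "c x = c y \<longleftrightarrow> x = y" if "x \<in> D" "y \<in> D" for x y
    using inj_c that by (simp add: inj_on_eq_iff)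
  have iA: "integral_monoid A"
    unfolding integral_monoid_iff using cA canc by (auto simp: A_simps \<pi> c_eq D_mult D_C)
  have \<pi>h: "\<pi> \<in> mhom A A'"
    by (auto simp: mhom_def hom_def A_simps \<pi> D_mult D_one D_C)
  have \<pi>inj: "inj_on \<pi> (carrier A)" by (rule inj_onI) (auto simp: A_simps \<pi>)
  have "saturated_monoid A" if sA': "saturated_monoid A'"
    unfolding saturated_monoid_iff
  proof (intro conjI iA ballI allI impI)
    fix a b z and n :: nat
    assume abz: "a \<in> carrier A" "b \<in> carrier A" "z \<in> carrier A" and n: "n \<ge> 1"
      and eq: "a [^]\<^bsub>A\<^esub> n = z \<otimes>\<^bsub>A\<^esub> b [^]\<^bsub>A\<^esub> n"
    interpret A: comm_monoid A by fact
    have "\<pi> a [^]\<^bsub>A'\<^esub> n = \<pi> z \<otimes>\<^bsub>A'\<^esub> \<pi> b [^]\<^bsub>A'\<^esub> n"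
      using arg_cong[OF eq, of \<pi>] abz
      by (simp add: mhom_mult[OF \<pi>h] mhom_pow[OF \<pi>h cA cA'])
    then obtain w where w: "w \<in> carrier A'" "\<pi> a = w \<otimes>\<^bsub>A'\<^esub> \<pi> b"
      using sA' n abz[THEN mhom_closed[OF \<pi>h]] unfolding saturated_monoid_iff by blast
    have D: "\<pi> a \<in> D" "\<pi> b \<in> D" using abz by (auto simp: A_simps \<pi>)
    have wD: "w \<in> D" by (rule D_div[OF w(1) D w(2)])
    have "a = c w \<otimes>\<^bsub>A\<^esub> b" using abz wD w(2) by (auto simp: A_simps \<pi>)
    then show "\<exists>w\<in>carrier A. a = w \<otimes>\<^bsub>A\<^esub> b" using wD by (auto simp: A_simps)
  qed
  moreover have g'D: "g' p \<in> D" if "p \<in> carrier P" for p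
  proof -
    have "ev (p, \<lambda>_. 0) = g' p" using that by (simp add: ev_def fin_0 mhom_closed[OF g'])
    then show ?thesis using ev_D[of "(p, \<lambda>_. 0)"] that by (simp add: free_cmonoid_def)
  qed
  moreover have "(\<lambda>p. c (g' p)) \<in> mhom P A"
    using g'D by (auto simp: mhom_def[of P A] hom_def A_simps \<pi> mhom_mult[OF g'] mhom_one[OF g'])
  moreover have "F \<subseteq> D"
  proof
    fix x assume "x \<in> F"
    then obtain j where j: "j < r" "x = e j" using e by auto
    let ?m = "\<lambda>i. if i = j then 1 else 0 :: nat"
    have "(\<Otimes>\<^bsub>A'\<^esub>i\<in>{..<r}. e i [^]\<^bsub>A'\<^esub> ?m i) = (\<Otimes>\<^bsub>A'\<^esub>i\<in>{..<r}. if j = i then e i else \<one>\<^bsub>A'\<^esub>)"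
      by (rule A'.finprod_cong') (auto simp: eC)
    also have "\<dots> = e j" by (rule A'.finprod_singleton) (use j eC in auto)
    finally have "ev (\<one>\<^bsub>P\<^esub>, ?m) = x" using j eC by (simp add: ev_def mhom_one[OF g'])
    then show "x \<in> D" using ev_D[of "(\<one>\<^bsub>P\<^esub>, ?m)"] j by (auto simp: free_cmonoid_def)
  qed
  then have "F \<subseteq> \<pi> ` carrier A" by (force simp: A_simps \<pi>)
  ultimately show ?thesis using iA \<pi>h \<pi>inj \<pi>
    by (intro exI[of _ A] exI[of _ \<pi>] exI[of _ "\<lambda>p. c (g' p)"]) auto
qed

context
  fixes P :: "'p monoid" and Q :: "'q monoid" and f :: "'p \<Rightarrow> 'q"
    and P' :: "'z monoid" and g' :: "'p \<Rightarrow> 'z"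
  assumes cP: "comm_monoid P" and cQ: "comm_monoid Q" and f: "f \<in> mhom P Q"
    and iP': "integral_monoid P'" and g': "g' \<in> mhom P P'"
begin

lemma cP': "comm_monoid P'" using iP' by (simp add: integral_monoid_def)

abbreviation (input) pushout_class :: "'z \<Rightarrow> 'q \<Rightarrow> ('z \<times> 'q) set" where
  "pushout_class a q \<equiv> pushout_cong P P' Q g' f `` {(a, q)}"

lemma mc_pushout:
  assumes "comm_monoid A" shows "mcong (A \<times>\<times> Q) (pushout_cong P A Q g f)"
  unfolding pushout_cong_def by (rule mcong_gen_cong[OF comm_monoid_DirProd[OF assms cQ]])

lemma pushout_obtain:
  assumes "comm_monoid A" "X \<in> carrier (pushout P A Q g f)"
  obtains a q where "a \<in> carrier A" "q \<in> carrier Q" "X = pushout_cong P A Q g f `` {(a, q)}"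
proof -
  obtain z where "z \<in> carrier (A \<times>\<times> Q)" "X = pushout_cong P A Q g f `` {z}"
    using assms(2) unfolding pushout_def
    by (rule quot_obtain[OF comm_monoid_DirProd[OF assms(1) cQ] mc_pushout[OF assms(1)]])
  then show ?thesis using that by (cases z) auto
qed

lemma pushout_simps:
  assumes A: "comm_monoid A" and aq: "a \<in> carrier A" "q \<in> carrier Q"
  shows "pushout_cong P A Q g f `` {(a, q)} \<in> carrier (pushout P A Q g f)"
    and "pushout_cong P A Q g f `` {(a, q)} [^]\<^bsub>pushout P A Q g f\<^esub> (n::nat) =
      pushout_cong P A Q g f `` {(a [^]\<^bsub>A\<^esub> n, q [^]\<^bsub>Q\<^esub> n)}"
    and "b \<in> carrier A \<Longrightarrow> r \<in> carrier Q \<Longrightarrow>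
      pushout_cong P A Q g f `` {(a, q)} \<otimes>\<^bsub>pushout P A Q g f\<^esub> pushout_cong P A Q g f `` {(b, r)} =
      pushout_cong P A Q g f `` {(a \<otimes>\<^bsub>A\<^esub> b, q \<otimes>\<^bsub>Q\<^esub> r)}"
    and "b \<in> carrier A \<Longrightarrow> r \<in> carrier Q \<Longrightarrow>
      pushout_cong P A Q g f `` {(a, q)} = pushout_cong P A Q g f `` {(b, r)} \<longleftrightarrow>
      ((a, q), (b, r)) \<in> pushout_cong P A Q g f"
proof -
  note cm = comm_monoid_DirProd[OF A cQ]
  note mc = mc_pushout[OF A]
  have z: "(a, q) \<in> carrier (A \<times>\<times> Q)" using aq by simp
  show "pushout_cong P A Q g f `` {(a, q)} \<in> carrier (pushout P A Q g f)"
    unfolding pushout_def by (rule quot_class_in[OF cm mc z])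
  show "pushout_cong P A Q g f `` {(a, q)} [^]\<^bsub>pushout P A Q g f\<^esub> (n::nat) =
      pushout_cong P A Q g f `` {(a [^]\<^bsub>A\<^esub> n, q [^]\<^bsub>Q\<^esub> n)}"
    unfolding pushout_def quot_pow[OF cm mc z] DirProd_pow ..
  assume br: "b \<in> carrier A" "r \<in> carrier Q"
  then have w: "(b, r) \<in> carrier (A \<times>\<times> Q)" by simp
  show "pushout_cong P A Q g f `` {(a, q)} \<otimes>\<^bsub>pushout P A Q g f\<^esub> pushout_cong P A Q g f `` {(b, r)} =
      pushout_cong P A Q g f `` {(a \<otimes>\<^bsub>A\<^esub> b, q \<otimes>\<^bsub>Q\<^esub> r)}"
    unfolding pushout_def quot_mult[OF cm mc z w] by simp
  show "pushout_cong P A Q g f `` {(a, q)} = pushout_cong P A Q g f `` {(b, r)} \<longleftrightarrow>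
      ((a, q), (b, r)) \<in> pushout_cong P A Q g f"
    by (rule quot_class_eq[OF cm mc z w])
qed

text \<open>Given an identity in the pushout and finitely many elements of \<open>P'\<close>, a small submonoid of
  \<open>P'\<close> containing the elements, over which the identity holds as well.\<close>

lemma small_pushout:
  assumes xy: "(x, y) \<in> pushout_cong P P' Q g' f" and E: "finite E" "E \<subseteq> carrier P'"
  obtains A :: "'p sat_alg monoid" and \<pi> g where
    "integral_monoid A" "saturated_monoid P' \<Longrightarrow> saturated_monoid A" "\<pi> \<in> mhom A P'"
    "g \<in> mhom P A" "\<And>p. p \<in> carrier P \<Longrightarrow> \<pi> (g p) = g' p" "E \<subseteq> \<pi> ` carrier A"
    "\<And>a b. a \<in> carrier A \<Longrightarrow> b \<in> carrier A \<Longrightarrow> \<pi> a = fst x \<Longrightarrow> \<pi> b = fst y \<Longrightarrow>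
      ((a, snd x), (b, snd y)) \<in> pushout_cong P A Q g f"
proof -
  from pushout_cong_finitary[OF cP' cQ f g' xy, where 'c = "'p sat_alg"]
  obtain F where F: "finite F" "F \<subseteq> carrier P'" and FQ: "\<forall>(A :: 'p sat_alg monoid) \<pi> g.
    comm_monoid A \<longrightarrow> \<pi> \<in> mhom A P' \<longrightarrow> inj_on \<pi> (carrier A) \<longrightarrow> g \<in> mhom P A \<longrightarrow>
    (\<forall>p\<in>carrier P. \<pi> (g p) = g' p) \<longrightarrow> F \<subseteq> \<pi> ` carrier A \<longrightarrow>
    (\<forall>a\<in>carrier A. \<forall>b\<in>carrier A. \<pi> a = fst x \<longrightarrow> \<pi> b = fst y \<longrightarrow>
      ((a, snd x), (b, snd y)) \<in> pushout_cong P A Q g f)" by (elim exE conjE) (rule that)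
  have "finite (E \<union> F)" "E \<union> F \<subseteq> carrier P'" using E F by auto
  from small_submonoid[OF cP iP' g' this] obtain A :: "'p sat_alg monoid" and \<pi> g where
    A: "integral_monoid A" "saturated_monoid P' \<longrightarrow> saturated_monoid A" "\<pi> \<in> mhom A P'"
    "inj_on \<pi> (carrier A)" "g \<in> mhom P A" "\<forall>p\<in>carrier P. \<pi> (g p) = g' p" "E \<union> F \<subseteq> \<pi> ` carrier A"
    by (elim exE conjE) (rule that)
  have cA: "comm_monoid A" using A(1) by (simp add: integral_monoid_def)
  have "F \<subseteq> \<pi> ` carrier A" using A(7) by simp
  note * = FQ[THEN spec, THEN spec, THEN spec, THEN mp, THEN mp,
      THEN mp, THEN mp, THEN mp, THEN mp, THEN bspec, THEN bspec, THEN mp, THEN mp, OF cA A(3,4,5,6) this]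
  show ?thesis
    by (rule that[OF A(1) _ A(3,5)]) (use A * in auto)
qed

lemma integral_pushout:
  assumes int: "\<And>(A :: 'p sat_alg monoid) g. integral_monoid A \<Longrightarrow>
      (saturated_monoid P' \<Longrightarrow> saturated_monoid A) \<Longrightarrow> g \<in> mhom P A \<Longrightarrow> integral_monoid (pushout P A Q g f)"
  shows "integral_monoid (pushout P P' Q g' f)"
  unfolding integral_monoid_iff
proof (intro conjI ballI impI)
  interpret P': comm_monoid P' by (rule cP')
  interpret Q: comm_monoid Q by (rule cQ)
  let ?M = "pushout P P' Q g' f"
  show "comm_monoid ?M" by (rule comm_monoid_pushout[OF cP' cQ])
  fix X Y T assume XYT: "X \<in> carrier ?M" "Y \<in> carrier ?M" "T \<in> carrier ?M" and eq: "X \<otimes>\<^bsub>?M\<^esub> T = Y \<otimes>\<^bsub>?M\<^esub> T"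
  obtain x1 x2 where X: "x1 \<in> carrier P'" "x2 \<in> carrier Q" "X = pushout_class x1 x2"
    using XYT(1) by (rule pushout_obtain[OF cP'])
  obtain y1 y2 where Y: "y1 \<in> carrier P'" "y2 \<in> carrier Q" "Y = pushout_class y1 y2"
    using XYT(2) by (rule pushout_obtain[OF cP'])
  obtain t1 t2 where T: "t1 \<in> carrier P'" "t2 \<in> carrier Q" "T = pushout_class t1 t2"
    using XYT(3) by (rule pushout_obtain[OF cP'])
  have "((x1 \<otimes>\<^bsub>P'\<^esub> t1, x2 \<otimes>\<^bsub>Q\<^esub> t2), (y1 \<otimes>\<^bsub>P'\<^esub> t1, y2 \<otimes>\<^bsub>Q\<^esub> t2)) \<in> pushout_cong P P' Q g' f"
    using eq X Y T by (simp add: pushout_simps[OF cP'])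
  then obtain A :: "'p sat_alg monoid" and \<pi> g where
    A: "integral_monoid A" "saturated_monoid P' \<Longrightarrow> saturated_monoid A" "\<pi> \<in> mhom A P'"
      "g \<in> mhom P A" "\<And>p. p \<in> carrier P \<Longrightarrow> \<pi> (g p) = g' p" "{x1, y1, t1} \<subseteq> \<pi> ` carrier A"
    and *: "\<And>a b. a \<in> carrier A \<Longrightarrow> b \<in> carrier A \<Longrightarrow> \<pi> a = x1 \<otimes>\<^bsub>P'\<^esub> t1 \<Longrightarrow> \<pi> b = y1 \<otimes>\<^bsub>P'\<^esub> t1 \<Longrightarrow>
      ((a, x2 \<otimes>\<^bsub>Q\<^esub> t2), (b, y2 \<otimes>\<^bsub>Q\<^esub> t2)) \<in> pushout_cong P A Q g f"
    by (rule small_pushout[of _ _ "{x1, y1, t1}"]) (use X Y T in auto)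
  have cA: "comm_monoid A" using A(1) by (simp add: integral_monoid_def)
  interpret A: comm_monoid A by (rule cA)
  obtain a b t where abt: "a \<in> carrier A" "b \<in> carrier A" "t \<in> carrier A" "\<pi> a = x1" "\<pi> b = y1" "\<pi> t = t1"
    using A(6) by auto
  let ?c = "\<lambda>a q. pushout_cong P A Q g f `` {(a, q)}"
  have "((a \<otimes>\<^bsub>A\<^esub> t, x2 \<otimes>\<^bsub>Q\<^esub> t2), (b \<otimes>\<^bsub>A\<^esub> t, y2 \<otimes>\<^bsub>Q\<^esub> t2)) \<in> pushout_cong P A Q g f"
    by (rule *) (use abt in \<open>auto simp: mhom_mult[OF A(3)]\<close>)
  then have "?c a x2 \<otimes>\<^bsub>pushout P A Q g f\<^esub> ?c t t2 = ?c b y2 \<otimes>\<^bsub>pushout P A Q g f\<^esub> ?c t t2"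
    using abt X Y T by (simp add: pushout_simps[OF cA])
  then have "?c a x2 = ?c b y2"
    using int[OF A(1,2,4)] pushout_simps(1)[OF cA] abt X Y T unfolding integral_monoid_iff by blast
  then have "((a, x2), (b, y2)) \<in> pushout_cong P A Q g f"
    using abt X Y by (simp add: pushout_simps[OF cA])
  from pushout_cong_mono[OF cA cQ cP' A(3,4,5) this]
  show "X = Y" using abt X Y by (simp add: pushout_simps[OF cP'])
qed

lemma saturated_pushout:
  assumes sat: "\<And>(A :: 'p sat_alg monoid) g. saturated_monoid A \<Longrightarrow> g \<in> mhom P A \<Longrightarrow>
      saturated_monoid (pushout P A Q g f)"
    and sP': "saturated_monoid P'"
  shows "saturated_monoid (pushout P P' Q g' f)"
  unfolding saturated_monoid_iff
proof (intro conjI ballI allI impI)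
  interpret P': comm_monoid P' by (rule cP')
  interpret Q: comm_monoid Q by (rule cQ)
  let ?M = "pushout P P' Q g' f"
  show "integral_monoid ?M"
    by (rule integral_pushout) (use sat sP' in \<open>auto simp: saturated_monoid_def\<close>)
  fix X Y Z and n :: nat
  assume XYZ: "X \<in> carrier ?M" "Y \<in> carrier ?M" "Z \<in> carrier ?M" and n: "n \<ge> 1"
    and eq: "X [^]\<^bsub>?M\<^esub> n = Z \<otimes>\<^bsub>?M\<^esub> Y [^]\<^bsub>?M\<^esub> n"
  obtain x1 x2 where X: "x1 \<in> carrier P'" "x2 \<in> carrier Q" "X = pushout_class x1 x2"
    using XYZ(1) by (rule pushout_obtain[OF cP'])
  obtain y1 y2 where Y: "y1 \<in> carrier P'" "y2 \<in> carrier Q" "Y = pushout_class y1 y2"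
    using XYZ(2) by (rule pushout_obtain[OF cP'])
  obtain z1 z2 where Z: "z1 \<in> carrier P'" "z2 \<in> carrier Q" "Z = pushout_class z1 z2"
    using XYZ(3) by (rule pushout_obtain[OF cP'])
  have "((x1 [^]\<^bsub>P'\<^esub> n, x2 [^]\<^bsub>Q\<^esub> n), (z1 \<otimes>\<^bsub>P'\<^esub> y1 [^]\<^bsub>P'\<^esub> n, z2 \<otimes>\<^bsub>Q\<^esub> y2 [^]\<^bsub>Q\<^esub> n)) \<in> pushout_cong P P' Q g' f"
    using eq X Y Z by (simp add: pushout_simps[OF cP'])
  then obtain A :: "'p sat_alg monoid" and \<pi> g where
    A: "integral_monoid A" "saturated_monoid P' \<Longrightarrow> saturated_monoid A" "\<pi> \<in> mhom A P'"
      "g \<in> mhom P A" "\<And>p. p \<in> carrier P \<Longrightarrow> \<pi> (g p) = g' p" "{x1, y1, z1} \<subseteq> \<pi> ` carrier A"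
    and *: "\<And>a b. a \<in> carrier A \<Longrightarrow> b \<in> carrier A \<Longrightarrow> \<pi> a = x1 [^]\<^bsub>P'\<^esub> n \<Longrightarrow>
      \<pi> b = z1 \<otimes>\<^bsub>P'\<^esub> y1 [^]\<^bsub>P'\<^esub> n \<Longrightarrow>
      ((a, x2 [^]\<^bsub>Q\<^esub> n), (b, z2 \<otimes>\<^bsub>Q\<^esub> y2 [^]\<^bsub>Q\<^esub> n)) \<in> pushout_cong P A Q g f"
    by (rule small_pushout[of _ _ "{x1, y1, z1}"]) (use X Y Z in auto)
  have cA: "comm_monoid A" using A(1) by (simp add: integral_monoid_def)
  interpret A: comm_monoid A by (rule cA)
  obtain a b c where abc: "a \<in> carrier A" "b \<in> carrier A" "c \<in> carrier A" "\<pi> a = x1" "\<pi> b = y1" "\<pi> c = z1"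
    using A(6) by auto
  let ?c = "\<lambda>a q. pushout_cong P A Q g f `` {(a, q)}" and ?N = "pushout P A Q g f"
  have "((a [^]\<^bsub>A\<^esub> n, x2 [^]\<^bsub>Q\<^esub> n), (c \<otimes>\<^bsub>A\<^esub> b [^]\<^bsub>A\<^esub> n, z2 \<otimes>\<^bsub>Q\<^esub> y2 [^]\<^bsub>Q\<^esub> n)) \<in> pushout_cong P A Q g f"
    by (rule *) (use abc in \<open>auto simp: mhom_mult[OF A(3)] mhom_pow[OF A(3) cA cP']\<close>)
  then have "?c a x2 [^]\<^bsub>?N\<^esub> n = ?c c z2 \<otimes>\<^bsub>?N\<^esub> ?c b y2 [^]\<^bsub>?N\<^esub> n"
    using abc X Y Z by (simp add: pushout_simps[OF cA])
  then obtain W where W: "W \<in> carrier ?N" "?c a x2 = W \<otimes>\<^bsub>?N\<^esub> ?c b y2"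
    using sat[OF A(2)[OF sP'] A(4)] n pushout_simps(1)[OF cA] abc X Y Z
    unfolding saturated_monoid_iff by blast
  obtain w1 w2 where w: "w1 \<in> carrier A" "w2 \<in> carrier Q" "W = ?c w1 w2"
    using W(1) by (rule pushout_obtain[OF cA])
  have "((a, x2), (w1 \<otimes>\<^bsub>A\<^esub> b, w2 \<otimes>\<^bsub>Q\<^esub> y2)) \<in> pushout_cong P A Q g f"
    using W(2) w abc X Y by (simp add: pushout_simps[OF cA])
  from pushout_cong_mono[OF cA cQ cP' A(3,4,5) this]
  have "X = pushout_class (\<pi> w1) w2 \<otimes>\<^bsub>?M\<^esub> Y"
    using abc X Y w mhom_closed[OF A(3) w(1)] by (simp add: pushout_simps[OF cP'] mhom_mult[OF A(3)])
  then show "\<exists>W\<in>carrier ?M. X = W \<otimes>\<^bsub>?M\<^esub> Y"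
    using pushout_simps(1)[OF cP' mhom_closed[OF A(3) w(1)] w(2)] by blast
qed

end

theorem integral_hom_all_types:
  fixes P' :: "'z monoid"
  assumes h: "integral_hom P Q f" and P': "integral_monoid P'" and g: "g \<in> mhom P P'"
  shows "gp_of (pushout P P' Q g f) \<in> iso (pushout P P' Q g f) (integralisation (pushout P P' Q g f))"
proof -
  have c: "comm_monoid P" "comm_monoid Q" "f \<in> mhom P Q" "comm_monoid P'"
    using h P' by (auto simp: integral_hom_def integral_monoid_def)
  have "integral_monoid (pushout P P' Q g f)"
    by (rule integral_pushout[OF c(1-3) P' g])
      (metis h integral_hom_def gp_of_iso_integralisation_iff comm_monoid_pushout c(2) integral_monoid_def)
  then show ?thesis by (simp add: gp_of_iso_integralisation_iff comm_monoid_pushout c)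
qed

theorem saturated_hom_all_types:
  fixes P' :: "'z monoid"
  assumes h: "saturated_hom P Q f" and P': "saturated_monoid P'" and g: "g \<in> mhom P P'"
  shows "gp_of (pushout P P' Q g f) \<in> iso (pushout P P' Q g f) (saturation (pushout P P' Q g f))"
proof -
  have c: "comm_monoid P" "comm_monoid Q" "f \<in> mhom P Q" "comm_monoid P'" "integral_monoid P'"
    using h P' by (auto simp: saturated_hom_def integral_hom_def saturated_monoid_def integral_monoid_def)
  have "saturated_monoid (pushout P P' Q g f)"
    by (rule saturated_pushout[OF c(1-3) c(5) g _ P'])
      (metis h saturated_hom_def gp_of_iso_saturation_iff comm_monoid_pushout c(2) integral_monoid_def
        saturated_monoid_def)
  then show ?thesis by (simp add: gp_of_iso_saturation_iff comm_monoid_pushout c)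
qed

section \<open>Sfp homomorphisms: independence of the type of the intermediate monoid\<close>

lemma gp_map_iso:
  assumes M: "comm_monoid M" and N: "comm_monoid N" and h: "h \<in> mhom M N" and b: "bij_betw h (carrier M) (carrier N)"
  shows "gp_map N h \<in> iso (saturation M) (saturation N)"
proof -
  interpret M: comm_monoid M by fact
  interpret N: comm_monoid N by fact
  interpret GM: comm_group "gp M" by (rule gp_comm_group[OF M])
  interpret GN: comm_group "gp N" by (rule gp_comm_group[OF N])
  note gm = gp_map_hom[OF M N h]
  have onto: thesis if "y \<in> carrier N" "\<And>x. x \<in> carrier M \<Longrightarrow> y = h x \<Longrightarrow> thesis" for y thesis
    using that bij_betw_imp_surj_on[OF b] by auto
  have inj: "inj_on (gp_map N h) (carrier (gp M))"
  proof (rule inj_onI)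
    fix x y assume xy: "x \<in> carrier (gp M)" "y \<in> carrier (gp M)" and eq: "gp_map N h x = gp_map N h y"
    obtain a b where ab: "a \<in> carrier M" "b \<in> carrier M" "x = gp_frac M a b"
      using xy(1) by (rule gp_obtain[OF M])
    obtain c d where cd: "c \<in> carrier M" "d \<in> carrier M" "y = gp_frac M c d"
      using xy(2) by (rule gp_obtain[OF M])
    note C = ab(1,2) cd(1,2)
    have "\<exists>t\<in>carrier N. h a \<otimes>\<^bsub>N\<^esub> h d \<otimes>\<^bsub>N\<^esub> t = h c \<otimes>\<^bsub>N\<^esub> h b \<otimes>\<^bsub>N\<^esub> t"
      using eq C[THEN mhom_closed[OF h]] unfolding ab(3) cd(3) gp_map_frac[OF M N h ab(1,2)] gp_map_frac[OF M N h cd(1,2)]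
      by (simp add: frac_eq[OF N])
    then obtain s where s: "s \<in> carrier N" "h a \<otimes>\<^bsub>N\<^esub> h d \<otimes>\<^bsub>N\<^esub> s = h c \<otimes>\<^bsub>N\<^esub> h b \<otimes>\<^bsub>N\<^esub> s" by (rule bexE)
    from s(1) obtain t where "t \<in> carrier M" "s = h t" by (rule onto)
    with s(2) have t: "t \<in> carrier M" "h a \<otimes>\<^bsub>N\<^esub> h d \<otimes>\<^bsub>N\<^esub> h t = h c \<otimes>\<^bsub>N\<^esub> h b \<otimes>\<^bsub>N\<^esub> h t" by simp_all
    then have "h (a \<otimes>\<^bsub>M\<^esub> d \<otimes>\<^bsub>M\<^esub> t) = h (c \<otimes>\<^bsub>M\<^esub> b \<otimes>\<^bsub>M\<^esub> t)"
      using C by (simp add: mhom_mult[OF h])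
    then have "a \<otimes>\<^bsub>M\<^esub> d \<otimes>\<^bsub>M\<^esub> t = c \<otimes>\<^bsub>M\<^esub> b \<otimes>\<^bsub>M\<^esub> t"
      using b C t(1) unfolding bij_betw_def by (auto dest: inj_onD)
    then show "x = y" unfolding ab(3) cd(3) using C t(1) by (auto simp: frac_eq[OF M])
  qed
  have surj: "\<exists>x\<in>carrier (gp M). gp_map N h x = y" if y: "y \<in> carrier (gp N)" for y
  proof -
    obtain c d where cd: "c \<in> carrier N" "d \<in> carrier N" "y = gp_frac N c d"
      using y by (rule gp_obtain[OF N])
    from cd(1) obtain a where a: "a \<in> carrier M" "c = h a" by (rule onto)
    from cd(2) obtain e where e: "e \<in> carrier M" "d = h e" by (rule onto)
    show ?thesis
      by (rule bexI[OF _ frac_in[OF M a(1) e(1)]]) (simp add: gp_map_frac[OF M N h a(1) e(1)] cd(3) a(2) e(2))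
  qed
  have pow: "gp_map N h x [^]\<^bsub>gp N\<^esub> (n::nat) \<in> gp_of N ` carrier N \<longleftrightarrow> x [^]\<^bsub>gp M\<^esub> n \<in> gp_of M ` carrier M"
    if x: "x \<in> carrier (gp M)" for x n
  proof -
    have im: "gp_of N ` carrier N = gp_map N h ` gp_of M ` carrier M"
      unfolding bij_betw_imp_surj_on[OF b, symmetric] image_image by (rule image_cong) (simp_all add: gm(2))
    have sub: "gp_of M ` carrier M \<subseteq> carrier (gp M)" using mhom_closed[OF gp_of_hom[OF M]] by auto
    show ?thesis
      unfolding im mhom_pow[OF gm(1) GM.comm_monoid_axioms GN.comm_monoid_axioms x, symmetric]
      by (rule inj_on_image_mem_iff[OF inj _ sub]) (use x in simp)
  qed
  have S: "x \<in> carrier (saturation M) \<longleftrightarrow> gp_map N h x \<in> carrier (saturation N)" if x: "x \<in> carrier (gp M)" for x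
    using x mhom_closed[OF gm(1) x] by (simp add: saturation_def pow)
  have sub: "carrier (saturation M) \<subseteq> carrier (gp M)" "carrier (saturation N) \<subseteq> carrier (gp N)"
    by (auto simp: saturation_def)
  have "bij_betw (gp_map N h) (carrier (saturation M)) (carrier (saturation N))"
    unfolding bij_betw_def
  proof
    show "inj_on (gp_map N h) (carrier (saturation M))" using inj sub(1) by (rule inj_on_subset)
    show "gp_map N h ` carrier (saturation M) = carrier (saturation N)"
    proof
      show "gp_map N h ` carrier (saturation M) \<subseteq> carrier (saturation N)" using S sub(1) by auto
      show "carrier (saturation N) \<subseteq> gp_map N h ` carrier (saturation M)"
      proof
        fix y assume y: "y \<in> carrier (saturation N)"
        then have "y \<in> carrier (gp N)" using sub(2) by auto
        then obtain x where "x \<in> carrier (gp M)" "gp_map N h x = y" using surj by auto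
        then show "y \<in> gp_map N h ` carrier (saturation M)" using S[of x] y by auto
      qed
    qed
  qed
  moreover have "gp_map N h \<in> hom (saturation M) (saturation N)"
  proof (rule homI)
    fix x y assume xy: "x \<in> carrier (saturation M)" "y \<in> carrier (saturation M)"
    then have "x \<in> carrier (gp M)" "y \<in> carrier (gp M)" using sub(1) by auto
    then show "gp_map N h (x \<otimes>\<^bsub>saturation M\<^esub> y) = gp_map N h x \<otimes>\<^bsub>saturation N\<^esub> gp_map N h y"
      using mhom_mult[OF gm(1), of x y] by (simp add: saturation_def)
  qed (use S sub(1) in auto)
  ultimately show ?thesis by (simp add: iso_def)
qed

theorem sfp_hom_any_type:
  fixes P :: "'p monoid" and Q' :: "'z monoid"
  assumes P: "saturated_monoid P" and Q: "saturated_monoid Q" and f: "f \<in> mhom P Q"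
    and fp: "finitely_presented_hom P Q' g" and h: "h \<in> mhom Q' Q"
    and hg: "\<And>p. p \<in> carrier P \<Longrightarrow> h (g p) = f p"
    and \<phi>: "\<phi> \<in> iso (saturation Q') Q" "\<And>x. x \<in> carrier Q' \<Longrightarrow> \<phi> (gp_of Q' x) = h x"
  shows "sfp_hom P Q f"
proof -
  have cP: "comm_monoid P" using P by (simp add: saturated_monoid_def integral_monoid_def)
  interpret P: comm_monoid P by fact
  from fp obtain r S \<psi> where S: "finite S"
      "S \<subseteq> carrier (P \<times>\<times> free_cmonoid r) \<times> carrier (P \<times>\<times> free_cmonoid r)"
    and \<psi>: "\<psi> \<in> iso (quotient_monoid (P \<times>\<times> free_cmonoid r) (gen_cong (P \<times>\<times> free_cmonoid r) S)) Q'"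
    and \<psi>g: "\<forall>p\<in>carrier P. \<psi> (gen_cong (P \<times>\<times> free_cmonoid r) S `` {(p, \<one>\<^bsub>free_cmonoid r\<^esub>)}) = g p"
    and cQ': "comm_monoid Q'" and g: "g \<in> mhom P Q'"
    unfolding finitely_presented_hom_def by (elim conjE exE) (rule that)
  define N where "N = P \<times>\<times> free_cmonoid r"
  define R where "R = gen_cong N S"
  define k where "k p = R `` {(p, \<one>\<^bsub>free_cmonoid r\<^esub>)}" for p
  define A where "A = quotient_monoid N R"
  interpret F: comm_monoid "free_cmonoid r"
    by (rule comm_monoidI) (auto simp: free_cmonoid_def)
  have cN: "comm_monoid N" unfolding N_def by (rule comm_monoid_DirProd[OF cP F.comm_monoid_axioms])
  have mc: "mcong N R" unfolding R_def by (rule mcong_gen_cong[OF cN])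
  have cA: "comm_monoid A" unfolding A_def by (rule quot_comm_monoid[OF cN mc])
  interpret A: comm_monoid A by fact
  have \<psi>A: "\<psi> \<in> iso A Q'" using \<psi> by (simp add: A_def R_def N_def)
  have k: "k \<in> mhom P A"
    unfolding mhom_def hom_def A_def k_def
    by (auto simp: quot_class_in[OF cN mc] quot_mult[OF cN mc] quot_one[OF cN mc] N_def[THEN arg_cong[where f = carrier]]
        N_def[THEN arg_cong[where f = monoid.mult]] N_def[THEN arg_cong[where f = monoid.one]])
  have \<psi>k: "\<psi> (k p) = g p" if "p \<in> carrier P" for p using \<psi>g that by (simp add: k_def R_def N_def)
  have bij: "bij_betw \<psi> (carrier A) (carrier Q')" using \<psi>A by (simp add: iso_def)
  have \<psi>h: "\<psi> \<in> mhom A Q'"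
    using \<psi>A \<psi>k[OF P.one_closed] by (auto simp: mhom_def iso_def mhom_one[OF k, unfolded mhom_def] mhom_one[OF k] mhom_one[OF g])
  have "finitely_presented_hom P A k"
    unfolding finitely_presented_hom_def
    using cP cA k S by (intro conjI exI[of _ r] exI[of _ S] exI[of _ id]) (auto simp: A_def R_def N_def k_def iso_def hom_def)
  moreover have "h \<circ> \<psi> \<in> mhom A Q"
    unfolding mhom_def[of A] hom_def
    using mhom_closed[OF h] mhom_closed[OF \<psi>h] mhom_mult[OF h] mhom_mult[OF \<psi>h] mhom_one[OF h] mhom_one[OF \<psi>h]
    by simp
  moreover have "\<forall>p\<in>carrier P. (h \<circ> \<psi>) (k p) = f p" by (simp add: \<psi>k hg)
  moreover have "\<phi> \<circ> gp_map Q' \<psi> \<in> iso (saturation A) Q"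
    by (rule iso_set_trans[OF gp_map_iso[OF cA cQ' \<psi>h bij] \<phi>(1)])
  moreover have "\<forall>x\<in>carrier A. (\<phi> \<circ> gp_map Q' \<psi>) (gp_of A x) = (h \<circ> \<psi>) x"
    by (simp add: gp_map_hom(2)[OF cA cQ' \<psi>h] \<phi>(2) mhom_closed[OF \<psi>h])
  ultimately show ?thesis unfolding sfp_hom_def using P Q f
    unfolding A_def N_def by blast
qed

text \<open>Every sfp homomorphism out of \<open>P :: 'a monoid\<close> has an isomorphic copy with codomain
  of type \<^typ>\<open>'a sat_alg monoid\<close>.\<close>

theorem sfp_hom_copy:
  fixes P :: "'a monoid" and Q :: "'b monoid"
  assumes "sfp_hom P Q f"
  shows "\<exists>(W :: 'a sat_alg monoid) \<phi> w. w \<in> mhom P W \<and> \<phi> \<in> iso W Q \<and> (\<forall>p\<in>carrier P. \<phi> (w p) = f p)"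
proof -
  obtain Q' :: "'a fg_alg monoid" and g h \<phi> where fp: "finitely_presented_hom P Q' g"
    and hg: "\<forall>p\<in>carrier P. h (g p) = f p"
    and \<phi>: "\<phi> \<in> iso (saturation Q') Q" "\<forall>x\<in>carrier Q'. \<phi> (gp_of Q' x) = h x"
    using assms unfolding sfp_hom_def by blast
  have cQ': "comm_monoid Q'" and g: "g \<in> mhom P Q'" using fp by (auto simp: finitely_presented_hom_def)
  have "(\<lambda>p. gp_of Q' (g p)) \<in> mhom P (saturation Q')"
    using g gp_of_hom[OF cQ'] gp_of_in_saturation[OF cQ'] mhom_closed[OF g]
    by (auto simp: mhom_def hom_def saturation_def Pi_iff)
  moreover have "\<forall>p\<in>carrier P. \<phi> (gp_of Q' (g p)) = f p"
    using \<phi>(2) hg mhom_closed[OF g] by simp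
  ultimately show ?thesis using \<phi>(1) by blast
qed

end

theory Submission
  imports Defs "HOL-Algebra.Sylow" "HOL-Algebra.Multiplicative_Group"
begin

text \<open>The statement is written multiplicatively here. Up to saturation, \<open>P\<close> is generated over \<open>V\<close> by finitely
many elements \<open>x_i\<close>. As the homomorphism is sfp, the group of relations \<open>\<theta> g = x^d\<close>, with \<open>g\<close> in the group
completion of \<open>V\<close> and an integer vector \<open>d\<close>, is finitely generated (\<open>sfp_relations\<close>), and since \<open>V\<close> is
valuative its generators \<open>(v_j, c_j)\<close> can be chosen with \<open>v_j \<in> V\<close>. The monoid \<open>W\<close> is the saturation of
the monoid obtained from \<open>V\<close> by adjoining an \<open>m\<close>-th root of every \<open>v_j\<close>. Every element of its group
completion has its \<open>m\<close>-th power in that of \<open>V\<close>, so \<open>W\<close> is again valuative and \<open>V \<rightarrow> W\<close> is Kummer etale as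
soon as \<open>m\<close> is prime to all primes in \<open>\<Sigma>\<close> (\<open>root_extension.kummer_etale\<close>). The exponent \<open>m\<close> has to
annihilate certain torsion groups that are determined by the vectors \<open>c_j\<close>. If \<open>\<Sigma>\<close> is empty, any such
\<open>m\<close> will do (\<open>torsion_exponent\<close>). If \<open>\<theta>\<close> is etale, the order of the cokernel on group completions is one
(\<open>cokernel_order_clears_torsion\<close>).

After the base change, the group of relations has the same generators, but all coefficients of relations
are \<open>m\<close>-th powers (\<open>root_extension.base_change\<close>). Let \<open>Q\<close> be the saturated pushout. An element \<open>q\<close> of its
group completion lies in \<open>Q\<close> if and only if some power of it is a monomial \<open>w z^e\<close> with \<open>w \<in> W\<close> and \<open>e \<ge> 0\<close>, where \<open>z_i\<close>
is the image of \<open>x_i\<close>. The heart of the proof is \<open>cone_group.root_decomposition\<close>: if \<open>q^n v \<in> Q\<close> for a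
coefficient \<open>v\<close>, then there are a coefficient \<open>w\<close> and \<open>a \<ge> 0\<close> with \<open>q^m = w^m z^a\<close> and \<open>w^n v \<in> Q\<close>. For this a
power of \<open>q^n v\<close> is expressed as a monomial whose support is made as small as possible in the manner of
Caratheodory's theorem, subtracting relations; that \<open>W\<close> is valuative allows each relation to be oriented
so that this preserves membership in \<open>Q\<close>. On a support without relations the exponents are unique, which
makes it possible to compare the expression with one for \<open>q^m\<close>, and the coefficient that appears there
belongs to a relation, hence is an \<open>m\<close>-th power.

It follows that \<open>Q\<close> is finitely presented and saturated over \<open>W\<close>. Since the decompositions are recorded
by integer vectors, Gordan's lemma shows that \<open>Q\<close> is finitely generated over its coefficients (\<open>cone_group.finitely_generated\<close>), and then over \<open>W\<close>,
because inverting one element of \<open>W\<close> accounts for all coefficients that lie in \<open>Q\<close>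
(\<open>cone_hom.unit_absorbing_preimage\<close>). The relations between the generators are finitely generated by
Gordan's lemma too, and \<open>W\<close> being valuative they already generate the congruence of monoids
(\<open>cone_hom.finitely_presented\<close>). For the other assertion, a pushout of integral monoids along a valuative
monoid has an explicit description (\<open>po_eq_linked\<close>), from which it is integral, and saturated if
divisibilities \<open>q^n v \<in> Q\<close> can be divided by \<open>n\<close>: there has to be a coefficient \<open>u\<close> with \<open>q u \<in> Q\<close> and
\<open>v / u^n \<in> W\<close> (\<open>saturated_homI\<close>). That is the decomposition with \<open>u = w^(-1)\<close>, up to the inverted element
(\<open>cone_hom.division\<close>).\<close>

section \<open>Finite generation of monoids of integer vectors\<close>

lemma exists_seq_of_finite: "finite S \<Longrightarrow> \<exists>(K::nat) f. S = f ` {..<K}"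
  using finite_imp_nat_seg_image_inj_on[of S] by (auto simp: lessThan_def)

text \<open>Dickson's lemma. The minimal vectors for the first \<open>k\<close> coordinates also lie below every vector whose
coordinate \<open>k\<close> exceeds all of theirs; this leaves finitely many values of that coordinate, each of
which is again a problem in \<open>k\<close> coordinates.\<close>

lemma dickson:
  fixes X :: "(nat \<Rightarrow> nat) set"
  shows "\<exists>B. finite B \<and> B \<subseteq> X \<and> (\<forall>x\<in>X. \<exists>b\<in>B. \<forall>i<k. b i \<le> x i)"
proof (induction k arbitrary: X)
  case 0
  show ?case
  proof (cases "X = {}")
    case False
    then obtain x where "x \<in> X" by blast
    then show ?thesis by (intro exI[of _ "{x}"]) auto
  qed auto
next
  case (Suc k)
  obtain B where B: "finite B" "B \<subseteq> X" "\<forall>x\<in>X. \<exists>b\<in>B. \<forall>i<k. b i \<le> x i"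
    using Suc.IH[of X] by (elim exE conjE)
  define m where "m = Max (insert 0 ((\<lambda>b. b k) ` B))"
  have m: "b k \<le> m" if "b \<in> B" for b
    unfolding m_def using that B(1) by (intro Max_ge) auto
  have "\<exists>C. finite C \<and> C \<subseteq> {x\<in>X. x k = v} \<and> (\<forall>x\<in>{x\<in>X. x k = v}. \<exists>b\<in>C. \<forall>i<k. b i \<le> x i)" for v
    by (rule Suc.IH)
  then have "\<forall>v. \<exists>C. finite C \<and> C \<subseteq> {x\<in>X. x k = v} \<and> (\<forall>x\<in>{x\<in>X. x k = v}. \<exists>b\<in>C. \<forall>i<k. b i \<le> x i)"
    by (rule allI)
  from choice[OF this] obtain C where CC: "\<forall>v. finite (C v) \<and> C v \<subseteq> {x\<in>X. x k = v} \<and>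
    (\<forall>x\<in>{x\<in>X. x k = v}. \<exists>b\<in>C v. \<forall>i<k. b i \<le> x i)" by (elim exE)
  have C': "finite (C v)" "C v \<subseteq> {x\<in>X. x k = v}" "\<forall>x\<in>{x\<in>X. x k = v}. \<exists>b\<in>C v. \<forall>i<k. b i \<le> x i" for v
    using spec[OF CC, of v] by blast+
  have C: "\<exists>b\<in>C v. \<forall>i<k. b i \<le> x i" if "x \<in> X" "x k = v" for v x
    using C'(3)[of v] that by simp
  let ?B = "B \<union> (\<Union>v\<le>m. C v)"
  have "\<exists>b\<in>?B. \<forall>i<Suc k. b i \<le> x i" if x: "x \<in> X" for x
  proof (cases "x k \<le> m")
    case True
    obtain b where b: "b \<in> C (x k)" "\<forall>i<k. b i \<le> x i" using C[OF x refl] by blast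
    moreover have "b k = x k" using b(1) C'(2) by blast
    ultimately show ?thesis using True by (intro bexI[of _ b]) (auto simp: less_Suc_eq)
  next
    case False
    obtain b where b: "b \<in> B" "\<forall>i<k. b i \<le> x i" using B(3) x by blast
    then show ?thesis using m[of b] False by (intro bexI[of _ b]) (auto simp: less_Suc_eq)
  qed
  moreover have "finite ?B" using B(1) C'(1) by simp
  moreover have "?B \<subseteq> X" using B(2) C'(2) by blast
  ultimately show ?case by blast
qed

text \<open>Gordan's lemma for subgroups of the integer vectors. By Dickson's lemma, finitely many nonzero
nonnegative vectors of \<open>A\<close> lie below all the others; subtracting one of them stays in \<open>A\<close> and decreases
the sum of the coordinates. Vectors are functions of which only the first \<open>k\<close> values count.\<close>

lemma gordan_nonneg:
  fixes A :: "(nat \<Rightarrow> int) set"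
  assumes diff: "\<And>x y. x \<in> A \<Longrightarrow> y \<in> A \<Longrightarrow> (\<lambda>i. x i - y i) \<in> A"
    and ext: "\<And>x y. (\<And>i. i < k \<Longrightarrow> x i = y i) \<Longrightarrow> x \<in> A \<Longrightarrow> y \<in> A"
  shows "\<exists>(s::nat) b. (\<forall>t<s. b t \<in> A \<and> (\<forall>i<k. 0 \<le> b t i)) \<and>
    (\<forall>x\<in>A. (\<forall>i<k. 0 \<le> x i) \<longrightarrow> (\<exists>n. (\<forall>t. 0 \<le> n t) \<and> (\<forall>i<k. x i = (\<Sum>t<s. n t * b t i))))"
proof -
  define X where "X = {p :: nat \<Rightarrow> nat. (\<lambda>i. int (p i)) \<in> A \<and> (\<exists>i<k. p i > 0)}"
  obtain B where B: "finite B" "B \<subseteq> X" "\<forall>x\<in>X. \<exists>b\<in>B. \<forall>i<k. b i \<le> x i"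
    using dickson[of X k] by blast
  obtain e and s :: nat where e: "B = e ` {..<s}"
    using exists_seq_of_finite[OF B(1)] by blast
  define b where "b t i = int (e t i)" for t i
  have "\<exists>n. (\<forall>t. 0 \<le> n t) \<and> (\<forall>i<k. x i = (\<Sum>t<s. n t * b t i))"
    if "x \<in> A" "\<forall>i<k. 0 \<le> x i" for x
    using that
  proof (induction "nat (\<Sum>i<k. x i)" arbitrary: x rule: less_induct)
    case less
    show ?case
    proof (cases "\<forall>i<k. x i = 0")
      case True
      then show ?thesis by (intro exI[of _ "\<lambda>_. 0"]) simp
    next
      case False
      have "(\<lambda>i. int (nat (x i))) \<in> A" by (rule ext[OF _ less.prems(1)]) (use less.prems(2) in auto)
      moreover obtain i where "i < k" "x i \<noteq> 0" using False by blast
      then have "\<exists>i<k. nat (x i) > 0" using less.prems(2) by (intro exI[of _ i]) force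
      ultimately have "(\<lambda>i. nat (x i)) \<in> X" by (simp add: X_def)
      from bspec[OF B(3) this] obtain t where t: "t < s" "\<forall>i<k. e t i \<le> nat (x i)" unfolding e by auto
      then have bx: "b t i \<le> x i" if "i < k" for i using that less.prems(2) by (force simp: b_def)
      have etX: "e t \<in> X" using t B(2) e by auto
      then have bA: "b t \<in> A" by (simp add: X_def b_def[abs_def])
      have pos: "(\<Sum>i<k. b t i) > 0"
      proof -
        obtain i where "i < k" "e t i > 0" using etX by (auto simp: X_def)
        then have "b t i > 0" "i \<in> {..<k}" by (auto simp: b_def)
        then show ?thesis by (intro sum_pos2[of _ i]) (auto simp: b_def)
      qed
      have "(\<Sum>i<k. x i - b t i) \<ge> 0" by (rule sum_nonneg) (use bx in auto)
      then have "nat (\<Sum>i<k. x i - b t i) < nat (\<Sum>i<k. x i)"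
        using pos by (simp add: sum_subtractf)
      from less.hyps[OF this diff[OF less.prems(1) bA]] bx
      obtain n where n: "\<forall>t. 0 \<le> n t" "\<forall>i<k. x i - b t i = (\<Sum>t<s. n t * b t i)" by auto
      have del: "(if u = t then 1 else 0) * b u i = (if u = t then b u i else 0)" for u i by simp
      have "x i = (\<Sum>u<s. (n u + (if u = t then 1 else 0)) * b u i)" if "i < k" for i
        using n(2)[rule_format, OF that] t(1)
        by (simp add: distrib_right sum.distrib del)
      then show ?thesis using n(1) by (intro exI[of _ "\<lambda>u. n u + (if u = t then 1 else 0)"]) auto
    qed
  qed
  moreover have "\<forall>t<s. b t \<in> A \<and> (\<forall>i<k. 0 \<le> b t i)"
    using B(2) unfolding e X_def by (auto simp: b_def[abs_def])
  ultimately show ?thesis by blast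
qed

text \<open>With sign conditions only on the coordinates in \<open>I\<close>, a free coordinate is a difference of two
nonnegative ones, which are stored in positions \<open>i\<close> and \<open>k + i\<close>. For empty \<open>I\<close> this says that
subgroups are finitely generated.\<close>

lemma gordan:
  fixes A :: "(nat \<Rightarrow> int) set"
  assumes diff: "\<And>x y. x \<in> A \<Longrightarrow> y \<in> A \<Longrightarrow> (\<lambda>i. x i - y i) \<in> A"
    and ext: "\<And>x y. (\<And>i. i < k \<Longrightarrow> x i = y i) \<Longrightarrow> x \<in> A \<Longrightarrow> y \<in> A"
  obtains s :: nat and b where "\<And>t. t < s \<Longrightarrow> b t \<in> A" "\<And>t i. t < s \<Longrightarrow> i < k \<Longrightarrow> i \<in> I \<Longrightarrow> 0 \<le> b t i"
    "\<And>x. x \<in> A \<Longrightarrow> (\<And>i. i < k \<Longrightarrow> i \<in> I \<Longrightarrow> 0 \<le> x i) \<Longrightarrow>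
      \<exists>n. (\<forall>t. 0 \<le> n t) \<and> (\<forall>i<k. x i = (\<Sum>t<s. n t * b t i))"
proof -
  define h where "h p = (\<lambda>i. if i \<in> I then p i else p i - p (k + i))" for p :: "nat \<Rightarrow> int"
  have "\<exists>(s::nat) b. (\<forall>t<s. b t \<in> {p. h p \<in> A} \<and> (\<forall>i<2*k. 0 \<le> b t i)) \<and>
    (\<forall>x\<in>{p. h p \<in> A}. (\<forall>i<2*k. 0 \<le> x i) \<longrightarrow> (\<exists>n. (\<forall>t. 0 \<le> n t) \<and> (\<forall>i<2*k. x i = (\<Sum>t<s. n t * b t i))))"
  proof (rule gordan_nonneg)
    fix x y assume "x \<in> {p. h p \<in> A}" "y \<in> {p. h p \<in> A}"
    then have "(\<lambda>i. h x i - h y i) \<in> A" using diff by simp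
    moreover have "(\<lambda>i. h x i - h y i) = h (\<lambda>i. x i - y i)" by (auto simp: h_def)
    ultimately show "(\<lambda>i. x i - y i) \<in> {p. h p \<in> A}" by simp
  next
    fix x y :: "nat \<Rightarrow> int" assume *: "\<And>i. i < 2 * k \<Longrightarrow> x i = y i" "x \<in> {p. h p \<in> A}"
    have "h y \<in> A" by (rule ext[of "h x"]) (use * in \<open>auto simp: h_def\<close>)
    then show "y \<in> {p. h p \<in> A}" by simp
  qed
  then obtain s :: nat and b where B: "(\<forall>t<s. b t \<in> {p. h p \<in> A} \<and> (\<forall>i<2*k. 0 \<le> b t i)) \<and>
    (\<forall>x\<in>{p. h p \<in> A}. (\<forall>i<2*k. 0 \<le> x i) \<longrightarrow> (\<exists>n. (\<forall>t. 0 \<le> n t) \<and> (\<forall>i<2*k. x i = (\<Sum>t<s. n t * b t i))))"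
    by (elim exE)
  have b: "h (b t) \<in> A" "i < 2 * k \<Longrightarrow> 0 \<le> b t i" if "t < s" for t i
    using B that by blast+
  have gen: "\<exists>n. (\<forall>t. 0 \<le> n t) \<and> (\<forall>i<2*k. x i = (\<Sum>t<s. n t * b t i))"
    if "h x \<in> A" "\<forall>i<2*k. 0 \<le> x i" for x
    using conjunct2[OF B, THEN bspec, of x] that by blast
  show thesis
  proof (rule that[of s "\<lambda>t. h (b t)"])
    fix t i assume "t < s" "i < k" "i \<in> I"
    then show "0 \<le> h (b t) i" using b(2)[of t i] by (simp add: h_def)
  next
    fix x assume x: "x \<in> A" "\<And>i. i < k \<Longrightarrow> i \<in> I \<Longrightarrow> 0 \<le> x i"
    define p where "p i = (if i < k then max (x i) 0 else max (- x (i - k)) 0)" for i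
    have hp: "x i = h p i" if "i < k" for i using that x(2)[of i] by (auto simp: h_def p_def)
    have "h p \<in> A" by (rule ext[OF _ x(1)]) (simp add: hp)
    moreover have "\<forall>i<2*k. 0 \<le> p i" by (simp add: p_def)
    ultimately obtain n where n: "\<forall>t. 0 \<le> n t" "\<forall>i<2*k. p i = (\<Sum>t<s. n t * b t i)"
      by (rule gen[THEN exE]) blast
    have "x i = (\<Sum>t<s. n t * h (b t) i)" if "i < k" for i
    proof -
      have "i < 2 * k" "k + i < 2 * k" using that by auto
      then have "p i = (\<Sum>t<s. n t * b t i)" "p (k + i) = (\<Sum>t<s. n t * b t (k + i))" using n(2) by blast+
      then show ?thesis using hp[OF that] by (auto simp: h_def right_diff_distrib sum_subtractf)
    qed
    then show "\<exists>n. (\<forall>t. 0 \<le> n t) \<and> (\<forall>i<k. x i = (\<Sum>t<s. n t * h (b t) i))" using n(1) by blast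
  qed (use b in auto)
qed

section \<open>Monomials in commutative groups\<close>

text \<open>Laurent monomials, defined by recursion on the number of variables so that the laws of exponents are
plain inductions.\<close>

primrec mon :: "('a, 'm) monoid_scheme \<Rightarrow> nat \<Rightarrow> (nat \<Rightarrow> 'a) \<Rightarrow> (nat \<Rightarrow> int) \<Rightarrow> 'a" where
  "mon G 0 z c = \<one>\<^bsub>G\<^esub>"
| "mon G (Suc r) z c = mon G r z c \<otimes>\<^bsub>G\<^esub> z r [^]\<^bsub>G\<^esub> c r"

lemma mon_cong:
  assumes "\<And>i. i < r \<Longrightarrow> z i = z' i" "\<And>i. i < r \<Longrightarrow> c i = c' i"
  shows "mon G r z c = mon G r z' c'"
  using assms by (induction r) auto

context comm_group
begin

lemma mon_closed [simp, intro]: "(\<And>i. i < r \<Longrightarrow> z i \<in> carrier G) \<Longrightarrow> mon G r z c \<in> carrier G"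
  by (induction r) auto

lemma mon_0 [simp]: "(\<And>i. i < r \<Longrightarrow> c i = 0) \<Longrightarrow> mon G r z c = \<one>"
  by (induction r) auto

lemma mon_add:
  "(\<And>i. i < r \<Longrightarrow> z i \<in> carrier G) \<Longrightarrow> mon G r z (\<lambda>i. c i + d i) = mon G r z c \<otimes> mon G r z d"
proof (induction r)
  case (Suc r)
  then show ?case by (simp add: int_pow_mult m_ac)
qed simp

lemma mon_scale:
  "(\<And>i. i < r \<Longrightarrow> z i \<in> carrier G) \<Longrightarrow> mon G r z (\<lambda>i. k * c i) = mon G r z c [^] (k::int)"
proof (induction r)
  case (Suc r)
  then show ?case by (simp add: int_pow_distrib int_pow_pow mult.commute)
qed simp

lemma mon_neg:
  assumes "\<And>i. i < r \<Longrightarrow> z i \<in> carrier G" shows "mon G r z (\<lambda>i. - c i) = inv (mon G r z c)"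
  using mon_scale[OF assms, of r "\<lambda>i. i" "-1" c] assms by (simp add: int_pow_neg)

lemma mon_diff:
  assumes "\<And>i. i < r \<Longrightarrow> z i \<in> carrier G"
  shows "mon G r z (\<lambda>i. c i - d i) = mon G r z c \<otimes> inv (mon G r z d)"
  using mon_add[OF assms, of r "\<lambda>i. i" c "\<lambda>i. - d i"] mon_neg[OF assms, of r "\<lambda>i. i" d] by simp

lemma mon_unit:
  "(\<And>i. i < r \<Longrightarrow> z i \<in> carrier G) \<Longrightarrow> j < r \<Longrightarrow> mon G r z (\<lambda>i. if i = j then 1 else 0) = z j"
proof (induction r)
  case (Suc r)
  show ?case
  proof (cases "j = r")
    case True
    then have "mon G r z (\<lambda>i. if i = j then 1 else 0) = \<one>" by (intro mon_0) auto
    then show ?thesis using True Suc.prems by simp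
  qed (use Suc in auto)
qed simp

lemma mon_sum:
  "(\<And>i. i < r \<Longrightarrow> z i \<in> carrier G) \<Longrightarrow>
    mon G r z (\<lambda>i. \<Sum>t<s. n t * c t i) = mon G s (\<lambda>t. mon G r z (c t)) n"
proof (induction s)
  case (Suc s)
  have "mon G r z (\<lambda>i. (\<Sum>t<s. n t * c t i) + n s * c s i) =
    mon G r z (\<lambda>i. \<Sum>t<s. n t * c t i) \<otimes> mon G r z (\<lambda>i. n s * c s i)"
    using Suc.prems by (rule mon_add)
  then show ?case using Suc by (simp add: mon_scale)
qed simp

lemma mon_mult:
  "(\<And>i. i < r \<Longrightarrow> z i \<in> carrier G) \<Longrightarrow> (\<And>i. i < r \<Longrightarrow> y i \<in> carrier G) \<Longrightarrow>
    mon G r (\<lambda>i. z i \<otimes> y i) c = mon G r z c \<otimes> mon G r y c"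
proof (induction r)
  case (Suc r)
  then show ?case by (simp add: int_pow_distrib m_ac)
qed simp

lemma mon_pow:
  "(\<And>i. i < r \<Longrightarrow> z i \<in> carrier G) \<Longrightarrow> mon G r (\<lambda>i. z i [^] (k::int)) c = mon G r z c [^] k"
proof (induction r)
  case (Suc r)
  then show ?case by (simp add: int_pow_distrib int_pow_pow mult.commute)
qed simp

lemma mon_inv:
  assumes "\<And>i. i < r \<Longrightarrow> z i \<in> carrier G" shows "mon G r (\<lambda>i. inv (z i)) c = inv (mon G r z c)"
proof -
  have "mon G r (\<lambda>i. inv (z i)) c = mon G r (\<lambda>i. z i [^] (-1::int)) c"
    by (rule mon_cong) (simp_all add: assms int_pow_neg)
  then show ?thesis using mon_pow[OF assms, of r "\<lambda>i. i" "-1" c] assms by (simp add: int_pow_neg)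
qed

lemma mon_mem:
  assumes "\<one> \<in> Q" "\<And>x y. x \<in> Q \<Longrightarrow> y \<in> Q \<Longrightarrow> x \<otimes> y \<in> Q"
    and "\<And>i. i < r \<Longrightarrow> z i \<in> Q" "\<And>i. i < r \<Longrightarrow> 0 \<le> c i"
  shows "mon G r z c \<in> Q"
proof -
  have nat: "x [^] (n::nat) \<in> Q" if "x \<in> Q" for x n using that assms(1,2) by (induction n) auto
  have "x [^] (k::int) \<in> Q" if "x \<in> Q" "0 \<le> k" for x k
    using nat[OF that(1), of "nat k"] that(2) by (metis int_nat_eq int_pow_int)
  then show ?thesis using assms by (induction r) auto
qed

lemma mon_subgroup:
  assumes "subgroup H G" "\<And>i. i < r \<Longrightarrow> z i \<in> H" shows "mon G r z c \<in> H"
  using assms(2)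
proof (induction r)
  case (Suc r)
  then show ?case using assms(1) by (simp add: subgroup.m_closed subgroup_int_pow_closed)
qed (simp add: assms(1) subgroup.one_closed)

end

lemma (in comm_group) mon_const: "a \<in> carrier G \<Longrightarrow> mon G s (\<lambda>_. a) n = a [^] (\<Sum>t<s. n t)"
  by (induction s) (simp_all add: int_pow_mult)

lemma (in comm_group) mon_factor:
  assumes "\<And>i. i < s \<Longrightarrow> a i \<in> carrier G" "t < s"
  shows "mon G s a (\<lambda>_. 1) = a t \<otimes> mon G s a (\<lambda>i. if i = t then 0 else 1)"
proof -
  have "mon G s a (\<lambda>_. 1) = mon G s a (\<lambda>i. (if i = t then 1 else 0) + (if i = t then 0 else 1))"
    by (rule mon_cong) auto
  then show ?thesis using assms by (simp only: mon_add[OF assms(1)] mon_unit[OF assms])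
qed

lemma (in group) inv_cancel [simp]:
  assumes "x \<in> carrier G" "y \<in> carrier G"
  shows "x \<otimes> (inv x \<otimes> y) = y" "inv x \<otimes> (x \<otimes> y) = y"
  using assms by (simp_all add: m_assoc[symmetric])

lemma (in comm_group) inv_cancel_comm [simp]:
  assumes "x \<in> carrier G" "y \<in> carrier G"
  shows "x \<otimes> (y \<otimes> inv x) = y" "inv x \<otimes> (y \<otimes> x) = y"
  using assms by (simp_all add: m_comm[of y])

lemma (in comm_group) inv_cancel_left_comm [simp]:
  assumes "x \<in> carrier G" "y \<in> carrier G" "z \<in> carrier G"
  shows "x \<otimes> (y \<otimes> (inv x \<otimes> z)) = y \<otimes> z" "inv x \<otimes> (y \<otimes> (x \<otimes> z)) = y \<otimes> z"
  using assms by (simp_all add: m_lcomm[of x y] m_lcomm[of "inv x" y])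

lemma (in comm_group) cross_mult:
  assumes "a \<otimes> b = c \<otimes> d" "a \<in> carrier G" "b \<in> carrier G" "c \<in> carrier G" "d \<in> carrier G"
  shows "b \<otimes> inv d = c \<otimes> inv a"
proof -
  have "b \<otimes> inv d = inv a \<otimes> (a \<otimes> b) \<otimes> inv d" using assms(2-5) by simp
  also have "\<dots> = c \<otimes> inv a" unfolding assms(1) using assms(2-5) by (simp add: m_ac)
  finally show ?thesis .
qed

lemma hom_mon:
  assumes "comm_group G" "comm_group H" "f \<in> mhom G H" and "\<And>i. i < r \<Longrightarrow> z i \<in> carrier G"
  shows "f (mon G r z c) = mon H r (\<lambda>i. f (z i)) c"
proof -
  interpret G: comm_group G by fact
  interpret H: comm_group H by fact
  have h: "f \<in> hom G H" using assms(3) by (simp add: mhom_def)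
  show ?thesis using assms(4)
    by (induction r) (simp_all add: mhom_one[OF assms(3)] mhom_mult[OF assms(3)]
        hom_int_pow[OF h _ G.group_axioms H.group_axioms])
qed

section \<open>Saturated cones over a totally preordered group of coefficients\<close>

text \<open>\<open>Q\<close> is a saturated submonoid of \<open>L\<close> whose elements are, up to powers, monomials in the \<open>z i\<close> with
coefficients in \<open>B \<inter> Q\<close>; by \<open>val\<close>, divisibility by \<open>B \<inter> Q\<close> is a total preorder on \<open>B\<close>. A vector \<open>d\<close> with
\<open>M d \<in> B\<close> is called a relation. If a power of the monomial with exponents \<open>b\<close> is congruent modulo \<open>B\<close> to
a monomial in the variables from \<open>I\<close>, then by \<open>tors\<close> so is its \<open>m\<close>-th power, where \<open>m\<close> is independent of
the power and of \<open>I\<close>. By \<open>roots\<close>, coefficients that come from relations are \<open>m\<close>-th powers.\<close>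

locale cone_group = comm_group L for L :: "'a monoid" (structure) +
  fixes B Q :: "'a set" and z :: "nat \<Rightarrow> 'a" and r :: nat and m :: int
  assumes B: "subgroup B L"
    and Q_sub: "Q \<subseteq> carrier L" and Q_one: "\<one> \<in> Q"
    and Q_mult: "\<And>x y. x \<in> Q \<Longrightarrow> y \<in> Q \<Longrightarrow> x \<otimes> y \<in> Q"
    and Q_sat: "\<And>x n. x \<in> carrier L \<Longrightarrow> n \<ge> 1 \<Longrightarrow> x [^] (n::int) \<in> Q \<Longrightarrow> x \<in> Q"
    and val: "\<And>g. g \<in> B \<Longrightarrow> g \<in> Q \<or> inv g \<in> Q"
    and z: "\<And>i. i < r \<Longrightarrow> z i \<in> Q"
    and Q_gen: "\<And>q. q \<in> Q \<Longrightarrow> \<exists>n\<ge>1. \<exists>w\<in>B \<inter> Q. \<exists>c. (\<forall>i. 0 \<le> c i) \<and> q [^] (n::int) = w \<otimes> mon L r z c"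
    and L_gen: "\<And>q. q \<in> carrier L \<Longrightarrow> \<exists>g\<in>B. \<exists>b. q = g \<otimes> mon L r z b"
    and m: "m \<ge> 1"
    and tors: "\<And>I N b d. N \<ge> 1 \<Longrightarrow> (\<And>i. i \<notin> I \<Longrightarrow> d i = 0) \<Longrightarrow> mon L r z (\<lambda>i. N * b i - d i) \<in> B \<Longrightarrow>
      \<exists>d'. (\<forall>i. i \<notin> I \<longrightarrow> d' i = 0) \<and> mon L r z (\<lambda>i. m * b i - d' i) \<in> B"
    and roots: "\<And>c. mon L r z c \<in> B \<Longrightarrow> \<exists>k\<in>B. mon L r z c = k [^] m"
begin

lemma Q_C [simp]: "x \<in> Q \<Longrightarrow> x \<in> carrier L" using Q_sub by auto
lemma B_C [simp]: "x \<in> B \<Longrightarrow> x \<in> carrier L" using subgroup.subset[OF B] by auto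
lemma z_C [simp]: "i < r \<Longrightarrow> z i \<in> carrier L" using z by auto

lemmas B_mult = subgroup.m_closed[OF B]
lemmas B_inv = subgroup.m_inv_closed[OF B]
lemmas B_pow = subgroup_int_pow_closed[OF B]

lemma Q_pow: "x \<in> Q \<Longrightarrow> 0 \<le> k \<Longrightarrow> x [^] (k::int) \<in> Q"
  using mon_mem[of Q 1 "\<lambda>_. x" "\<lambda>_. k"] Q_one Q_mult by simp

lemma mon_Q: "(\<And>i. i < s \<Longrightarrow> y i \<in> Q) \<Longrightarrow> (\<And>i. i < s \<Longrightarrow> 0 \<le> c i) \<Longrightarrow> mon L s y c \<in> Q"
  by (rule mon_mem[OF Q_one Q_mult])

abbreviation M :: "(nat \<Rightarrow> int) \<Rightarrow> 'a" where "M c \<equiv> mon L r z c"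

abbreviation supp :: "(nat \<Rightarrow> int) \<Rightarrow> nat set" where "supp c \<equiv> {i. i < r \<and> c i \<noteq> 0}"

text \<open>Up to a sign, a relation \<open>d\<close> satisfies \<open>M d \<in> Q\<close> because \<open>B\<close> is totally preordered. Should all exponents
then be nonpositive, the opposite monomial lies in \<open>Q\<close> too, as a product of variables, and the sign can
be changed once more.\<close>

lemma oriented_relation:
  assumes d: "M d \<in> B" "i < r" "d i \<noteq> 0"
  shows "\<exists>d'. M d' \<in> B \<and> M d' \<in> Q \<and> supp d' = supp d \<and> (\<exists>i<r. d' i > 0)"
proof -
  have M_neg: "M (\<lambda>i. - e i) \<in> B" if "M e \<in> B" for e
    using that by (simp add: mon_neg B_inv)
  have *: "\<exists>d'. M d' \<in> B \<and> M d' \<in> Q \<and> supp d' = supp e \<and> (\<exists>i<r. d' i > 0)"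
    if e: "M e \<in> B" "M e \<in> Q" "e i \<noteq> 0" for e
  proof (cases "\<exists>i<r. e i > 0")
    case True
    then show ?thesis using e by (intro exI[of _ e]) simp
  next
    case False
    then have le: "e j \<le> 0" if "j < r" for j using that by force
    have "M (\<lambda>i. - e i) \<in> Q" by (rule mon_Q) (use z le in auto)
    moreover have "- e i > 0" using e(3) le[OF d(2)] by simp
    ultimately show ?thesis using M_neg[OF e(1)] d(2) by (intro exI[of _ "\<lambda>i. - e i"]) auto
  qed
  show ?thesis
  proof (cases "M d \<in> Q")
    case True
    show ?thesis by (rule *[OF d(1) True d(3)])
  next
    case False
    then have "M (\<lambda>i. - d i) \<in> Q" using val[OF d(1)] by (simp add: mon_neg)
    from *[OF M_neg[OF d(1)] this] d(3) show ?thesis by simp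
  qed
qed

text \<open>An expression of a power of \<open>q\<close> as a monomial with coefficient \<open>inv u\<close>, together with a certificate
that this coefficient is good enough for \<open>q [^] n \<otimes> v \<in> Q\<close>: the \<open>N\<close>-th power of that element is
\<open>M c [^] n \<otimes> (v [^] N \<otimes> inv (u [^] n))\<close>.\<close>

definition presents :: "'a \<Rightarrow> 'a \<Rightarrow> int \<Rightarrow> int \<Rightarrow> 'a \<Rightarrow> (nat \<Rightarrow> int) \<Rightarrow> bool" where
  "presents q v n N u c \<longleftrightarrow> N \<ge> 1 \<and> u \<in> B \<and> (\<forall>i. 0 \<le> c i) \<and> q [^] N \<otimes> u = M c \<and> v [^] N \<otimes> inv (u [^] n) \<in> Q"

text \<open>As in the proof of Caratheodory's theorem, the largest multiple of a relation \<open>d'\<close> that keeps all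
exponents nonnegative is subtracted, which removes a variable. The coefficient changes by a power of
\<open>M d'\<close>, and the certificate survives because \<open>M d' \<in> Q\<close> for an oriented relation.\<close>

lemma caratheodory_step:
  assumes q: "q \<in> carrier L" and v: "v \<in> B" and n: "n \<ge> 0" and p: "presents q v n N u c"
    and d: "M d \<in> B" "supp d \<subseteq> supp c" "i < r" "d i \<noteq> 0"
  shows "\<exists>N u c'. presents q v n N u c' \<and> supp c' \<subset> supp c"
proof -
  obtain d' where "M d' \<in> B \<and> M d' \<in> Q \<and> supp d' = supp d \<and> (\<exists>i<r. d' i > 0)"
    using oriented_relation[OF d(1,3,4)] by (elim exE)
  then have d': "M d' \<in> B" "M d' \<in> Q" "supp d' = supp d" "\<exists>i<r. d' i > 0" by simp_all
  let ?J = "{i. i < r \<and> d' i > 0}" and ?f = "\<lambda>j. of_int (c j) / of_int (d' j) :: rat"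
  have "finite ?J" "?J \<noteq> {}" using d'(4) by auto
  \<comment> \<open>The exponent at this \<open>j\<close> is the first to vanish; multiplying by \<open>d' j\<close> avoids fractions.\<close>
  from ex_is_arg_min_if_finite[OF this, of ?f] obtain j where j: "j < r" "d' j > 0"
    and min: "\<And>i. i < r \<Longrightarrow> d' i > 0 \<Longrightarrow> ?f j \<le> ?f i"
    unfolding is_arg_min_linorder by auto
  have pp: "N \<ge> 1" "u \<in> B" "\<And>i. 0 \<le> c i" "q [^] N \<otimes> u = M c" "v [^] N \<otimes> inv (u [^] n) \<in> Q"
    using p by (auto simp: presents_def)
  define g where "g = M d'"
  have g: "g \<in> B" "g \<in> Q" using d' by (auto simp: g_def)
  define c' where "c' i = (if i < r then d' j * c i - c j * d' i else 0)" for i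
  define u' where "u' = u [^] (d' j) \<otimes> inv (g [^] (c j))"
  have "0 \<le> c' i" for i
  proof (cases "i < r \<and> d' i > 0")
    case True
    then have "?f j \<le> ?f i" using min by blast
    then have "of_int (c j * d' i) \<le> (of_int (c i * d' j) :: rat)" using True j by (simp add: field_simps)
    then have "c j * d' i \<le> c i * d' j" by (simp only: of_int_le_iff)
    then show ?thesis by (simp add: c'_def mult.commute)
  next
    case False
    then have "i < r \<Longrightarrow> c j * d' i \<le> 0" using pp(3)[of j] by (simp add: mult_nonneg_nonpos)
    moreover have "d' j * c i \<ge> 0" using j pp(3)[of i] by simp
    ultimately show ?thesis by (cases "i < r") (simp_all add: c'_def)
  qed
  moreover have "u' \<in> B" using pp(2) g(1) by (simp add: u'_def B_mult B_inv B_pow)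
  moreover have "N * d' j \<ge> 1" using pp(1) j(2) by (simp add: int_one_le_iff_zero_less)
  moreover have "q [^] (N * d' j) \<otimes> u' = M c'"
  proof -
    have "M c' = M (\<lambda>i. d' j * c i - c j * d' i)" by (rule mon_cong) (auto simp: c'_def)
    also have "\<dots> = M c [^] (d' j) \<otimes> inv (g [^] (c j))"
      by (simp add: mon_diff mon_scale g_def)
    also have "\<dots> = (q [^] N \<otimes> u) [^] (d' j) \<otimes> inv (g [^] (c j))" using pp(4) by simp
    also have "\<dots> = q [^] (N * d' j) \<otimes> u'"
      using q pp(2) g by (simp add: u'_def int_pow_distrib int_pow_pow m_assoc)
    finally show ?thesis by simp
  qed
  moreover have "v [^] (N * d' j) \<otimes> inv (u' [^] n) \<in> Q"
  proof -
    have "(v [^] N \<otimes> inv (u [^] n)) [^] (d' j) \<otimes> g [^] (c j * n) \<in> Q"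
      using pp(3)[of j] pp(5) j(2) g(2) n by (intro Q_mult[OF Q_pow Q_pow]) auto
    also have "(v [^] N \<otimes> inv (u [^] n)) [^] (d' j) \<otimes> g [^] (c j * n) = v [^] (N * d' j) \<otimes> inv (u' [^] n)"
      using v pp(2) g by (simp add: u'_def int_pow_distrib int_pow_pow int_pow_inv inv_mult m_ac mult.commute)
    finally show ?thesis .
  qed
  ultimately have "presents q v n (N * d' j) u' c'" by (simp add: presents_def)
  moreover have "supp c' \<subset> supp c"
  proof -
    have sub: "supp d' \<subseteq> supp c" using d' d by simp
    then have "j \<in> supp c" using j by auto
    moreover have "j \<notin> supp c'" by (simp add: c'_def)
    moreover have "supp c' \<subseteq> supp c" using sub by (auto simp: c'_def)
    ultimately show ?thesis by blast
  qed
  ultimately show ?thesis by blast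
qed

lemma caratheodory:
  assumes q: "q \<in> carrier L" and v: "v \<in> B" and n: "n \<ge> 0" and p: "presents q v n N u c"
  shows "\<exists>N u c. presents q v n N u c \<and> (\<forall>d. M d \<in> B \<longrightarrow> supp d \<subseteq> supp c \<longrightarrow> supp d = {})"
  using p
proof (induction "card (supp c)" arbitrary: N u c rule: less_induct)
  case less
  show ?case
  proof (cases "\<forall>d. M d \<in> B \<longrightarrow> supp d \<subseteq> supp c \<longrightarrow> supp d = {}")
    case False
    then obtain d i where "M d \<in> B" "supp d \<subseteq> supp c" "i < r" "d i \<noteq> 0" by blast
    from caratheodory_step[OF q v n less.prems this] obtain N' u' c'
      where c': "presents q v n N' u' c'" "supp c' \<subset> supp c" by blast
    have "card (supp c') < card (supp c)" by (rule psubset_card_mono[OF _ c'(2)]) simp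
    from less.hyps[OF this c'(1)] show ?thesis .
  next
    case True
    with less.prems have "presents q v n N u c \<and> (\<forall>d. M d \<in> B \<longrightarrow> supp d \<subseteq> supp c \<longrightarrow> supp d = {})"
      by (rule conjI)
    then show ?thesis by (intro exI)
  qed
qed

text \<open>After the reduction no relation lives on the support of the exponents \<open>c\<close>. Passing from the power \<open>N\<close>,
which depends on \<open>q\<close>, to the fixed power \<open>m\<close> by means of \<open>tors\<close>, one gets a second expression for a power
of \<open>q\<close> with exponents \<open>a\<close> on the same support. The two expressions differ by a relation on that support,
which vanishes; hence \<open>a\<close> is proportional to \<open>c\<close>, in particular nonnegative, and the certificate for \<open>c\<close>
turns into \<open>w [^] n \<otimes> v \<in> Q\<close>.\<close>

theorem root_decomposition:
  assumes q: "q \<in> carrier L" and v: "v \<in> B" and n: "n \<ge> 1" and qv: "q [^] (n::int) \<otimes> v \<in> Q"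
  shows "\<exists>w\<in>B. \<exists>a. (\<forall>i. 0 \<le> a i) \<and> q [^] m = w [^] m \<otimes> M a \<and> w [^] n \<otimes> v \<in> Q"
proof -
  obtain n' w0 c0 where c0: "n' \<ge> (1::int)" "w0 \<in> B" "w0 \<in> Q" "\<forall>i. 0 \<le> c0 i"
    "(q [^] n \<otimes> v) [^] n' = w0 \<otimes> M c0" using Q_gen[OF qv] by blast
  have "presents q v n (n * n') (v [^] n' \<otimes> inv w0) c0"
  proof -
    have "q [^] (n * n') \<otimes> (v [^] n' \<otimes> inv w0) = (q [^] n \<otimes> v) [^] n' \<otimes> inv w0"
      using q v c0(2) by (simp add: int_pow_distrib int_pow_pow m_assoc)
    also have "\<dots> = M c0" using c0 by (simp add: m_comm[of w0] m_assoc)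
    finally have 1: "q [^] (n * n') \<otimes> (v [^] n' \<otimes> inv w0) = M c0" .
    have "v [^] (n * n') \<otimes> inv ((v [^] n' \<otimes> inv w0) [^] n) = w0 [^] n"
      using v c0 by (simp add: int_pow_distrib int_pow_pow int_pow_inv inv_mult m_assoc[symmetric] mult.commute)
    moreover have "w0 [^] n \<in> Q" using c0 n by (simp add: Q_pow)
    ultimately show ?thesis unfolding presents_def using 1 n c0 v
      by (simp add: B_mult B_inv B_pow int_one_le_iff_zero_less)
  qed
  from caratheodory[OF q v _ this] n obtain N u c where p: "presents q v n N u c"
    and indep: "\<And>d. M d \<in> B \<Longrightarrow> supp d \<subseteq> supp c \<Longrightarrow> supp d = {}" by auto
  have p': "N \<ge> 1" "u \<in> B" "\<And>i. 0 \<le> c i" "q [^] N \<otimes> u = M c" "v [^] N \<otimes> inv (u [^] n) \<in> Q"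
    using p by (auto simp: presents_def)
  obtain g b where g: "g \<in> B" "q = g \<otimes> M b" using L_gen[OF q] by blast
  \<comment> \<open>Outside the first \<open>r\<close> positions the exponents are irrelevant, but \<open>tors\<close> asks for zeros there.\<close>
  define c1 where "c1 i = (if i < r then c i else 0)" for i
  have M1: "M (\<lambda>i. N * b i - c1 i) = inv (g [^] N \<otimes> u)"
  proof -
    have "M (\<lambda>i. N * b i - c1 i) = M (\<lambda>i. N * b i - c i)" by (rule mon_cong) (auto simp: c1_def)
    also have "\<dots> = M b [^] N \<otimes> inv (q [^] N \<otimes> u)" by (simp add: mon_diff mon_scale p'(4))
    also have "\<dots> = inv (g [^] N \<otimes> u)"
      using g p'(2) by (simp add: int_pow_distrib inv_mult m_assoc[symmetric])
        (simp add: m_ac)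
    finally show ?thesis .
  qed
  then have M1B: "M (\<lambda>i. N * b i - c1 i) \<in> B" using g p'(2) by (simp add: B_mult B_inv B_pow)
  have "c1 i = 0" if "i \<notin> supp c" for i using that by (auto simp: c1_def)
  from tors[OF p'(1) this M1B]
  have "\<exists>a. (\<forall>i. i \<notin> supp c \<longrightarrow> a i = 0) \<and> M (\<lambda>i. m * b i - a i) \<in> B" .
  then obtain a where a: "\<And>i. i \<notin> supp c \<Longrightarrow> a i = 0" "M (\<lambda>i. m * b i - a i) \<in> B" by blast
  obtain k where k: "k \<in> B" "M (\<lambda>i. m * b i - a i) = k [^] m" using roots[OF a(2)] by blast
  define w where "w = k \<otimes> g"
  have w: "w \<in> B" using k g by (simp add: w_def B_mult)
  have qm: "q [^] m = w [^] m \<otimes> M a"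
  proof -
    have "M b [^] m \<otimes> inv (M a) = k [^] m" using k(2) by (simp add: mon_diff mon_scale)
    then have "M b [^] m = k [^] m \<otimes> M a" using k by (simp add: inv_solve_right')
    then show ?thesis using k g by (simp add: w_def int_pow_distrib m_ac)
  qed
  \<comment> \<open>Both expressions are raised to reach the power \<open>m * N\<close> of \<open>q\<close> and then divided.\<close>
  have e: "M (\<lambda>i. m * c i - N * a i) = w [^] (m * N) \<otimes> u [^] m"
  proof -
    have "M (\<lambda>i. m * c i - N * a i) = (q [^] N \<otimes> u) [^] m \<otimes> inv (M a [^] N)"
      by (simp add: mon_diff mon_scale p'(4))
    also have "\<dots> = (q [^] m) [^] N \<otimes> u [^] m \<otimes> inv (M a [^] N)"
      using q p'(2) by (simp add: int_pow_distrib int_pow_pow mult.commute)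
    also have "\<dots> = w [^] (m * N) \<otimes> u [^] m"
      unfolding qm using w p'(2) by (simp add: int_pow_distrib int_pow_pow m_assoc)
    finally show ?thesis .
  qed
  have "supp (\<lambda>i. m * c i - N * a i) = {}"
    by (rule indep) (use w p'(2) a(1) in \<open>auto simp: e B_mult B_pow\<close>)
  then have ac: "m * c i = N * a i" if "i < r" for i using that by auto
  have a0: "0 \<le> a i" for i
  proof (cases "i < r")
    case True
    have "0 \<le> N * a i" unfolding ac[OF True, symmetric] using m p'(3)[of i] by simp
    then show ?thesis using p'(1) by (simp add: zero_le_mult_iff)
  qed (use a(1) in auto)
  have wv: "w [^] n \<otimes> v \<in> Q"
  proof (rule Q_sat)
    have "w [^] (m * N) \<otimes> u [^] m = \<one>" unfolding e[symmetric] by (rule mon_0) (use ac in auto)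
    then have wu: "w [^] (m * N) = inv (u [^] m)" by (rule inv_equality[symmetric]) (simp_all add: w p'(2))
    have "(w [^] n \<otimes> v) [^] (m * N) = (w [^] (m * N)) [^] n \<otimes> v [^] (m * N)"
      using w v by (simp add: int_pow_distrib int_pow_pow mult.commute mult.left_commute)
    also have "\<dots> = (v [^] N \<otimes> inv (u [^] n)) [^] m"
      unfolding wu using v p'(2) by (simp add: int_pow_distrib int_pow_pow int_pow_inv m_comm mult.commute)
    finally show "(w [^] n \<otimes> v) [^] (m * N) \<in> Q" using p'(5) m by (simp add: Q_pow)
    show "m * N \<ge> 1" using m p'(1) by (simp add: int_one_le_iff_zero_less)
  qed (use w v in auto)
  have "(\<forall>i. 0 \<le> a i) \<and> q [^] m = w [^] m \<otimes> M a \<and> w [^] n \<otimes> v \<in> Q"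
    by (rule conjI[OF allI[OF a0] conjI[OF qm wv]])
  then have "\<exists>a. (\<forall>i. 0 \<le> a i) \<and> q [^] m = w [^] m \<otimes> M a \<and> w [^] n \<otimes> v \<in> Q" by (intro exI[of _ a])
  then show ?thesis using w by (rule bexI)
qed

text \<open>By the decomposition with \<open>n = 1\<close> and \<open>v = \<one>\<close>, an element \<open>q = g \<otimes> M d\<close> of \<open>Q\<close> comes with an element
\<open>w \<in> B \<inter> Q\<close> and exponents \<open>a \<ge> 0\<close> such that \<open>q [^] m = w [^] m \<otimes> M a\<close>. The pairs \<open>(d, a)\<close> that can occur
form the group \<open>A\<close>, written as vectors of length \<open>2 * r\<close>, so Gordan's lemma provides generators for
those with \<open>a \<ge> 0\<close>. The \<open>m\<close>-th root of the \<open>a\<close>-part that \<open>roots\<close> yields for a generator is the element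
\<open>y t\<close> of \<open>Q\<close>.\<close>

theorem finitely_generated:
  "\<exists>(s::nat) y. (\<forall>t<s. y t \<in> Q) \<and>
    (\<forall>q\<in>Q. \<exists>w\<in>B. \<exists>n. w \<in> Q \<and> (\<forall>t. 0 \<le> n t) \<and> q = w \<otimes> mon L s y n)"
proof -
  let ?h = "\<lambda>f i. m * f i - f (r + i)"
  define A where "A = {f. M (?h f) \<in> B}"
  obtain s :: nat and b where b: "\<And>t. t < s \<Longrightarrow> b t \<in> A" "\<And>t i. t < s \<Longrightarrow> i < 2 * r \<Longrightarrow> i \<in> {r..} \<Longrightarrow> 0 \<le> b t i"
    and gen: "\<And>x. x \<in> A \<Longrightarrow> (\<And>i. i < 2 * r \<Longrightarrow> i \<in> {r..} \<Longrightarrow> 0 \<le> x i) \<Longrightarrow>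
      \<exists>n. (\<forall>t. 0 \<le> n t) \<and> (\<forall>i<2*r. x i = (\<Sum>t<s. n t * b t i))"
  proof (rule gordan[of A "2 * r" "{r..}"])
    fix x y assume "x \<in> A" "y \<in> A"
    then have "M (?h x) \<otimes> inv (M (?h y)) \<in> B" by (simp add: A_def B_mult B_inv)
    also have "M (?h x) \<otimes> inv (M (?h y)) = M (\<lambda>i. ?h x i - ?h y i)" by (simp add: mon_diff)
    also have "\<dots> = M (?h (\<lambda>i. x i - y i))" by (rule mon_cong) (auto simp: algebra_simps)
    finally show "(\<lambda>i. x i - y i) \<in> A" by (simp add: A_def)
  next
    fix x y :: "nat \<Rightarrow> int" assume *: "\<And>i. i < 2 * r \<Longrightarrow> x i = y i" "x \<in> A"
    have "M (?h x) = M (?h y)" by (rule mon_cong) (auto simp: *(1))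
    then show "y \<in> A" using *(2) by (simp add: A_def)
  qed blast
  have "\<exists>k. k \<in> B \<and> M (?h (b t)) = k [^] m" if "t < s" for t
    using roots[of "?h (b t)"] b(1)[OF that] by (auto simp: A_def)
  then have "\<forall>t. \<exists>k. t < s \<longrightarrow> k \<in> B \<and> M (?h (b t)) = k [^] m" by blast
  from choice[OF this] obtain k where k': "\<forall>t<s. k t \<in> B \<and> M (?h (b t)) = k t [^] m" by (elim exE)
  have k: "k t \<in> B" "M (?h (b t)) = k t [^] m" if "t < s" for t using k' that by auto
  define y where "y t = M (b t) \<otimes> inv (k t)" for t
  have yC: "y t \<in> carrier L" if "t < s" for t using k(1)[OF that] by (simp add: y_def)
  have ym: "y t [^] m = M (\<lambda>i. b t (r + i))" if "t < s" for t
  proof -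
    have "M (b t) [^] m \<otimes> inv (M (\<lambda>i. b t (r + i))) = k t [^] m"
      using k(2)[OF that] by (simp add: mon_diff mon_scale)
    then have "M (b t) [^] m = k t [^] m \<otimes> M (\<lambda>i. b t (r + i))" using k(1)[OF that] by (simp add: inv_solve_right')
    then show ?thesis using k(1)[OF that] by (simp add: y_def int_pow_distrib int_pow_inv m_ac)
  qed
  have yQ: "y t \<in> Q" if "t < s" for t
  proof (rule Q_sat[OF yC[OF that] m])
    show "y t [^] m \<in> Q" unfolding ym[OF that] by (rule mon_Q[OF z]) (use b(2)[OF that] in auto)
  qed
  have "\<exists>w\<in>B. \<exists>n. w \<in> Q \<and> (\<forall>t. 0 \<le> n t) \<and> q = w \<otimes> mon L s y n" if q: "q \<in> Q" for q
  proof -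
    have "\<one> \<in> B" by (rule subgroup.one_closed[OF B])
    from root_decomposition[OF Q_C[OF q] this, of 1] q obtain w a
      where w: "w \<in> B" "\<And>i. 0 \<le> a i" "q [^] m = w [^] m \<otimes> M a" "w \<in> Q" by auto
    obtain g d where g: "g \<in> B" "q = g \<otimes> M d" using L_gen[OF Q_C[OF q]] by blast
    define f where "f i = (if i < r then d i else a (i - r))" for i
    have "M (?h f) = M (\<lambda>i. m * d i - a i)" by (rule mon_cong) (auto simp: f_def)
    also have "\<dots> = M d [^] m \<otimes> inv (M a)" by (simp add: mon_diff mon_scale)
    also have "\<dots> = w [^] m \<otimes> inv (g [^] m)"
    proof -
      have "g [^] m \<otimes> M d [^] m = w [^] m \<otimes> M a" using w(3) g by (simp add: int_pow_distrib)
      then show ?thesis by (rule cross_mult) (use g(1) w(1) in auto)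
    qed
    finally have "f \<in> A" using g(1) w(1) by (simp add: A_def B_mult B_inv B_pow)
    moreover have "0 \<le> f i" if "i \<in> {r..}" for i using that w(2) by (simp add: f_def)
    ultimately obtain n where n: "\<forall>t. 0 \<le> n t" "\<forall>i<2*r. f i = (\<Sum>t<s. n t * b t i)"
      using gen[of f] by blast
    \<comment> \<open>This coefficient may differ from \<open>w\<close>, but both have the same \<open>m\<close>-th power, and \<open>Q\<close> is saturated.\<close>
    define w' where "w' = g \<otimes> mon L s k n"
    have kB: "mon L s k n \<in> B" by (rule mon_subgroup[OF B k(1)])
    have w'B: "w' \<in> B" using g(1) kB by (simp add: w'_def B_mult)
    have yk: "mon L s y n = mon L s (\<lambda>t. M (b t)) n \<otimes> inv (mon L s k n)"
      unfolding y_def using k(1) by (subst mon_mult) (simp_all add: mon_inv)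
    have "M d = M (\<lambda>i. \<Sum>t<s. n t * b t i)"
    proof (rule mon_cong)
      fix i assume "i < r"
      then show "d i = (\<Sum>t<s. n t * b t i)" using n(2)[rule_format, of i] by (simp add: f_def)
    qed simp
    then have Md: "M d = mon L s (\<lambda>t. M (b t)) n" by (simp add: mon_sum)
    have q': "q = w' \<otimes> mon L s y n"
      unfolding yk w'_def g(2) Md using g(1) kB by (simp add: m_ac)
    have "M a = M (\<lambda>i. \<Sum>t<s. n t * b t (r + i))"
    proof (rule mon_cong)
      fix i assume "i < r"
      then show "a i = (\<Sum>t<s. n t * b t (r + i))" using n(2)[rule_format, of "r + i"] by (simp add: f_def)
    qed simp
    also have "\<dots> = mon L s (\<lambda>t. M (\<lambda>i. b t (r + i))) n" by (simp add: mon_sum)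
    also have "\<dots> = mon L s (\<lambda>t. y t [^] m) n" by (rule mon_cong) (simp_all add: ym)
    also have "\<dots> = mon L s y n [^] m" by (simp add: mon_pow yC)
    finally have "w [^] m \<otimes> mon L s y n [^] m = w' [^] m \<otimes> mon L s y n [^] m"
      using w(3) w'B yC by (simp add: q' int_pow_distrib)
    then have "w' [^] m = w [^] m" using w(1) w'B yC by simp
    then have "w' \<in> Q" using Q_sat[OF B_C[OF w'B] m] Q_pow[OF w(4), of m] m by simp
    then show ?thesis using w'B n(1) q' by (intro bexI[OF _ w'B] exI[of _ n]) simp
  qed
  then show ?thesis using yQ by (intro exI[of _ s] exI[of _ y]) simp
qed

end

section \<open>Cones over a valuative monoid\<close>

text \<open>The situation after adjoining roots: \<open>G\<close> is the group completion of a valuative monoid with image \<open>W\<close>,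
\<open>L\<close> is the group completion of its pushout with the given monoid, \<open>\<psi>\<close> is the canonical map and \<open>Q\<close> the
saturated pushout. The relations \<open>\<psi> g = z^d\<close> are generated by the pairs \<open>(\<gamma> j, c j)\<close>, and every \<open>\<gamma> j\<close> has
the \<open>m\<close>-th root \<open>\<epsilon> j\<close> in \<open>G\<close>.\<close>

locale cone_hom = G: comm_group G + L: comm_group L for G :: "'g monoid" and L :: "'l monoid" +
  fixes \<psi> :: "'g \<Rightarrow> 'l" and W :: "'g set" and Q :: "'l set" and z :: "nat \<Rightarrow> 'l" and r :: nat
    and m :: int and k :: nat and \<gamma> \<epsilon> :: "nat \<Rightarrow> 'g" and c :: "nat \<Rightarrow> nat \<Rightarrow> int"
  assumes \<psi>: "\<psi> \<in> mhom G L"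
    and W_sub: "W \<subseteq> carrier G" and W_one: "\<one>\<^bsub>G\<^esub> \<in> W"
    and W_mult: "\<And>x y. x \<in> W \<Longrightarrow> y \<in> W \<Longrightarrow> x \<otimes>\<^bsub>G\<^esub> y \<in> W"
    and W_val: "\<And>g. g \<in> carrier G \<Longrightarrow> g \<in> W \<or> inv\<^bsub>G\<^esub> g \<in> W"
    and z_C: "\<And>i. i < r \<Longrightarrow> z i \<in> carrier L"
    and Q_def: "Q = {q \<in> carrier L. \<exists>n\<ge>1. \<exists>w\<in>W. \<exists>d. (\<forall>i. 0 \<le> d i) \<and>
      q [^]\<^bsub>L\<^esub> (n::int) = \<psi> w \<otimes>\<^bsub>L\<^esub> mon L r z d}"
    and L_gen: "\<And>q. q \<in> carrier L \<Longrightarrow> \<exists>g\<in>carrier G. \<exists>b. q = \<psi> g \<otimes>\<^bsub>L\<^esub> mon L r z b"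
    and \<epsilon>: "\<And>j. j < k \<Longrightarrow> \<epsilon> j \<in> carrier G" "\<And>j. j < k \<Longrightarrow> \<gamma> j = \<epsilon> j [^]\<^bsub>G\<^esub> m"
    and rel: "\<And>j. j < k \<Longrightarrow> \<psi> (\<gamma> j) = mon L r z (c j)"
    and rel_gen: "\<And>g d. g \<in> carrier G \<Longrightarrow> \<psi> g = mon L r z d \<Longrightarrow>
      \<exists>n. g = mon G k \<gamma> n \<and> (\<forall>i<r. d i = (\<Sum>j<k. n j * c j i))"
    and m: "m \<ge> 1"
    and tors: "\<And>I N b d. N \<ge> 1 \<Longrightarrow> (\<And>i. i \<notin> I \<Longrightarrow> d i = 0) \<Longrightarrow>
      \<exists>n. \<forall>i<r. N * b i - d i = (\<Sum>j<k. n j * c j i) \<Longrightarrow>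
      \<exists>d'. (\<forall>i. i \<notin> I \<longrightarrow> d' i = 0) \<and> (\<exists>n. \<forall>i<r. m * b i - d' i = (\<Sum>j<k. n j * c j i))"
begin

lemma \<gamma>_C [simp]: "j < k \<Longrightarrow> \<gamma> j \<in> carrier G" using \<epsilon> by simp
lemma \<psi>_C [simp]: "g \<in> carrier G \<Longrightarrow> \<psi> g \<in> carrier L" by (rule mhom_closed[OF \<psi>])
lemma W_C [simp]: "g \<in> W \<Longrightarrow> g \<in> carrier G" using W_sub by auto
lemmas [simp] = z_C \<epsilon>(1)
lemmas \<psi>_mult = mhom_mult[OF \<psi>]
lemmas \<psi>_one = mhom_one[OF \<psi>]

lemma \<psi>_hom: "group_hom G L \<psi>"
  using \<psi> by (intro group_hom.intro group_hom_axioms.intro G.group_axioms L.group_axioms) (simp add: mhom_def)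

lemmas \<psi>_inv = group_hom.hom_inv[OF \<psi>_hom]
lemmas \<psi>_pow = group_hom.hom_int_pow[OF \<psi>_hom]
lemmas \<psi>_mon = hom_mon[OF G.comm_group_axioms L.comm_group_axioms \<psi>]

lemma W_pow: "x \<in> W \<Longrightarrow> 0 \<le> n \<Longrightarrow> x [^]\<^bsub>G\<^esub> (n::int) \<in> W"
  using G.mon_mem[of W 1 "\<lambda>_. x" "\<lambda>_. n"] W_one W_mult by simp

lemma W_sat:
  assumes "x \<in> carrier G" "n \<ge> 1" "x [^]\<^bsub>G\<^esub> (n::int) \<in> W" shows "x \<in> W"
proof (rule ccontr)
  assume "x \<notin> W"
  then have "inv\<^bsub>G\<^esub> x \<in> W" using W_val assms(1) by blast
  then have "x [^]\<^bsub>G\<^esub> n \<otimes>\<^bsub>G\<^esub> (inv\<^bsub>G\<^esub> x) [^]\<^bsub>G\<^esub> (n - 1) \<in> W" using assms(2) by (intro W_mult[OF assms(3)] W_pow) auto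
  also have "x [^]\<^bsub>G\<^esub> n \<otimes>\<^bsub>G\<^esub> (inv\<^bsub>G\<^esub> x) [^]\<^bsub>G\<^esub> (n - 1) = x [^]\<^bsub>G\<^esub> (n - (n - 1))"
    using assms(1) by (simp only: G.int_pow_inv G.int_pow_diff)
  finally show False using \<open>x \<notin> W\<close> assms(1) by simp
qed

lemma relation_monomial: "\<psi> (mon G k \<gamma> n) = mon L r z (\<lambda>i. \<Sum>j<k. n j * c j i)"
proof -
  have "\<psi> (mon G k \<gamma> n) = mon L k (\<lambda>j. mon L r z (c j)) n"
    by (subst \<psi>_mon) (auto intro!: mon_cong simp: rel)
  then show ?thesis by (simp add: L.mon_sum)
qed

lemma relation_iff:
  "mon L r z d \<in> \<psi> ` carrier G \<longleftrightarrow> (\<exists>n. \<forall>i<r. d i = (\<Sum>j<k. n j * c j i))"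
proof
  assume "mon L r z d \<in> \<psi> ` carrier G"
  then obtain g where "g \<in> carrier G" "\<psi> g = mon L r z d" by auto
  from rel_gen[OF this] show "\<exists>n. \<forall>i<r. d i = (\<Sum>j<k. n j * c j i)" by blast
next
  assume "\<exists>n. \<forall>i<r. d i = (\<Sum>j<k. n j * c j i)"
  then obtain n where "\<forall>i<r. d i = (\<Sum>j<k. n j * c j i)" by blast
  then have "mon L r z d = \<psi> (mon G k \<gamma> n)" unfolding relation_monomial by (intro mon_cong) auto
  moreover have "mon G k \<gamma> n \<in> carrier G" by simp
  ultimately show "mon L r z d \<in> \<psi> ` carrier G" by simp
qed

lemma Q_I:
  "q \<in> carrier L \<Longrightarrow> n \<ge> 1 \<Longrightarrow> w \<in> W \<Longrightarrow> (\<And>i. 0 \<le> d i) \<Longrightarrow>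
    q [^]\<^bsub>L\<^esub> (n::int) = \<psi> w \<otimes>\<^bsub>L\<^esub> mon L r z d \<Longrightarrow> q \<in> Q"
  unfolding Q_def by (intro CollectI conjI exI[of _ n] bexI[of _ w] exI[of _ d] allI) auto

lemma Q_E:
  assumes "q \<in> Q"
  obtains n w d where "q \<in> carrier L" "n \<ge> (1::int)" "w \<in> W" "\<forall>i. 0 \<le> d i"
    "q [^]\<^bsub>L\<^esub> n = \<psi> w \<otimes>\<^bsub>L\<^esub> mon L r z d"
proof -
  have "q \<in> carrier L" using assms by (simp add: Q_def)
  have "\<exists>n\<ge>1. \<exists>w\<in>W. \<exists>d. (\<forall>i. 0 \<le> d i) \<and> q [^]\<^bsub>L\<^esub> (n::int) = \<psi> w \<otimes>\<^bsub>L\<^esub> mon L r z d"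
    using assms by (simp add: Q_def)
  then obtain n w d where "n \<ge> 1" "w \<in> W" "\<forall>i. 0 \<le> d i" "q [^]\<^bsub>L\<^esub> (n::int) = \<psi> w \<otimes>\<^bsub>L\<^esub> mon L r z d"
    by (elim exE conjE bexE)
  then show thesis using \<open>q \<in> carrier L\<close> by (intro that[of n w d]) auto
qed

lemma W_Q: "w \<in> W \<Longrightarrow> \<psi> w \<in> Q"
  by (rule Q_I[of _ 1 w "\<lambda>_. 0"]) auto

lemma z_Q: "i < r \<Longrightarrow> z i \<in> Q"
  by (rule Q_I[of _ 1 "\<one>\<^bsub>G\<^esub>" "\<lambda>j. if j = i then 1 else 0"])
    (auto simp: W_one \<psi>_one L.mon_unit)

sublocale cone: cone_group L "\<psi> ` carrier G" Q z r m
proof (intro cone_group.intro cone_group_axioms.intro L.comm_group_axioms)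
  interpret group_hom G L \<psi> by (rule \<psi>_hom)
  show "subgroup (\<psi> ` carrier G) L" by (rule img_is_subgroup)
  show "Q \<subseteq> carrier L" by (auto simp: Q_def)
  show "\<one>\<^bsub>L\<^esub> \<in> Q" using W_Q[OF W_one] by (simp add: \<psi>_one)
next
  fix x y assume "x \<in> Q" "y \<in> Q"
  obtain n w d where x: "x \<in> carrier L" "n \<ge> (1::int)" "w \<in> W" "\<forall>i. 0 \<le> d i"
    "x [^]\<^bsub>L\<^esub> n = \<psi> w \<otimes>\<^bsub>L\<^esub> mon L r z d" using \<open>x \<in> Q\<close> by (rule Q_E)
  obtain n' w' d' where y: "y \<in> carrier L" "n' \<ge> (1::int)" "w' \<in> W" "\<forall>i. 0 \<le> d' i"
    "y [^]\<^bsub>L\<^esub> n' = \<psi> w' \<otimes>\<^bsub>L\<^esub> mon L r z d'" using \<open>y \<in> Q\<close> by (rule Q_E)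
  show "x \<otimes>\<^bsub>L\<^esub> y \<in> Q"
  proof (rule Q_I[of _ "n * n'" "w [^]\<^bsub>G\<^esub> n' \<otimes>\<^bsub>G\<^esub> w' [^]\<^bsub>G\<^esub> n" "\<lambda>i. n' * d i + n * d' i"])
    have "(x \<otimes>\<^bsub>L\<^esub> y) [^]\<^bsub>L\<^esub> (n * n') = (x [^]\<^bsub>L\<^esub> n) [^]\<^bsub>L\<^esub> n' \<otimes>\<^bsub>L\<^esub> (y [^]\<^bsub>L\<^esub> n') [^]\<^bsub>L\<^esub> n"
      using x(1) y(1) by (simp add: L.int_pow_distrib L.int_pow_pow mult.commute)
    then show "(x \<otimes>\<^bsub>L\<^esub> y) [^]\<^bsub>L\<^esub> (n * n') = \<psi> (w [^]\<^bsub>G\<^esub> n' \<otimes>\<^bsub>G\<^esub> w' [^]\<^bsub>G\<^esub> n) \<otimes>\<^bsub>L\<^esub> mon L r z (\<lambda>i. n' * d i + n * d' i)"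
      unfolding x(5) y(5) using x(3) y(3)
      by (simp add: L.int_pow_distrib \<psi>_mult \<psi>_pow L.mon_add L.mon_scale L.m_ac)
    show "w [^]\<^bsub>G\<^esub> n' \<otimes>\<^bsub>G\<^esub> w' [^]\<^bsub>G\<^esub> n \<in> W" using x y by (intro W_mult W_pow) auto
    show "1 \<le> n * n'" using x(2) y(2) by (simp add: int_one_le_iff_zero_less)
    show "0 \<le> n' * d i + n * d' i" for i using x(2,4) y(2,4) by simp
  qed (use x y in auto)
next
  fix x and n :: int assume x: "x \<in> carrier L" "n \<ge> 1" "x [^]\<^bsub>L\<^esub> n \<in> Q"
  obtain n' w d where y: "n' \<ge> (1::int)" "w \<in> W" "\<forall>i. 0 \<le> d i"
    "(x [^]\<^bsub>L\<^esub> n) [^]\<^bsub>L\<^esub> n' = \<psi> w \<otimes>\<^bsub>L\<^esub> mon L r z d" using x(3) by (rule Q_E)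
  show "x \<in> Q"
    by (rule Q_I[of _ "n * n'" w d]) (use x y in \<open>auto simp: L.int_pow_pow int_one_le_iff_zero_less\<close>)
next
  fix g assume "g \<in> \<psi> ` carrier G"
  then obtain h where h: "h \<in> carrier G" "g = \<psi> h" by auto
  from W_val[OF h(1)] show "g \<in> Q \<or> inv\<^bsub>L\<^esub> g \<in> Q"
    using W_Q[of h] W_Q[of "inv\<^bsub>G\<^esub> h"] h by (auto simp: \<psi>_inv)
next
  fix q assume "q \<in> Q"
  obtain n w d where x: "n \<ge> (1::int)" "w \<in> W" "\<forall>i. 0 \<le> d i"
    "q [^]\<^bsub>L\<^esub> n = \<psi> w \<otimes>\<^bsub>L\<^esub> mon L r z d" using \<open>q \<in> Q\<close> by (rule Q_E)
  then show "\<exists>n\<ge>1. \<exists>w\<in>\<psi> ` carrier G \<inter> Q. \<exists>c. (\<forall>i. 0 \<le> c i) \<and> q [^]\<^bsub>L\<^esub> (n::int) = w \<otimes>\<^bsub>L\<^esub> mon L r z c"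
    using W_Q[OF x(2)] by (intro exI[of _ n] conjI bexI[of _ "\<psi> w"] exI[of _ d]) auto
next
  fix q assume "q \<in> carrier L"
  from L_gen[OF this] show "\<exists>g\<in>\<psi> ` carrier G. \<exists>b. q = g \<otimes>\<^bsub>L\<^esub> mon L r z b" by blast
next
  fix I N b d assume *: "N \<ge> (1::int)" "\<And>i. i \<notin> I \<Longrightarrow> d i = 0" "mon L r z (\<lambda>i. N * b i - d i) \<in> \<psi> ` carrier G"
  from tors[OF *(1,2) *(3)[unfolded relation_iff]]
  show "\<exists>d'. (\<forall>i. i \<notin> I \<longrightarrow> d' i = 0) \<and> mon L r z (\<lambda>i. m * b i - d' i) \<in> \<psi> ` carrier G"
    unfolding relation_iff .
next
  fix d assume "mon L r z d \<in> \<psi> ` carrier G"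
  then obtain g where g: "g \<in> carrier G" "\<psi> g = mon L r z d" by auto
  from rel_gen[OF this] obtain n where n: "g = mon G k \<gamma> n" by blast
  also have "\<dots> = mon G k (\<lambda>j. \<epsilon> j [^]\<^bsub>G\<^esub> m) n" by (rule mon_cong) (simp_all add: \<epsilon>)
  also have "\<dots> = mon G k \<epsilon> n [^]\<^bsub>G\<^esub> m" by (simp add: G.mon_pow)
  finally have "mon L r z d = \<psi> (mon G k \<epsilon> n) [^]\<^bsub>L\<^esub> m" using g(2) by (simp add: \<psi>_pow)
  then show "\<exists>k\<in>\<psi> ` carrier G. mon L r z d = k [^]\<^bsub>L\<^esub> m" by auto
qed (fact z_Q m)+

text \<open>The relations \<open>y^d = \<psi> g y^d'\<close> with \<open>d, d' \<ge> 0\<close> form a finitely generated monoid, for arbitrary elements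
\<open>y i\<close>. Written in terms of the \<open>z i\<close>, such a relation becomes a solution \<open>(l, d, d')\<close> of linear equations,
where \<open>l\<close> expresses the resulting relation between the \<open>z i\<close> by the generating ones; Gordan's lemma
applies with sign conditions on the \<open>d\<close>- and \<open>d'\<close>-parts.\<close>

lemma relation_monoid_fg:
  fixes y :: "nat \<Rightarrow> 'l" and s :: nat
  assumes "\<forall>i<s. y i \<in> carrier L"
  shows "\<exists>(T::nat) h a a'. (\<forall>t<T. h t \<in> carrier G) \<and> (\<forall>t<T. \<forall>i<s. 0 \<le> a t i \<and> 0 \<le> a' t i) \<and>
    (\<forall>t<T. mon L s y (a t) = \<psi> (h t) \<otimes>\<^bsub>L\<^esub> mon L s y (a' t)) \<and>
    (\<forall>g\<in>carrier G. \<forall>d d'. (\<forall>i<s. 0 \<le> d i \<and> 0 \<le> d' i) \<longrightarrow>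
      mon L s y d = \<psi> g \<otimes>\<^bsub>L\<^esub> mon L s y d' \<longrightarrow>
      (\<exists>n. (\<forall>t. 0 \<le> n t) \<and> g = mon G T h n \<and>
        (\<forall>i<s. d i = (\<Sum>t<T. n t * a t i) \<and> d' i = (\<Sum>t<T. n t * a' t i))))"
proof -
  have y: "y i \<in> carrier L" if "i < s" for i using assms that by simp
  have "\<forall>i. \<exists>gb. i < s \<longrightarrow> fst gb \<in> carrier G \<and> y i = \<psi> (fst gb) \<otimes>\<^bsub>L\<^esub> mon L r z (snd gb)"
    using L_gen[OF y] by (metis fst_conv snd_conv)
  from choice[OF this] obtain gb where
    gb: "\<forall>i<s. fst (gb i) \<in> carrier G \<and> y i = \<psi> (fst (gb i)) \<otimes>\<^bsub>L\<^esub> mon L r z (snd (gb i))" by (elim exE)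
  define \<delta> where "\<delta> i = fst (gb i)" for i
  define b where "b i = snd (gb i)" for i
  have \<delta>: "\<delta> i \<in> carrier G" "y i = \<psi> (\<delta> i) \<otimes>\<^bsub>L\<^esub> mon L r z (b i)" if "i < s" for i
    using gb that by (auto simp: \<delta>_def b_def)
  have mon_y: "mon L s y e = \<psi> (mon G s \<delta> e) \<otimes>\<^bsub>L\<^esub> mon L r z (\<lambda>i. \<Sum>j<s. e j * b j i)" for e
  proof -
    have "mon L s y e = mon L s (\<lambda>i. \<psi> (\<delta> i) \<otimes>\<^bsub>L\<^esub> mon L r z (b i)) e"
      by (rule mon_cong) (simp_all add: \<delta>)
    also have "\<dots> = mon L s (\<lambda>i. \<psi> (\<delta> i)) e \<otimes>\<^bsub>L\<^esub> mon L s (\<lambda>i. mon L r z (b i)) e"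
      by (rule L.mon_mult) (simp_all add: \<delta>(1))
    finally show ?thesis by (simp add: \<psi>_mon \<delta>(1) L.mon_sum)
  qed
  let ?e = "\<lambda>f j. f (k + j) - f (k + s + j)"
  define A where "A = {f :: nat \<Rightarrow> int. \<forall>i<r. (\<Sum>j<s. ?e f j * b j i) = (\<Sum>j<k. f j * c j i)}"
  obtain T :: nat and B where B: "\<And>t. t < T \<Longrightarrow> B t \<in> A"
      "\<And>t i. t < T \<Longrightarrow> i < k + 2 * s \<Longrightarrow> i \<in> {k..} \<Longrightarrow> 0 \<le> B t i"
    and gen: "\<And>x. x \<in> A \<Longrightarrow> (\<And>i. i < k + 2 * s \<Longrightarrow> i \<in> {k..} \<Longrightarrow> 0 \<le> x i) \<Longrightarrow>
      \<exists>n. (\<forall>t. 0 \<le> n t) \<and> (\<forall>i<k + 2 * s. x i = (\<Sum>t<T. n t * B t i))"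
  proof (rule gordan[of A "k + 2 * s" "{k..}"])
    fix x y assume xy: "x \<in> A" "y \<in> A"
    have "(\<Sum>j<s. ?e (\<lambda>i. x i - y i) j * b j i) = (\<Sum>j<s. ?e x j * b j i) - (\<Sum>j<s. ?e y j * b j i)" for i
      by (simp add: sum_subtractf[symmetric] algebra_simps)
    moreover have "(\<Sum>j<k. (x j - y j) * c j i) = (\<Sum>j<k. x j * c j i) - (\<Sum>j<k. y j * c j i)" for i
      by (simp add: sum_subtractf[symmetric] algebra_simps)
    ultimately show "(\<lambda>i. x i - y i) \<in> A" using xy by (simp add: A_def)
  next
    fix x y :: "nat \<Rightarrow> int" assume *: "\<And>i. i < k + 2 * s \<Longrightarrow> x i = y i" "x \<in> A"
    have "(\<Sum>j<s. ?e y j * b j i) = (\<Sum>j<s. ?e x j * b j i)" for i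
      by (rule sum.cong) (auto simp: *(1))
    moreover have "(\<Sum>j<k. y j * c j i) = (\<Sum>j<k. x j * c j i)" for i
      by (rule sum.cong) (auto simp: *(1))
    ultimately show "y \<in> A" using *(2) by (simp add: A_def)
  qed blast
  define h where "h t = mon G s \<delta> (?e (B t)) \<otimes>\<^bsub>G\<^esub> mon G k \<gamma> (B t)" for t
  have hC: "h t \<in> carrier G" for t by (simp add: h_def \<delta>(1))
  show ?thesis
  proof (rule exI[of _ T], rule exI[of _ h], rule exI[of _ "\<lambda>t j. B t (k + j)"],
      rule exI[of _ "\<lambda>t j. B t (k + s + j)"], intro conjI allI impI ballI)
    fix t assume t: "t < T"
    have "mon L s y (?e (B t)) = \<psi> (mon G s \<delta> (?e (B t))) \<otimes>\<^bsub>L\<^esub> mon L r z (\<lambda>i. \<Sum>j<k. B t j * c j i)"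
      unfolding mon_y using B(1)[OF t] by (intro arg_cong2[where f = "(\<otimes>\<^bsub>L\<^esub>)"] refl mon_cong) (simp_all add: A_def)
    also have "\<dots> = \<psi> (h t)" by (simp add: h_def \<psi>_mult \<delta>(1) relation_monomial)
    finally have "mon L s y (\<lambda>j. B t (k + j)) \<otimes>\<^bsub>L\<^esub> inv\<^bsub>L\<^esub> (mon L s y (\<lambda>j. B t (k + s + j))) = \<psi> (h t)"
      by (simp add: L.mon_diff y)
    then show "mon L s y (\<lambda>j. B t (k + j)) = \<psi> (h t) \<otimes>\<^bsub>L\<^esub> mon L s y (\<lambda>j. B t (k + s + j))"
      using hC y by (simp add: L.inv_solve_right')
  next
    fix g d d' assume g: "g \<in> carrier G" and d: "\<forall>i<s. 0 \<le> d i \<and> 0 \<le> d' i"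
      and eq: "mon L s y d = \<psi> g \<otimes>\<^bsub>L\<^esub> mon L s y d'"
    let ?D = "\<lambda>j. d j - d' j"
    have "mon L s y ?D = \<psi> g" using eq g y by (simp add: L.mon_diff L.m_assoc)
    then have \<psi>g: "\<psi> g = \<psi> (mon G s \<delta> ?D) \<otimes>\<^bsub>L\<^esub> mon L r z (\<lambda>i. \<Sum>j<s. ?D j * b j i)" by (simp add: mon_y)
    then have "\<psi> (g \<otimes>\<^bsub>G\<^esub> inv\<^bsub>G\<^esub> (mon G s \<delta> ?D)) = mon L r z (\<lambda>i. \<Sum>j<s. ?D j * b j i)"
      using g \<delta>(1) by (simp add: \<psi>_mult \<psi>_inv \<psi>g L.m_ac)
    from rel_gen[OF _ this] g \<delta>(1) obtain l where
      l: "g \<otimes>\<^bsub>G\<^esub> inv\<^bsub>G\<^esub> (mon G s \<delta> ?D) = mon G k \<gamma> l" "\<forall>i<r. (\<Sum>j<s. ?D j * b j i) = (\<Sum>j<k. l j * c j i)"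
      by auto
    define x where "x i = (if i < k then l i else if i < k + s then d (i - k) else d' (i - k - s))" for i
    have ex: "?e x j = ?D j" if "j < s" for j using that by (simp add: x_def)
    have "x \<in> A" using l(2) ex by (simp add: A_def) (simp add: x_def)
    moreover have "0 \<le> x i" if "i < k + 2 * s" "i \<in> {k..}" for i
      using that d[rule_format, of "i - k"] d[rule_format, of "i - k - s"] by (auto simp: x_def)
    ultimately obtain n where n: "\<forall>t. 0 \<le> n t" "\<forall>i<k + 2 * s. x i = (\<Sum>t<T. n t * B t i)"
      using gen[of x] by blast
    have dn: "d i = (\<Sum>t<T. n t * B t (k + i))" "d' i = (\<Sum>t<T. n t * B t (k + s + i))" if "i < s" for i
      using n(2)[rule_format, of "k + i"] n(2)[rule_format, of "k + s + i"] that by (simp_all add: x_def)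
    have "mon G T h n = mon G T (\<lambda>t. mon G s \<delta> (?e (B t))) n \<otimes>\<^bsub>G\<^esub> mon G T (\<lambda>t. mon G k \<gamma> (B t)) n"
      unfolding h_def by (rule G.mon_mult) (simp_all add: \<delta>(1))
    also have "\<dots> = mon G s \<delta> (\<lambda>j. \<Sum>t<T. n t * ?e (B t) j) \<otimes>\<^bsub>G\<^esub> mon G k \<gamma> (\<lambda>j. \<Sum>t<T. n t * B t j)"
      by (simp add: G.mon_sum \<delta>(1))
    also have "mon G s \<delta> (\<lambda>j. \<Sum>t<T. n t * ?e (B t) j) = mon G s \<delta> ?D"
      by (rule mon_cong) (simp_all add: dn right_diff_distrib sum_subtractf)
    also have "mon G k \<gamma> (\<lambda>j. \<Sum>t<T. n t * B t j) = mon G k \<gamma> l"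
      by (rule mon_cong) (simp_all add: n(2)[rule_format, symmetric] x_def)
    also have "mon G s \<delta> ?D \<otimes>\<^bsub>G\<^esub> mon G k \<gamma> l = g"
      unfolding l(1)[symmetric] using g \<delta>(1) by simp
    finally show "\<exists>n. (\<forall>t. 0 \<le> n t) \<and> g = mon G T h n \<and>
        (\<forall>i<s. d i = (\<Sum>t<T. n t * B t (k + i)) \<and> d' i = (\<Sum>t<T. n t * B t (k + s + i)))"
      using n(1) dn by (intro exI[of _ n]) simp
  next
    fix t i assume "t < T" "i < s"
    then show "0 \<le> B t (k + i)" "0 \<le> B t (k + s + i)" using B(2) by simp_all
  qed (rule hC)
qed

text \<open>The preimage of \<open>Q\<close> in \<open>G\<close> can be larger than \<open>W\<close>, but it is contained in the monoid obtained from \<open>W\<close> by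
inverting a single \<open>a\<close>, and \<open>a\<close> becomes a unit of \<open>Q\<close>. If \<open>\<psi> g \<in> Q\<close>, then some power of \<open>g\<close> is an element
of \<open>W\<close> times a \<open>g'\<close> for which \<open>\<psi> g'\<close> is a monomial with nonnegative exponents. Such \<open>g'\<close> are products of
those generators \<open>h t\<close> of the relation monoid that involve no monomial on the right. For \<open>a\<close> one takes
the product of the inverses of the ones among them that are not in \<open>W\<close>.\<close>

lemma unit_absorbing_preimage:
  "\<exists>a\<in>W. inv\<^bsub>L\<^esub> (\<psi> a) \<in> Q \<and>
    (\<forall>g\<in>carrier G. \<psi> g \<in> Q \<longrightarrow> (\<exists>n\<ge>0. g \<otimes>\<^bsub>G\<^esub> a [^]\<^bsub>G\<^esub> (n::int) \<in> W))"
proof -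
  have "\<forall>i<r. z i \<in> carrier L" by simp
  from relation_monoid_fg[OF this] obtain T :: nat and h b b' where
    h': "\<forall>t<T. h t \<in> carrier G" and b': "\<forall>t<T. \<forall>i<r. 0 \<le> b t i \<and> 0 \<le> b' t i"
    and hb': "\<forall>t<T. mon L r z (b t) = \<psi> (h t) \<otimes>\<^bsub>L\<^esub> mon L r z (b' t)"
    and gen: "\<forall>g\<in>carrier G. \<forall>d d'. (\<forall>i<r. 0 \<le> d i \<and> 0 \<le> d' i) \<longrightarrow>
      mon L r z d = \<psi> g \<otimes>\<^bsub>L\<^esub> mon L r z d' \<longrightarrow>
      (\<exists>n. (\<forall>t. 0 \<le> n t) \<and> g = mon G T h n \<and>
        (\<forall>i<r. d i = (\<Sum>t<T. n t * b t i) \<and> d' i = (\<Sum>t<T. n t * b' t i)))"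
    by (elim exE conjE)
  have h: "h t \<in> carrier G" and b: "i < r \<Longrightarrow> 0 \<le> b t i \<and> 0 \<le> b' t i"
    and hb: "mon L r z (b t) = \<psi> (h t) \<otimes>\<^bsub>L\<^esub> mon L r z (b' t)" if "t < T" for t i
    using h' b' hb' that by simp_all
  define p where "p t \<longleftrightarrow> h t \<in> W \<or> \<not> (\<forall>i<r. b' t i = 0)" for t
  define \<alpha> where "\<alpha> t = (if p t then \<one>\<^bsub>G\<^esub> else inv\<^bsub>G\<^esub> (h t))" for t
  have \<alpha>: "\<alpha> t \<in> W" if "t < T" for t
    using W_val[OF h[OF that]] by (auto simp: \<alpha>_def p_def W_one)
  define a where "a = mon G T \<alpha> (\<lambda>_. 1)"
  have aW: "a \<in> W" unfolding a_def by (rule G.mon_mem[OF W_one W_mult \<alpha>]) auto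
  have "inv\<^bsub>L\<^esub> (\<psi> a) = mon L T (\<lambda>t. inv\<^bsub>L\<^esub> (\<psi> (\<alpha> t))) (\<lambda>_. 1)"
    unfolding a_def using \<alpha> by (simp add: \<psi>_mon L.mon_inv)
  also have "\<dots> \<in> Q"
  proof (rule cone.mon_Q)
    fix t assume t: "t < T"
    show "inv\<^bsub>L\<^esub> (\<psi> (\<alpha> t)) \<in> Q"
    proof (cases "p t")
      case False
      then have "mon L r z (b' t) = \<one>\<^bsub>L\<^esub>" by (intro L.mon_0) (simp add: p_def)
      then have "\<psi> (h t) = mon L r z (b t)" using hb[OF t] h[OF t] by simp
      moreover have "mon L r z (b t) \<in> Q" by (rule cone.mon_Q[OF z_Q]) (use b t in auto)
      ultimately show ?thesis using False h[OF t] by (simp add: \<alpha>_def \<psi>_inv)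
    qed (simp add: \<alpha>_def \<psi>_one cone.Q_one)
  qed simp
  finally have aQ: "inv\<^bsub>L\<^esub> (\<psi> a) \<in> Q" .
  have ha: "h t \<otimes>\<^bsub>G\<^esub> a \<in> W" if t: "t < T" and b0: "\<forall>i<r. b' t i = 0" for t
  proof -
    have "h t \<otimes>\<^bsub>G\<^esub> \<alpha> t \<in> W" using h[OF t] b0 W_one by (auto simp: \<alpha>_def p_def)
    moreover have "mon G T \<alpha> (\<lambda>i. if i = t then 0 else 1) \<in> W"
      by (rule G.mon_mem[OF W_one W_mult \<alpha>]) auto
    ultimately have "(h t \<otimes>\<^bsub>G\<^esub> \<alpha> t) \<otimes>\<^bsub>G\<^esub> mon G T \<alpha> (\<lambda>i. if i = t then 0 else 1) \<in> W" by (rule W_mult)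
    then show ?thesis unfolding a_def using \<alpha> t h[OF t]
      by (subst G.mon_factor[of T \<alpha> t]) (simp_all add: G.m_assoc)
  qed
  have "\<exists>n\<ge>0. g \<otimes>\<^bsub>G\<^esub> a [^]\<^bsub>G\<^esub> (n::int) \<in> W" if g: "g \<in> carrier G" "\<psi> g \<in> Q" for g
  proof -
    obtain n w d where n: "n \<ge> (1::int)" "w \<in> W" "\<forall>i. 0 \<le> d i" "\<psi> g [^]\<^bsub>L\<^esub> n = \<psi> w \<otimes>\<^bsub>L\<^esub> mon L r z d"
      using g(2) by (rule Q_E)
    define g' where "g' = g [^]\<^bsub>G\<^esub> n \<otimes>\<^bsub>G\<^esub> inv\<^bsub>G\<^esub> w"
    have g': "g' \<in> carrier G" using g(1) n(2) by (simp add: g'_def)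
    have "\<psi> g' = mon L r z d"
      using g(1) n(2,4) by (simp add: g'_def \<psi>_mult \<psi>_inv \<psi>_pow L.m_ac)
    then have "mon L r z d = \<psi> g' \<otimes>\<^bsub>L\<^esub> mon L r z (\<lambda>_. 0)" using g' by simp
    from gen[rule_format, OF g' _ this] n(3) obtain l where
      l: "\<forall>t. 0 \<le> l t" "g' = mon G T h l" "\<forall>i<r. 0 = (\<Sum>t<T. l t * b' t i)" by auto
    define K where "K = (\<Sum>t<T. l t)"
    have K: "K \<ge> 0" unfolding K_def using l(1) by (simp add: sum_nonneg)
    have "g' \<otimes>\<^bsub>G\<^esub> a [^]\<^bsub>G\<^esub> K = mon G T (\<lambda>t. h t \<otimes>\<^bsub>G\<^esub> a) l"
      using aW h by (simp add: l(2) K_def G.mon_const G.mon_mult)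
    also have "\<dots> = mon G T (\<lambda>t. if l t = 0 then \<one>\<^bsub>G\<^esub> else h t \<otimes>\<^bsub>G\<^esub> a) l"
    proof -
      have "mon G N (\<lambda>t. h t \<otimes>\<^bsub>G\<^esub> a) l = mon G N (\<lambda>t. if l t = 0 then \<one>\<^bsub>G\<^esub> else h t \<otimes>\<^bsub>G\<^esub> a) l" for N
        by (induction N) auto
      then show ?thesis .
    qed
    also have "\<dots> \<in> W"
    proof (rule G.mon_mem[OF W_one W_mult])
      fix t assume t: "t < T"
      have "b' t i = 0" if "i < r" "l t \<noteq> 0" for i
      proof -
        have "(\<Sum>t<T. l t * b' t i) = 0" using l(3) that(1) by simp
        then have "\<forall>t\<in>{..<T}. l t * b' t i = 0"
          using l(1) b that(1) by (subst (asm) sum_nonneg_eq_0_iff) auto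
        then show ?thesis using t that(2) by auto
      qed
      then show "(if l t = 0 then \<one>\<^bsub>G\<^esub> else h t \<otimes>\<^bsub>G\<^esub> a) \<in> W" using ha[OF t] W_one by auto
    qed (use l(1) in auto)
    finally have g'a: "g' \<otimes>\<^bsub>G\<^esub> a [^]\<^bsub>G\<^esub> K \<in> W" .
    have "(g' \<otimes>\<^bsub>G\<^esub> a [^]\<^bsub>G\<^esub> K) \<otimes>\<^bsub>G\<^esub> (w \<otimes>\<^bsub>G\<^esub> a [^]\<^bsub>G\<^esub> (K * (n - 1))) \<in> W"
      using n(1,2) aW K by (intro W_mult[OF g'a] W_mult[of w] W_pow) auto
    also have "(g' \<otimes>\<^bsub>G\<^esub> a [^]\<^bsub>G\<^esub> K) \<otimes>\<^bsub>G\<^esub> (w \<otimes>\<^bsub>G\<^esub> a [^]\<^bsub>G\<^esub> (K * (n - 1))) =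
      g [^]\<^bsub>G\<^esub> n \<otimes>\<^bsub>G\<^esub> a [^]\<^bsub>G\<^esub> (K + K * (n - 1))"
      using g(1) n(2) aW by (simp add: g'_def G.int_pow_mult G.m_ac)
    also have "\<dots> = (g \<otimes>\<^bsub>G\<^esub> a [^]\<^bsub>G\<^esub> K) [^]\<^bsub>G\<^esub> n"
      using g(1) aW by (simp add: G.int_pow_distrib G.int_pow_pow algebra_simps)
    finally have gn: "(g \<otimes>\<^bsub>G\<^esub> a [^]\<^bsub>G\<^esub> K) [^]\<^bsub>G\<^esub> n \<in> W" .
    have "g \<otimes>\<^bsub>G\<^esub> a [^]\<^bsub>G\<^esub> K \<in> W" by (rule W_sat[OF _ n(1) gn]) (use g(1) aW in simp)
    with K show ?thesis by (intro exI[of _ K] conjI)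
  qed
  then have "\<forall>g\<in>carrier G. \<psi> g \<in> Q \<longrightarrow> (\<exists>n\<ge>0. g \<otimes>\<^bsub>G\<^esub> a [^]\<^bsub>G\<^esub> (n::int) \<in> W)" by simp
  with aQ have "inv\<^bsub>L\<^esub> (\<psi> a) \<in> Q \<and>
    (\<forall>g\<in>carrier G. \<psi> g \<in> Q \<longrightarrow> (\<exists>n\<ge>0. g \<otimes>\<^bsub>G\<^esub> a [^]\<^bsub>G\<^esub> (n::int) \<in> W))" by (rule conjI)
  then show ?thesis using aW by (rule bexI)
qed

text \<open>The decomposition of \<open>q\<close> gives \<open>w\<close> with \<open>q / \<psi> w \<in> Q\<close> and \<open>\<psi> (w^n v) \<in> Q\<close>. To bring \<open>w^n v\<close> itself into \<open>W\<close>
it is multiplied by a power of the element \<open>a\<close> that is invertible in \<open>Q\<close>, which does not affect the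
first condition.\<close>

theorem division:
  assumes q: "q \<in> carrier L" and v: "v \<in> carrier G" and n: "n \<ge> 1"
    and qv: "q [^]\<^bsub>L\<^esub> (n::int) \<otimes>\<^bsub>L\<^esub> \<psi> v \<in> Q"
  shows "\<exists>u\<in>carrier G. q \<otimes>\<^bsub>L\<^esub> \<psi> u \<in> Q \<and> v \<otimes>\<^bsub>G\<^esub> inv\<^bsub>G\<^esub> (u [^]\<^bsub>G\<^esub> n) \<in> W"
proof -
  obtain a where a: "a \<in> W" "inv\<^bsub>L\<^esub> (\<psi> a) \<in> Q"
    "\<forall>g\<in>carrier G. \<psi> g \<in> Q \<longrightarrow> (\<exists>n\<ge>0. g \<otimes>\<^bsub>G\<^esub> a [^]\<^bsub>G\<^esub> (n::int) \<in> W)"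
    using unit_absorbing_preimage by (elim bexE conjE)
  have "\<psi> v \<in> \<psi> ` carrier G" using v by simp
  from cone.root_decomposition[OF q this n qv] obtain w d where
    w: "w \<in> carrier G" "\<forall>i. 0 \<le> d i" "q [^]\<^bsub>L\<^esub> m = \<psi> w [^]\<^bsub>L\<^esub> m \<otimes>\<^bsub>L\<^esub> mon L r z d"
      "\<psi> w [^]\<^bsub>L\<^esub> n \<otimes>\<^bsub>L\<^esub> \<psi> v \<in> Q" by blast
  have "\<psi> (w [^]\<^bsub>G\<^esub> n \<otimes>\<^bsub>G\<^esub> v) \<in> Q" using w v by (simp add: \<psi>_mult \<psi>_pow)
  from a(3)[rule_format, OF _ this] w(1) v obtain K where
    K: "K \<ge> (0::int)" "w [^]\<^bsub>G\<^esub> n \<otimes>\<^bsub>G\<^esub> v \<otimes>\<^bsub>G\<^esub> a [^]\<^bsub>G\<^esub> K \<in> W" by auto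
  define u where "u = inv\<^bsub>G\<^esub> (w \<otimes>\<^bsub>G\<^esub> a [^]\<^bsub>G\<^esub> K)"
  have u: "u \<in> carrier G" using w(1) a(1) by (simp add: u_def)
  have "q \<otimes>\<^bsub>L\<^esub> inv\<^bsub>L\<^esub> (\<psi> w) \<in> Q"
  proof (rule cone.Q_sat[OF _ m])
    have "(q \<otimes>\<^bsub>L\<^esub> inv\<^bsub>L\<^esub> (\<psi> w)) [^]\<^bsub>L\<^esub> m = mon L r z d"
      using q w by (simp add: L.int_pow_distrib L.int_pow_inv L.m_ac)
    also have "\<dots> \<in> Q" by (rule cone.mon_Q[OF z_Q]) (use w in auto)
    finally show "(q \<otimes>\<^bsub>L\<^esub> inv\<^bsub>L\<^esub> (\<psi> w)) [^]\<^bsub>L\<^esub> m \<in> Q" .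
  qed (use q w in auto)
  from cone.Q_mult[OF this cone.Q_pow[OF a(2) K(1)]]
  have "q \<otimes>\<^bsub>L\<^esub> \<psi> u \<in> Q"
    using q w(1) a(1) by (simp add: u_def \<psi>_inv \<psi>_mult \<psi>_pow L.inv_mult L.int_pow_inv L.m_assoc)
  moreover have "v \<otimes>\<^bsub>G\<^esub> inv\<^bsub>G\<^esub> (u [^]\<^bsub>G\<^esub> n) \<in> W"
  proof -
    have "(w [^]\<^bsub>G\<^esub> n \<otimes>\<^bsub>G\<^esub> v \<otimes>\<^bsub>G\<^esub> a [^]\<^bsub>G\<^esub> K) \<otimes>\<^bsub>G\<^esub> a [^]\<^bsub>G\<^esub> (K * (n - 1)) \<in> W"
      using K n a(1) by (intro W_mult[OF K(2)] W_pow) auto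
    also have "(w [^]\<^bsub>G\<^esub> n \<otimes>\<^bsub>G\<^esub> v \<otimes>\<^bsub>G\<^esub> a [^]\<^bsub>G\<^esub> K) \<otimes>\<^bsub>G\<^esub> a [^]\<^bsub>G\<^esub> (K * (n - 1)) =
      w [^]\<^bsub>G\<^esub> n \<otimes>\<^bsub>G\<^esub> v \<otimes>\<^bsub>G\<^esub> a [^]\<^bsub>G\<^esub> (K + K * (n - 1))"
      using w(1) v a(1) by (simp add: G.int_pow_mult G.m_assoc)
    also have "\<dots> = v \<otimes>\<^bsub>G\<^esub> inv\<^bsub>G\<^esub> (u [^]\<^bsub>G\<^esub> n)"
      using w(1) v a(1) by (simp add: u_def G.int_pow_inv G.int_pow_distrib G.int_pow_pow G.m_ac algebra_simps)
    finally show ?thesis .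
  qed
  ultimately show ?thesis using u by blast
qed

text \<open>With the inverse of \<open>\<psi> a\<close> as an additional generator, coefficients from \<open>W\<close> suffice.\<close>

theorem finitely_generated_over_W:
  "\<exists>(s::nat) y. (\<forall>t<s. y t \<in> Q) \<and>
    (\<forall>q\<in>Q. \<exists>w\<in>W. \<exists>n. (\<forall>t. 0 \<le> n t) \<and> q = \<psi> w \<otimes>\<^bsub>L\<^esub> mon L s y n)"
proof -
  obtain a where a: "a \<in> W" "inv\<^bsub>L\<^esub> (\<psi> a) \<in> Q"
    "\<forall>g\<in>carrier G. \<psi> g \<in> Q \<longrightarrow> (\<exists>n\<ge>0. g \<otimes>\<^bsub>G\<^esub> a [^]\<^bsub>G\<^esub> (n::int) \<in> W)"
    using unit_absorbing_preimage by (elim bexE conjE)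
  obtain s :: nat and y where yQ: "\<forall>t<s. y t \<in> Q"
    and gen: "\<forall>q\<in>Q. \<exists>w\<in>\<psi> ` carrier G. \<exists>n. w \<in> Q \<and> (\<forall>t. 0 \<le> n t) \<and> q = w \<otimes>\<^bsub>L\<^esub> mon L s y n"
    using cone.finitely_generated by (elim exE conjE)
  define y' where "y' t = (if t < s then y t else inv\<^bsub>L\<^esub> (\<psi> a))" for t
  have *: "\<exists>w\<in>W. \<exists>n. (\<forall>t. 0 \<le> n t) \<and> q = \<psi> w \<otimes>\<^bsub>L\<^esub> mon L (Suc s) y' n" if "q \<in> Q" for q
  proof -
    from bspec[OF gen that] obtain w n where
      w: "w \<in> \<psi> ` carrier G" "w \<in> Q" "\<forall>t. 0 \<le> n t" "q = w \<otimes>\<^bsub>L\<^esub> mon L s y n" by (elim bexE exE conjE)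
    obtain g where "g \<in> carrier G" "w = \<psi> g" using w(1) by (rule imageE)
    with w have g: "g \<in> carrier G" "\<psi> g \<in> Q" "\<forall>t. 0 \<le> n t" "q = \<psi> g \<otimes>\<^bsub>L\<^esub> mon L s y n" by simp_all
    from a(3)[rule_format, OF g(1,2)] obtain K where K: "K \<ge> (0::int)" "g \<otimes>\<^bsub>G\<^esub> a [^]\<^bsub>G\<^esub> K \<in> W" by (elim exE conjE)
    let ?n = "\<lambda>t. if t < s then n t else K"
    have "mon L s y' ?n = mon L s y n" by (rule mon_cong) (simp_all add: y'_def)
    moreover have "mon L s y n \<in> carrier L" using yQ by simp
    ultimately have "q = \<psi> (g \<otimes>\<^bsub>G\<^esub> a [^]\<^bsub>G\<^esub> K) \<otimes>\<^bsub>L\<^esub> mon L (Suc s) y' ?n"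
      using g(1) a(1) by (simp add: g(4) y'_def \<psi>_mult \<psi>_pow L.int_pow_inv L.m_ac)
    moreover have "\<forall>t. 0 \<le> ?n t" using K(1) g(3) by simp
    ultimately have "(\<forall>t. 0 \<le> ?n t) \<and> q = \<psi> (g \<otimes>\<^bsub>G\<^esub> a [^]\<^bsub>G\<^esub> K) \<otimes>\<^bsub>L\<^esub> mon L (Suc s) y' ?n"
      by (rule conjI[rotated])
    then have "\<exists>n. (\<forall>t. 0 \<le> n t) \<and> q = \<psi> (g \<otimes>\<^bsub>G\<^esub> a [^]\<^bsub>G\<^esub> K) \<otimes>\<^bsub>L\<^esub> mon L (Suc s) y' n"
      by (rule exI[of _ ?n])
    then show ?thesis using K(2) by (rule bexI)
  qed
  have "\<forall>t<Suc s. y' t \<in> Q" using yQ a(2) by (simp add: y'_def)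
  then have "(\<forall>t<Suc s. y' t \<in> Q) \<and>
    (\<forall>q\<in>Q. \<exists>w\<in>W. \<exists>n. (\<forall>t. 0 \<le> n t) \<and> q = \<psi> w \<otimes>\<^bsub>L\<^esub> mon L (Suc s) y' n)"
    by (rule conjI[OF _ ballI[OF *]])
  then show ?thesis by (intro exI[of _ "Suc s"] exI[of _ y'])
qed

end

section \<open>Presentations of monoids\<close>

lemma mhomI:
  assumes "\<And>x. x \<in> carrier M \<Longrightarrow> f x \<in> carrier N"
    and "\<And>x y. x \<in> carrier M \<Longrightarrow> y \<in> carrier M \<Longrightarrow> f (x \<otimes>\<^bsub>M\<^esub> y) = f x \<otimes>\<^bsub>N\<^esub> f y"
    and "f \<one>\<^bsub>M\<^esub> = \<one>\<^bsub>N\<^esub>"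
  shows "f \<in> mhom M N"
  using assms by (simp add: mhom_def hom_def)

lemma comm_monoid_free: "comm_monoid (free_cmonoid r)"
  by (rule comm_monoidI) (auto simp: free_cmonoid_def)

lemma finitely_presented_homI:
  fixes W :: "'a monoid" and Q :: "'b monoid" and \<sigma> :: "'a \<times> (nat \<Rightarrow> nat) \<Rightarrow> 'b"
  defines "N \<equiv> \<lambda>s. W \<times>\<times> free_cmonoid s"
  assumes W: "comm_monoid W" and Q: "comm_monoid Q" and j: "j \<in> mhom W Q"
    and \<sigma>: "\<sigma> \<in> mhom (N s) Q" and \<sigma>j: "\<And>w. w \<in> carrier W \<Longrightarrow> \<sigma> (w, \<one>\<^bsub>free_cmonoid s\<^esub>) = j w"
    and surj: "\<And>q. q \<in> carrier Q \<Longrightarrow> \<exists>x\<in>carrier (N s). q = \<sigma> x"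
    and S: "finite S" "S \<subseteq> carrier (N s) \<times> carrier (N s)"
    and S\<sigma>: "\<And>x y. (x, y) \<in> S \<Longrightarrow> \<sigma> x = \<sigma> y"
    and ker: "\<And>x y. x \<in> carrier (N s) \<Longrightarrow> y \<in> carrier (N s) \<Longrightarrow> \<sigma> x = \<sigma> y \<Longrightarrow> (x, y) \<in> gen_cong (N s) S"
  shows "finitely_presented_hom W Q j"
proof -
  have cN: "comm_monoid (N s)" unfolding N_def by (rule comm_monoid_DirProd[OF W comm_monoid_free])
  let ?R = "gen_cong (N s) S"
  have mc: "mcong (N s) ?R" by (rule mcong_gen_cong[OF cN])
  have resp: "\<sigma> x = \<sigma> y" if "(x, y) \<in> ?R" for x y
    using that
  proof induction
    case (gen_cong_mult x y x' y')
    then show ?case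
      using gen_cong_carrier[OF cN gen_cong_mult.hyps(1)] gen_cong_carrier[OF cN gen_cong_mult.hyps(2)]
      by (simp add: mhom_mult[OF \<sigma>])
  qed (auto simp: S\<sigma>)
  have "\<exists>\<phi>\<in>mhom (quotient_monoid (N s) ?R) Q. \<forall>x\<in>carrier (N s). \<phi> (?R `` {x}) = \<sigma> x"
    by (rule quot_universal[OF cN mc Q \<sigma> resp])
  then obtain \<phi> where \<phi>: "\<phi> \<in> mhom (quotient_monoid (N s) ?R) Q" "\<forall>x\<in>carrier (N s). \<phi> (?R `` {x}) = \<sigma> x"
    by (elim bexE)
  have "inj_on \<phi> (carrier (quotient_monoid (N s) ?R))"
  proof (rule inj_onI)
    fix X Y assume X: "X \<in> carrier (quotient_monoid (N s) ?R)" and Y: "Y \<in> carrier (quotient_monoid (N s) ?R)"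
      and eq: "\<phi> X = \<phi> Y"
    obtain x where x: "x \<in> carrier (N s)" "X = ?R `` {x}" using X by (rule quot_obtain[OF cN mc])
    obtain y where y: "y \<in> carrier (N s)" "Y = ?R `` {y}" using Y by (rule quot_obtain[OF cN mc])
    have "\<sigma> x = \<sigma> y" using eq \<phi>(2) x y by simp
    then show "X = Y" unfolding x y quot_class_eq[OF cN mc x(1) y(1)] by (rule ker[OF x(1) y(1)])
  qed
  moreover have "\<phi> ` carrier (quotient_monoid (N s) ?R) = carrier Q"
  proof
    show "\<phi> ` carrier (quotient_monoid (N s) ?R) \<subseteq> carrier Q" using mhom_closed[OF \<phi>(1)] by auto
    show "carrier Q \<subseteq> \<phi> ` carrier (quotient_monoid (N s) ?R)"
    proof
      fix q assume "q \<in> carrier Q"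
      from surj[OF this] obtain x where x: "x \<in> carrier (N s)" "q = \<sigma> x" by (elim bexE)
      then have "q = \<phi> (?R `` {x})" using \<phi>(2) by simp
      then show "q \<in> \<phi> ` carrier (quotient_monoid (N s) ?R)"
        using quot_class_in[OF cN mc x(1)] by (rule image_eqI)
    qed
  qed
  ultimately have iso: "\<phi> \<in> iso (quotient_monoid (N s) ?R) Q"
    using \<phi>(1) by (simp add: iso_def mhom_def bij_betw_def)
  have "\<forall>p\<in>carrier W. \<phi> (?R `` {(p, \<one>\<^bsub>free_cmonoid s\<^esub>)}) = j p"
    using \<phi>(2) \<sigma>j by (simp add: N_def free_cmonoid_def)
  then show ?thesis unfolding finitely_presented_hom_def
    using W Q j S iso unfolding N_def
    by (intro conjI exI[of _ s] exI[of _ S] exI[of _ \<phi>])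
qed

text \<open>The counterpart of \<open>mon\<close> in a monoid, where only natural exponents make sense.\<close>

primrec mprod :: "'a monoid \<Rightarrow> nat \<Rightarrow> (nat \<Rightarrow> 'a) \<Rightarrow> (nat \<Rightarrow> nat) \<Rightarrow> 'a" where
  "mprod M 0 z n = \<one>\<^bsub>M\<^esub>"
| "mprod M (Suc r) z n = mprod M r z n \<otimes>\<^bsub>M\<^esub> z r [^]\<^bsub>M\<^esub> n r"

lemma mprod_closed:
  assumes "comm_monoid M" "\<And>t. t < T \<Longrightarrow> z t \<in> carrier M" shows "mprod M T z n \<in> carrier M"
proof -
  interpret comm_monoid M by fact
  show ?thesis using assms(2) by (induction T) auto
qed

lemma mprod_one:
  assumes "comm_monoid M" shows "mprod M T (\<lambda>_. \<one>\<^bsub>M\<^esub>) n = \<one>\<^bsub>M\<^esub>"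
proof -
  interpret comm_monoid M by fact
  show ?thesis by (induction T) auto
qed

lemma mprod_DirProd:
  "mprod (M \<times>\<times> N) T (\<lambda>t. (x t, y t)) n = (mprod M T x n, mprod N T y n)"
  by (induction T) (simp_all add: DirProd_pow mult_DirProd' one_DirProd)

lemma free_pow: "x [^]\<^bsub>free_cmonoid s\<^esub> (n::nat) = (\<lambda>i. n * x i)"
  by (induction n) (auto simp: pow_rec free_cmonoid_def)

lemma mprod_free: "mprod (free_cmonoid s) T x n = (\<lambda>i. \<Sum>t<T. n t * x t i)"
  by (induction T) (auto simp: free_pow, auto simp: free_cmonoid_def)

lemma mprod_hom:
  assumes "comm_monoid M" "comm_group G" "f \<in> mhom M G" "\<And>t. t < T \<Longrightarrow> z t \<in> carrier M"
  shows "f (mprod M T z n) = mon G T (\<lambda>t. f (z t)) (\<lambda>t. int (n t))"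
proof -
  interpret M: comm_monoid M by fact
  interpret G: comm_group G by fact
  show ?thesis using assms(4)
    by (induction T) (simp_all add: mhom_one[OF assms(3)] mhom_mult[OF assms(3)]
        mprod_closed[OF assms(1)] mhom_pow[OF assms(3,1) G.comm_monoid_axioms] int_pow_int)
qed

lemma mprod_gen_cong:
  assumes "comm_monoid M" "\<And>t. t < T \<Longrightarrow> (x t, y t) \<in> gen_cong M S"
  shows "(mprod M T x n, mprod M T y n) \<in> gen_cong M S"
proof -
  interpret comm_monoid M by fact
  have "(a [^]\<^bsub>M\<^esub> (k::nat), b [^]\<^bsub>M\<^esub> k) \<in> gen_cong M S" if "(a, b) \<in> gen_cong M S" for a b k
    using that by (induction k) (auto simp: pow_rec intro: gen_cong_refl gen_cong_mult)
  then show ?thesis using assms(2) by (induction T) (auto intro: gen_cong_refl gen_cong_mult)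
qed

lemma hom_free_extension:
  fixes V :: "'a monoid"
  assumes V: "comm_monoid V" and G: "comm_group G" and f: "f \<in> mhom (V \<times>\<times> free_cmonoid r) G"
    and x: "x \<in> carrier V" and e: "e \<in> carrier (free_cmonoid r)"
  shows "f (x, e) = f (x, \<lambda>_. 0) \<otimes>\<^bsub>G\<^esub> mon G r (\<lambda>j. f (\<one>\<^bsub>V\<^esub>, \<lambda>i. if i = j then 1 else 0)) (\<lambda>j. int (e j))"
proof -
  interpret V: comm_monoid V by fact
  let ?N = "V \<times>\<times> free_cmonoid r" and ?u = "\<lambda>j. (\<one>\<^bsub>V\<^esub>, \<lambda>i. if i = j then 1 else 0 :: nat)"
  have N: "comm_monoid ?N" by (rule comm_monoid_DirProd[OF V comm_monoid_free])
  have u: "?u j \<in> carrier ?N" if "j < r" for j using that by (simp add: free_cmonoid_def)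
  have "(\<lambda>i. \<Sum>j<r. e j * (if i = j then 1 else 0)) = e"
  proof
    fix i show "(\<Sum>j<r. e j * (if i = j then 1 else 0)) = e i"
      using e by (cases "i < r") (simp_all add: free_cmonoid_def if_distrib[of "(*) _"] cong: if_cong)
  qed
  then have "(\<one>\<^bsub>V\<^esub>, e) = mprod ?N r ?u e" by (simp add: mprod_DirProd mprod_free mprod_one[OF V])
  then have "f (\<one>\<^bsub>V\<^esub>, e) = mon G r (\<lambda>j. f (?u j)) (\<lambda>j. int (e j))"
    using mprod_hom[OF N G f u] by simp
  moreover have "(x, e) = (x, \<lambda>_. 0) \<otimes>\<^bsub>?N\<^esub> (\<one>\<^bsub>V\<^esub>, e)" using x by (simp add: free_cmonoid_def)
  then have "f (x, e) = f (x, \<lambda>_. 0) \<otimes>\<^bsub>G\<^esub> f (\<one>\<^bsub>V\<^esub>, e)"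
    using mhom_mult[OF f, of "(x, \<lambda>_. 0)" "(\<one>\<^bsub>V\<^esub>, e)"] x e by (simp add: free_cmonoid_def)
  ultimately show ?thesis by simp
qed

text \<open>A generating pair changes the class of the first component by a fixed element of the group completion
and the second component by a fixed integer vector. An arbitrary pair of the congruence is therefore
displaced by an integer combination of these.\<close>

lemma gen_cong_difference:
  fixes s s' :: "nat \<Rightarrow> 'a \<times> (nat \<Rightarrow> nat)"
  assumes V: "comm_monoid V"
    and s: "\<And>t. t < K \<Longrightarrow> s t \<in> carrier (V \<times>\<times> free_cmonoid r) \<and> s' t \<in> carrier (V \<times>\<times> free_cmonoid r)"
    and xy: "(x, y) \<in> gen_cong (V \<times>\<times> free_cmonoid r) ((\<lambda>t. (s t, s' t)) ` {..<K})"
  shows "\<exists>n. gp_of V (fst y) = gp_of V (fst x) \<otimes>\<^bsub>gp V\<^esub>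
      mon (gp V) K (\<lambda>t. gp_of V (fst (s' t)) \<otimes>\<^bsub>gp V\<^esub> inv\<^bsub>gp V\<^esub> (gp_of V (fst (s t)))) n \<and>
    (\<forall>i<r. int (snd x i) - int (snd y i) = (\<Sum>t<K. n t * (int (snd (s t) i) - int (snd (s' t) i))))"
proof -
  interpret V: comm_monoid V by fact
  interpret G: comm_group "gp V" by (rule gp_comm_group[OF V])
  let ?N = "V \<times>\<times> free_cmonoid r"
  have cN: "comm_monoid ?N" by (rule comm_monoid_DirProd[OF V comm_monoid_free])
  interpret N: comm_monoid ?N by (rule cN)
  note gh = gp_of_hom[OF V]
  define \<gamma> where "\<gamma> t = gp_of V (fst (s' t)) \<otimes>\<^bsub>gp V\<^esub> inv\<^bsub>gp V\<^esub> (gp_of V (fst (s t)))" for t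
  define c where "c t i = int (snd (s t) i) - int (snd (s' t) i)" for t i
  have gC: "gp_of V (fst x) \<in> carrier (gp V)" if "x \<in> carrier ?N" for x
    using mhom_closed[OF gh, of "fst x"] that by auto
  have \<gamma>C: "\<gamma> t \<in> carrier (gp V)" if "t < K" for t using gC s[OF that] by (simp add: \<gamma>_def)
  define D where "D x y n \<longleftrightarrow> gp_of V (fst y) = gp_of V (fst x) \<otimes>\<^bsub>gp V\<^esub> mon (gp V) K \<gamma> n \<and>
    (\<forall>i<r. int (snd x i) - int (snd y i) = (\<Sum>t<K. n t * c t i))" for x y :: "'a \<times> (nat \<Rightarrow> nat)" and n
  have "x \<in> carrier ?N \<and> y \<in> carrier ?N \<and> (\<exists>n. D x y n)"
    using xy
  proof induction
    case (gen_cong_base x y)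
    then obtain u where u: "u < K" "x = s u" "y = s' u" by auto
    have "mon (gp V) K \<gamma> (\<lambda>t. if t = u then 1 else 0) = \<gamma> u" by (rule G.mon_unit[OF \<gamma>C u(1)])
    moreover have "gp_of V (fst (s u)) \<in> carrier (gp V)" "gp_of V (fst (s' u)) \<in> carrier (gp V)"
      using gC s[OF u(1)] by blast+
    then have "gp_of V (fst (s u)) \<otimes>\<^bsub>gp V\<^esub> \<gamma> u = gp_of V (fst (s' u))" by (simp add: \<gamma>_def)
    moreover have "(\<Sum>t<K. (if t = u then 1 else 0) * c t i) = c u i" for i
    proof -
      have "(\<Sum>t<K. (if t = u then 1 else 0) * c t i) = (\<Sum>t<K. if t = u then c t i else 0)"
        by (rule sum.cong) auto
      then show ?thesis using u(1) by simp
    qed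
    ultimately have "D x y (\<lambda>t. if t = u then 1 else 0)" by (simp add: D_def u(2,3) c_def)
    then show ?case using gen_cong_base by blast
  next
    case (gen_cong_refl x)
    then have "D x x (\<lambda>_. 0)" using gC by (simp add: D_def)
    then show ?case using gen_cong_refl by blast
  next
    case (gen_cong_sym x y)
    then obtain n where C: "x \<in> carrier ?N" "y \<in> carrier ?N" and n: "D x y n" by blast
    have "D y x (\<lambda>t. - n t)" unfolding D_def
    proof (intro conjI allI impI)
      show "gp_of V (fst x) = gp_of V (fst y) \<otimes>\<^bsub>gp V\<^esub> mon (gp V) K \<gamma> (\<lambda>t. - n t)"
        using n C[THEN gC] \<gamma>C by (simp add: D_def G.mon_neg G.m_assoc)
      fix i assume "i < r"
      then have "int (snd x i) - int (snd y i) = (\<Sum>t<K. n t * c t i)" using n by (simp add: D_def)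
      then show "int (snd y i) - int (snd x i) = (\<Sum>t<K. - n t * c t i)" by (simp add: sum_negf)
    qed
    then show ?case using C by blast
  next
    case (gen_cong_trans x y z)
    then obtain n n' where C: "x \<in> carrier ?N" "z \<in> carrier ?N" and n: "D x y n" "D y z n'" by blast
    have "D x z (\<lambda>t. n t + n' t)" unfolding D_def
    proof (intro conjI allI impI)
      show "gp_of V (fst z) = gp_of V (fst x) \<otimes>\<^bsub>gp V\<^esub> mon (gp V) K \<gamma> (\<lambda>t. n t + n' t)"
        using n C[THEN gC] \<gamma>C by (simp add: D_def G.mon_add G.m_assoc)
      fix i assume "i < r"
      then have "int (snd x i) - int (snd y i) = (\<Sum>t<K. n t * c t i)"
        "int (snd y i) - int (snd z i) = (\<Sum>t<K. n' t * c t i)" using n by (simp_all add: D_def)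
      then show "int (snd x i) - int (snd z i) = (\<Sum>t<K. (n t + n' t) * c t i)"
        by (simp add: distrib_right sum.distrib)
    qed
    then show ?case using C by blast
  next
    case (gen_cong_mult x y x' y')
    then obtain n n' where C: "x \<in> carrier ?N" "y \<in> carrier ?N" "x' \<in> carrier ?N" "y' \<in> carrier ?N"
      and n: "D x y n" "D x' y' n'" by blast
    have fC: "fst x \<in> carrier V" "fst y \<in> carrier V" "fst x' \<in> carrier V" "fst y' \<in> carrier V" using C by auto
    have "D (x \<otimes>\<^bsub>?N\<^esub> x') (y \<otimes>\<^bsub>?N\<^esub> y') (\<lambda>t. n t + n' t)" unfolding D_def
    proof (intro conjI allI impI)
      have "gp_of V (fst (y \<otimes>\<^bsub>?N\<^esub> y')) = gp_of V (fst y) \<otimes>\<^bsub>gp V\<^esub> gp_of V (fst y')"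
        using fC by (simp add: mult_DirProd' mhom_mult[OF gh])
      also have "\<dots> = (gp_of V (fst x) \<otimes>\<^bsub>gp V\<^esub> gp_of V (fst x')) \<otimes>\<^bsub>gp V\<^esub> mon (gp V) K \<gamma> (\<lambda>t. n t + n' t)"
        using n C(1,3)[THEN gC] \<gamma>C by (simp add: D_def G.mon_add G.m_ac)
      also have "gp_of V (fst x) \<otimes>\<^bsub>gp V\<^esub> gp_of V (fst x') = gp_of V (fst (x \<otimes>\<^bsub>?N\<^esub> x'))"
        using fC by (simp add: mult_DirProd' mhom_mult[OF gh])
      finally show "gp_of V (fst (y \<otimes>\<^bsub>?N\<^esub> y')) =
        gp_of V (fst (x \<otimes>\<^bsub>?N\<^esub> x')) \<otimes>\<^bsub>gp V\<^esub> mon (gp V) K \<gamma> (\<lambda>t. n t + n' t)" .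
      fix i assume "i < r"
      then have "int (snd x i) - int (snd y i) = (\<Sum>t<K. n t * c t i)"
        "int (snd x' i) - int (snd y' i) = (\<Sum>t<K. n' t * c t i)" using n by (simp_all add: D_def)
      then show "int (snd (x \<otimes>\<^bsub>?N\<^esub> x') i) - int (snd (y \<otimes>\<^bsub>?N\<^esub> y') i) = (\<Sum>t<K. (n t + n' t) * c t i)"
        by (simp add: mult_DirProd' free_cmonoid_def distrib_right sum.distrib)
    qed
    moreover have "x \<otimes>\<^bsub>?N\<^esub> x' \<in> carrier ?N" "y \<otimes>\<^bsub>?N\<^esub> y' \<in> carrier ?N"
      using N.m_closed[OF C(1,3)] N.m_closed[OF C(2,4)] by blast+
    ultimately show ?case by blast
  qed
  then show ?thesis unfolding D_def \<gamma>_def c_def by blast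
qed

text \<open>Since \<open>W\<close> is valuative, each of the finitely many generating relations between the generators \<open>y\<close> can be
written as \<open>p' y^e = p y^e'\<close> with one of \<open>p\<close>, \<open>p'\<close> equal to \<open>\<one>\<close>. They generate all relations: an equation
between \<open>w1 y^d\<close> and \<open>w2 y^d'\<close> is, in the group, a product of generating relations with multiplicities
\<open>k\<close>. Inside the monoid the coefficients cannot be cancelled, so the relations are applied in a suitable
order: first those with \<open>p' = \<one>\<close>, which only create coefficients, then those with \<open>p = \<one>\<close>, which only
consume them. The coefficients in the middle agree because they do in the group.\<close>

theorem (in cone_hom) finitely_presented:
  fixes Wm :: "'w monoid"
  assumes Wm: "comm_monoid Wm" and \<iota>: "\<iota> \<in> mhom Wm G" "inj_on \<iota> (carrier Wm)" "\<iota> ` carrier Wm = W"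
  shows "finitely_presented_hom Wm (L\<lparr>carrier := Q\<rparr>) (\<lambda>w. \<psi> (\<iota> w))"
proof -
  interpret Wm: comm_monoid Wm by fact
  let ?Q = "L\<lparr>carrier := Q\<rparr>"
  have cQ: "comm_monoid ?Q"
    by (rule comm_monoidI) (auto simp: cone.Q_one cone.Q_mult L.m_assoc, simp add: L.m_comm)
  have \<iota>W: "\<iota> w \<in> W" if "w \<in> carrier Wm" for w using \<iota>(3) that by auto
  have \<iota>C [simp]: "\<iota> w \<in> carrier G" if "w \<in> carrier Wm" for w using \<iota>W[OF that] by simp
  obtain s :: nat and y where y: "\<forall>t<s. y t \<in> Q"
    and y_gen: "\<forall>q\<in>Q. \<exists>w\<in>W. \<exists>n. (\<forall>t. 0 \<le> n t) \<and> q = \<psi> w \<otimes>\<^bsub>L\<^esub> mon L s y n"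
    using finitely_generated_over_W by (elim exE conjE)
  have yC: "\<forall>i<s. y i \<in> carrier L" using y by simp
  then have yC' [simp]: "y i \<in> carrier L" if "i < s" for i using that by simp
  from relation_monoid_fg[OF yC] obtain T :: nat and h a a' where
    h: "\<forall>t<T. h t \<in> carrier G" and a: "\<forall>t<T. \<forall>i<s. 0 \<le> a t i \<and> 0 \<le> a' t i"
    and ha: "\<forall>t<T. mon L s y (a t) = \<psi> (h t) \<otimes>\<^bsub>L\<^esub> mon L s y (a' t)"
    and gen: "\<forall>g\<in>carrier G. \<forall>d d'. (\<forall>i<s. 0 \<le> d i \<and> 0 \<le> d' i) \<longrightarrow>
      mon L s y d = \<psi> g \<otimes>\<^bsub>L\<^esub> mon L s y d' \<longrightarrow>
      (\<exists>n. (\<forall>t. 0 \<le> n t) \<and> g = mon G T h n \<and>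
        (\<forall>i<s. d i = (\<Sum>t<T. n t * a t i) \<and> d' i = (\<Sum>t<T. n t * a' t i)))"
    by (elim exE conjE)
  have "\<exists>pp. fst pp \<in> carrier Wm \<and> snd pp \<in> carrier Wm \<and>
    (if h t \<in> W then \<iota> (fst pp) = h t \<and> snd pp = \<one>\<^bsub>Wm\<^esub>
     else fst pp = \<one>\<^bsub>Wm\<^esub> \<and> \<iota> (snd pp) = inv\<^bsub>G\<^esub> (h t))" if "t < T" for t
  proof (cases "h t \<in> W")
    case True
    then obtain p where "p \<in> carrier Wm" "\<iota> p = h t" using \<iota>(3) by auto
    then show ?thesis using True by (intro exI[of _ "(p, \<one>\<^bsub>Wm\<^esub>)"]) simp
  next
    case False
    then have "inv\<^bsub>G\<^esub> (h t) \<in> W" using W_val h that by blast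
    then obtain p where "p \<in> carrier Wm" "\<iota> p = inv\<^bsub>G\<^esub> (h t)" using \<iota>(3) by auto
    then show ?thesis using False by (intro exI[of _ "(\<one>\<^bsub>Wm\<^esub>, p)"]) simp
  qed
  then have "\<forall>t. \<exists>pp. t < T \<longrightarrow> fst pp \<in> carrier Wm \<and> snd pp \<in> carrier Wm \<and>
    (if h t \<in> W then \<iota> (fst pp) = h t \<and> snd pp = \<one>\<^bsub>Wm\<^esub>
     else fst pp = \<one>\<^bsub>Wm\<^esub> \<and> \<iota> (snd pp) = inv\<^bsub>G\<^esub> (h t))" by blast
  from choice[OF this] obtain pp where pp: "\<forall>t<T. fst (pp t) \<in> carrier Wm \<and> snd (pp t) \<in> carrier Wm \<and>
    (if h t \<in> W then \<iota> (fst (pp t)) = h t \<and> snd (pp t) = \<one>\<^bsub>Wm\<^esub>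
     else fst (pp t) = \<one>\<^bsub>Wm\<^esub> \<and> \<iota> (snd (pp t)) = inv\<^bsub>G\<^esub> (h t))" by (elim exE)
  define p where "p t = fst (pp t)" for t
  define p' where "p' t = snd (pp t)" for t
  have pC [simp]: "p t \<in> carrier Wm" "p' t \<in> carrier Wm" if "t < T" for t
    using pp that by (simp_all add: p_def p'_def)
  have pW: "\<iota> (p t) = h t" "p' t = \<one>\<^bsub>Wm\<^esub>" if "t < T" "h t \<in> W" for t
    using pp[rule_format, OF that(1)] that(2) by (simp_all add: p_def p'_def)
  have pN: "p t = \<one>\<^bsub>Wm\<^esub>" "\<iota> (p' t) = inv\<^bsub>G\<^esub> (h t)" if "t < T" "h t \<notin> W" for t
    using pp[rule_format, OF that(1)] that(2) by (simp_all add: p_def p'_def)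
  have hp: "h t = \<iota> (p t) \<otimes>\<^bsub>G\<^esub> inv\<^bsub>G\<^esub> (\<iota> (p' t))" if "t < T" for t
    using h that by (cases "h t \<in> W") (simp_all add: pW pN mhom_one[OF \<iota>(1)])
  define e where "e t i = (if i < s then nat (a t i) else 0)" for t i
  define e' where "e' t i = (if i < s then nat (a' t i) else 0)" for t i
  have eC: "e t \<in> carrier (free_cmonoid s)" "e' t \<in> carrier (free_cmonoid s)" for t
    by (simp_all add: e_def e'_def free_cmonoid_def)
  define \<sigma> where "\<sigma> = (\<lambda>(w, x). \<psi> (\<iota> w) \<otimes>\<^bsub>L\<^esub> mon L s y (\<lambda>i. int (x i)))"
  let ?N = "Wm \<times>\<times> free_cmonoid s"
  have cN: "comm_monoid ?N" by (rule comm_monoid_DirProd[OF Wm comm_monoid_free])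
  interpret N: comm_monoid ?N by (rule cN)
  define S where "S = (\<lambda>t. ((p' t, e t), (p t, e' t))) ` {..<T}"
  let ?R = "gen_cong ?N S"
  have \<sigma>_hom: "\<sigma> \<in> mhom ?N ?Q"
  proof -
    have "\<sigma> x \<in> Q" if "x \<in> carrier ?N" for x
      using that y \<iota>W by (auto simp: \<sigma>_def intro!: cone.Q_mult W_Q cone.mon_Q)
    moreover have "\<sigma> (x \<otimes>\<^bsub>?N\<^esub> x') = \<sigma> x \<otimes>\<^bsub>L\<^esub> \<sigma> x'" if "x \<in> carrier ?N" "x' \<in> carrier ?N" for x x'
      using that by (auto simp: \<sigma>_def mult_DirProd' free_cmonoid_def mhom_mult[OF \<iota>(1)] \<psi>_mult L.mon_add L.m_ac)
    moreover have "\<sigma> \<one>\<^bsub>?N\<^esub> = \<one>\<^bsub>L\<^esub>"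
      by (simp add: \<sigma>_def one_DirProd mhom_one[OF \<iota>(1)] \<psi>_one free_cmonoid_def)
    ultimately show ?thesis by (intro mhomI) simp_all
  qed
  have mon_e: "mon L s y (\<lambda>i. int (e t i)) = mon L s y (a t)" "mon L s y (\<lambda>i. int (e' t i)) = mon L s y (a' t)"
    if "t < T" for t
    using a that by (auto intro!: mon_cong simp: e_def e'_def)
  have S\<sigma>: "\<sigma> x = \<sigma> x'" if xx: "(x, x') \<in> S" for x x'
  proof -
    obtain t where t: "t < T" "x = (p' t, e t)" "x' = (p t, e' t)" using xx by (auto simp: S_def)
    have "\<psi> (\<iota> (p t)) = \<psi> (h t) \<otimes>\<^bsub>L\<^esub> \<psi> (\<iota> (p' t))"
      using t(1) by (simp add: hp \<psi>_mult[symmetric] G.m_assoc)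
    then show ?thesis
      using t(1) ha h by (simp add: t(2,3) \<sigma>_def mon_e L.m_ac)
  qed
  have ker: "(x, x') \<in> ?R" if x: "x \<in> carrier ?N" "x' \<in> carrier ?N" "\<sigma> x = \<sigma> x'" for x x'
  proof -
    obtain w1 d w2 d' where xs: "x = (w1, d)" "x' = (w2, d')" by (cases x, cases x')
    have C: "w1 \<in> carrier Wm" "w2 \<in> carrier Wm" using x by (auto simp: xs)
    have dC: "d i = 0" "d' i = 0" if "\<not> i < s" for i using x that by (auto simp: xs free_cmonoid_def)
    define g where "g = \<iota> w2 \<otimes>\<^bsub>G\<^esub> inv\<^bsub>G\<^esub> (\<iota> w1)"
    have g: "g \<in> carrier G" using C by (simp add: g_def)
    have "\<psi> (\<iota> w1) \<otimes>\<^bsub>L\<^esub> mon L s y (\<lambda>i. int (d i)) = \<psi> (\<iota> w2) \<otimes>\<^bsub>L\<^esub> mon L s y (\<lambda>i. int (d' i))"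
      using x(3) by (simp add: xs \<sigma>_def)
    from L.cross_mult[OF this] C
    have "mon L s y (\<lambda>i. int (d i)) \<otimes>\<^bsub>L\<^esub> inv\<^bsub>L\<^esub> (mon L s y (\<lambda>i. int (d' i))) = \<psi> g"
      by (simp add: g_def \<psi>_mult \<psi>_inv)
    then have "mon L s y (\<lambda>i. int (d i)) = \<psi> g \<otimes>\<^bsub>L\<^esub> mon L s y (\<lambda>i. int (d' i))"
      using g by (simp add: L.inv_solve_right')
    from gen[rule_format, OF g _ this] obtain n where n: "\<forall>t. 0 \<le> n t" "g = mon G T h n"
      "\<forall>i<s. int (d i) = (\<Sum>t<T. n t * a t i) \<and> int (d' i) = (\<Sum>t<T. n t * a' t i)" by auto
    define k where "k t = nat (n t)" for t
    have nk: "n t = int (k t)" for t using n(1) by (simp add: k_def)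
    have d: "d = (\<lambda>i. \<Sum>t<T. k t * e t i)" "d' = (\<lambda>i. \<Sum>t<T. k t * e' t i)"
    proof -
      have "int (d i) = int (\<Sum>t<T. k t * e t i) \<and> int (d' i) = int (\<Sum>t<T. k t * e' t i)" for i
      proof (cases "i < s")
        case True
        then have "(\<Sum>t<T. n t * a t i) = (\<Sum>t<T. int (k t) * int (e t i))"
          "(\<Sum>t<T. n t * a' t i) = (\<Sum>t<T. int (k t) * int (e' t i))"
          using a by (auto intro!: sum.cong simp: nk e_def e'_def)
        then show ?thesis using n(3) True by simp
      qed (simp add: dC e_def e'_def)
      then show "d = (\<lambda>i. \<Sum>t<T. k t * e t i)" "d' = (\<lambda>i. \<Sum>t<T. k t * e' t i)"
        by (auto simp only: of_nat_eq_iff fun_eq_iff)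
    qed
    define P where "P = mprod Wm T p k"
    define P' where "P' = mprod Wm T p' k"
    have PC: "P \<in> carrier Wm" "P' \<in> carrier Wm" unfolding P_def P'_def by (simp_all add: mprod_closed[OF Wm])
    have "w1 \<otimes>\<^bsub>Wm\<^esub> P = w2 \<otimes>\<^bsub>Wm\<^esub> P'"
    proof (rule inj_onD[OF \<iota>(2)])
      have "mon G T h n = mon G T (\<lambda>t. \<iota> (p t) \<otimes>\<^bsub>G\<^esub> inv\<^bsub>G\<^esub> (\<iota> (p' t))) (\<lambda>t. int (k t))"
        by (rule mon_cong) (simp_all add: hp nk)
      also have "\<dots> = \<iota> P \<otimes>\<^bsub>G\<^esub> inv\<^bsub>G\<^esub> (\<iota> P')"
        unfolding P_def P'_def
        by (simp add: G.mon_mult G.mon_inv mprod_hom[OF Wm G.comm_group_axioms \<iota>(1)])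
      finally have "\<iota> w2 \<otimes>\<^bsub>G\<^esub> inv\<^bsub>G\<^esub> (\<iota> w1) = \<iota> P \<otimes>\<^bsub>G\<^esub> inv\<^bsub>G\<^esub> (\<iota> P')" using n(2) by (simp add: g_def)
      then have "\<iota> w2 \<otimes>\<^bsub>G\<^esub> inv\<^bsub>G\<^esub> (\<iota> w1) \<otimes>\<^bsub>G\<^esub> (\<iota> w1 \<otimes>\<^bsub>G\<^esub> \<iota> P') = \<iota> P \<otimes>\<^bsub>G\<^esub> inv\<^bsub>G\<^esub> (\<iota> P') \<otimes>\<^bsub>G\<^esub> (\<iota> w1 \<otimes>\<^bsub>G\<^esub> \<iota> P')"
        by simp
      then show "\<iota> (w1 \<otimes>\<^bsub>Wm\<^esub> P) = \<iota> (w2 \<otimes>\<^bsub>Wm\<^esub> P')"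
        using C PC by (simp add: mhom_mult[OF \<iota>(1)] G.m_ac)
    qed (use C PC in auto)
    \<comment> \<open>The monomial reached after the first phase.\<close>
    define v where "v t = (if h t \<in> W then e' t else e t)" for t
    have 1: "((\<one>\<^bsub>Wm\<^esub>, e t), (p t, v t)) \<in> ?R" and 2: "((p' t, v t), (\<one>\<^bsub>Wm\<^esub>, e' t)) \<in> ?R" if "t < T" for t
    proof -
      have base: "((p' t, e t), (p t, e' t)) \<in> ?R"
        by (rule gen_cong_base) (use that eC in \<open>auto simp: S_def\<close>)
      have refl: "((\<one>\<^bsub>Wm\<^esub>, e t), (\<one>\<^bsub>Wm\<^esub>, e t)) \<in> ?R" "((\<one>\<^bsub>Wm\<^esub>, e' t), (\<one>\<^bsub>Wm\<^esub>, e' t)) \<in> ?R"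
        by (rule gen_cong_refl; use eC in simp)+
      show "((\<one>\<^bsub>Wm\<^esub>, e t), (p t, v t)) \<in> ?R" "((p' t, v t), (\<one>\<^bsub>Wm\<^esub>, e' t)) \<in> ?R"
        using base refl that by (cases "h t \<in> W"; simp add: v_def pW pN)+
    qed
    have w: "((w, \<one>\<^bsub>free_cmonoid s\<^esub>), (w, \<one>\<^bsub>free_cmonoid s\<^esub>)) \<in> ?R" if "w \<in> carrier Wm" for w
      by (rule gen_cong_refl) (use that in \<open>simp add: free_cmonoid_def\<close>)
    have mult: "(w, \<one>\<^bsub>free_cmonoid s\<^esub>) \<otimes>\<^bsub>?N\<^esub> mprod ?N T (\<lambda>t. (q t, x t)) k =
        (w \<otimes>\<^bsub>Wm\<^esub> mprod Wm T q k, \<lambda>i. \<Sum>t<T. k t * x t i)" for w q x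
      unfolding mprod_DirProd mprod_free by (simp add: mult_DirProd' free_cmonoid_def)
    have "(mprod ?N T (\<lambda>t. (\<one>\<^bsub>Wm\<^esub>, e t)) k, mprod ?N T (\<lambda>t. (p t, v t)) k) \<in> ?R"
      by (rule mprod_gen_cong[OF cN 1])
    from gen_cong_mult[OF w[OF C(1)] this]
    have "(x, (w1 \<otimes>\<^bsub>Wm\<^esub> P, \<lambda>i. \<Sum>t<T. k t * v t i)) \<in> ?R"
      using C by (simp add: mult mprod_one[OF Wm] xs d(1) P_def)
    moreover have "(mprod ?N T (\<lambda>t. (p' t, v t)) k, mprod ?N T (\<lambda>t. (\<one>\<^bsub>Wm\<^esub>, e' t)) k) \<in> ?R"
      by (rule mprod_gen_cong[OF cN 2])
    from gen_cong_mult[OF w[OF C(2)] this]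
    have "((w2 \<otimes>\<^bsub>Wm\<^esub> P', \<lambda>i. \<Sum>t<T. k t * v t i), x') \<in> ?R"
      using C by (simp add: mult mprod_one[OF Wm] xs d(2) P'_def)
    ultimately show ?thesis unfolding \<open>w1 \<otimes>\<^bsub>Wm\<^esub> P = w2 \<otimes>\<^bsub>Wm\<^esub> P'\<close> by (rule gen_cong_trans)
  qed
  have surj: "\<exists>x\<in>carrier ?N. q = \<sigma> x" if "q \<in> Q" for q
  proof -
    from bspec[OF y_gen that] obtain g n where
      g: "g \<in> W" "\<forall>t. 0 \<le> n t" "q = \<psi> g \<otimes>\<^bsub>L\<^esub> mon L s y n" by (elim bexE exE conjE)
    obtain w where w: "w \<in> carrier Wm" "\<iota> w = g" using g(1) \<iota>(3) by auto
    have "mon L s y n = mon L s y (\<lambda>i. int (if i < s then nat (n i) else 0))"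
      by (rule mon_cong) (use g(2) in auto)
    then have "q = \<sigma> (w, \<lambda>i. if i < s then nat (n i) else 0)" using w by (simp add: \<sigma>_def g(3))
    moreover have "(w, \<lambda>i. if i < s then nat (n i) else 0) \<in> carrier ?N" using w by (simp add: free_cmonoid_def)
    ultimately show ?thesis by (rule bexI)
  qed
  have j: "(\<lambda>w. \<psi> (\<iota> w)) \<in> mhom Wm ?Q"
    using W_Q \<iota>W by (auto simp: mhom_def[of Wm ?Q] hom_def mhom_mult[OF \<iota>(1)] mhom_one[OF \<iota>(1)] \<psi>_mult \<psi>_one)
  show ?thesis
  proof (rule finitely_presented_homI[of Wm ?Q _ \<sigma> s S])
    show "\<And>w. w \<in> carrier Wm \<Longrightarrow> \<sigma> (w, \<one>\<^bsub>free_cmonoid s\<^esub>) = \<psi> (\<iota> w)"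
      by (simp add: \<sigma>_def free_cmonoid_def)
    show "S \<subseteq> carrier ?N \<times> carrier ?N" using eC by (auto simp: S_def)
    show "\<And>q. q \<in> carrier ?Q \<Longrightarrow> \<exists>x\<in>carrier ?N. q = \<sigma> x" using surj by simp
  qed (fact Wm cQ j \<sigma>_hom S\<sigma> ker | simp add: S_def)+
qed

section \<open>Pushouts along valuative monoids\<close>

lemma integral_cancel:
  assumes "integral_monoid M" "a \<otimes>\<^bsub>M\<^esub> t = b \<otimes>\<^bsub>M\<^esub> t" "a \<in> carrier M" "b \<in> carrier M" "t \<in> carrier M"
  shows "a = b"
  using assms unfolding integral_monoid_iff by blast

lemma gp_frac_div:
  assumes "comm_monoid M" "a \<in> carrier M" "b \<in> carrier M"
  shows "gp_frac M a b = gp_of M a \<otimes>\<^bsub>gp M\<^esub> inv\<^bsub>gp M\<^esub> (gp_of M b)"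
proof -
  interpret M: comm_monoid M by fact
  interpret G: comm_group "gp M" by (rule gp_comm_group[OF assms(1)])
  have C: "gp_of M a \<in> carrier (gp M)" "gp_of M b \<in> carrier (gp M)"
    using mhom_closed[OF gp_of_hom[OF assms(1)]] assms(2,3) by auto
  have "gp_frac M a b \<otimes>\<^bsub>gp M\<^esub> gp_of M b = gp_of M a"
    using assms by (auto simp: gp_of_def frac_mult[OF assms(1)] Defs.frac_eq[OF assms(1)])
  then have "gp_of M a \<otimes>\<^bsub>gp M\<^esub> inv\<^bsub>gp M\<^esub> (gp_of M b) =
      gp_frac M a b \<otimes>\<^bsub>gp M\<^esub> gp_of M b \<otimes>\<^bsub>gp M\<^esub> inv\<^bsub>gp M\<^esub> (gp_of M b)" by simp
  then show ?thesis using C frac_in[OF assms] by (simp add: G.m_assoc)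
qed

lemma valuative_divides:
  assumes V: "valuative_monoid V" and ab: "a \<in> carrier V" "b \<in> carrier V"
  shows "(\<exists>c\<in>carrier V. a = c \<otimes>\<^bsub>V\<^esub> b) \<or> (\<exists>c\<in>carrier V. b = c \<otimes>\<^bsub>V\<^esub> a)"
proof -
  have iV: "integral_monoid V" and cV: "comm_monoid V" using V by (auto simp: valuative_monoid_def integral_monoid_def)
  interpret V: comm_monoid V by fact
  interpret G: comm_group "gp V" by (rule gp_comm_group[OF cV])
  have *: "\<exists>c\<in>carrier V. a = c \<otimes>\<^bsub>V\<^esub> b"
    if im: "gp_frac V a b \<in> gp_of V ` carrier V" and ab: "a \<in> carrier V" "b \<in> carrier V" for a b
  proof -
    obtain c where c: "c \<in> carrier V" "gp_frac V a b = gp_of V c" using im by auto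
    then obtain t where t: "t \<in> carrier V" "a \<otimes>\<^bsub>V\<^esub> t = c \<otimes>\<^bsub>V\<^esub> b \<otimes>\<^bsub>V\<^esub> t"
      using ab by (auto simp: gp_of_def Defs.frac_eq[OF cV])
    have "a = c \<otimes>\<^bsub>V\<^esub> b" by (rule integral_cancel[OF iV t(2)]) (use ab c t in auto)
    then show ?thesis using c(1) by (rule bexI)
  qed
  have "inv\<^bsub>gp V\<^esub> (gp_frac V a b) = gp_frac V b a"
  proof (rule G.inv_equality)
    show "gp_frac V b a \<otimes>\<^bsub>gp V\<^esub> gp_frac V a b = \<one>\<^bsub>gp V\<^esub>"
      using ab by (auto simp: frac_mult[OF cV] gp_one[OF cV] Defs.frac_eq[OF cV] V.m_comm)
  qed (use frac_in[OF cV] ab in auto)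
  moreover have "gp_frac V a b \<in> gp_of V ` carrier V \<or> inv\<^bsub>gp V\<^esub> (gp_frac V a b) \<in> gp_of V ` carrier V"
    using V frac_in[OF cV ab] unfolding valuative_monoid_def by blast
  ultimately show ?thesis using *[of a b] *[of b a] ab by auto
qed

text \<open>Moving the fraction \<open>v / v'\<close> of elements of \<open>P\<close> from one component to the other turns \<open>x\<close> into \<open>y\<close>. For
valuative \<open>P\<close> this is an explicit description of the pushout congruence.\<close>

definition linked ::
  "'p monoid \<Rightarrow> 'a monoid \<Rightarrow> 'b monoid \<Rightarrow> ('p \<Rightarrow> 'a) \<Rightarrow> ('p \<Rightarrow> 'b) \<Rightarrow> 'a \<times> 'b \<Rightarrow> 'a \<times> 'b \<Rightarrow> bool" where
  "linked P A B f g x y \<longleftrightarrow> (\<exists>v\<in>carrier P. \<exists>v'\<in>carrier P.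
     fst x \<otimes>\<^bsub>A\<^esub> f v' = fst y \<otimes>\<^bsub>A\<^esub> f v \<and> snd y \<otimes>\<^bsub>B\<^esub> g v' = snd x \<otimes>\<^bsub>B\<^esub> g v)"

lemma pushout_cong_linked:
  assumes P: "comm_monoid P" and A: "integral_monoid A" and B: "integral_monoid B"
    and f: "f \<in> mhom P A" and g: "g \<in> mhom P B" and xy: "(x, y) \<in> pushout_cong P A B f g"
  shows "linked P A B f g x y"
proof -
  have cA: "comm_monoid A" and cB: "comm_monoid B" using A B by (auto simp: integral_monoid_def)
  interpret P: comm_monoid P by fact
  interpret A: comm_monoid A by fact
  interpret B: comm_monoid B by fact
  note cAB = comm_monoid_DirProd[OF cA cB]
  have "x \<in> carrier (A \<times>\<times> B) \<and> y \<in> carrier (A \<times>\<times> B) \<and> linked P A B f g x y"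
    using xy unfolding pushout_cong_def
  proof induction
    case (gen_cong_base x y)
    then obtain p where "p \<in> carrier P" "x = (f p, \<one>\<^bsub>B\<^esub>)" "y = (\<one>\<^bsub>A\<^esub>, g p)" by auto
    then show ?case using gen_cong_base(2,3) unfolding linked_def
      by (intro conjI, simp, simp, intro bexI[of _ p] bexI[of _ "\<one>\<^bsub>P\<^esub>"]) (simp_all add: mhom_one[OF f] mhom_one[OF g] mhom_closed[OF f] mhom_closed[OF g])
  next
    case (gen_cong_refl x)
    then show ?case unfolding linked_def by auto
  next
    case (gen_cong_sym x y)
    then obtain v v' where "v \<in> carrier P" "v' \<in> carrier P"
      "fst x \<otimes>\<^bsub>A\<^esub> f v' = fst y \<otimes>\<^bsub>A\<^esub> f v" "snd y \<otimes>\<^bsub>B\<^esub> g v' = snd x \<otimes>\<^bsub>B\<^esub> g v"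
      unfolding linked_def by (elim conjE bexE)
    then have "linked P A B f g y x" unfolding linked_def by (intro bexI[of _ v'] bexI[of _ v] conjI) simp_all
    then show ?case using gen_cong_sym.IH by simp
  next
    case (gen_cong_trans x y z)
    from gen_cong_trans.IH obtain v v' u u' where
      v: "v \<in> carrier P" "v' \<in> carrier P" "fst x \<otimes>\<^bsub>A\<^esub> f v' = fst y \<otimes>\<^bsub>A\<^esub> f v" "snd y \<otimes>\<^bsub>B\<^esub> g v' = snd x \<otimes>\<^bsub>B\<^esub> g v"
      and u: "u \<in> carrier P" "u' \<in> carrier P" "fst y \<otimes>\<^bsub>A\<^esub> f u' = fst z \<otimes>\<^bsub>A\<^esub> f u" "snd z \<otimes>\<^bsub>B\<^esub> g u' = snd y \<otimes>\<^bsub>B\<^esub> g u"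
      unfolding linked_def by (elim conjE bexE)
    have C: "fst x \<in> carrier A" "snd x \<in> carrier B" "fst y \<in> carrier A" "snd y \<in> carrier B"
      "fst z \<in> carrier A" "snd z \<in> carrier B" using gen_cong_trans.IH by auto
    note F = v(1,2)[THEN mhom_closed[OF f]] u(1,2)[THEN mhom_closed[OF f]]
    note G = v(1,2)[THEN mhom_closed[OF g]] u(1,2)[THEN mhom_closed[OF g]]
    have "fst x \<otimes>\<^bsub>A\<^esub> f (v' \<otimes>\<^bsub>P\<^esub> u') = (fst x \<otimes>\<^bsub>A\<^esub> f v') \<otimes>\<^bsub>A\<^esub> f u'"
      using C F v(1,2) u(1,2) by (simp add: mhom_mult[OF f] A.m_ac)
    also have "\<dots> = (fst y \<otimes>\<^bsub>A\<^esub> f u') \<otimes>\<^bsub>A\<^esub> f v" unfolding v(3) using C F by (simp add: A.m_ac)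
    also have "\<dots> = fst z \<otimes>\<^bsub>A\<^esub> f (v \<otimes>\<^bsub>P\<^esub> u)" unfolding u(3) using C F v(1,2) u(1,2) by (simp add: mhom_mult[OF f] A.m_ac)
    finally have 1: "fst x \<otimes>\<^bsub>A\<^esub> f (v' \<otimes>\<^bsub>P\<^esub> u') = fst z \<otimes>\<^bsub>A\<^esub> f (v \<otimes>\<^bsub>P\<^esub> u)" .
    have "snd z \<otimes>\<^bsub>B\<^esub> g (v' \<otimes>\<^bsub>P\<^esub> u') = (snd z \<otimes>\<^bsub>B\<^esub> g u') \<otimes>\<^bsub>B\<^esub> g v'"
      using C G v(1,2) u(1,2) by (simp add: mhom_mult[OF g] B.m_ac)
    also have "\<dots> = (snd y \<otimes>\<^bsub>B\<^esub> g v') \<otimes>\<^bsub>B\<^esub> g u" unfolding u(4) using C G by (simp add: B.m_ac)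
    also have "\<dots> = snd x \<otimes>\<^bsub>B\<^esub> g (v \<otimes>\<^bsub>P\<^esub> u)" unfolding v(4) using C G v(1,2) u(1,2) by (simp add: mhom_mult[OF g] B.m_ac)
    finally have "linked P A B f g x z" unfolding linked_def using 1 v u
      by (intro bexI[of _ "v \<otimes>\<^bsub>P\<^esub> u"] bexI[of _ "v' \<otimes>\<^bsub>P\<^esub> u'"]) auto
    then show ?case using gen_cong_trans.IH by simp
  next
    case (gen_cong_mult x y x' y')
    from gen_cong_mult.IH obtain v v' u u' where
      v: "v \<in> carrier P" "v' \<in> carrier P" "fst x \<otimes>\<^bsub>A\<^esub> f v' = fst y \<otimes>\<^bsub>A\<^esub> f v" "snd y \<otimes>\<^bsub>B\<^esub> g v' = snd x \<otimes>\<^bsub>B\<^esub> g v"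
      and u: "u \<in> carrier P" "u' \<in> carrier P" "fst x' \<otimes>\<^bsub>A\<^esub> f u' = fst y' \<otimes>\<^bsub>A\<^esub> f u" "snd y' \<otimes>\<^bsub>B\<^esub> g u' = snd x' \<otimes>\<^bsub>B\<^esub> g u"
      unfolding linked_def by (elim conjE bexE)
    have C: "fst x \<in> carrier A" "snd x \<in> carrier B" "fst y \<in> carrier A" "snd y \<in> carrier B"
      "fst x' \<in> carrier A" "snd x' \<in> carrier B" "fst y' \<in> carrier A" "snd y' \<in> carrier B"
      using gen_cong_mult.IH by auto
    note F = v(1,2)[THEN mhom_closed[OF f]] u(1,2)[THEN mhom_closed[OF f]]
    note G = v(1,2)[THEN mhom_closed[OF g]] u(1,2)[THEN mhom_closed[OF g]]
    have "(fst x \<otimes>\<^bsub>A\<^esub> fst x') \<otimes>\<^bsub>A\<^esub> f (v' \<otimes>\<^bsub>P\<^esub> u') = (fst x \<otimes>\<^bsub>A\<^esub> f v') \<otimes>\<^bsub>A\<^esub> (fst x' \<otimes>\<^bsub>A\<^esub> f u')"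
      using C F v(1,2) u(1,2) by (simp add: mhom_mult[OF f] A.m_ac)
    also have "\<dots> = (fst y \<otimes>\<^bsub>A\<^esub> fst y') \<otimes>\<^bsub>A\<^esub> f (v \<otimes>\<^bsub>P\<^esub> u)"
      unfolding v(3) u(3) using C F v(1,2) u(1,2) by (simp add: mhom_mult[OF f] A.m_ac)
    finally have 1: "(fst x \<otimes>\<^bsub>A\<^esub> fst x') \<otimes>\<^bsub>A\<^esub> f (v' \<otimes>\<^bsub>P\<^esub> u') = (fst y \<otimes>\<^bsub>A\<^esub> fst y') \<otimes>\<^bsub>A\<^esub> f (v \<otimes>\<^bsub>P\<^esub> u)" .
    have "(snd y \<otimes>\<^bsub>B\<^esub> snd y') \<otimes>\<^bsub>B\<^esub> g (v' \<otimes>\<^bsub>P\<^esub> u') = (snd y \<otimes>\<^bsub>B\<^esub> g v') \<otimes>\<^bsub>B\<^esub> (snd y' \<otimes>\<^bsub>B\<^esub> g u')"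
      using C G v(1,2) u(1,2) by (simp add: mhom_mult[OF g] B.m_ac)
    also have "\<dots> = (snd x \<otimes>\<^bsub>B\<^esub> snd x') \<otimes>\<^bsub>B\<^esub> g (v \<otimes>\<^bsub>P\<^esub> u)"
      unfolding v(4) u(4) using C G v(1,2) u(1,2) by (simp add: mhom_mult[OF g] B.m_ac)
    finally have "linked P A B f g (x \<otimes>\<^bsub>A \<times>\<times> B\<^esub> x') (y \<otimes>\<^bsub>A \<times>\<times> B\<^esub> y')"
      unfolding linked_def using 1 v u
      by (intro bexI[of _ "v \<otimes>\<^bsub>P\<^esub> u"] bexI[of _ "v' \<otimes>\<^bsub>P\<^esub> u'"]) (auto simp: mult_DirProd')
    then show ?case using gen_cong_mult.IH by (auto simp: mult_DirProd')
  qed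
  then show ?thesis by simp
qed

text \<open>In a valuative monoid one of \<open>v\<close>, \<open>v'\<close> divides the other. Cancelling it leaves a fraction that is an element
of \<open>P\<close> or the inverse of one, and moving an element is a single step of the congruence.\<close>

lemma linked_pushout_cong:
  assumes V: "valuative_monoid P" and A: "integral_monoid A" and B: "integral_monoid B"
    and f: "f \<in> mhom P A" and g: "g \<in> mhom P B"
    and x: "x \<in> carrier (A \<times>\<times> B)" "y \<in> carrier (A \<times>\<times> B)" and xy: "linked P A B f g x y"
  shows "(x, y) \<in> pushout_cong P A B f g"
proof -
  have cA: "comm_monoid A" and cB: "comm_monoid B" and cP: "comm_monoid P"
    using A B V by (auto simp: integral_monoid_def valuative_monoid_def)
  interpret P: comm_monoid P by fact
  interpret A: comm_monoid A by fact
  interpret B: comm_monoid B by fact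
  let ?R = "pushout_cong P A B f g"
  have move: "((b \<otimes>\<^bsub>A\<^esub> f v, s), (b, s \<otimes>\<^bsub>B\<^esub> g v)) \<in> ?R" if "b \<in> carrier A" "s \<in> carrier B" "v \<in> carrier P" for b s v
  proof -
    have "((f v, \<one>\<^bsub>B\<^esub>), (\<one>\<^bsub>A\<^esub>, g v)) \<in> ?R" unfolding pushout_cong_def
      by (rule gen_cong_base) (use that mhom_closed[OF f] mhom_closed[OF g] in auto)
    moreover have "((b, s), (b, s)) \<in> ?R" unfolding pushout_cong_def by (rule gen_cong_refl) (use that in auto)
    ultimately have "((b, s) \<otimes>\<^bsub>A \<times>\<times> B\<^esub> (f v, \<one>\<^bsub>B\<^esub>), (b, s) \<otimes>\<^bsub>A \<times>\<times> B\<^esub> (\<one>\<^bsub>A\<^esub>, g v)) \<in> ?R"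
      unfolding pushout_cong_def by (intro gen_cong_mult)
    then show ?thesis using that by simp
  qed
  obtain a s b t where xs: "x = (a, s)" "y = (b, t)" by (cases x, cases y)
  have C: "a \<in> carrier A" "b \<in> carrier A" "s \<in> carrier B" "t \<in> carrier B" using x by (auto simp: xs)
  obtain v v' where v: "v \<in> carrier P" "v' \<in> carrier P" "a \<otimes>\<^bsub>A\<^esub> f v' = b \<otimes>\<^bsub>A\<^esub> f v" "t \<otimes>\<^bsub>B\<^esub> g v' = s \<otimes>\<^bsub>B\<^esub> g v"
    using xy by (auto simp: linked_def xs)
  note F = v(1,2)[THEN mhom_closed[OF f]] v(1,2)[THEN mhom_closed[OF g]]
  from valuative_divides[OF V v(1,2)] show ?thesis
  proof
    assume "\<exists>c\<in>carrier P. v = c \<otimes>\<^bsub>P\<^esub> v'"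
    then obtain c where c: "c \<in> carrier P" "v = c \<otimes>\<^bsub>P\<^esub> v'" by (elim bexE)
    note FC = mhom_closed[OF f c(1)] mhom_closed[OF g c(1)]
    have "a \<otimes>\<^bsub>A\<^esub> f v' = (b \<otimes>\<^bsub>A\<^esub> f c) \<otimes>\<^bsub>A\<^esub> f v'"
      using v(2) c(1) C F FC by (simp add: v(3) c(2) mhom_mult[OF f] A.m_assoc)
    then have "a = b \<otimes>\<^bsub>A\<^esub> f c" by (rule integral_cancel[OF A]) (use C F FC in simp_all)
    moreover have "t \<otimes>\<^bsub>B\<^esub> g v' = (s \<otimes>\<^bsub>B\<^esub> g c) \<otimes>\<^bsub>B\<^esub> g v'"
      using v(2) c(1) C F FC by (simp add: v(4) c(2) mhom_mult[OF g] B.m_assoc)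
    then have "t = s \<otimes>\<^bsub>B\<^esub> g c" by (rule integral_cancel[OF B]) (use C F FC in simp_all)
    ultimately show ?thesis using move[of b s c] C c by (simp add: xs)
  next
    assume "\<exists>c\<in>carrier P. v' = c \<otimes>\<^bsub>P\<^esub> v"
    then obtain c where c: "c \<in> carrier P" "v' = c \<otimes>\<^bsub>P\<^esub> v" by (elim bexE)
    note FC = mhom_closed[OF f c(1)] mhom_closed[OF g c(1)]
    have "(a \<otimes>\<^bsub>A\<^esub> f c) \<otimes>\<^bsub>A\<^esub> f v = b \<otimes>\<^bsub>A\<^esub> f v"
      using v(1) c(1) C F FC by (simp add: v(3)[symmetric] c(2) mhom_mult[OF f] A.m_assoc)
    then have "a \<otimes>\<^bsub>A\<^esub> f c = b" by (rule integral_cancel[OF A]) (use C F FC in simp_all)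
    moreover have "(t \<otimes>\<^bsub>B\<^esub> g c) \<otimes>\<^bsub>B\<^esub> g v = s \<otimes>\<^bsub>B\<^esub> g v"
      using v(1) c(1) C F FC by (simp add: v(4)[symmetric] c(2) mhom_mult[OF g] B.m_assoc)
    then have "t \<otimes>\<^bsub>B\<^esub> g c = s" by (rule integral_cancel[OF B]) (use C F FC in simp_all)
    moreover have "((a, t \<otimes>\<^bsub>B\<^esub> g c), (a \<otimes>\<^bsub>A\<^esub> f c, t)) \<in> ?R"
      using gen_cong_sym[OF move[of a t c, unfolded pushout_cong_def]] C c(1) unfolding pushout_cong_def by simp
    ultimately show ?thesis by (simp add: xs)
  qed
qed

text \<open>If \<open>b = c a\<close> and \<open>a^n = z b^n\<close>, cancelling \<open>a^n\<close> gives \<open>1 = z c^n\<close>, so \<open>c\<close> is invertible and \<open>b\<close> divides \<open>a\<close>.\<close>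

lemma valuative_imp_saturated:
  assumes V: "valuative_monoid V" shows "saturated_monoid V"
proof -
  have iV: "integral_monoid V" and cV: "comm_monoid V" using V by (auto simp: valuative_monoid_def integral_monoid_def)
  interpret V: comm_monoid V by fact
  have "\<exists>w\<in>carrier V. a = w \<otimes>\<^bsub>V\<^esub> b"
    if C: "a \<in> carrier V" "b \<in> carrier V" "z \<in> carrier V" and n: "n \<ge> 1"
      and eq: "a [^]\<^bsub>V\<^esub> n = z \<otimes>\<^bsub>V\<^esub> b [^]\<^bsub>V\<^esub> n" for a b z and n :: nat
    using valuative_divides[OF V C(1,2)]
  proof
    assume "\<exists>c\<in>carrier V. b = c \<otimes>\<^bsub>V\<^esub> a"
    then obtain c where c: "c \<in> carrier V" "b = c \<otimes>\<^bsub>V\<^esub> a" by (elim bexE)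
    obtain k where k: "n = Suc k" using n by (cases n) auto
    have "\<one>\<^bsub>V\<^esub> \<otimes>\<^bsub>V\<^esub> a [^]\<^bsub>V\<^esub> n = a [^]\<^bsub>V\<^esub> n" using C(1) by simp
    also have "\<dots> = z \<otimes>\<^bsub>V\<^esub> (c \<otimes>\<^bsub>V\<^esub> a) [^]\<^bsub>V\<^esub> n" using eq unfolding c(2) .
    also have "\<dots> = (z \<otimes>\<^bsub>V\<^esub> c [^]\<^bsub>V\<^esub> n) \<otimes>\<^bsub>V\<^esub> a [^]\<^bsub>V\<^esub> n"
      using C(1,3) c(1) by (simp add: V.nat_pow_distrib V.m_assoc)
    finally have "\<one>\<^bsub>V\<^esub> \<otimes>\<^bsub>V\<^esub> a [^]\<^bsub>V\<^esub> n = (z \<otimes>\<^bsub>V\<^esub> c [^]\<^bsub>V\<^esub> n) \<otimes>\<^bsub>V\<^esub> a [^]\<^bsub>V\<^esub> n" .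
    then have 1: "\<one>\<^bsub>V\<^esub> = z \<otimes>\<^bsub>V\<^esub> c [^]\<^bsub>V\<^esub> n" by (rule integral_cancel[OF iV]) (use C c in auto)
    have "(z \<otimes>\<^bsub>V\<^esub> c [^]\<^bsub>V\<^esub> k) \<otimes>\<^bsub>V\<^esub> b = (z \<otimes>\<^bsub>V\<^esub> c [^]\<^bsub>V\<^esub> n) \<otimes>\<^bsub>V\<^esub> a"
      using C c by (simp add: k V.m_assoc)
    also have "\<dots> = a" using C(1) by (simp add: 1[symmetric])
    finally show ?thesis using C c by (intro bexI[of _ "z \<otimes>\<^bsub>V\<^esub> c [^]\<^bsub>V\<^esub> k"]) simp_all
  qed
  then show ?thesis unfolding saturated_monoid_iff using iV by blast
qed

context
  fixes P :: "'p monoid" and A :: "'a monoid" and B :: "'b monoid" and f :: "'p \<Rightarrow> 'a" and g :: "'p \<Rightarrow> 'b"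
  assumes cA: "comm_monoid A" and cB: "comm_monoid B"
begin

abbreviation (input) po_class :: "'a \<Rightarrow> 'b \<Rightarrow> ('a \<times> 'b) set" where
  "po_class a b \<equiv> pushout_cong P A B f g `` {(a, b)}"

lemma po_mcong: "mcong (A \<times>\<times> B) (pushout_cong P A B f g)"
  unfolding pushout_cong_def by (rule mcong_gen_cong[OF comm_monoid_DirProd[OF cA cB]])

lemma po_obtain:
  assumes "X \<in> carrier (pushout P A B f g)"
  obtains a b where "a \<in> carrier A" "b \<in> carrier B" "X = po_class a b"
proof -
  obtain z where "z \<in> carrier (A \<times>\<times> B)" "X = pushout_cong P A B f g `` {z}"
    using assms unfolding pushout_def by (rule quot_obtain[OF comm_monoid_DirProd[OF cA cB] po_mcong])
  then show ?thesis using that by (cases z) auto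
qed

lemma po_in: "a \<in> carrier A \<Longrightarrow> b \<in> carrier B \<Longrightarrow> po_class a b \<in> carrier (pushout P A B f g)"
  unfolding pushout_def by (rule quot_class_in[OF comm_monoid_DirProd[OF cA cB] po_mcong]) simp

lemma po_mult:
  "a \<in> carrier A \<Longrightarrow> b \<in> carrier B \<Longrightarrow> a' \<in> carrier A \<Longrightarrow> b' \<in> carrier B \<Longrightarrow>
    po_class a b \<otimes>\<^bsub>pushout P A B f g\<^esub> po_class a' b' = po_class (a \<otimes>\<^bsub>A\<^esub> a') (b \<otimes>\<^bsub>B\<^esub> b')"
  unfolding pushout_def by (subst quot_mult[OF comm_monoid_DirProd[OF cA cB] po_mcong]) simp_all

lemma po_pow:
  "a \<in> carrier A \<Longrightarrow> b \<in> carrier B \<Longrightarrow>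
    po_class a b [^]\<^bsub>pushout P A B f g\<^esub> (n::nat) = po_class (a [^]\<^bsub>A\<^esub> n) (b [^]\<^bsub>B\<^esub> n)"
  unfolding pushout_def by (subst quot_pow[OF comm_monoid_DirProd[OF cA cB] po_mcong]) (simp_all add: DirProd_pow)

lemma po_eq:
  "a \<in> carrier A \<Longrightarrow> b \<in> carrier B \<Longrightarrow> a' \<in> carrier A \<Longrightarrow> b' \<in> carrier B \<Longrightarrow>
    po_class a b = po_class a' b' \<longleftrightarrow> ((a, b), (a', b')) \<in> pushout_cong P A B f g"
  by (rule quot_class_eq[OF comm_monoid_DirProd[OF cA cB] po_mcong]) simp_all

end

lemma po_eq_linked:
  assumes V: "valuative_monoid P" and A: "integral_monoid A" and B: "integral_monoid B"
    and f: "f \<in> mhom P A" and g: "g \<in> mhom P B"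
    and C: "a \<in> carrier A" "b \<in> carrier B" "a' \<in> carrier A" "b' \<in> carrier B"
  shows "pushout_cong P A B f g `` {(a, b)} = pushout_cong P A B f g `` {(a', b')} \<longleftrightarrow>
    linked P A B f g (a, b) (a', b')"
proof -
  have c: "comm_monoid A" "comm_monoid B" "comm_monoid P"
    using A B V by (auto simp: integral_monoid_def valuative_monoid_def)
  show ?thesis unfolding po_eq[OF c(1,2) C]
    using pushout_cong_linked[OF c(3) A B f g] linked_pushout_cong[OF V A B f g, of "(a, b)" "(a', b')"] C
    by auto
qed

text \<open>A common factor cancels from both equations of a link.\<close>

lemma integral_pushout_valuative:
  assumes V: "valuative_monoid P" and A: "integral_monoid A" and B: "integral_monoid B"
    and f: "f \<in> mhom P A" and g: "g \<in> mhom P B"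
  shows "integral_monoid (pushout P A B f g)"
  unfolding integral_monoid_iff
proof (intro conjI ballI impI)
  have c: "comm_monoid A" "comm_monoid B" using A B by (auto simp: integral_monoid_def)
  interpret A: comm_monoid A by fact
  interpret B: comm_monoid B by fact
  show "comm_monoid (pushout P A B f g)" by (rule comm_monoid_pushout[OF c])
  fix X Y T assume X: "X \<in> carrier (pushout P A B f g)" and Y: "Y \<in> carrier (pushout P A B f g)"
    and T: "T \<in> carrier (pushout P A B f g)"
    and eq: "X \<otimes>\<^bsub>pushout P A B f g\<^esub> T = Y \<otimes>\<^bsub>pushout P A B f g\<^esub> T"
  obtain x x' where x: "x \<in> carrier A" "x' \<in> carrier B" "X = pushout_cong P A B f g `` {(x, x')}"
    using X by (rule po_obtain[OF c])
  obtain y y' where y: "y \<in> carrier A" "y' \<in> carrier B" "Y = pushout_cong P A B f g `` {(y, y')}"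
    using Y by (rule po_obtain[OF c])
  obtain t t' where t: "t \<in> carrier A" "t' \<in> carrier B" "T = pushout_cong P A B f g `` {(t, t')}"
    using T by (rule po_obtain[OF c])
  have "linked P A B f g (x \<otimes>\<^bsub>A\<^esub> t, x' \<otimes>\<^bsub>B\<^esub> t') (y \<otimes>\<^bsub>A\<^esub> t, y' \<otimes>\<^bsub>B\<^esub> t')"
    using eq x y t by (simp add: po_mult[OF c] po_eq_linked[OF V A B f g])
  then obtain v v' where v: "v \<in> carrier P" "v' \<in> carrier P"
    "x \<otimes>\<^bsub>A\<^esub> t \<otimes>\<^bsub>A\<^esub> f v' = y \<otimes>\<^bsub>A\<^esub> t \<otimes>\<^bsub>A\<^esub> f v" "y' \<otimes>\<^bsub>B\<^esub> t' \<otimes>\<^bsub>B\<^esub> g v' = x' \<otimes>\<^bsub>B\<^esub> t' \<otimes>\<^bsub>B\<^esub> g v"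
    by (auto simp: linked_def)
  note F = v(1,2)[THEN mhom_closed[OF f]] v(1,2)[THEN mhom_closed[OF g]]
  have "x \<otimes>\<^bsub>A\<^esub> f v' = y \<otimes>\<^bsub>A\<^esub> f v"
    by (rule integral_cancel[OF A, of _ t]) (use v(3) x y t F in \<open>simp_all add: A.m_ac\<close>)
  moreover have "y' \<otimes>\<^bsub>B\<^esub> g v' = x' \<otimes>\<^bsub>B\<^esub> g v"
    by (rule integral_cancel[OF B, of _ t']) (use v(4) x y t F in \<open>simp_all add: B.m_ac\<close>)
  ultimately have "linked P A B f g (x, x') (y, y')" using v(1,2) by (auto simp: linked_def)
  then show "X = Y" using x y by (simp add: po_eq_linked[OF V A B f g])
qed

text \<open>A divisibility between \<open>n\<close>-th powers in the pushout with \<open>A\<close> is a divisibility in \<open>Q\<close> up to factors \<open>v\<close>, \<open>v'\<close>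
from \<open>W\<close> that it shares with \<open>A\<close>. The hypothesis \<open>div\<close> takes the \<open>n\<close>-th root of it in \<open>Q\<close> at the expense of
factors \<open>u1\<close>, \<open>u2\<close> for which the remaining discrepancy is an \<open>n\<close>-th power divisibility in \<open>W\<close>. Its image
in \<open>A\<close> has an \<open>n\<close>-th root because \<open>A\<close> is saturated.\<close>

theorem saturated_homI:
  fixes W :: "'w monoid" and Q :: "'q monoid"
  assumes V: "valuative_monoid W" and Q: "saturated_monoid Q" and j: "j \<in> mhom W Q"
    and div: "\<And>q1 q2 x v v' n. q1 \<in> carrier Q \<Longrightarrow> q2 \<in> carrier Q \<Longrightarrow> x \<in> carrier Q \<Longrightarrow>
      v \<in> carrier W \<Longrightarrow> v' \<in> carrier W \<Longrightarrow> n \<ge> 1 \<Longrightarrow>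
      q1 [^]\<^bsub>Q\<^esub> (n::nat) \<otimes>\<^bsub>Q\<^esub> j v = x \<otimes>\<^bsub>Q\<^esub> q2 [^]\<^bsub>Q\<^esub> n \<otimes>\<^bsub>Q\<^esub> j v' \<Longrightarrow>
      \<exists>u1\<in>carrier W. \<exists>u2\<in>carrier W. \<exists>y\<in>carrier Q. \<exists>w\<in>carrier W.
        q1 \<otimes>\<^bsub>Q\<^esub> j u1 = y \<otimes>\<^bsub>Q\<^esub> q2 \<otimes>\<^bsub>Q\<^esub> j u2 \<and>
        v \<otimes>\<^bsub>W\<^esub> u2 [^]\<^bsub>W\<^esub> n = w \<otimes>\<^bsub>W\<^esub> v' \<otimes>\<^bsub>W\<^esub> u1 [^]\<^bsub>W\<^esub> n"
  shows "saturated_hom W Q j"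
proof -
  have iW: "integral_monoid W" and iQ: "integral_monoid Q" and cW: "comm_monoid W" and cQ: "comm_monoid Q"
    using V Q by (auto simp: valuative_monoid_def saturated_monoid_def integral_monoid_def)
  interpret W: comm_monoid W by fact
  interpret Q: comm_monoid Q by fact
  have int: "integral_hom W Q j"
    unfolding integral_hom_def
  proof (intro conjI allI impI iW iQ j)
    fix A :: "'w sat_alg monoid" and g assume A: "integral_monoid A \<and> g \<in> mhom W A"
    have "comm_monoid A" using A by (simp add: integral_monoid_def)
    moreover have "integral_monoid (pushout W A Q g j)"
      by (rule integral_pushout_valuative[OF V conjunct1[OF A] iQ conjunct2[OF A] j])
    ultimately show "gp_of (pushout W A Q g j) \<in> iso (pushout W A Q g j) (integralisation (pushout W A Q g j))"
      by (simp add: gp_of_iso_integralisation_iff[OF comm_monoid_pushout[OF _ cQ]])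
  qed
  show ?thesis
    unfolding saturated_hom_def
  proof (intro conjI allI impI int Q valuative_imp_saturated[OF V])
    fix A :: "'w sat_alg monoid" and g assume A': "saturated_monoid A \<and> g \<in> mhom W A"
    then have A: "integral_monoid A" and g: "g \<in> mhom W A" and c: "comm_monoid A" "comm_monoid Q"
      using cQ by (auto simp: saturated_monoid_def integral_monoid_def)
    interpret A: comm_monoid A by fact
    let ?M = "pushout W A Q g j"
    have "saturated_monoid ?M"
      unfolding saturated_monoid_iff
    proof (intro conjI ballI allI impI)
      show "integral_monoid ?M" by (rule integral_pushout_valuative[OF V A iQ g j])
      fix X Y Z and n :: nat
      assume X: "X \<in> carrier ?M" and Y: "Y \<in> carrier ?M" and Z: "Z \<in> carrier ?M" and n: "n \<ge> 1"
        and eq: "X [^]\<^bsub>?M\<^esub> n = Z \<otimes>\<^bsub>?M\<^esub> Y [^]\<^bsub>?M\<^esub> n"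
      obtain x x' where x: "x \<in> carrier A" "x' \<in> carrier Q" "X = pushout_cong W A Q g j `` {(x, x')}"
        using X by (rule po_obtain[OF c])
      obtain y y' where y: "y \<in> carrier A" "y' \<in> carrier Q" "Y = pushout_cong W A Q g j `` {(y, y')}"
        using Y by (rule po_obtain[OF c])
      obtain z z' where z: "z \<in> carrier A" "z' \<in> carrier Q" "Z = pushout_cong W A Q g j `` {(z, z')}"
        using Z by (rule po_obtain[OF c])
      have "linked W A Q g j (x [^]\<^bsub>A\<^esub> n, x' [^]\<^bsub>Q\<^esub> n) (z \<otimes>\<^bsub>A\<^esub> y [^]\<^bsub>A\<^esub> n, z' \<otimes>\<^bsub>Q\<^esub> y' [^]\<^bsub>Q\<^esub> n)"
        using eq x y z by (simp add: po_mult[OF c] po_pow[OF c] po_eq_linked[OF V A iQ g j])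
      then obtain v v' where v: "v \<in> carrier W" "v' \<in> carrier W"
        "x [^]\<^bsub>A\<^esub> n \<otimes>\<^bsub>A\<^esub> g v' = z \<otimes>\<^bsub>A\<^esub> y [^]\<^bsub>A\<^esub> n \<otimes>\<^bsub>A\<^esub> g v"
        "z' \<otimes>\<^bsub>Q\<^esub> y' [^]\<^bsub>Q\<^esub> n \<otimes>\<^bsub>Q\<^esub> j v' = x' [^]\<^bsub>Q\<^esub> n \<otimes>\<^bsub>Q\<^esub> j v"
        by (auto simp: linked_def)
      from div[OF x(2) y(2) z(2) v(1,2) n v(4)[symmetric]]
      obtain u1 u2 q w where u: "u1 \<in> carrier W" "u2 \<in> carrier W" "q \<in> carrier Q" "w \<in> carrier W"
        "x' \<otimes>\<^bsub>Q\<^esub> j u1 = q \<otimes>\<^bsub>Q\<^esub> y' \<otimes>\<^bsub>Q\<^esub> j u2"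
        "v \<otimes>\<^bsub>W\<^esub> u2 [^]\<^bsub>W\<^esub> n = w \<otimes>\<^bsub>W\<^esub> v' \<otimes>\<^bsub>W\<^esub> u1 [^]\<^bsub>W\<^esub> n" by (elim bexE conjE)
      note F = v(1,2)[THEN mhom_closed[OF g]] u(1,2,4)[THEN mhom_closed[OF g]]
      have "(x \<otimes>\<^bsub>A\<^esub> g u2) [^]\<^bsub>A\<^esub> n \<otimes>\<^bsub>A\<^esub> g v' = (x [^]\<^bsub>A\<^esub> n \<otimes>\<^bsub>A\<^esub> g v') \<otimes>\<^bsub>A\<^esub> g u2 [^]\<^bsub>A\<^esub> n"
        using x F by (simp add: A.nat_pow_distrib A.m_ac)
      also have "\<dots> = z \<otimes>\<^bsub>A\<^esub> y [^]\<^bsub>A\<^esub> n \<otimes>\<^bsub>A\<^esub> g (v \<otimes>\<^bsub>W\<^esub> u2 [^]\<^bsub>W\<^esub> n)"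
        unfolding v(3) using y z F v(1) u(2) by (simp add: mhom_mult[OF g] mhom_pow[OF g cW c(1)] A.m_ac)
      also have "\<dots> = (z \<otimes>\<^bsub>A\<^esub> g w \<otimes>\<^bsub>A\<^esub> (y \<otimes>\<^bsub>A\<^esub> g u1) [^]\<^bsub>A\<^esub> n) \<otimes>\<^bsub>A\<^esub> g v'"
        unfolding u(6) using y z F v(2) u(1,4)
        by (simp add: mhom_mult[OF g] mhom_pow[OF g cW c(1)] A.nat_pow_distrib A.m_ac)
      finally have "(x \<otimes>\<^bsub>A\<^esub> g u2) [^]\<^bsub>A\<^esub> n = z \<otimes>\<^bsub>A\<^esub> g w \<otimes>\<^bsub>A\<^esub> (y \<otimes>\<^bsub>A\<^esub> g u1) [^]\<^bsub>A\<^esub> n"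
        by (rule integral_cancel[OF A]) (use x y z F in simp_all)
      moreover have "\<forall>a\<in>carrier A. \<forall>b\<in>carrier A. \<forall>z\<in>carrier A. \<forall>n::nat. n \<ge> 1 \<longrightarrow>
        a [^]\<^bsub>A\<^esub> n = z \<otimes>\<^bsub>A\<^esub> b [^]\<^bsub>A\<^esub> n \<longrightarrow> (\<exists>w\<in>carrier A. a = w \<otimes>\<^bsub>A\<^esub> b)"
        using A' by (simp add: saturated_monoid_iff)
      moreover have "x \<otimes>\<^bsub>A\<^esub> g u2 \<in> carrier A" "y \<otimes>\<^bsub>A\<^esub> g u1 \<in> carrier A" "z \<otimes>\<^bsub>A\<^esub> g w \<in> carrier A"
        using x y z F by simp_all
      ultimately have "\<exists>p\<in>carrier A. x \<otimes>\<^bsub>A\<^esub> g u2 = p \<otimes>\<^bsub>A\<^esub> (y \<otimes>\<^bsub>A\<^esub> g u1)"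
        using n by blast
      then obtain p where p: "p \<in> carrier A" "x \<otimes>\<^bsub>A\<^esub> g u2 = p \<otimes>\<^bsub>A\<^esub> (y \<otimes>\<^bsub>A\<^esub> g u1)" by (elim bexE)
      have "linked W A Q g j (x, x') (p \<otimes>\<^bsub>A\<^esub> y, q \<otimes>\<^bsub>Q\<^esub> y')"
        unfolding linked_def using p u(5) u(1,2) F y by (intro bexI[of _ u1] bexI[of _ u2]) (simp_all add: A.m_assoc)
      then have "X = pushout_cong W A Q g j `` {(p, q)} \<otimes>\<^bsub>?M\<^esub> Y"
        using x y p(1) u(3) by (simp add: po_mult[OF c] po_eq_linked[OF V A iQ g j])
      then show "\<exists>w\<in>carrier ?M. X = w \<otimes>\<^bsub>?M\<^esub> Y" using po_in[OF c p(1) u(3)] by (rule bexI)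
    qed
    then show "gp_of ?M \<in> iso ?M (saturation ?M)"
      by (simp add: gp_of_iso_saturation_iff[OF comm_monoid_pushout[OF c]])
  qed
qed

text \<open>The criterion is the division theorem applied to the quotients \<open>q1 / q2\<close> and \<open>v / v'\<close>; the element \<open>u\<close>
that it returns is a fraction of elements of \<open>W\<close>.\<close>

theorem (in cone_hom) saturated:
  fixes Wm :: "'w monoid"
  assumes Wm: "valuative_monoid Wm" and \<iota>: "\<iota> \<in> mhom Wm G" "inj_on \<iota> (carrier Wm)" "\<iota> ` carrier Wm = W"
    and Qm: "saturated_monoid (L\<lparr>carrier := Q\<rparr>)"
  shows "saturated_hom Wm (L\<lparr>carrier := Q\<rparr>) (\<lambda>w. \<psi> (\<iota> w))"
proof -
  have cW: "comm_monoid Wm" using Wm by (simp add: valuative_monoid_def integral_monoid_def)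
  interpret Wm: comm_monoid Wm by fact
  let ?Q = "L\<lparr>carrier := Q\<rparr>"
  have \<iota>W: "\<iota> w \<in> W" if "w \<in> carrier Wm" for w using \<iota>(3) that by auto
  have \<iota>C [simp]: "\<iota> w \<in> carrier G" if "w \<in> carrier Wm" for w using \<iota>W[OF that] by simp
  have \<iota>_inv: "\<exists>w\<in>carrier Wm. \<iota> w = g" if "g \<in> W" for g using \<iota>(3) that by auto
  note \<iota>_mult = mhom_mult[OF \<iota>(1)]
  have \<iota>_pow: "\<iota> (w [^]\<^bsub>Wm\<^esub> n) = \<iota> w [^]\<^bsub>G\<^esub> int n" if "w \<in> carrier Wm" for w and n :: nat
    using mhom_pow[OF \<iota>(1) cW G.comm_monoid_axioms that] by (simp add: int_pow_int)
  have pow: "x [^]\<^bsub>?Q\<^esub> n = x [^]\<^bsub>L\<^esub> int n" for x and n :: nat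
    unfolding int_pow_int by (induction n) (simp_all add: pow_rec)
  have j: "(\<lambda>w. \<psi> (\<iota> w)) \<in> mhom Wm ?Q"
    using W_Q \<iota>W by (auto simp: mhom_def[of Wm ?Q] hom_def \<iota>_mult mhom_one[OF \<iota>(1)] \<psi>_mult \<psi>_one)
  show ?thesis
  proof (rule saturated_homI[OF Wm Qm j])
    fix q1 q2 x v v' and n :: nat
    assume q: "q1 \<in> carrier ?Q" "q2 \<in> carrier ?Q" "x \<in> carrier ?Q" and v: "v \<in> carrier Wm" "v' \<in> carrier Wm"
      and n: "n \<ge> 1" and eq: "q1 [^]\<^bsub>?Q\<^esub> n \<otimes>\<^bsub>?Q\<^esub> \<psi> (\<iota> v) = x \<otimes>\<^bsub>?Q\<^esub> q2 [^]\<^bsub>?Q\<^esub> n \<otimes>\<^bsub>?Q\<^esub> \<psi> (\<iota> v')"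
    have C: "q1 \<in> carrier L" "q2 \<in> carrier L" "x \<in> carrier L" "x \<in> Q" using q by auto
    define q0 where "q0 = q1 \<otimes>\<^bsub>L\<^esub> inv\<^bsub>L\<^esub> q2"
    define v0 where "v0 = \<iota> v \<otimes>\<^bsub>G\<^esub> inv\<^bsub>G\<^esub> (\<iota> v')"
    have "q0 [^]\<^bsub>L\<^esub> int n \<otimes>\<^bsub>L\<^esub> \<psi> v0 =
        (q1 [^]\<^bsub>L\<^esub> int n \<otimes>\<^bsub>L\<^esub> \<psi> (\<iota> v)) \<otimes>\<^bsub>L\<^esub> (inv\<^bsub>L\<^esub> (q2 [^]\<^bsub>L\<^esub> int n) \<otimes>\<^bsub>L\<^esub> inv\<^bsub>L\<^esub> (\<psi> (\<iota> v')))"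
      using C v by (simp add: q0_def v0_def L.int_pow_distrib L.int_pow_inv \<psi>_mult \<psi>_inv L.m_ac)
    also have "\<dots> = x \<otimes>\<^bsub>L\<^esub> q2 [^]\<^bsub>L\<^esub> int n \<otimes>\<^bsub>L\<^esub> \<psi> (\<iota> v') \<otimes>\<^bsub>L\<^esub> (inv\<^bsub>L\<^esub> (q2 [^]\<^bsub>L\<^esub> int n) \<otimes>\<^bsub>L\<^esub> inv\<^bsub>L\<^esub> (\<psi> (\<iota> v')))"
      using eq by (simp add: pow)
    also have "\<dots> = x" using C v by (simp add: L.m_ac)
    finally have "q0 [^]\<^bsub>L\<^esub> int n \<otimes>\<^bsub>L\<^esub> \<psi> v0 \<in> Q" using C(4) by simp
    from division[OF _ _ _ this] C v n obtain u where
      u: "u \<in> carrier G" "q0 \<otimes>\<^bsub>L\<^esub> \<psi> u \<in> Q" "v0 \<otimes>\<^bsub>G\<^esub> inv\<^bsub>G\<^esub> (u [^]\<^bsub>G\<^esub> int n) \<in> W"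
      by (auto simp: q0_def v0_def)
    obtain u1 u2 where u12: "u1 \<in> carrier Wm" "u2 \<in> carrier Wm" "u = \<iota> u1 \<otimes>\<^bsub>G\<^esub> inv\<^bsub>G\<^esub> (\<iota> u2)"
    proof (cases "u \<in> W")
      case True
      then obtain w where "w \<in> carrier Wm" "\<iota> w = u" using \<iota>_inv by blast
      then show thesis using that[of w "\<one>\<^bsub>Wm\<^esub>"] u(1) by (simp add: mhom_one[OF \<iota>(1)])
    next
      case False
      then have "inv\<^bsub>G\<^esub> u \<in> W" using W_val[OF u(1)] by simp
      then obtain w where "w \<in> carrier Wm" "\<iota> w = inv\<^bsub>G\<^esub> u" using \<iota>_inv by blast
      then show thesis using that[of "\<one>\<^bsub>Wm\<^esub>" w] u(1) by (simp add: mhom_one[OF \<iota>(1)])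
    qed
    obtain w where w: "w \<in> carrier Wm" "\<iota> w = v0 \<otimes>\<^bsub>G\<^esub> inv\<^bsub>G\<^esub> (u [^]\<^bsub>G\<^esub> int n)" using \<iota>_inv[OF u(3)] by (elim bexE)
    have "q1 \<otimes>\<^bsub>L\<^esub> \<psi> (\<iota> u1) = (q0 \<otimes>\<^bsub>L\<^esub> \<psi> u) \<otimes>\<^bsub>L\<^esub> q2 \<otimes>\<^bsub>L\<^esub> \<psi> (\<iota> u2)"
      using C u12 by (simp add: q0_def \<psi>_mult \<psi>_inv L.m_ac)
    moreover have "v \<otimes>\<^bsub>Wm\<^esub> u2 [^]\<^bsub>Wm\<^esub> n = w \<otimes>\<^bsub>Wm\<^esub> v' \<otimes>\<^bsub>Wm\<^esub> u1 [^]\<^bsub>Wm\<^esub> n"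
    proof (rule inj_onD[OF \<iota>(2)])
      show "\<iota> (v \<otimes>\<^bsub>Wm\<^esub> u2 [^]\<^bsub>Wm\<^esub> n) = \<iota> (w \<otimes>\<^bsub>Wm\<^esub> v' \<otimes>\<^bsub>Wm\<^esub> u1 [^]\<^bsub>Wm\<^esub> n)"
        using v u12 w by (simp add: \<iota>_mult \<iota>_pow v0_def G.int_pow_distrib G.int_pow_inv G.inv_mult G.m_ac)
    qed (use v u12 w in auto)
    ultimately have "q1 \<otimes>\<^bsub>?Q\<^esub> \<psi> (\<iota> u1) = (q0 \<otimes>\<^bsub>L\<^esub> \<psi> u) \<otimes>\<^bsub>?Q\<^esub> q2 \<otimes>\<^bsub>?Q\<^esub> \<psi> (\<iota> u2) \<and>
        v \<otimes>\<^bsub>Wm\<^esub> u2 [^]\<^bsub>Wm\<^esub> n = w \<otimes>\<^bsub>Wm\<^esub> v' \<otimes>\<^bsub>Wm\<^esub> u1 [^]\<^bsub>Wm\<^esub> n" by simp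
    then show "\<exists>u1\<in>carrier Wm. \<exists>u2\<in>carrier Wm. \<exists>y\<in>carrier ?Q. \<exists>w\<in>carrier Wm.
        q1 \<otimes>\<^bsub>?Q\<^esub> \<psi> (\<iota> u1) = y \<otimes>\<^bsub>?Q\<^esub> q2 \<otimes>\<^bsub>?Q\<^esub> \<psi> (\<iota> u2) \<and>
        v \<otimes>\<^bsub>Wm\<^esub> u2 [^]\<^bsub>Wm\<^esub> n = w \<otimes>\<^bsub>Wm\<^esub> v' \<otimes>\<^bsub>Wm\<^esub> u1 [^]\<^bsub>Wm\<^esub> n"
      using u12(1,2) u(2) w(1) by (intro bexI[of _ u1] bexI[of _ u2] bexI[of _ "q0 \<otimes>\<^bsub>L\<^esub> \<psi> u"] bexI[of _ w]) simp_all
  qed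
qed

section \<open>Adjoining roots to a valuative monoid\<close>

text \<open>The quotient is generated by \<open>k\<close> elements of order dividing \<open>m\<close>, so the exponents can be reduced modulo \<open>m\<close>.\<close>

lemma (in comm_group) quotient_by_root_extension:
  assumes I: "subgroup I G" and e: "\<And>j. j < k \<Longrightarrow> e j \<in> carrier G" and m: "m \<ge> (1::nat)"
    and em: "\<And>j. j < k \<Longrightarrow> e j [^] m \<in> I"
    and gen: "\<And>x. x \<in> carrier G \<Longrightarrow> \<exists>y\<in>I. \<exists>d. x = y \<otimes> mon G k e d"
  shows "finite (carrier (G Mod I))" "\<And>X. X \<in> carrier (G Mod I) \<Longrightarrow> X [^]\<^bsub>G Mod I\<^esub> m = \<one>\<^bsub>G Mod I\<^esub>"
    "\<And>x. x \<in> carrier G \<Longrightarrow> x [^] m \<in> I"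
proof -
  interpret N: normal I G using subgroup_imp_normal[OF I] .
  have e_m: "mon G k e (\<lambda>j. int m * d j) \<in> I" for d
  proof -
    have "mon G k e (\<lambda>j. int m * d j) = mon G k e d [^] int m" using e by (simp add: mon_scale)
    also have "\<dots> = mon G k (\<lambda>j. e j [^] int m) d" using e by (simp add: mon_pow)
    also have "\<dots> \<in> I" by (rule mon_subgroup[OF I]) (use em in \<open>simp add: int_pow_int\<close>)
    finally show ?thesis .
  qed
  show pow: "x [^] m \<in> I" if x: "x \<in> carrier G" for x
  proof -
    obtain y d where y: "y \<in> I" "x = y \<otimes> mon G k e d" using gen[OF x] by (elim bexE exE)
    have yC: "y \<in> carrier G" using y(1) by simp
    have "x [^] m = x [^] int m" by (simp add: int_pow_int)
    also have "\<dots> = y [^] int m \<otimes> mon G k e (\<lambda>j. int m * d j)"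
      using yC e by (simp add: y(2) int_pow_distrib mon_scale)
    also have "\<dots> \<in> I" using y(1) e_m by (simp add: subgroup_int_pow_closed[OF I])
    finally show ?thesis .
  qed
  show "X [^]\<^bsub>G Mod I\<^esub> m = \<one>\<^bsub>G Mod I\<^esub>" if X: "X \<in> carrier (G Mod I)" for X
  proof -
    obtain x where x: "x \<in> carrier G" "X = I #> x" using X by (auto simp: carrier_FactGroup)
    then show ?thesis using pow[OF x(1)] by (simp add: N.FactGroup_pow coset_join2[OF _ I])
  qed
  define D where "D = {d :: nat \<Rightarrow> int. \<forall>j. (j \<in> {..<k} \<longrightarrow> d j \<in> {0..<int m}) \<and> (j \<notin> {..<k} \<longrightarrow> d j = 0)}"
  have "finite D" unfolding D_def by (rule finite_set_of_finite_funs) simp_all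
  moreover have "carrier (G Mod I) \<subseteq> (\<lambda>d. I #> mon G k e d) ` D"
  proof
    fix X assume "X \<in> carrier (G Mod I)"
    then obtain x where x: "x \<in> carrier G" "X = I #> x" by (auto simp: carrier_FactGroup)
    obtain y d where y: "y \<in> I" "x = y \<otimes> mon G k e d" using gen[OF x(1)] by (elim bexE exE)
    have yC: "y \<in> carrier G" using y(1) by simp
    define d' where "d' j = (if j < k then d j mod int m else 0)" for j
    have "mon G k e d = mon G k e (\<lambda>j. int m * (d j div int m) + d' j)"
      by (rule mon_cong) (simp_all add: d'_def)
    then have "x = (y \<otimes> mon G k e (\<lambda>j. int m * (d j div int m))) \<otimes> mon G k e d'"
      using e yC by (simp add: y(2) mon_add m_assoc)
    moreover have "y \<otimes> mon G k e (\<lambda>j. int m * (d j div int m)) \<in> I" using y(1) e_m by simp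
    ultimately obtain y0 where y0: "y0 \<in> I" "x = y0 \<otimes> mon G k e d'" by (intro that)
    have "I #> x = (I #> y0) #> mon G k e d'"
      using y0 e subgroup.subset[OF I] by (simp add: coset_mult_assoc)
    then have "X = I #> mon G k e d'" using y0(1) by (simp add: x(2) coset_join2[OF _ I])
    moreover have "d' \<in> D" using m by (auto simp: D_def d'_def)
    ultimately show "X \<in> (\<lambda>d. I #> mon G k e d) ` D" by (rule image_eqI)
  qed
  ultimately show "finite (carrier (G Mod I))" by (meson finite_imageI finite_subset)
qed

text \<open>A prime divisor of the order is the order of a subgroup, whose elements would be killed by two coprime
numbers.\<close>

lemma (in group) coprime_order:
  assumes fin: "finite (carrier G)" and l: "prime (l::nat)" and m: "coprime m l"
    and tors: "\<And>x. x \<in> carrier G \<Longrightarrow> x [^] (m::nat) = \<one>"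
  shows "coprime (card (carrier G)) l"
proof (rule ccontr)
  assume "\<not> coprime (card (carrier G)) l"
  then have "l dvd order G" using l by (metis order_def prime_imp_coprime coprime_commute)
  then obtain c where "order G = l ^ 1 * c" by auto
  from sylow_thm[OF l group_axioms this fin] obtain H where H: "subgroup H G" "card H = l" by auto
  have finH: "finite H" using subgroup.subset[OF H(1)] fin by (rule finite_subset)
  interpret H: group "G\<lparr>carrier := H\<rparr>" by (rule subgroup.subgroup_is_group[OF H(1) group_axioms])
  have "H \<subseteq> {\<one>}"
  proof
    fix x assume x: "x \<in> H"
    then have xC: "x \<in> carrier G" using subgroup.subset[OF H(1)] by auto
    have "x [^] l = \<one>"
      using H.pow_order_eq_1[of x] x H(2) by (simp add: order_def nat_pow_consistent[symmetric])
    then have "ord x dvd l" "ord x dvd m" using tors xC by (simp_all add: pow_eq_id[symmetric])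
    then have "ord x = 1" using m by (metis coprime_common_divisor_nat nat_dvd_1_iff_1)
    then show "x \<in> {\<one>}" using pow_ord_eq_1[OF xC] xC by simp
  qed
  then have "card H \<le> 1" using card_mono[of "{\<one>}" H] by simp
  then show False using H(2) l prime_gt_1_nat[OF l] by simp
qed

lemma gp_map_inj:
  assumes M: "integral_monoid M" and N: "integral_monoid N" and f: "f \<in> mhom M N" and inj: "inj_on f (carrier M)"
  shows "inj_on (gp_map N f) (carrier (gp M))"
proof -
  have cM: "comm_monoid M" and cN: "comm_monoid N" using M N by (auto simp: integral_monoid_def)
  interpret M: comm_monoid M by fact
  interpret N: comm_monoid N by fact
  show ?thesis
  proof (rule inj_onI)
    fix x y assume x: "x \<in> carrier (gp M)" and y: "y \<in> carrier (gp M)" and eq: "gp_map N f x = gp_map N f y"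
    obtain a b where a: "a \<in> carrier M" "b \<in> carrier M" "x = gp_frac M a b" using x by (rule gp_obtain[OF cM])
    obtain c d where c: "c \<in> carrier M" "d \<in> carrier M" "y = gp_frac M c d" using y by (rule gp_obtain[OF cM])
    note C = a(1,2)[THEN mhom_closed[OF f]] c(1,2)[THEN mhom_closed[OF f]]
    have "gp_frac N (f a) (f b) = gp_frac N (f c) (f d)"
      using eq a c by (simp add: gp_map_frac[OF cM cN f])
    then obtain t where t: "t \<in> carrier N" "f a \<otimes>\<^bsub>N\<^esub> f d \<otimes>\<^bsub>N\<^esub> t = f c \<otimes>\<^bsub>N\<^esub> f b \<otimes>\<^bsub>N\<^esub> t"
      using C by (auto simp: Defs.frac_eq[OF cN])
    have "f a \<otimes>\<^bsub>N\<^esub> f d = f c \<otimes>\<^bsub>N\<^esub> f b" by (rule integral_cancel[OF N t(2)]) (use C t in auto)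
    then have "f (a \<otimes>\<^bsub>M\<^esub> d) = f (c \<otimes>\<^bsub>M\<^esub> b)" using a c by (simp add: mhom_mult[OF f])
    then have "a \<otimes>\<^bsub>M\<^esub> d = c \<otimes>\<^bsub>M\<^esub> b" by (rule inj_onD[OF inj]) (use a c in auto)
    then have "\<exists>t\<in>carrier M. a \<otimes>\<^bsub>M\<^esub> d \<otimes>\<^bsub>M\<^esub> t = c \<otimes>\<^bsub>M\<^esub> b \<otimes>\<^bsub>M\<^esub> t" by (intro bexI[of _ "\<one>\<^bsub>M\<^esub>"]) simp_all
    then show "x = y" using a c by (simp add: Defs.frac_eq[OF cM])
  qed
qed

definition roots_rel :: "nat \<Rightarrow> nat \<Rightarrow> 'a monoid \<Rightarrow> (nat \<Rightarrow> 'a) \<Rightarrow> (('a \<times> (nat \<Rightarrow> nat)) \<times> ('a \<times> (nat \<Rightarrow> nat))) set" where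
  "roots_rel m k V v = (\<lambda>j. ((\<one>\<^bsub>V\<^esub>, \<lambda>i. if i = j then m else 0), (v j, \<lambda>_. 0))) ` {..<k}"

definition roots_cong :: "nat \<Rightarrow> nat \<Rightarrow> 'a monoid \<Rightarrow> (nat \<Rightarrow> 'a) \<Rightarrow> (('a \<times> (nat \<Rightarrow> nat)) \<times> ('a \<times> (nat \<Rightarrow> nat))) set" where
  "roots_cong m k V v = gen_cong (V \<times>\<times> free_cmonoid k) (roots_rel m k V v)"

text \<open>\<open>A\<close> is obtained from \<open>V\<close> by freely adjoining \<open>m\<close>-th roots of the elements \<open>v j\<close>, and \<open>W\<close> is its saturation.
The image of \<open>x e_0^(n_0) e_1^(n_1) ...\<close> in \<open>W\<close> is \<open>adj x n\<close>, so that \<open>h\<close> is the canonical map from \<open>V\<close> and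
\<open>\<epsilon> j\<close> is the adjoined root of \<open>v j\<close>.\<close>

locale root_extension =
  fixes V :: "'a monoid" and m k :: nat and v :: "nat \<Rightarrow> 'a"
  assumes V: "valuative_monoid V" and m: "m \<ge> 1" and v: "\<And>j. j < k \<Longrightarrow> v j \<in> carrier V"
begin

abbreviation N :: "('a \<times> (nat \<Rightarrow> nat)) monoid" where "N \<equiv> V \<times>\<times> free_cmonoid k"
abbreviation R :: "(('a \<times> (nat \<Rightarrow> nat)) \<times> ('a \<times> (nat \<Rightarrow> nat))) set" where "R \<equiv> roots_cong m k V v"
definition A :: "'a fg_alg monoid" where "A = quotient_monoid N R"
definition W :: "'a sat_alg monoid" where "W = saturation A"
definition adj :: "'a \<Rightarrow> (nat \<Rightarrow> nat) \<Rightarrow> 'a sat_alg" where "adj x e = gp_of A (R `` {(x, e)})"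
definition h :: "'a \<Rightarrow> 'a sat_alg" where "h x = adj x (\<lambda>_. 0)"
definition \<epsilon> :: "nat \<Rightarrow> 'a sat_alg" where "\<epsilon> j = adj \<one>\<^bsub>V\<^esub> (\<lambda>i. if i = j then 1 else 0)"

lemma iV: "integral_monoid V" and cV: "comm_monoid V" and sV: "saturated_monoid V"
  using V valuative_imp_saturated[OF V] by (auto simp: valuative_monoid_def integral_monoid_def)

sublocale V: comm_monoid V by (rule cV)
sublocale GV: comm_group "gp V" by (rule gp_comm_group[OF cV])

lemma cN: "comm_monoid N" by (rule comm_monoid_DirProd[OF cV comm_monoid_free])
lemma mc: "mcong N R" unfolding roots_cong_def by (rule mcong_gen_cong[OF cN])
lemma cA: "comm_monoid A" unfolding A_def by (rule quot_comm_monoid[OF cN mc])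

sublocale A: comm_monoid A by (rule cA)
sublocale GA: comm_group "gp A" by (rule gp_comm_group[OF cA])

lemma sW: "saturated_monoid W" unfolding W_def by (rule saturated_monoid_saturation[OF cA])
lemma iW: "integral_monoid W" and cW: "comm_monoid W" using sW by (auto simp: saturated_monoid_def integral_monoid_def)

sublocale W: comm_monoid W by (rule cW)
sublocale GW: comm_group "gp W" by (rule gp_comm_group[OF cW])

lemma W_simps: "x \<otimes>\<^bsub>W\<^esub> y = x \<otimes>\<^bsub>gp A\<^esub> y" "\<one>\<^bsub>W\<^esub> = \<one>\<^bsub>gp A\<^esub>" "x [^]\<^bsub>W\<^esub> (n::nat) = x [^]\<^bsub>gp A\<^esub> n"
  by (simp_all add: W_def saturation_def gp_pow_consistent)

lemma class_hom: "(\<lambda>x. R `` {x}) \<in> mhom N A"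
  unfolding A_def by (rule mhomI) (simp_all add: quot_class_in[OF cN mc] quot_mult[OF cN mc] quot_one[OF cN mc] del: DirProd_def)

lemma adj_hom: "(\<lambda>(x, e). adj x e) \<in> mhom N W"
proof (rule mhomI)
  fix x assume "x \<in> carrier N"
  then show "(case x of (x, e) \<Rightarrow> adj x e) \<in> carrier W"
    using gp_of_in_saturation[OF cA mhom_closed[OF class_hom]] by (cases x) (simp add: W_def adj_def)
next
  fix x y assume xy: "x \<in> carrier N" "y \<in> carrier N"
  have "gp_of A (R `` {x \<otimes>\<^bsub>N\<^esub> y}) = gp_of A (R `` {x}) \<otimes>\<^bsub>gp A\<^esub> gp_of A (R `` {y})"
    using mhom_mult[OF class_hom xy] mhom_mult[OF gp_of_hom[OF cA]] xy mhom_closed[OF class_hom] by simp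
  then show "(case x \<otimes>\<^bsub>N\<^esub> y of (x, e) \<Rightarrow> adj x e) =
      (case x of (x, e) \<Rightarrow> adj x e) \<otimes>\<^bsub>W\<^esub> (case y of (x, e) \<Rightarrow> adj x e)"
    by (cases "x \<otimes>\<^bsub>N\<^esub> y"; cases x; cases y) (simp only: adj_def W_simps prod.case)
next
  show "(case \<one>\<^bsub>N\<^esub> of (x, e) \<Rightarrow> adj x e) = \<one>\<^bsub>W\<^esub>"
    using mhom_one[OF class_hom] mhom_one[OF gp_of_hom[OF cA]]
    by (cases "\<one>\<^bsub>N\<^esub>") (simp only: adj_def W_simps prod.case)
qed

lemma zero_free: "(\<lambda>_. 0) \<in> carrier (free_cmonoid k)" "\<one>\<^bsub>free_cmonoid k\<^esub> = (\<lambda>_. 0)"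
  by (simp_all add: free_cmonoid_def)

lemma h_hom: "h \<in> mhom V W"
proof -
  have "(x \<otimes>\<^bsub>V\<^esub> y, \<lambda>_. 0) = (x, \<lambda>_. 0) \<otimes>\<^bsub>N\<^esub> (y, \<lambda>_. 0)" for x y by (simp add: free_cmonoid_def)
  then show ?thesis
    using mhom_closed[OF adj_hom] mhom_mult[OF adj_hom] mhom_one[OF adj_hom] zero_free
    by (intro mhomI) (fastforce simp: h_def one_DirProd)+
qed

lemma \<epsilon>_in: "j < k \<Longrightarrow> \<epsilon> j \<in> carrier W"
  using mhom_closed[OF adj_hom, of "(\<one>\<^bsub>V\<^esub>, \<lambda>i. if i = j then 1 else 0)"]
  by (simp add: \<epsilon>_def free_cmonoid_def)

lemma \<epsilon>_pow:
  assumes "j < k" shows "\<epsilon> j [^]\<^bsub>W\<^esub> m = h (v j)"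
proof -
  let ?u = "(\<one>\<^bsub>V\<^esub>, \<lambda>i. if i = j then 1 else 0 :: nat)"
  have u: "?u \<in> carrier N" using assms by (simp add: free_cmonoid_def)
  have um: "?u [^]\<^bsub>N\<^esub> m = (\<one>\<^bsub>V\<^esub>, \<lambda>i. if i = j then m else 0)"
    by (auto simp: DirProd_pow free_pow)
  have "\<epsilon> j [^]\<^bsub>W\<^esub> m = (\<lambda>(x, e). adj x e) (?u [^]\<^bsub>N\<^esub> m)"
    using mhom_pow[OF adj_hom cN cW u, of m] by (simp add: \<epsilon>_def)
  also have "\<dots> = adj \<one>\<^bsub>V\<^esub> (\<lambda>i. if i = j then m else 0)" by (simp add: um)
  also have "R `` {(\<one>\<^bsub>V\<^esub>, \<lambda>i. if i = j then m else 0)} = R `` {(v j, \<lambda>_. 0)}"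
    using assms v[OF assms] by (subst quot_class_eq[OF cN mc])
      (auto simp: free_cmonoid_def roots_cong_def roots_rel_def intro!: gen_cong_base)
  then have "adj \<one>\<^bsub>V\<^esub> (\<lambda>i. if i = j then m else 0) = h (v j)" by (simp add: h_def adj_def)
  finally show ?thesis .
qed

text \<open>The relation \<open>e_j^m = v_j\<close> changes the exponents by multiples of \<open>m\<close>. Two elements of \<open>V\<close> that become equal
have the same exponents, so every relation has been used with total multiplicity zero.\<close>

lemma h_inj: "inj_on h (carrier V)"
proof (rule inj_onI)
  fix x y assume xy: "x \<in> carrier V" "y \<in> carrier V" "h x = h y"
  note gh = gp_of_hom[OF cV]
  let ?s = "\<lambda>j. (\<one>\<^bsub>V\<^esub>, \<lambda>i::nat. if i = j then m else 0)" and ?s' = "\<lambda>j. (v j, \<lambda>_::nat. 0 :: nat)"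
  let ?\<gamma> = "\<lambda>j. gp_of V (fst (?s' j)) \<otimes>\<^bsub>gp V\<^esub> inv\<^bsub>gp V\<^esub> (gp_of V (fst (?s j)))"
  have C: "R `` {(z, \<lambda>_. 0)} \<in> carrier A" if "z \<in> carrier V" for z
    using mhom_closed[OF class_hom, of "(z, \<lambda>_. 0)"] that zero_free by simp
  obtain T where T: "T \<in> carrier A" "R `` {(x, \<lambda>_. 0)} \<otimes>\<^bsub>A\<^esub> T = R `` {(y, \<lambda>_. 0)} \<otimes>\<^bsub>A\<^esub> T"
    using xy(3) unfolding h_def adj_def gp_of_eq[OF cA C[OF xy(1)] C[OF xy(2)]] by (elim bexE)
  obtain t where t: "t \<in> carrier N" "T = R `` {t}" using T(1) unfolding A_def by (rule quot_obtain[OF cN mc])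
  have xN: "(x, \<lambda>_. 0) \<in> carrier N" "(y, \<lambda>_. 0) \<in> carrier N" using xy zero_free by simp_all
  interpret N: comm_monoid N by (rule cN)
  have "R `` {(x, \<lambda>_. 0) \<otimes>\<^bsub>N\<^esub> t} = R `` {(y, \<lambda>_. 0) \<otimes>\<^bsub>N\<^esub> t}"
    using T(2) by (simp only: t(2) A_def quot_mult[OF cN mc xN(1) t(1)] quot_mult[OF cN mc xN(2) t(1)])
  then have "((x, \<lambda>_. 0) \<otimes>\<^bsub>N\<^esub> t, (y, \<lambda>_. 0) \<otimes>\<^bsub>N\<^esub> t) \<in> R"
    by (subst (asm) quot_class_eq[OF cN mc N.m_closed[OF xN(1) t(1)] N.m_closed[OF xN(2) t(1)]])
  then have "((x, \<lambda>_. 0) \<otimes>\<^bsub>N\<^esub> t, (y, \<lambda>_. 0) \<otimes>\<^bsub>N\<^esub> t) \<in> gen_cong N ((\<lambda>j. (?s j, ?s' j)) ` {..<k})"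
    unfolding roots_cong_def roots_rel_def .
  from gen_cong_difference[OF cV _ this] obtain n where
    n: "gp_of V (y \<otimes>\<^bsub>V\<^esub> fst t) = gp_of V (x \<otimes>\<^bsub>V\<^esub> fst t) \<otimes>\<^bsub>gp V\<^esub> mon (gp V) k ?\<gamma> n"
      "\<forall>i<k. 0 = (\<Sum>j<k. n j * int (if i = j then m else 0))"
    using v by (auto simp: mult_DirProd' free_cmonoid_def)
  have "n i = 0" if i: "i < k" for i
  proof -
    have "(\<Sum>j<k. n j * int (if i = j then m else 0)) = (\<Sum>j<k. if i = j then n j * int m else 0)"
      by (rule sum.cong) auto
    then show ?thesis using n(2) i m by simp
  qed
  then have "mon (gp V) k ?\<gamma> n = \<one>\<^bsub>gp V\<^esub>" by (rule GV.mon_0)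
  moreover have tV: "fst t \<in> carrier V" using t(1) by auto
  ultimately have "gp_of V (x \<otimes>\<^bsub>V\<^esub> fst t) = gp_of V (y \<otimes>\<^bsub>V\<^esub> fst t)"
    using n(1) xy mhom_closed[OF gh] by simp
  moreover have "inj_on (gp_of V) (carrier V)" using iV by (simp add: integral_monoid_def)
  ultimately have "x \<otimes>\<^bsub>V\<^esub> fst t = y \<otimes>\<^bsub>V\<^esub> fst t" using xy tV by (auto dest: inj_onD)
  then show "x = y" by (rule integral_cancel[OF iV]) (use xy tV in auto)
qed

abbreviation \<iota> :: "('a \<times> 'a) set \<Rightarrow> ('a sat_alg \<times> 'a sat_alg) set" where "\<iota> \<equiv> gp_map W h"
abbreviation I :: "('a sat_alg \<times> 'a sat_alg) set set" where "I \<equiv> \<iota> ` carrier (gp V)"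
abbreviation \<eta> :: "nat \<Rightarrow> ('a sat_alg \<times> 'a sat_alg) set" where "\<eta> j \<equiv> gp_of W (\<epsilon> j)"

lemmas \<iota>_hom = gp_map_hom(1)[OF cV cW h_hom]
lemmas \<iota>_of = gp_map_hom(2)[OF cV cW h_hom]
lemmas W_of = gp_of_hom[OF cW]

lemma \<iota>_group_hom: "group_hom (gp V) (gp W) \<iota>"
  using \<iota>_hom by (intro group_hom.intro group_hom_axioms.intro GV.group_axioms GW.group_axioms) (simp add: mhom_def)

lemma I_subgroup: "subgroup I (gp W)" by (rule group_hom.img_is_subgroup[OF \<iota>_group_hom])

lemma I_C: "y \<in> I \<Longrightarrow> y \<in> carrier (gp W)" using subgroup.subset[OF I_subgroup] by auto

lemma \<eta>_C [simp]: "j < k \<Longrightarrow> \<eta> j \<in> carrier (gp W)" by (rule mhom_closed[OF W_of \<epsilon>_in])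

lemma \<eta>_pow:
  assumes "j < k" shows "\<eta> j [^]\<^bsub>gp W\<^esub> m = \<iota> (gp_of V (v j))"
  using mhom_pow[OF W_of cW GW.comm_monoid_axioms \<epsilon>_in[OF assms], of m] \<iota>_of[OF v[OF assms]] \<epsilon>_pow[OF assms] by simp

lemma gp_of_adj:
  assumes x: "x \<in> carrier V" and e: "e \<in> carrier (free_cmonoid k)"
  shows "gp_of W (adj x e) = \<iota> (gp_of V x) \<otimes>\<^bsub>gp W\<^esub> mon (gp W) k \<eta> (\<lambda>j. int (e j))"
proof -
  define \<chi> where "\<chi> z = gp_of W ((\<lambda>(x, e). adj x e) z)" for z
  have \<chi>: "\<chi> \<in> mhom N (gp W)"
    unfolding \<chi>_def using mhom_closed[OF adj_hom] mhom_mult[OF adj_hom] mhom_one[OF adj_hom]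
    by (intro mhomI) (simp_all only: mhom_closed[OF W_of] mhom_mult[OF W_of] mhom_one[OF W_of])
  from hom_free_extension[OF cV GW.comm_group_axioms \<chi> x e] show ?thesis
    using \<iota>_of[OF x] by (simp add: \<chi>_def h_def \<epsilon>_def)
qed

lemma gp_W_gen:
  assumes "g \<in> carrier (gp W)"
  shows "\<exists>y\<in>I. \<exists>d. g = y \<otimes>\<^bsub>gp W\<^esub> mon (gp W) k \<eta> d"
proof -
  let ?P = "\<lambda>g. \<exists>y\<in>I. \<exists>d. g = y \<otimes>\<^bsub>gp W\<^esub> mon (gp W) k \<eta> d"
  have div: "?P (g \<otimes>\<^bsub>gp W\<^esub> inv\<^bsub>gp W\<^esub> g')" if g: "?P g" and g': "?P g'" for g g'
  proof -
    obtain y d where y: "y \<in> I" "g = y \<otimes>\<^bsub>gp W\<^esub> mon (gp W) k \<eta> d" using g by (elim bexE exE)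
    obtain y' d' where y': "y' \<in> I" "g' = y' \<otimes>\<^bsub>gp W\<^esub> mon (gp W) k \<eta> d'" using g' by (elim bexE exE)
    have "g \<otimes>\<^bsub>gp W\<^esub> inv\<^bsub>gp W\<^esub> g' = (y \<otimes>\<^bsub>gp W\<^esub> inv\<^bsub>gp W\<^esub> y') \<otimes>\<^bsub>gp W\<^esub> mon (gp W) k \<eta> (\<lambda>j. d j - d' j)"
      using I_C[OF y(1)] I_C[OF y'(1)] by (simp add: y(2) y'(2) GW.mon_diff GW.inv_mult GW.m_ac)
    moreover have "y \<otimes>\<^bsub>gp W\<^esub> inv\<^bsub>gp W\<^esub> y' \<in> I"
      by (intro subgroup.m_closed[OF I_subgroup] subgroup.m_inv_closed[OF I_subgroup] y(1) y'(1))
    ultimately show ?thesis by (intro bexI[of _ "y \<otimes>\<^bsub>gp W\<^esub> inv\<^bsub>gp W\<^esub> y'"] exI[of _ "\<lambda>j. d j - d' j"])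
  qed
  have adj: "?P (gp_of W (adj x e))" if x: "x \<in> carrier V" "e \<in> carrier (free_cmonoid k)" for x e
    using gp_of_adj[OF x] mhom_closed[OF gp_of_hom[OF cV] x(1)]
    by (intro bexI[of _ "\<iota> (gp_of V x)"] exI[of _ "\<lambda>j. int (e j)"]) auto
  have of: "?P (gp_of W w)" if w: "w \<in> carrier W" for w
  proof -
    have wA: "w \<in> carrier (gp A)" using w by (simp add: W_def saturation_def)
    obtain X Y where XY: "X \<in> carrier A" "Y \<in> carrier A" "w = gp_frac A X Y" using wA by (rule gp_obtain[OF cA])
    obtain z where z: "z \<in> carrier N" "X = R `` {z}" using XY(1) unfolding A_def by (rule quot_obtain[OF cN mc])
    obtain z' where z': "z' \<in> carrier N" "Y = R `` {z'}" using XY(2) unfolding A_def by (rule quot_obtain[OF cN mc])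
    obtain x e where x: "x \<in> carrier V" "e \<in> carrier (free_cmonoid k)" "z = (x, e)" using z(1) by auto
    obtain x' e' where x': "x' \<in> carrier V" "e' \<in> carrier (free_cmonoid k)" "z' = (x', e')" using z'(1) by auto
    have C: "adj x e \<in> carrier W" "adj x' e' \<in> carrier W"
      using mhom_closed[OF adj_hom, of "(x, e)"] mhom_closed[OF adj_hom, of "(x', e')"] x x' by simp_all
    have "w \<otimes>\<^bsub>gp A\<^esub> gp_of A Y = gp_of A X"
      using XY(1,2) mhom_closed[OF gp_of_hom[OF cA]] by (simp add: XY(3) gp_frac_div[OF cA] GA.m_assoc)
    then have "w \<otimes>\<^bsub>W\<^esub> adj x' e' = adj x e" by (simp add: W_simps adj_def z z' x x')
    then have "gp_of W w \<otimes>\<^bsub>gp W\<^esub> gp_of W (adj x' e') = gp_of W (adj x e)"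
      using mhom_mult[OF W_of w C(2)] by simp
    then have "gp_of W w = gp_of W (adj x e) \<otimes>\<^bsub>gp W\<^esub> inv\<^bsub>gp W\<^esub> (gp_of W (adj x' e'))"
      using mhom_closed[OF W_of] w C by (simp add: GW.inv_solve_right)
    then show ?thesis using div[OF adj[OF x(1,2)] adj[OF x'(1,2)]] by simp
  qed
  obtain a b where ab: "a \<in> carrier W" "b \<in> carrier W" "g = gp_frac W a b" using assms by (rule gp_obtain[OF cW])
  show ?thesis using div[OF of[OF ab(1)] of[OF ab(2)]] by (simp only: ab(3) gp_frac_div[OF cW ab(1,2)])
qed

lemma \<eta>_pow_I: "j < k \<Longrightarrow> \<eta> j [^]\<^bsub>gp W\<^esub> m \<in> I"
  unfolding \<eta>_pow using mhom_closed[OF gp_of_hom[OF cV] v] by simp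

lemma quotient_W:
  "finite (carrier (gp W Mod I))"
  "X \<in> carrier (gp W Mod I) \<Longrightarrow> X [^]\<^bsub>gp W Mod I\<^esub> m = \<one>\<^bsub>gp W Mod I\<^esub>"
  "x \<in> carrier (gp W) \<Longrightarrow> x [^]\<^bsub>gp W\<^esub> m \<in> I"
  using GW.quotient_by_root_extension[OF I_subgroup \<eta>_C m \<eta>_pow_I gp_W_gen] by simp_all

text \<open>Every element of \<open>W\<close> has a power in \<open>V\<close>: the saturation requires one power, the roots another.\<close>

lemma power_in_V:
  assumes w: "w \<in> carrier W"
  shows "\<exists>n\<ge>1. \<exists>u\<in>carrier V. gp_of W w [^]\<^bsub>gp W\<^esub> (n::nat) = \<iota> (gp_of V u)"
proof -
  note gh = gp_of_hom[OF cV]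
  obtain n X where n: "n \<ge> (1::nat)" "X \<in> carrier A" "w [^]\<^bsub>gp A\<^esub> n = gp_of A X"
    using w by (auto simp: W_def saturation_def)
  obtain z where z: "z \<in> carrier N" "X = R `` {z}" using n(2) unfolding A_def by (rule quot_obtain[OF cN mc])
  obtain x e where x: "x \<in> carrier V" "e \<in> carrier (free_cmonoid k)" "z = (x, e)" using z(1) by auto
  define u where "u = x [^]\<^bsub>V\<^esub> m \<otimes>\<^bsub>V\<^esub> mprod V k v e"
  have u: "u \<in> carrier V" using x(1) mprod_closed[OF cV v] by (simp add: u_def)
  have gv: "gp_of V (v j) \<in> carrier (gp V)" if "j < k" for j using mhom_closed[OF gh v[OF that]] .
  have "gp_of W w [^]\<^bsub>gp W\<^esub> n = gp_of W (adj x e)"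
    using mhom_pow[OF W_of cW GW.comm_monoid_axioms w, of n] n(3) by (simp add: W_simps adj_def z x)
  then have "gp_of W w [^]\<^bsub>gp W\<^esub> (n * m) = gp_of W (adj x e) [^]\<^bsub>gp W\<^esub> int m"
    using mhom_closed[OF W_of w] by (simp add: GW.nat_pow_pow[symmetric] int_pow_int)
  also have "\<dots> = \<iota> (gp_of V x) [^]\<^bsub>gp W\<^esub> int m \<otimes>\<^bsub>gp W\<^esub> mon (gp W) k (\<lambda>j. \<eta> j [^]\<^bsub>gp W\<^esub> int m) (\<lambda>j. int (e j))"
    using mhom_closed[OF \<iota>_hom mhom_closed[OF gh x(1)]]
    by (simp add: gp_of_adj[OF x(1,2)] GW.int_pow_distrib GW.mon_pow)
  also have "mon (gp W) k (\<lambda>j. \<eta> j [^]\<^bsub>gp W\<^esub> int m) (\<lambda>j. int (e j)) =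
      mon (gp W) k (\<lambda>j. \<iota> (gp_of V (v j))) (\<lambda>j. int (e j))"
    by (rule mon_cong) (simp_all add: int_pow_int \<eta>_pow)
  also have "\<dots> = \<iota> (gp_of V (mprod V k v e))"
    using hom_mon[OF GV.comm_group_axioms GW.comm_group_axioms \<iota>_hom gv, of k "\<lambda>j. j" "\<lambda>j. int (e j)"]
      mprod_hom[OF cV GV.comm_group_axioms gh v, of k "\<lambda>j. j" e] by simp
  also have "\<iota> (gp_of V x) [^]\<^bsub>gp W\<^esub> int m \<otimes>\<^bsub>gp W\<^esub> \<iota> (gp_of V (mprod V k v e)) = \<iota> (gp_of V u)"
    using x(1) mprod_closed[OF cV v, of k "\<lambda>j. j" e] mhom_closed[OF gh] 
    by (simp add: u_def mhom_mult[OF gh] mhom_mult[OF \<iota>_hom] int_pow_int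
        mhom_pow[OF gh cV GV.comm_monoid_axioms] mhom_pow[OF \<iota>_hom GV.comm_monoid_axioms GW.comm_monoid_axioms])
  finally have "gp_of W w [^]\<^bsub>gp W\<^esub> (n * m) = \<iota> (gp_of V u)" .
  moreover have "n * m \<ge> 1" using n(1) m by simp
  ultimately show ?thesis using u by blast
qed

text \<open>The \<open>m\<close>-th power of an element of the group completion of \<open>W\<close> comes from the group completion of \<open>V\<close>,
where it or its inverse belongs to \<open>V\<close>. The same alternative holds for the element, as \<open>W\<close> is saturated.\<close>

lemma valuative_W: "valuative_monoid W"
proof -
  have *: "g \<in> gp_of W ` carrier W" if g: "g \<in> carrier (gp W)" and x: "x \<in> gp_of V ` carrier V"
    and gx: "g [^]\<^bsub>gp W\<^esub> m = \<iota> x" for g x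
  proof -
    obtain y where y: "y \<in> carrier V" "x = gp_of V y" using x by auto
    have "g [^]\<^bsub>gp W\<^esub> m = gp_of W (h y)" using gx \<iota>_of[OF y(1)] by (simp add: y(2))
    then have "g [^]\<^bsub>gp W\<^esub> m \<in> gp_of W ` carrier W" using mhom_closed[OF h_hom y(1)] by simp
    with sW g m show ?thesis unfolding saturated_monoid_def by blast
  qed
  have "g \<in> gp_of W ` carrier W \<or> inv\<^bsub>gp W\<^esub> g \<in> gp_of W ` carrier W" if g: "g \<in> carrier (gp W)" for g
  proof -
    have "g [^]\<^bsub>gp W\<^esub> m \<in> I" by (rule quotient_W(3)[OF g])
    then obtain x where x: "x \<in> carrier (gp V)" "g [^]\<^bsub>gp W\<^esub> m = \<iota> x" by auto
    from V x(1) have "x \<in> gp_of V ` carrier V \<or> inv\<^bsub>gp V\<^esub> x \<in> gp_of V ` carrier V"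
      by (simp add: valuative_monoid_def)
    then show ?thesis
    proof
      assume "inv\<^bsub>gp V\<^esub> x \<in> gp_of V ` carrier V"
      moreover have "inv\<^bsub>gp W\<^esub> g [^]\<^bsub>gp W\<^esub> m = \<iota> (inv\<^bsub>gp V\<^esub> x)"
        using g x by (simp add: GW.nat_pow_inv group_hom.hom_inv[OF \<iota>_group_hom])
      ultimately show ?thesis using *[of "inv\<^bsub>gp W\<^esub> g"] g by simp
    qed (use *[OF g _ x(2)] in simp)
  qed
  then show ?thesis using iW by (simp add: valuative_monoid_def)
qed

lemma sfp_h: "sfp_hom V W h"
proof -
  let ?g = "\<lambda>x. R `` {(x, \<lambda>_. 0)}"
  have g: "?g \<in> mhom V A"
  proof (rule mhomI)
    fix x y assume "x \<in> carrier V" "y \<in> carrier V"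
    then show "?g (x \<otimes>\<^bsub>V\<^esub> y) = ?g x \<otimes>\<^bsub>A\<^esub> ?g y"
      using mhom_mult[OF class_hom, of "(x, \<lambda>_. 0)" "(y, \<lambda>_. 0)"] zero_free by (simp add: free_cmonoid_def)
  qed (use mhom_closed[OF class_hom] mhom_one[OF class_hom] zero_free in \<open>simp_all add: one_DirProd\<close>)
  have S: "finite (roots_rel m k V v)" "roots_rel m k V v \<subseteq> carrier N \<times> carrier N"
    using v by (auto simp: roots_rel_def free_cmonoid_def)
  have "finitely_presented_hom V A ?g"
    unfolding finitely_presented_hom_def using cV cA g S
    by (intro conjI exI[of _ k] exI[of _ "roots_rel m k V v"] exI[of _ id])
      (auto simp: A_def roots_cong_def zero_free iso_def hom_def)
  moreover have "gp_of A \<in> mhom A W"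
    using mhom_closed[OF gp_of_hom[OF cA]] mhom_mult[OF gp_of_hom[OF cA]] mhom_one[OF gp_of_hom[OF cA]] gp_of_in_saturation[OF cA]
    by (intro mhomI) (simp_all add: W_simps, simp add: W_def)
  moreover have "id \<in> iso (saturation A) W" unfolding W_def by (auto simp: iso_def hom_def)
  ultimately show ?thesis unfolding sfp_hom_def
    using sV sW h_hom
    by (intro conjI exI[of _ A] exI[of _ ?g] exI[of _ "gp_of A"] bexI[of _ id]) (auto simp: h_def adj_def)
qed

text \<open>The cokernel on group completions is a finite group of exponent dividing \<open>m\<close>. For exactness, an element
of the group completion of \<open>V\<close> that lands in \<open>W\<close> has a power in \<open>V\<close>, which is saturated.\<close>

theorem kummer_etale:
  assumes \<Sigma>: "\<And>l. l \<in> \<Sigma> \<Longrightarrow> prime l \<and> coprime m l"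
  shows "kummer_etale_hom \<Sigma> V W h"
proof -
  have "gp_kernel V W h = {\<one>\<^bsub>gp V\<^esub>}"
  proof
    show "gp_kernel V W h \<subseteq> {\<one>\<^bsub>gp V\<^esub>}"
    proof
      fix x assume "x \<in> gp_kernel V W h"
      then have x: "x \<in> carrier (gp V)" "\<iota> x = \<iota> \<one>\<^bsub>gp V\<^esub>"
        using mhom_one[OF \<iota>_hom] by (auto simp: gp_kernel_def kernel_def)
      then have "x = \<one>\<^bsub>gp V\<^esub>" using inj_onD[OF gp_map_inj[OF iV iW h_hom h_inj]] by simp
      then show "x \<in> {\<one>\<^bsub>gp V\<^esub>}" by simp
    qed
    show "{\<one>\<^bsub>gp V\<^esub>} \<subseteq> gp_kernel V W h"
      using mhom_one[OF \<iota>_hom] by (simp add: gp_kernel_def kernel_def)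
  qed
  then have ker: "finite_order_prime_to \<Sigma> (gp_kernel V W h)" by (simp add: finite_order_prime_to_def)
  interpret Q: comm_group "gp_cokernel V W h"
    unfolding gp_cokernel_def by (rule GW.abelian_FactGroup[OF I_subgroup])
  have fin: "finite (carrier (gp_cokernel V W h))" using quotient_W(1) by (simp add: gp_cokernel_def)
  have pow: "X [^]\<^bsub>gp_cokernel V W h\<^esub> m = \<one>\<^bsub>gp_cokernel V W h\<^esub>" if "X \<in> carrier (gp_cokernel V W h)" for X
    using quotient_W(2) that by (simp add: gp_cokernel_def)
  have tors: "torsion_part (gp_cokernel V W h) = carrier (gp_cokernel V W h)"
    using pow m by (auto simp: torsion_part_def)
  have cok: "finite_order_prime_to \<Sigma> (torsion_part (gp_cokernel V W h))"
    unfolding tors finite_order_prime_to_def using fin \<Sigma> Q.coprime_order[OF fin _ _ pow] by blast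
  have "exact_hom V W h"
    unfolding exact_hom_def
  proof (intro equalityI subsetI)
    fix x assume "x \<in> gp_of V ` carrier V"
    then show "x \<in> {x \<in> carrier (gp V). \<iota> x \<in> gp_of W ` carrier W}"
      using mhom_closed[OF gp_of_hom[OF cV]] \<iota>_of mhom_closed[OF h_hom] by auto
  next
    fix x assume "x \<in> {x \<in> carrier (gp V). \<iota> x \<in> gp_of W ` carrier W}"
    then have x: "x \<in> carrier (gp V)" "\<iota> x \<in> gp_of W ` carrier W" by simp_all
    obtain w where w: "w \<in> carrier W" "\<iota> x = gp_of W w" using x(2) by auto
    from power_in_V[OF w(1)] obtain n u where n: "n \<ge> (1::nat)" "u \<in> carrier V"
      "gp_of W w [^]\<^bsub>gp W\<^esub> n = \<iota> (gp_of V u)" by (elim exE bexE conjE)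
    have "\<iota> (x [^]\<^bsub>gp V\<^esub> n) = \<iota> (gp_of V u)"
      using n(3) by (simp add: w(2) mhom_pow[OF \<iota>_hom GV.comm_monoid_axioms GW.comm_monoid_axioms x(1)])
    then have "x [^]\<^bsub>gp V\<^esub> n = gp_of V u"
      by (rule inj_onD[OF gp_map_inj[OF iV iW h_hom h_inj]])
        (use x(1) n(2) mhom_closed[OF gp_of_hom[OF cV]] in simp_all)
    then have "x [^]\<^bsub>gp V\<^esub> n \<in> gp_of V ` carrier V" using n(2) by simp
    with sV x(1) n(1) show "x \<in> gp_of V ` carrier V" unfolding saturated_monoid_def by blast
  qed
  then show ?thesis unfolding kummer_etale_hom_def etale_hom_def smooth_hom_def
    using h_inj sfp_h ker cok tors by simp
qed

end

section \<open>The relations of an sfp homomorphism\<close>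

text \<open>For every set \<open>I\<close> of coordinates, \<open>m\<close> annihilates the torsion of the quotient of the lattice of integer
vectors of length \<open>r\<close> by the vectors \<open>c 0, ..., c (K - 1)\<close> and the unit vectors with index in \<open>I\<close>.\<close>

definition clears_torsion :: "nat \<Rightarrow> nat \<Rightarrow> nat \<Rightarrow> (nat \<Rightarrow> nat \<Rightarrow> int) \<Rightarrow> bool" where
  "clears_torsion m r K c \<longleftrightarrow> (\<forall>I N b d. N \<ge> (1::int) \<longrightarrow> (\<forall>i. i \<notin> I \<longrightarrow> d i = 0) \<longrightarrow>
      (\<exists>n. \<forall>i<r. N * b i - d i = (\<Sum>j<K. n j * c j i)) \<longrightarrow>
      (\<exists>d'. (\<forall>i. i \<notin> I \<longrightarrow> d' i = 0) \<and> (\<exists>n. \<forall>i<r. int m * b i - d' i = (\<Sum>j<K. n j * c j i))))"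

text \<open>Only finitely many sets of coordinates matter, and for each of them the vectors whose class is torsion
form a finitely generated group, so that finitely many orders have a common multiple.\<close>

lemma torsion_exponent: "\<exists>m\<ge>1. clears_torsion m r K c"
proof -
  define Rel where "Rel = {x :: nat \<Rightarrow> int. \<exists>n. \<forall>i<r. x i = (\<Sum>j<K. n j * c j i)}"
  have Rel_lin: "(\<lambda>i. a * x i + b * y i) \<in> Rel" if x: "x \<in> Rel" and y: "y \<in> Rel" for a b x y
  proof -
    obtain n n' where n: "\<forall>i<r. x i = (\<Sum>j<K. n j * c j i)" "\<forall>i<r. y i = (\<Sum>j<K. n' j * c j i)"
      using x y by (auto simp: Rel_def)
    have "a * x i + b * y i = (\<Sum>j<K. (a * n j + b * n' j) * c j i)" if "i < r" for i
    proof -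
      have "a * x i + b * y i = a * (\<Sum>j<K. n j * c j i) + b * (\<Sum>j<K. n' j * c j i)" using n that by simp
      also have "\<dots> = (\<Sum>j<K. (a * n j + b * n' j) * c j i)"
        by (simp add: distrib_right sum.distrib sum_distrib_left mult.assoc)
      finally show ?thesis .
    qed
    then show ?thesis unfolding Rel_def by (intro CollectI exI[of _ "\<lambda>j. a * n j + b * n' j"]) simp
  qed
  have Rel_ext: "y \<in> Rel" if "x \<in> Rel" "\<And>i. i < r \<Longrightarrow> x i = y i" for x y using that by (auto simp: Rel_def)
  have Rel_sum: "(\<lambda>i. \<Sum>t<s. a t * x t i) \<in> Rel" if "\<And>t. t < s \<Longrightarrow> x t \<in> Rel" for s :: nat and a x
    using that
  proof (induction s)
    case 0
    have "(\<lambda>i. 0) \<in> Rel" unfolding Rel_def by (intro CollectI exI[of _ "\<lambda>_. 0"]) simp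
    then show ?case by simp
  next
    case (Suc s)
    then show ?case using Rel_lin[of "\<lambda>i. \<Sum>t<s. a t * x t i" "x s" 1 "a s"] by simp
  qed
  have one: "\<exists>m\<ge>(1::int). \<forall>b N d. N \<ge> (1::int) \<longrightarrow> (\<forall>i. i \<notin> I \<longrightarrow> d i = 0) \<longrightarrow> (\<lambda>i. N * b i - d i) \<in> Rel \<longrightarrow>
      (\<exists>d'. (\<forall>i. i \<notin> I \<longrightarrow> d' i = 0) \<and> (\<lambda>i. m * b i - d' i) \<in> Rel)" for I :: "nat set"
  proof -
    define T where "T = {b. \<exists>N d. N \<ge> (1::int) \<and> (\<forall>i. i \<notin> I \<longrightarrow> d i = 0) \<and> (\<lambda>i. N * b i - d i) \<in> Rel}"
    have T1: "(\<lambda>i. x i - y i) \<in> T" if x: "x \<in> T" and y: "y \<in> T" for x y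
    proof -
      obtain N d N' d' where N: "N \<ge> (1::int)" "\<forall>i. i \<notin> I \<longrightarrow> d i = 0" "(\<lambda>i. N * x i - d i) \<in> Rel"
        "N' \<ge> (1::int)" "\<forall>i. i \<notin> I \<longrightarrow> d' i = 0" "(\<lambda>i. N' * y i - d' i) \<in> Rel"
        using x y unfolding T_def by (elim CollectE exE conjE)
      have "(\<lambda>i. N' * (N * x i - d i) + (- N) * (N' * y i - d' i)) \<in> Rel" by (rule Rel_lin[OF N(3,6)])
      then have "(\<lambda>i. (N * N') * (x i - y i) - (N' * d i - N * d' i)) \<in> Rel" by (simp add: algebra_simps)
      moreover have "\<forall>i. i \<notin> I \<longrightarrow> N' * d i - N * d' i = 0" using N(2,5) by simp
      moreover have "N * N' \<ge> 1" using N(1,4) by (simp add: int_one_le_iff_zero_less)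
      ultimately show ?thesis unfolding T_def
        by (intro CollectI exI[of _ "N * N'"] exI[of _ "\<lambda>i. N' * d i - N * d' i"] conjI)
    qed
    have T2: "y \<in> T" if xy: "\<And>i. i < r \<Longrightarrow> x i = y i" and x: "x \<in> T" for x y
    proof -
      obtain N d where N: "N \<ge> (1::int)" "\<forall>i. i \<notin> I \<longrightarrow> d i = 0" "(\<lambda>i. N * x i - d i) \<in> Rel"
        using x unfolding T_def by (elim CollectE exE conjE)
      have "(\<lambda>i. N * y i - d i) \<in> Rel" by (rule Rel_ext[OF N(3)]) (simp add: xy)
      then show ?thesis unfolding T_def using N(1,2) by (intro CollectI exI[of _ N] exI[of _ d] conjI)
    qed
    \<comment> \<open>Without sign conditions, Gordan's lemma yields generators of the group \<open>T\<close>.\<close>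
    obtain s :: nat and B where B: "\<And>t. t < s \<Longrightarrow> B t \<in> T"
      and gen: "\<And>x. x \<in> T \<Longrightarrow> (\<And>i. i < r \<Longrightarrow> i \<in> {} \<Longrightarrow> 0 \<le> x i) \<Longrightarrow>
        \<exists>n. (\<forall>t. 0 \<le> n t) \<and> (\<forall>i<r. x i = (\<Sum>t<s. n t * B t i))"
    proof (rule gordan[of T r "{}"])
      show "\<And>x y. x \<in> T \<Longrightarrow> y \<in> T \<Longrightarrow> (\<lambda>i. x i - y i) \<in> T" by (rule T1)
      show "\<And>x y. (\<And>i. i < r \<Longrightarrow> x i = y i) \<Longrightarrow> x \<in> T \<Longrightarrow> y \<in> T" by (rule T2)
    qed blast
    have "\<exists>Nd. fst Nd \<ge> (1::int) \<and> (\<forall>i. i \<notin> I \<longrightarrow> snd Nd i = 0) \<and> (\<lambda>i. fst Nd * B t i - snd Nd i) \<in> Rel"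
      if t: "t < s" for t
    proof -
      obtain N d where "N \<ge> (1::int)" "\<forall>i. i \<notin> I \<longrightarrow> d i = 0" "(\<lambda>i. N * B t i - d i) \<in> Rel"
        using B[OF t] unfolding T_def by (elim CollectE exE conjE)
      then show ?thesis by (intro exI[of _ "(N, d)"]) simp
    qed
    then have "\<forall>t. \<exists>Nd. t < s \<longrightarrow> fst Nd \<ge> (1::int) \<and> (\<forall>i. i \<notin> I \<longrightarrow> snd Nd i = 0) \<and> (\<lambda>i. fst Nd * B t i - snd Nd i) \<in> Rel"
      by (intro allI) blast
    from choice[OF this] obtain Nd where Nd: "\<forall>t<s. fst (Nd t) \<ge> (1::int) \<and> (\<forall>i. i \<notin> I \<longrightarrow> snd (Nd t) i = 0) \<and>
        (\<lambda>i. fst (Nd t) * B t i - snd (Nd t) i) \<in> Rel" by (elim exE)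
    define m where "m = (\<Prod>t<s. fst (Nd t))"
    have m: "m \<ge> 1" unfolding m_def using Nd by (intro prod_ge_1) auto
    have dv: "fst (Nd t) * (m div fst (Nd t)) = m" if "t < s" for t
      unfolding m_def using that by (intro dvd_mult_div_cancel dvd_prodI) auto
    have "\<exists>d'. (\<forall>i. i \<notin> I \<longrightarrow> d' i = 0) \<and> (\<lambda>i. m * b i - d' i) \<in> Rel" if b: "b \<in> T" for b
    proof -
      obtain n where n: "\<forall>i<r. b i = (\<Sum>t<s. n t * B t i)" using gen[OF b] by auto
      define q where "q t = n t * (m div fst (Nd t))" for t
      define d' where "d' i = (\<Sum>t<s. q t * snd (Nd t) i)" for i
      have "(\<lambda>i. \<Sum>t<s. q t * (fst (Nd t) * B t i - snd (Nd t) i)) \<in> Rel"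
        by (rule Rel_sum) (use Nd in blast)
      then have "(\<lambda>i. m * b i - d' i) \<in> Rel"
      proof (rule Rel_ext)
        fix i assume i: "i < r"
        have "(\<Sum>t<s. q t * (fst (Nd t) * B t i - snd (Nd t) i)) = (\<Sum>t<s. m * (n t * B t i) - q t * snd (Nd t) i)"
        proof (rule sum.cong[OF refl])
          fix t assume "t \<in> {..<s}"
          then have "q t * fst (Nd t) = n t * m" using dv[of t] by (simp add: q_def mult.commute mult.left_commute)
          then have "q t * fst (Nd t) * B t i = n t * m * B t i" by simp
          then show "q t * (fst (Nd t) * B t i - snd (Nd t) i) = m * (n t * B t i) - q t * snd (Nd t) i"
            by (simp add: algebra_simps)
        qed
        then show "(\<Sum>t<s. q t * (fst (Nd t) * B t i - snd (Nd t) i)) = m * b i - d' i"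
          using n i by (simp add: d'_def sum_subtractf sum_distrib_left)
      qed
      moreover have "\<forall>i. i \<notin> I \<longrightarrow> d' i = 0" using Nd by (simp add: d'_def)
      ultimately show ?thesis by blast
    qed
    then show ?thesis using m unfolding T_def by blast
  qed
  have "\<forall>I. \<exists>m. m \<ge> (1::int) \<and> (\<forall>b N d. N \<ge> (1::int) \<longrightarrow> (\<forall>i. i \<notin> I \<longrightarrow> d i = 0) \<longrightarrow> (\<lambda>i. N * b i - d i) \<in> Rel \<longrightarrow>
      (\<exists>d'. (\<forall>i. i \<notin> I \<longrightarrow> d' i = 0) \<and> (\<lambda>i. m * b i - d' i) \<in> Rel))" using one by blast
  from choice[OF this] obtain M where M: "\<forall>I. M I \<ge> (1::int) \<and> (\<forall>b N d. N \<ge> (1::int) \<longrightarrow> (\<forall>i. i \<notin> I \<longrightarrow> d i = 0) \<longrightarrow>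
      (\<lambda>i. N * b i - d i) \<in> Rel \<longrightarrow> (\<exists>d'. (\<forall>i. i \<notin> I \<longrightarrow> d' i = 0) \<and> (\<lambda>i. M I * b i - d' i) \<in> Rel))" by (elim exE)
  define m where "m = (\<Prod>I\<in>Pow {..<r}. M I)"
  have m: "m \<ge> 1" unfolding m_def using M by (intro prod_ge_1) auto
  have main: "\<exists>d'. (\<forall>i. i \<notin> I \<longrightarrow> d' i = 0) \<and> (\<lambda>i. m * b i - d' i) \<in> Rel"
    if N: "N \<ge> (1::int)" and d: "\<forall>i. i \<notin> I \<longrightarrow> d i = 0" and R: "(\<lambda>i. N * b i - d i) \<in> Rel" for I N b d
  proof -
    let ?I = "I \<inter> {..<r}"
    have R1: "(\<lambda>i. N * b i - (if i < r then d i else 0)) \<in> Rel" by (rule Rel_ext[OF R]) simp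
    have D1: "\<forall>i. i \<notin> ?I \<longrightarrow> (if i < r then d i else 0) = 0" using d by simp
    from conjunct2[OF spec[OF M, of ?I], THEN spec, THEN spec, THEN spec, THEN mp, THEN mp, THEN mp, OF N D1 R1]
    obtain d' where d': "\<forall>i. i \<notin> ?I \<longrightarrow> d' i = 0" "(\<lambda>i. M ?I * b i - d' i) \<in> Rel" by (elim exE conjE)
    have "M ?I dvd m" unfolding m_def by (intro dvd_prodI) auto
    then obtain q where q: "m = M ?I * q" by auto
    have "(\<lambda>i. q * (M ?I * b i - d' i) + 0 * 0) \<in> Rel" using Rel_lin[OF d'(2) d'(2), of q 0] by simp
    then have "(\<lambda>i. m * b i - q * d' i) \<in> Rel" by (simp add: q algebra_simps)
    then show ?thesis using d'(1) by (intro exI[of _ "\<lambda>i. q * d' i"]) auto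
  qed
  show ?thesis unfolding clears_torsion_def
  proof (intro exI[of _ "nat m"] conjI allI impI)
    fix I N b d assume "N \<ge> (1::int)" "\<forall>i. i \<notin> I \<longrightarrow> d i = 0" "\<exists>n. \<forall>i<r. N * b i - d i = (\<Sum>j<K. n j * c j i)"
    then have "\<exists>d'. (\<forall>i. i \<notin> I \<longrightarrow> d' i = 0) \<and> (\<lambda>i. m * b i - d' i) \<in> Rel"
      by (intro main[of N I d b]) (simp_all add: Rel_def)
    then show "\<exists>d'. (\<forall>i. i \<notin> I \<longrightarrow> d' i = 0) \<and> (\<exists>n. \<forall>i<r. int (nat m) * b i - d' i = (\<Sum>j<K. n j * c j i))"
      using m by (simp add: Rel_def)
  qed (use m in auto)
qed

text \<open>The composite \<open>\<rho>\<close> of a presentation with the map to the saturation. Two elements get the same image as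
soon as they agree in the group completion, which is why the congruence only holds after multiplying
by some \<open>t\<close>; likewise elements of \<open>P\<close> are reached only up to powers, or as fractions.\<close>

lemma sfp_parametrisation:
  fixes V :: "'a monoid" and P :: "'b monoid"
  assumes "sfp_hom V P \<theta>"
  shows "\<exists>r S \<rho>. finite S \<and>
    S \<subseteq> carrier (V \<times>\<times> free_cmonoid r) \<times> carrier (V \<times>\<times> free_cmonoid r) \<and>
    \<rho> \<in> mhom (V \<times>\<times> free_cmonoid r) P \<and> (\<forall>x\<in>carrier V. \<rho> (x, \<lambda>_. 0) = \<theta> x) \<and>
    (\<forall>a b. (a, b) \<in> S \<longrightarrow> \<rho> a = \<rho> b) \<and>
    (\<forall>a\<in>carrier (V \<times>\<times> free_cmonoid r). \<forall>b\<in>carrier (V \<times>\<times> free_cmonoid r). \<rho> a = \<rho> b \<longrightarrow>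
      (\<exists>t\<in>carrier (V \<times>\<times> free_cmonoid r).
        (a \<otimes>\<^bsub>V \<times>\<times> free_cmonoid r\<^esub> t, b \<otimes>\<^bsub>V \<times>\<times> free_cmonoid r\<^esub> t) \<in> gen_cong (V \<times>\<times> free_cmonoid r) S)) \<and>
    (\<forall>p\<in>carrier P. \<exists>n\<ge>1. \<exists>a\<in>carrier (V \<times>\<times> free_cmonoid r). p [^]\<^bsub>P\<^esub> (n::nat) = \<rho> a) \<and>
    (\<forall>p\<in>carrier P. \<exists>a\<in>carrier (V \<times>\<times> free_cmonoid r). \<exists>b\<in>carrier (V \<times>\<times> free_cmonoid r). p \<otimes>\<^bsub>P\<^esub> \<rho> b = \<rho> a)"
proof -
  obtain Q' :: "'a fg_alg monoid" and g h \<phi> where fp: "finitely_presented_hom V Q' g" and h: "h \<in> mhom Q' P"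
    and hg: "\<forall>x\<in>carrier V. h (g x) = \<theta> x"
    and \<phi>: "\<phi> \<in> iso (saturation Q') P" "\<forall>x\<in>carrier Q'. \<phi> (gp_of Q' x) = h x" and sP: "saturated_monoid P"
    using assms unfolding sfp_hom_def by (elim conjE exE bexE)
  have cV: "comm_monoid V" and cQ: "comm_monoid Q'" and g: "g \<in> mhom V Q'"
    using fp by (auto simp: finitely_presented_hom_def)
  have cP: "comm_monoid P" using sP by (simp add: saturated_monoid_def integral_monoid_def)
  obtain r S \<chi> where S: "finite S" "S \<subseteq> carrier (V \<times>\<times> free_cmonoid r) \<times> carrier (V \<times>\<times> free_cmonoid r)"
    and \<chi>: "\<chi> \<in> iso (quotient_monoid (V \<times>\<times> free_cmonoid r) (gen_cong (V \<times>\<times> free_cmonoid r) S)) Q'"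
    and \<chi>g: "\<forall>p\<in>carrier V. \<chi> (gen_cong (V \<times>\<times> free_cmonoid r) S `` {(p, \<one>\<^bsub>free_cmonoid r\<^esub>)}) = g p"
    using fp unfolding finitely_presented_hom_def by (elim conjE exE)
  define N where "N = V \<times>\<times> free_cmonoid r"
  define R where "R = gen_cong N S"
  define q where "q x = \<chi> (R `` {x})" for x
  have cN: "comm_monoid N" unfolding N_def by (rule comm_monoid_DirProd[OF cV comm_monoid_free])
  interpret N: comm_monoid N by (rule cN)
  interpret V: comm_monoid V by (rule cV)
  interpret Q': comm_monoid Q' by (rule cQ)
  interpret P: comm_monoid P by (rule cP)
  have mc: "mcong N R" unfolding R_def by (rule mcong_gen_cong[OF cN])
  let ?A = "quotient_monoid N R"
  have \<chi>': "\<chi> \<in> hom ?A Q'" "bij_betw \<chi> (carrier ?A) (carrier Q')"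
    using \<chi> by (simp_all add: iso_def N_def R_def)
  have qg: "q (x, \<lambda>_. 0) = g x" if "x \<in> carrier V" for x
    using \<chi>g that by (simp add: q_def N_def R_def free_cmonoid_def)
  have oneN: "\<one>\<^bsub>N\<^esub> = (\<one>\<^bsub>V\<^esub>, \<lambda>_. 0)" by (simp add: N_def one_DirProd free_cmonoid_def)
  have q: "q \<in> mhom N Q'"
  proof (rule mhomI)
    fix x assume "x \<in> carrier N"
    then show "q x \<in> carrier Q'" unfolding q_def by (intro hom_in_carrier[OF \<chi>'(1)] quot_class_in[OF cN mc])
  next
    fix x y assume "x \<in> carrier N" "y \<in> carrier N"
    then show "q (x \<otimes>\<^bsub>N\<^esub> y) = q x \<otimes>\<^bsub>Q'\<^esub> q y"
      using hom_mult[OF \<chi>'(1), of "R `` {x}" "R `` {y}"] quot_class_in[OF cN mc] quot_mult[OF cN mc]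
      by (simp add: q_def)
  next
    show "q \<one>\<^bsub>N\<^esub> = \<one>\<^bsub>Q'\<^esub>" using qg[OF V.one_closed] mhom_one[OF g] by (simp add: oneN)
  qed
  have q_inj: "(x, y) \<in> R" if x: "x \<in> carrier N" "y \<in> carrier N" "q x = q y" for x y
  proof -
    have "R `` {x} = R `` {y}"
      by (rule inj_onD[OF bij_betw_imp_inj_on[OF \<chi>'(2)]])
        (use x quot_class_in[OF cN mc] in \<open>simp_all add: q_def\<close>)
    then show ?thesis using quot_class_eq[OF cN mc x(1,2)] by simp
  qed
  have q_surj: "\<exists>x\<in>carrier N. y = q x" if y: "y \<in> carrier Q'" for y
  proof -
    obtain X where X: "X \<in> carrier ?A" "y = \<chi> X" using y \<chi>'(2) by (auto simp: bij_betw_def)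
    obtain x where x: "x \<in> carrier N" "X = R `` {x}" using X(1) by (rule quot_obtain[OF cN mc])
    show ?thesis using x X(2) by (intro bexI[OF _ x(1)]) (simp add: q_def)
  qed
  have \<phi>': "\<phi> \<in> hom (saturation Q') P" "bij_betw \<phi> (carrier (saturation Q')) (carrier P)"
    using \<phi>(1) by (simp_all add: iso_def)
  define \<rho> where "\<rho> x = h (q x)" for x
  have \<rho>_\<phi>: "\<rho> x = \<phi> (gp_of Q' (q x))" if "x \<in> carrier N" for x
    using \<phi>(2) mhom_closed[OF q that] by (simp add: \<rho>_def)
  have \<rho>: "\<rho> \<in> mhom N P"
    using mhom_closed[OF q] mhom_mult[OF q] mhom_one[OF q] mhom_closed[OF h] mhom_mult[OF h] mhom_one[OF h]
    by (intro mhomI) (simp_all add: \<rho>_def)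
  have 1: "\<forall>x\<in>carrier V. \<rho> (x, \<lambda>_. 0) = \<theta> x" using hg by (simp add: \<rho>_def qg)
  have 2: "\<exists>t\<in>carrier N. (a \<otimes>\<^bsub>N\<^esub> t, b \<otimes>\<^bsub>N\<^esub> t) \<in> R" if ab: "a \<in> carrier N" "b \<in> carrier N" "\<rho> a = \<rho> b" for a b
  proof -
    note C = mhom_closed[OF q ab(1)] mhom_closed[OF q ab(2)]
    have "gp_of Q' (q a) = gp_of Q' (q b)"
      by (rule inj_onD[OF bij_betw_imp_inj_on[OF \<phi>'(2)]])
        (use gp_of_in_saturation[OF cQ] C ab \<rho>_\<phi>[OF ab(1)] \<rho>_\<phi>[OF ab(2)] in simp_all)
    then obtain y where y: "y \<in> carrier Q'" "q a \<otimes>\<^bsub>Q'\<^esub> y = q b \<otimes>\<^bsub>Q'\<^esub> y" unfolding gp_of_eq[OF cQ C] by (elim bexE)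
    obtain t where t: "t \<in> carrier N" "y = q t" using q_surj[OF y(1)] by (elim bexE)
    have "q (a \<otimes>\<^bsub>N\<^esub> t) = q (b \<otimes>\<^bsub>N\<^esub> t)" using y(2) t ab by (simp add: mhom_mult[OF q])
    then have "(a \<otimes>\<^bsub>N\<^esub> t, b \<otimes>\<^bsub>N\<^esub> t) \<in> R" by (intro q_inj) (simp_all add: ab t)
    then show ?thesis using t(1) by (rule bexI)
  qed
  have 0: "\<rho> a = \<rho> b" if ab: "(a, b) \<in> S" for a b
  proof -
    have C: "a \<in> carrier N" "b \<in> carrier N" using ab S(2) unfolding N_def by auto
    have "(a, b) \<in> R" unfolding R_def by (rule gen_cong_base[OF ab C])
    then have "R `` {a} = R `` {b}" using quot_class_eq[OF cN mc C] by simp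
    then show ?thesis by (simp add: \<rho>_def q_def)
  qed
  have \<phi>_surj: "\<exists>s\<in>carrier (saturation Q'). p = \<phi> s" if "p \<in> carrier P" for p
    using \<phi>'(2) that by (auto simp: bij_betw_def)
  have sQ: "x \<otimes>\<^bsub>saturation Q'\<^esub> y = x \<otimes>\<^bsub>gp Q'\<^esub> y" "x [^]\<^bsub>saturation Q'\<^esub> (n::nat) = x [^]\<^bsub>gp Q'\<^esub> n" for x y n
    by (simp_all add: saturation_def gp_pow_consistent)
  have \<phi>_hom: "\<phi> \<in> mhom (saturation Q') P"
  proof (rule mhomI)
    have "\<phi> (gp_of Q' \<one>\<^bsub>Q'\<^esub>) = \<one>\<^bsub>P\<^esub>" using \<phi>(2) mhom_one[OF h] by simp
    then show "\<phi> \<one>\<^bsub>saturation Q'\<^esub> = \<one>\<^bsub>P\<^esub>" using mhom_one[OF gp_of_hom[OF cQ]] by (simp add: saturation_def)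
  qed (use \<phi>'(1) in \<open>auto simp: hom_def\<close>)
  have csQ: "comm_monoid (saturation Q')"
    using saturated_monoid_saturation[OF cQ] by (simp add: saturated_monoid_def integral_monoid_def)
  have 3: "\<exists>n\<ge>1. \<exists>a\<in>carrier N. p [^]\<^bsub>P\<^esub> (n::nat) = \<rho> a" if p: "p \<in> carrier P" for p
  proof -
    obtain s where s: "s \<in> carrier (saturation Q')" "p = \<phi> s" using \<phi>_surj[OF p] by (elim bexE)
    obtain n y where n: "n \<ge> (1::nat)" "y \<in> carrier Q'" "s [^]\<^bsub>gp Q'\<^esub> n = gp_of Q' y"
      using s(1) by (auto simp: saturation_def)
    obtain a where a: "a \<in> carrier N" "y = q a" using q_surj[OF n(2)] by (elim bexE)
    have "p [^]\<^bsub>P\<^esub> n = \<phi> (s [^]\<^bsub>saturation Q'\<^esub> n)" using mhom_pow[OF \<phi>_hom csQ cP s(1)] by (simp add: s(2))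
    also have "\<dots> = \<rho> a" using n(3) a by (simp add: sQ \<rho>_\<phi>)
    finally show ?thesis using n(1) a(1) by blast
  qed
  have 4: "\<exists>a\<in>carrier N. \<exists>b\<in>carrier N. p \<otimes>\<^bsub>P\<^esub> \<rho> b = \<rho> a" if p: "p \<in> carrier P" for p
  proof -
    obtain s where s: "s \<in> carrier (saturation Q')" "p = \<phi> s" using \<phi>_surj[OF p] by (elim bexE)
    have "s \<in> carrier (gp Q')" using s(1) by (simp add: saturation_def)
    then obtain x y where x: "x \<in> carrier Q'" "y \<in> carrier Q'" "s = gp_frac Q' x y" by (rule gp_obtain[OF cQ])
    obtain a where a: "a \<in> carrier N" "x = q a" using q_surj[OF x(1)] by (elim bexE)
    obtain b where b: "b \<in> carrier N" "y = q b" using q_surj[OF x(2)] by (elim bexE)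
    interpret GQ: comm_group "gp Q'" by (rule gp_comm_group[OF cQ])
    have "s \<otimes>\<^bsub>gp Q'\<^esub> gp_of Q' y = gp_of Q' x"
      using x(1,2) mhom_closed[OF gp_of_hom[OF cQ]] by (simp add: x(3) gp_frac_div[OF cQ] GQ.m_assoc)
    then have "\<phi> s \<otimes>\<^bsub>P\<^esub> \<phi> (gp_of Q' y) = \<phi> (gp_of Q' x)"
      using mhom_mult[OF \<phi>_hom s(1) gp_of_in_saturation[OF cQ x(2)]] by (simp add: sQ)
    then have "p \<otimes>\<^bsub>P\<^esub> \<rho> b = \<rho> a" using a b by (simp add: s(2) \<rho>_\<phi>)
    then show ?thesis using a(1) b(1) by blast
  qed
  show ?thesis
    by (rule exI[of _ r], rule exI[of _ S], rule exI[of _ \<rho>], fold N_def, fold R_def)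
      (use S \<rho> 0 1 2 3 4 in \<open>simp add: N_def[symmetric]\<close>)
qed

text \<open>The group of all \<open>(g, d)\<close> with \<open>\<phi> g = X^d\<close> is generated by the pairs \<open>(\<gamma> j, c j)\<close>.\<close>

definition relations_generated ::
  "'g monoid \<Rightarrow> 'h monoid \<Rightarrow> ('g \<Rightarrow> 'h) \<Rightarrow> nat \<Rightarrow> (nat \<Rightarrow> 'h) \<Rightarrow> nat \<Rightarrow> (nat \<Rightarrow> 'g) \<Rightarrow> (nat \<Rightarrow> nat \<Rightarrow> int) \<Rightarrow> bool"
where
  "relations_generated G H \<phi> r X K \<gamma> c \<longleftrightarrow>
    (\<forall>j<K. \<gamma> j \<in> carrier G \<and> \<phi> (\<gamma> j) = mon H r X (c j)) \<and>
    (\<forall>g\<in>carrier G. \<forall>d. \<phi> g = mon H r X d \<longrightarrow>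
      (\<exists>n. g = mon G K \<gamma> n \<and> (\<forall>i<r. d i = (\<Sum>j<K. n j * c j i))))"

text \<open>By the displacement lemma, the finitely many pairs presenting \<open>P\<close> up to saturation provide generators of
the group of relations on group completions. Replacing a generator by its inverse if necessary, its
component in the group completion of \<open>V\<close> lies in \<open>V\<close>, since \<open>V\<close> is valuative.\<close>

lemma sfp_relations:
  fixes V :: "'a monoid" and P :: "'b monoid"
  assumes V: "valuative_monoid V" and \<theta>: "sfp_hom V P \<theta>"
  shows "\<exists>r x K v c. (\<forall>i<r. x i \<in> carrier P) \<and> (\<forall>j<K. v j \<in> carrier V) \<and>
    relations_generated (gp V) (gp P) (gp_map P \<theta>) r (\<lambda>i. gp_of P (x i)) K (\<lambda>j. gp_of V (v j)) c \<and>
    (\<forall>p\<in>carrier P. \<exists>n\<ge>1. \<exists>u\<in>carrier V. \<exists>e. (\<forall>i. 0 \<le> e i) \<and>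
      gp_of P p [^]\<^bsub>gp P\<^esub> (n::int) = gp_map P \<theta> (gp_of V u) \<otimes>\<^bsub>gp P\<^esub> mon (gp P) r (\<lambda>i. gp_of P (x i)) e) \<and>
    (\<forall>p\<in>carrier P. \<exists>g\<in>carrier (gp V). \<exists>e.
      gp_of P p = gp_map P \<theta> g \<otimes>\<^bsub>gp P\<^esub> mon (gp P) r (\<lambda>i. gp_of P (x i)) e)"
proof -
  have iV: "integral_monoid V" and cV: "comm_monoid V" using V by (auto simp: valuative_monoid_def integral_monoid_def)
  have iP: "integral_monoid P" and cP: "comm_monoid P" and \<theta>h: "\<theta> \<in> mhom V P"
    using \<theta> by (auto simp: sfp_hom_def saturated_monoid_def integral_monoid_def)
  interpret V: comm_monoid V by (rule cV)
  interpret P: comm_monoid P by (rule cP)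
  interpret GV: comm_group "gp V" by (rule gp_comm_group[OF cV])
  interpret GP: comm_group "gp P" by (rule gp_comm_group[OF cP])
  note gV = gp_of_hom[OF cV] and gP = gp_of_hom[OF cP]
  obtain r S \<rho> where S: "finite S" "S \<subseteq> carrier (V \<times>\<times> free_cmonoid r) \<times> carrier (V \<times>\<times> free_cmonoid r)"
    and \<rho>: "\<rho> \<in> mhom (V \<times>\<times> free_cmonoid r) P" "\<forall>x\<in>carrier V. \<rho> (x, \<lambda>_. 0) = \<theta> x"
    and \<rho>_S: "\<forall>a b. (a, b) \<in> S \<longrightarrow> \<rho> a = \<rho> b"
    and \<rho>_eq: "\<forall>a\<in>carrier (V \<times>\<times> free_cmonoid r). \<forall>b\<in>carrier (V \<times>\<times> free_cmonoid r). \<rho> a = \<rho> b \<longrightarrow>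
      (\<exists>t\<in>carrier (V \<times>\<times> free_cmonoid r).
        (a \<otimes>\<^bsub>V \<times>\<times> free_cmonoid r\<^esub> t, b \<otimes>\<^bsub>V \<times>\<times> free_cmonoid r\<^esub> t) \<in> gen_cong (V \<times>\<times> free_cmonoid r) S)"
    and \<rho>_pow: "\<forall>p\<in>carrier P. \<exists>n\<ge>1. \<exists>a\<in>carrier (V \<times>\<times> free_cmonoid r). p [^]\<^bsub>P\<^esub> (n::nat) = \<rho> a"
    and \<rho>_gen: "\<forall>p\<in>carrier P. \<exists>a\<in>carrier (V \<times>\<times> free_cmonoid r). \<exists>b\<in>carrier (V \<times>\<times> free_cmonoid r). p \<otimes>\<^bsub>P\<^esub> \<rho> b = \<rho> a"
    using sfp_parametrisation[OF \<theta>] by (elim exE conjE)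
  let ?N = "V \<times>\<times> free_cmonoid r" and ?\<phi> = "gp_map P \<theta>"
  note \<phi> = gp_map_hom[OF cV cP \<theta>h]
  define x where "x i = \<rho> (\<one>\<^bsub>V\<^esub>, \<lambda>j. if j = i then 1 else 0)" for i
  have xC: "x i \<in> carrier P" if "i < r" for i
    unfolding x_def by (rule mhom_closed[OF \<rho>(1)]) (use that in \<open>simp add: free_cmonoid_def\<close>)
  let ?X = "\<lambda>i. gp_of P (x i)"
  have XC [simp]: "?X i \<in> carrier (gp P)" if "i < r" for i by (rule mhom_closed[OF gP xC[OF that]])
  have \<rho>_mon: "gp_of P (\<rho> (u, e)) = ?\<phi> (gp_of V u) \<otimes>\<^bsub>gp P\<^esub> mon (gp P) r ?X (\<lambda>i. int (e i))"
    if "u \<in> carrier V" "e \<in> carrier (free_cmonoid r)" for u e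
  proof -
    have "(\<lambda>z. gp_of P (\<rho> z)) \<in> mhom ?N (gp P)"
      using mhom_closed[OF \<rho>(1)] mhom_mult[OF \<rho>(1)] mhom_one[OF \<rho>(1)] mhom_closed[OF gP] mhom_mult[OF gP] mhom_one[OF gP]
      by (intro mhomI) simp_all
    from hom_free_extension[OF cV GP.comm_group_axioms this that]
    show ?thesis using \<rho>(2) \<phi>(2) that(1) by (simp add: x_def)
  qed
  obtain K :: nat and f where "S = f ` {..<K}" using exists_seq_of_finite[OF S(1)] by (elim exE)
  then have Sf: "S = (\<lambda>t. (fst (f t), snd (f t))) ` {..<K}" by simp
  have fC: "fst (f t) \<in> carrier ?N \<and> snd (f t) \<in> carrier ?N" if "t < K" for t
  proof -
    have "f t \<in> S" using that \<open>S = f ` {..<K}\<close> by simp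
    then show ?thesis using S(2) by (cases "f t") auto
  qed
  define \<gamma>0 where "\<gamma>0 t = gp_of V (fst (snd (f t))) \<otimes>\<^bsub>gp V\<^esub> inv\<^bsub>gp V\<^esub> (gp_of V (fst (fst (f t))))" for t
  define c0 where "c0 t i = int (snd (fst (f t)) i) - int (snd (snd (f t)) i)" for t i
  have gC: "gp_of V (fst z) \<in> carrier (gp V)" if "z \<in> carrier ?N" for z
    using mhom_closed[OF gV, of "fst z"] that by auto
  have \<gamma>0C: "\<gamma>0 t \<in> carrier (gp V)" if "t < K" for t using fC[OF that] gC by (simp add: \<gamma>0_def)
  have \<phi>C: "?\<phi> g \<in> carrier (gp P)" if "g \<in> carrier (gp V)" for g by (rule mhom_closed[OF \<phi>(1) that])
  have \<phi>_inv: "?\<phi> (inv\<^bsub>gp V\<^esub> g) = inv\<^bsub>gp P\<^esub> (?\<phi> g)" if "g \<in> carrier (gp V)" for g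
    using \<phi>(1) that by (intro group_hom.hom_inv group_hom.intro group_hom_axioms.intro GV.group_axioms GP.group_axioms)
      (simp_all add: mhom_def)
  have rel0: "?\<phi> (\<gamma>0 t) = mon (gp P) r ?X (c0 t)" if t: "t < K" for t
  proof -
    obtain u e where u: "fst (f t) = (u, e)" by (cases "fst (f t)")
    obtain u' e' where u': "snd (f t) = (u', e')" by (cases "snd (f t)")
    have C: "u \<in> carrier V" "e \<in> carrier (free_cmonoid r)" "u' \<in> carrier V" "e' \<in> carrier (free_cmonoid r)"
      using fC[OF t] by (auto simp: u u')
    have "(fst (f t), snd (f t)) \<in> S" using t by (simp add: \<open>S = f ` {..<K}\<close>)
    then have "\<rho> (u, e) = \<rho> (u', e')" using \<rho>_S by (simp add: u u')
    then have "?\<phi> (gp_of V u) \<otimes>\<^bsub>gp P\<^esub> mon (gp P) r ?X (\<lambda>i. int (e i)) =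
        ?\<phi> (gp_of V u') \<otimes>\<^bsub>gp P\<^esub> mon (gp P) r ?X (\<lambda>i. int (e' i))"
      using \<rho>_mon[OF C(1,2)] \<rho>_mon[OF C(3,4)] by simp
    from GP.cross_mult[OF this] C
    have "mon (gp P) r ?X (\<lambda>i. int (e i)) \<otimes>\<^bsub>gp P\<^esub> inv\<^bsub>gp P\<^esub> (mon (gp P) r ?X (\<lambda>i. int (e' i))) =
      ?\<phi> (gp_of V u') \<otimes>\<^bsub>gp P\<^esub> inv\<^bsub>gp P\<^esub> (?\<phi> (gp_of V u))"
      using \<phi>C mhom_closed[OF gV] by simp
    then show ?thesis using C mhom_closed[OF gV]
      by (simp add: \<gamma>0_def c0_def u u' mhom_mult[OF \<phi>(1)] \<phi>_inv GP.mon_diff[symmetric] c0_def[abs_def])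
  qed
  have gen0: "\<exists>n. g = mon (gp V) K \<gamma>0 n \<and> (\<forall>i<r. d i = (\<Sum>t<K. n t * c0 t i))"
    if g: "g \<in> carrier (gp V)" and gd: "?\<phi> g = mon (gp P) r ?X d" for g d
  proof -
    obtain a b where a: "a \<in> carrier V" "b \<in> carrier V" "g = gp_frac V a b" using g by (rule gp_obtain[OF cV])
    have aC: "gp_of V a \<in> carrier (gp V)" "gp_of V b \<in> carrier (gp V)" using a mhom_closed[OF gV] by simp_all
    have g': "g = gp_of V a \<otimes>\<^bsub>gp V\<^esub> inv\<^bsub>gp V\<^esub> (gp_of V b)" using a by (simp add: gp_frac_div[OF cV])
    \<comment> \<open>The negative and the positive part of \<open>d\<close>, with which the relation is an equation in \<open>P\<close> itself.\<close>
    define d1 where "d1 i = (if i < r then nat (- d i) else 0)" for i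
    define d2 where "d2 i = (if i < r then nat (d i) else 0)" for i
    have dC: "d1 \<in> carrier (free_cmonoid r)" "d2 \<in> carrier (free_cmonoid r)"
      by (simp_all add: d1_def d2_def free_cmonoid_def)
    have "mon (gp P) r ?X (\<lambda>i. int (d2 i)) = mon (gp P) r ?X (\<lambda>i. d i + int (d1 i))"
      by (rule mon_cong) (simp_all add: d1_def d2_def)
    also have "\<dots> = ?\<phi> g \<otimes>\<^bsub>gp P\<^esub> mon (gp P) r ?X (\<lambda>i. int (d1 i))" by (simp add: GP.mon_add gd)
    finally have "?\<phi> (gp_of V a) \<otimes>\<^bsub>gp P\<^esub> mon (gp P) r ?X (\<lambda>i. int (d1 i)) =
        ?\<phi> (gp_of V b) \<otimes>\<^bsub>gp P\<^esub> mon (gp P) r ?X (\<lambda>i. int (d2 i))"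
      using aC \<phi>C by (simp add: g' mhom_mult[OF \<phi>(1)] \<phi>_inv GP.m_ac)
    then have "gp_of P (\<rho> (a, d1)) = gp_of P (\<rho> (b, d2))" using a dC by (simp add: \<rho>_mon)
    moreover have "inj_on (gp_of P) (carrier P)" using iP by (simp add: integral_monoid_def)
    ultimately have "\<rho> (a, d1) = \<rho> (b, d2)"
      using mhom_closed[OF \<rho>(1), of "(a, d1)"] mhom_closed[OF \<rho>(1), of "(b, d2)"] a dC by (auto dest: inj_onD)
    then obtain t where t: "t \<in> carrier ?N" "((a, d1) \<otimes>\<^bsub>?N\<^esub> t, (b, d2) \<otimes>\<^bsub>?N\<^esub> t) \<in> gen_cong ?N S"
      using \<rho>_eq[rule_format, of "(a, d1)" "(b, d2)"] a dC by auto
    from gen_cong_difference[OF cV fC t(2)[unfolded Sf]] obtain n where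
      n: "gp_of V (fst ((b, d2) \<otimes>\<^bsub>?N\<^esub> t)) = gp_of V (fst ((a, d1) \<otimes>\<^bsub>?N\<^esub> t)) \<otimes>\<^bsub>gp V\<^esub> mon (gp V) K \<gamma>0 n"
      "\<forall>i<r. int (snd ((a, d1) \<otimes>\<^bsub>?N\<^esub> t) i) - int (snd ((b, d2) \<otimes>\<^bsub>?N\<^esub> t) i) = (\<Sum>t<K. n t * c0 t i)"
      unfolding \<gamma>0_def c0_def by blast
    have tV: "fst t \<in> carrier V" using t(1) by auto
    have mC: "mon (gp V) K \<gamma>0 n \<in> carrier (gp V)" using \<gamma>0C by simp
    have "gp_of V b \<otimes>\<^bsub>gp V\<^esub> gp_of V (fst t) = (gp_of V a \<otimes>\<^bsub>gp V\<^esub> mon (gp V) K \<gamma>0 n) \<otimes>\<^bsub>gp V\<^esub> gp_of V (fst t)"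
      using n(1) a tV aC mC mhom_closed[OF gV tV] by (simp add: mult_DirProd' mhom_mult[OF gV] GV.m_ac)
    then have "gp_of V b = gp_of V a \<otimes>\<^bsub>gp V\<^esub> mon (gp V) K \<gamma>0 n" using aC mC mhom_closed[OF gV tV] by simp
    then have "g = mon (gp V) K \<gamma>0 (\<lambda>t. - n t)"
      using aC mC \<gamma>0C by (simp add: g' GV.mon_neg GV.inv_mult)
    moreover have "d i = (\<Sum>t<K. - n t * c0 t i)" if "i < r" for i
    proof -
      have "int (d1 i) - int (d2 i) = (\<Sum>t<K. n t * c0 t i)"
        using n(2)[rule_format, OF that] by (simp add: mult_DirProd' free_cmonoid_def)
      then show ?thesis using that by (simp add: d1_def d2_def sum_negf split: if_splits)
    qed
    ultimately show ?thesis by blast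
  qed
  \<comment> \<open>The sign that moves the generating relation into \<open>V\<close>.\<close>
  define \<sigma> where "\<sigma> t = (if \<gamma>0 t \<in> gp_of V ` carrier V then 1 else - 1 :: int)" for t
  define \<gamma> where "\<gamma> t = \<gamma>0 t [^]\<^bsub>gp V\<^esub> \<sigma> t" for t
  define c where "c t i = \<sigma> t * c0 t i" for t i
  have \<gamma>V: "\<gamma> t \<in> gp_of V ` carrier V" if "t < K" for t
    using V \<gamma>0C[OF that] by (auto simp: valuative_monoid_def \<gamma>_def \<sigma>_def GV.int_pow_neg)
  have "\<forall>t. \<exists>w. t < K \<longrightarrow> w \<in> carrier V \<and> \<gamma> t = gp_of V w" using \<gamma>V by blast
  from choice[OF this] obtain v where v: "\<forall>t<K. v t \<in> carrier V \<and> \<gamma> t = gp_of V (v t)" by (elim exE)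
  have \<gamma>C: "gp_of V (v t) \<in> carrier (gp V)" if "t < K" for t using v that mhom_closed[OF gV] by simp
  have vg: "gp_of V (v t) = \<gamma>0 t [^]\<^bsub>gp V\<^esub> \<sigma> t" if "t < K" for t using v that by (simp add: \<gamma>_def)
  have "?\<phi> (gp_of V (v t)) = mon (gp P) r ?X (c t)" if t: "t < K" for t
  proof -
    have "?\<phi> (gp_of V (v t)) = ?\<phi> (\<gamma>0 t) [^]\<^bsub>gp P\<^esub> \<sigma> t"
      using hom_int_pow[OF _ \<gamma>0C[OF t] GV.group_axioms GP.group_axioms, of ?\<phi> "\<sigma> t"] \<phi>(1)
      by (simp add: vg[OF t] mhom_def)
    then show ?thesis by (simp add: rel0[OF t] c_def[abs_def] GP.mon_scale)
  qed
  moreover have "\<exists>n. g = mon (gp V) K (\<lambda>t. gp_of V (v t)) n \<and> (\<forall>i<r. d i = (\<Sum>t<K. n t * c t i))"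
    if g: "g \<in> carrier (gp V)" and gd: "?\<phi> g = mon (gp P) r ?X d" for g d
  proof -
    obtain n where n: "g = mon (gp V) K \<gamma>0 n" "\<forall>i<r. d i = (\<Sum>t<K. n t * c0 t i)" using gen0[OF g gd] by (elim exE conjE)
    have \<sigma>2: "\<sigma> t * \<sigma> t = 1" for t by (simp add: \<sigma>_def)
    have mm: "mon (gp V) j \<gamma>0 n = mon (gp V) j (\<lambda>t. gp_of V (v t)) (\<lambda>t. n t * \<sigma> t)" if "j \<le> K" for j
      using that
    proof (induction j)
      case (Suc j)
      then have "gp_of V (v j) [^]\<^bsub>gp V\<^esub> (n j * \<sigma> j) = \<gamma>0 j [^]\<^bsub>gp V\<^esub> (\<sigma> j * (n j * \<sigma> j))"
        using \<gamma>0C[of j] by (simp add: vg GV.int_pow_pow)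
      also have "\<sigma> j * (n j * \<sigma> j) = n j" using \<sigma>2[of j] by (simp add: mult.left_commute)
      finally show ?case using Suc by simp
    qed simp
    have "d i = (\<Sum>t<K. (n t * \<sigma> t) * c t i)" if "i < r" for i
    proof -
      have "(n t * \<sigma> t) * c t i = n t * c0 t i" for t
      proof -
        have "(n t * \<sigma> t) * c t i = (\<sigma> t * \<sigma> t) * (n t * c0 t i)" by (simp add: c_def)
        then show ?thesis by (simp add: \<sigma>2)
      qed
      then show ?thesis using n(2) that by (simp only:)
    qed
    then show ?thesis using mm[of K] n(1) by (intro exI[of _ "\<lambda>t. n t * \<sigma> t"]) simp
  qed
  ultimately have rg: "relations_generated (gp V) (gp P) ?\<phi> r ?X K (\<lambda>j. gp_of V (v j)) c"
    unfolding relations_generated_def using \<gamma>C by (intro conjI ballI allI impI) simp_all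
  have pow: "\<exists>n\<ge>1. \<exists>u\<in>carrier V. \<exists>e. (\<forall>i. 0 \<le> e i) \<and>
      gp_of P p [^]\<^bsub>gp P\<^esub> (n::int) = ?\<phi> (gp_of V u) \<otimes>\<^bsub>gp P\<^esub> mon (gp P) r ?X e" if p: "p \<in> carrier P" for p
  proof -
    from bspec[OF \<rho>_pow p] obtain n a where n: "n \<ge> (1::nat)" "a \<in> carrier ?N" "p [^]\<^bsub>P\<^esub> n = \<rho> a" by (elim exE conjE bexE)
    obtain u e where u: "a = (u, e)" "u \<in> carrier V" "e \<in> carrier (free_cmonoid r)" using n(2) by (cases a) auto
    have "gp_of P p [^]\<^bsub>gp P\<^esub> int n = gp_of P (\<rho> (u, e))"
      using mhom_pow[OF gP cP GP.comm_monoid_axioms p, of n] n(3) u(1) by (simp add: int_pow_int)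
    then have "gp_of P p [^]\<^bsub>gp P\<^esub> int n = ?\<phi> (gp_of V u) \<otimes>\<^bsub>gp P\<^esub> mon (gp P) r ?X (\<lambda>i. int (e i))"
      by (simp add: \<rho>_mon u)
    then show ?thesis using n(1) u(2)
      by (intro exI[of _ "int n"] conjI bexI[of _ u] exI[of _ "\<lambda>i. int (e i)"]) simp_all
  qed
  have gen: "\<exists>g\<in>carrier (gp V). \<exists>e. gp_of P p = ?\<phi> g \<otimes>\<^bsub>gp P\<^esub> mon (gp P) r ?X e" if p: "p \<in> carrier P" for p
  proof -
    from bspec[OF \<rho>_gen p] obtain a b where ab: "a \<in> carrier ?N" "b \<in> carrier ?N" "p \<otimes>\<^bsub>P\<^esub> \<rho> b = \<rho> a" by (elim exE conjE bexE)
    obtain u e where u: "a = (u, e)" "u \<in> carrier V" "e \<in> carrier (free_cmonoid r)" using ab(1) by (cases a) auto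
    obtain u' e' where u': "b = (u', e')" "u' \<in> carrier V" "e' \<in> carrier (free_cmonoid r)" using ab(2) by (cases b) auto
    let ?g = "gp_of V u \<otimes>\<^bsub>gp V\<^esub> inv\<^bsub>gp V\<^esub> (gp_of V u')" and ?e = "\<lambda>i. int (e i) - int (e' i)"
    note uC = mhom_closed[OF gV u(2)] mhom_closed[OF gV u'(2)]
    have bC: "\<rho> b \<in> carrier P" by (rule mhom_closed[OF \<rho>(1) ab(2)])
    have "gp_of P p \<otimes>\<^bsub>gp P\<^esub> gp_of P (\<rho> b) = gp_of P (\<rho> a)" using ab(3) mhom_mult[OF gP p bC] by simp
    then have "gp_of P p = gp_of P (\<rho> a) \<otimes>\<^bsub>gp P\<^esub> inv\<^bsub>gp P\<^esub> (gp_of P (\<rho> b))"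
      using mhom_closed[OF gP] p bC mhom_closed[OF \<rho>(1) ab(1)] by (simp add: GP.inv_solve_right)
    also have "\<dots> = ?\<phi> ?g \<otimes>\<^bsub>gp P\<^esub> mon (gp P) r ?X ?e"
      using uC \<phi>C by (simp add: u u' \<rho>_mon mhom_mult[OF \<phi>(1)] \<phi>_inv GP.mon_diff GP.inv_mult GP.m_ac)
    finally show ?thesis using uC by (intro bexI[of _ ?g] exI[of _ ?e]) simp_all
  qed
  have "(\<forall>i<r. x i \<in> carrier P) \<and> (\<forall>j<K. v j \<in> carrier V)" using xC v by simp
  with rg pow gen show ?thesis
    by (intro exI[of _ r] exI[of _ x] exI[of _ K] exI[of _ v] exI[of _ c]) simp
qed

section \<open>The saturated base change\<close>

lemma finitely_presented_hom_cong:
  assumes "finitely_presented_hom W Q f" and eq: "\<And>w. w \<in> carrier W \<Longrightarrow> f w = g w"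
  shows "finitely_presented_hom W Q g"
proof -
  have W: "comm_monoid W" and Q: "comm_monoid Q" and f: "f \<in> mhom W Q"
    using assms(1) by (simp_all add: finitely_presented_hom_def)
  interpret W: comm_monoid W by (rule W)
  have "g \<in> mhom W Q"
    by (rule mhomI) (simp_all add: eq[symmetric] mhom_closed[OF f] mhom_mult[OF f] mhom_one[OF f])
  then show ?thesis using assms(1) unfolding finitely_presented_hom_def by (simp add: eq cong: ball_cong)
qed

lemma saturated_hom_cong:
  fixes W :: "'w monoid"
  assumes f: "saturated_hom W Q f" and eq: "\<And>w. w \<in> carrier W \<Longrightarrow> f w = g w"
  shows "saturated_hom W Q g"
proof -
  have fh: "f \<in> mhom W Q" and cW: "comm_monoid W"
    using f by (simp_all add: saturated_hom_def integral_hom_def integral_monoid_def)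
  interpret W: comm_monoid W by (rule cW)
  have "g \<in> mhom W Q"
    by (rule mhomI) (simp_all add: eq[symmetric] mhom_closed[OF fh] mhom_mult[OF fh] mhom_one[OF fh])
  moreover have "pushout W A Q k g = pushout W A Q k f" for A :: "'w sat_alg monoid" and k
  proof -
    have "(\<lambda>p. ((k p, \<one>\<^bsub>Q\<^esub>), (\<one>\<^bsub>A\<^esub>, g p))) ` carrier W = (\<lambda>p. ((k p, \<one>\<^bsub>Q\<^esub>), (\<one>\<^bsub>A\<^esub>, f p))) ` carrier W"
      by (rule image_cong) (simp_all add: eq)
    then show ?thesis by (simp add: pushout_def pushout_cong_def)
  qed
  ultimately show ?thesis using f by (simp add: saturated_hom_def integral_hom_def)
qed

text \<open>The elements \<open>z i\<close>, the images of the generators \<open>x i\<close> of \<open>P\<close>, generate the saturated pushout over \<open>W\<close>. A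
relation \<open>\<psi> g = z^d\<close> unfolds to a link in the pushout, and the fraction of elements of \<open>V\<close> that it moves
exhibits \<open>g\<close> as the image of some element \<open>g'\<close> of the group completion of \<open>V\<close> that satisfies the same
relation in \<open>P\<close>. The relations after base change are thus generated by those before, and their
coefficients have acquired \<open>m\<close>-th roots.\<close>

lemma (in root_extension) base_change:
  fixes P :: "'b monoid" and \<theta> :: "'a \<Rightarrow> 'b" and x :: "nat \<Rightarrow> 'b" and r :: nat and c :: "nat \<Rightarrow> nat \<Rightarrow> int"
  assumes \<theta>: "\<theta> \<in> mhom V P" and sP: "saturated_monoid P" and x: "\<forall>i<r. x i \<in> carrier P"
    and rg: "relations_generated (gp V) (gp P) (gp_map P \<theta>) r (\<lambda>i. gp_of P (x i)) k (\<lambda>j. gp_of V (v j)) c"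
    and pow: "\<forall>p\<in>carrier P. \<exists>n\<ge>1. \<exists>u\<in>carrier V. \<exists>e. (\<forall>i. 0 \<le> e i) \<and>
      gp_of P p [^]\<^bsub>gp P\<^esub> (n::int) = gp_map P \<theta> (gp_of V u) \<otimes>\<^bsub>gp P\<^esub> mon (gp P) r (\<lambda>i. gp_of P (x i)) e"
    and gen: "\<forall>p\<in>carrier P. \<exists>g\<in>carrier (gp V). \<exists>e.
      gp_of P p = gp_map P \<theta> g \<otimes>\<^bsub>gp P\<^esub> mon (gp P) r (\<lambda>i. gp_of P (x i)) e"
    and tors: "clears_torsion m r k c"
  defines "M \<equiv> pushout V W P h \<theta>"
  defines "j \<equiv> \<lambda>w. gp_of M (pushout_inl V W P h \<theta> w)"
  shows "saturated_hom W (saturation M) j" "finitely_presented_hom W (saturation M) j"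
proof -
  have iP: "integral_monoid P" and cP: "comm_monoid P" using sP by (auto simp: saturated_monoid_def integral_monoid_def)
  have cM: "comm_monoid M" unfolding M_def by (rule comm_monoid_pushout[OF cW cP])
  interpret P: comm_monoid P by (rule cP)
  interpret M: comm_monoid M by (rule cM)
  interpret GP: comm_group "gp P" by (rule gp_comm_group[OF cP])
  interpret GM: comm_group "gp M" by (rule gp_comm_group[OF cM])
  note gV = gp_of_hom[OF cV] and gP = gp_of_hom[OF cP] and gM = gp_of_hom[OF cM]
  let ?inl = "pushout_inl V W P h \<theta>" and ?inr = "pushout_inr V W P h \<theta>"
  have "(\<lambda>_. \<one>\<^bsub>V\<^esub>) \<in> mhom W V" "(\<lambda>_. \<one>\<^bsub>V\<^esub>) \<in> mhom P V" by (rule mhomI; simp)+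
  note univ = pushout_universal[OF cV cW cP cV h_hom \<theta> this refl, folded M_def]
  note inl = univ(3) and inr = univ(4)
  have inlr: "?inl (h u) = ?inr (\<theta> u)" if "u \<in> carrier V" for u using univ(2) that by simp
  let ?\<psi> = "gp_map M ?inl" and ?\<kappa> = "gp_map M ?inr" and ?\<phi> = "gp_map P \<theta>"
  note \<psi> = gp_map_hom[OF cW cM inl] and \<kappa> = gp_map_hom[OF cP cM inr] and \<phi> = gp_map_hom[OF cV cP \<theta>]
  let ?X = "\<lambda>i. gp_of P (x i)"
  define z where "z i = gp_of M (?inr (x i))" for i
  have XC: "?X i \<in> carrier (gp P)" if "i < r" for i using x mhom_closed[OF gP] that by simp
  have zC: "z i \<in> carrier (gp M)" if "i < r" for i
    unfolding z_def using x mhom_closed[OF gM mhom_closed[OF inr]] that by simp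
  have \<kappa>_mon: "?\<kappa> (mon (gp P) r ?X d) = mon (gp M) r z d" for d
  proof -
    have "?\<kappa> (mon (gp P) r ?X d) = mon (gp M) r (\<lambda>i. ?\<kappa> (?X i)) d"
      by (rule hom_mon[OF GP.comm_group_axioms GM.comm_group_axioms \<kappa>(1) XC])
    also have "\<dots> = mon (gp M) r z d" by (rule mon_cong) (use x in \<open>simp_all add: z_def \<kappa>(2)\<close>)
    finally show ?thesis .
  qed
  interpret \<psi>h: group_hom "gp W" "gp M" ?\<psi>
    using \<psi>(1) by (intro group_hom.intro group_hom_axioms.intro GW.group_axioms GM.group_axioms) (simp add: mhom_def)
  interpret \<kappa>h: group_hom "gp P" "gp M" ?\<kappa>
    using \<kappa>(1) by (intro group_hom.intro group_hom_axioms.intro GP.group_axioms GM.group_axioms) (simp add: mhom_def)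
  have compat: "?\<kappa> (?\<phi> g) = ?\<psi> (\<iota> g)" if g: "g \<in> carrier (gp V)" for g
  proof -
    obtain a b where a: "a \<in> carrier V" "b \<in> carrier V" "g = gp_frac V a b" using g by (rule gp_obtain[OF cV])
    note C = a(1,2)[THEN mhom_closed[OF \<theta>]] a(1,2)[THEN mhom_closed[OF h_hom]]
    show ?thesis using a C inlr
      by (simp add: gp_map_frac[OF cV cP \<theta>] gp_map_frac[OF cV cW h_hom] gp_map_frac[OF cP cM inr] gp_map_frac[OF cW cM inl])
  qed
  have M_elem: "\<exists>w\<in>carrier W. \<exists>p\<in>carrier P. gp_of M Y = ?\<psi> (gp_of W w) \<otimes>\<^bsub>gp M\<^esub> ?\<kappa> (gp_of P p)"
    if Y: "Y \<in> carrier M" for Y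
  proof -
    obtain w p where wp: "w \<in> carrier W" "p \<in> carrier P" "Y = pushout_cong V W P h \<theta> `` {(w, p)}"
      using Y unfolding M_def by (rule po_obtain[OF cW cP])
    have "Y = ?inl w \<otimes>\<^bsub>M\<^esub> ?inr p"
      using wp unfolding M_def pushout_inl_def pushout_inr_def by (subst po_mult[OF cW cP]) simp_all
    then have "gp_of M Y = gp_of M (?inl w) \<otimes>\<^bsub>gp M\<^esub> gp_of M (?inr p)"
      using mhom_mult[OF gM mhom_closed[OF inl wp(1)] mhom_closed[OF inr wp(2)]] by simp
    then show ?thesis using wp(1,2) by (intro bexI[of _ w] bexI[of _ p]) (simp_all add: \<psi>(2) \<kappa>(2))
  qed
  have M_gen: "\<exists>g\<in>carrier (gp W). \<exists>b. gp_of M Y = ?\<psi> g \<otimes>\<^bsub>gp M\<^esub> mon (gp M) r z b" if Y: "Y \<in> carrier M" for Y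
  proof -
    obtain w p where wp: "w \<in> carrier W" "p \<in> carrier P" "gp_of M Y = ?\<psi> (gp_of W w) \<otimes>\<^bsub>gp M\<^esub> ?\<kappa> (gp_of P p)"
      using M_elem[OF Y] by (elim bexE)
    obtain g e where g: "g \<in> carrier (gp V)" "gp_of P p = ?\<phi> g \<otimes>\<^bsub>gp P\<^esub> mon (gp P) r ?X e"
      using bspec[OF gen wp(2)] by (elim bexE exE)
    have gC: "gp_of W w \<in> carrier (gp W)" "\<iota> g \<in> carrier (gp W)" "?\<phi> g \<in> carrier (gp P)"
      using mhom_closed[OF W_of wp(1)] mhom_closed[OF \<iota>_hom g(1)] mhom_closed[OF \<phi>(1) g(1)] by simp_all
    have "gp_of M Y = ?\<psi> (gp_of W w \<otimes>\<^bsub>gp W\<^esub> \<iota> g) \<otimes>\<^bsub>gp M\<^esub> mon (gp M) r z e"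
      using gC XC zC by (simp add: wp(3) g(2) mhom_mult[OF \<kappa>(1)] mhom_mult[OF \<psi>(1)] compat[OF g(1)] \<kappa>_mon GM.m_assoc)
    then show ?thesis using gC by (intro bexI[of _ "gp_of W w \<otimes>\<^bsub>gp W\<^esub> \<iota> g"] exI[of _ e]) simp_all
  qed
  have L_gen: "\<exists>g\<in>carrier (gp W). \<exists>b. q = ?\<psi> g \<otimes>\<^bsub>gp M\<^esub> mon (gp M) r z b" if q: "q \<in> carrier (gp M)" for q
  proof -
    obtain Y Z where YZ: "Y \<in> carrier M" "Z \<in> carrier M" "q = gp_frac M Y Z" using q by (rule gp_obtain[OF cM])
    obtain g b where g: "g \<in> carrier (gp W)" "gp_of M Y = ?\<psi> g \<otimes>\<^bsub>gp M\<^esub> mon (gp M) r z b"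
      using M_gen[OF YZ(1)] by (elim bexE exE)
    obtain g' b' where g': "g' \<in> carrier (gp W)" "gp_of M Z = ?\<psi> g' \<otimes>\<^bsub>gp M\<^esub> mon (gp M) r z b'"
      using M_gen[OF YZ(2)] by (elim bexE exE)
    have "q = ?\<psi> (g \<otimes>\<^bsub>gp W\<^esub> inv\<^bsub>gp W\<^esub> g') \<otimes>\<^bsub>gp M\<^esub> mon (gp M) r z (\<lambda>i. b i - b' i)"
      unfolding YZ(3) gp_frac_div[OF cM YZ(1,2)] g(2) g'(2)
      using g(1) g'(1) zC by (simp add: mhom_mult[OF \<psi>(1)] GM.mon_diff GM.inv_mult GM.m_ac)
    then show ?thesis using g(1) g'(1) by (intro bexI[of _ "g \<otimes>\<^bsub>gp W\<^esub> inv\<^bsub>gp W\<^esub> g'"] exI[of _ "\<lambda>i. b i - b' i"]) simp_all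
  qed
  let ?WW = "gp_of W ` carrier W"
  have of_mult: "gp_of W a \<otimes>\<^bsub>gp W\<^esub> gp_of W b \<in> ?WW" if "a \<in> carrier W" "b \<in> carrier W" for a b
    unfolding mhom_mult[OF W_of that, symmetric] by (rule imageI[OF W.m_closed[OF that]])
  have Q_eq: "carrier (saturation M) = {q \<in> carrier (gp M). \<exists>n\<ge>1. \<exists>w\<in>?WW. \<exists>d. (\<forall>i. 0 \<le> d i) \<and>
      q [^]\<^bsub>gp M\<^esub> (n::int) = ?\<psi> w \<otimes>\<^bsub>gp M\<^esub> mon (gp M) r z d}"
  proof (intro equalityI subsetI)
    fix q assume "q \<in> carrier (saturation M)"
    then obtain n Y where q: "q \<in> carrier (gp M)" and n: "n \<ge> (1::nat)" "Y \<in> carrier M" "q [^]\<^bsub>gp M\<^esub> n = gp_of M Y"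
      by (auto simp: saturation_def)
    obtain w p where wp: "w \<in> carrier W" "p \<in> carrier P" "gp_of M Y = ?\<psi> (gp_of W w) \<otimes>\<^bsub>gp M\<^esub> ?\<kappa> (gp_of P p)"
      using M_elem[OF n(2)] by (elim bexE)
    obtain n' u e where u: "n' \<ge> (1::int)" "u \<in> carrier V" "\<forall>i. 0 \<le> e i"
      "gp_of P p [^]\<^bsub>gp P\<^esub> n' = ?\<phi> (gp_of V u) \<otimes>\<^bsub>gp P\<^esub> mon (gp P) r ?X e"
      using bspec[OF pow wp(2)] by (elim exE conjE bexE)
    have C: "gp_of W w \<in> carrier (gp W)" "gp_of P p \<in> carrier (gp P)" "gp_of V u \<in> carrier (gp V)" "h u \<in> carrier W"
      using mhom_closed[OF W_of wp(1)] mhom_closed[OF gP wp(2)] mhom_closed[OF gV u(2)] mhom_closed[OF h_hom u(2)] by simp_all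
    have C': "?\<phi> (gp_of V u) \<in> carrier (gp P)" "\<iota> (gp_of V u) \<in> carrier (gp W)"
      using C(3) mhom_closed[OF \<phi>(1)] mhom_closed[OF \<iota>_hom] by simp_all
    let ?w = "w [^]\<^bsub>W\<^esub> nat n' \<otimes>\<^bsub>W\<^esub> h u"
    have w_pow: "gp_of W (w [^]\<^bsub>W\<^esub> nat n') = gp_of W w [^]\<^bsub>gp W\<^esub> n'"
      using mhom_pow[OF W_of cW GW.comm_monoid_axioms wp(1), of "nat n'"] u(1) int_pow_int[of "gp W" "gp_of W w" "nat n'"] by simp
    have "q [^]\<^bsub>gp M\<^esub> (int n * n') = (?\<psi> (gp_of W w) \<otimes>\<^bsub>gp M\<^esub> ?\<kappa> (gp_of P p)) [^]\<^bsub>gp M\<^esub> n'"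
      using q n(3) wp(3) by (simp add: GM.int_pow_pow[symmetric] int_pow_int)
    also have "\<dots> = ?\<psi> (gp_of W w) [^]\<^bsub>gp M\<^esub> n' \<otimes>\<^bsub>gp M\<^esub> ?\<kappa> (gp_of P p [^]\<^bsub>gp P\<^esub> n')"
      using C by (simp add: GM.int_pow_distrib \<kappa>h.hom_int_pow)
    also have "\<dots> = ?\<psi> (gp_of W w [^]\<^bsub>gp W\<^esub> n' \<otimes>\<^bsub>gp W\<^esub> \<iota> (gp_of V u)) \<otimes>\<^bsub>gp M\<^esub> mon (gp M) r z e"
      using C C' XC zC by (simp add: u(4) mhom_mult[OF \<kappa>(1)] mhom_mult[OF \<psi>(1)] \<psi>h.hom_int_pow compat \<kappa>_mon GM.m_assoc)
    also have "gp_of W w [^]\<^bsub>gp W\<^esub> n' \<otimes>\<^bsub>gp W\<^esub> \<iota> (gp_of V u) = gp_of W ?w"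
      using wp(1) C(4) u(2) by (simp add: mhom_mult[OF W_of] w_pow \<iota>_of)
    finally have "q [^]\<^bsub>gp M\<^esub> (int n * n') = ?\<psi> (gp_of W ?w) \<otimes>\<^bsub>gp M\<^esub> mon (gp M) r z e" .
    moreover have "int n * n' \<ge> 1" using n(1) u(1) by (simp add: int_one_le_iff_zero_less)
    moreover have "gp_of W ?w \<in> ?WW" using wp(1) C(4) by simp
    ultimately show "q \<in> {q \<in> carrier (gp M). \<exists>n\<ge>1. \<exists>w\<in>?WW. \<exists>d. (\<forall>i. 0 \<le> d i) \<and>
      q [^]\<^bsub>gp M\<^esub> (n::int) = ?\<psi> w \<otimes>\<^bsub>gp M\<^esub> mon (gp M) r z d}"
      using q u(3) by (intro CollectI conjI exI[of _ "int n * n'"] bexI[of _ "gp_of W ?w"] exI[of _ e])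
  next
    fix q assume "q \<in> {q \<in> carrier (gp M). \<exists>n\<ge>1. \<exists>w\<in>?WW. \<exists>d. (\<forall>i. 0 \<le> d i) \<and>
      q [^]\<^bsub>gp M\<^esub> (n::int) = ?\<psi> w \<otimes>\<^bsub>gp M\<^esub> mon (gp M) r z d}"
    then obtain n w d where q: "q \<in> carrier (gp M)" and n: "n \<ge> (1::int)" "w \<in> carrier W" "\<forall>i. 0 \<le> d i"
      "q [^]\<^bsub>gp M\<^esub> n = ?\<psi> (gp_of W w) \<otimes>\<^bsub>gp M\<^esub> mon (gp M) r z d" by (elim CollectE exE conjE bexE imageE) simp
    have mult: "a \<otimes>\<^bsub>gp M\<^esub> b \<in> gp_of M ` carrier M" if A: "a \<in> gp_of M ` carrier M" "b \<in> gp_of M ` carrier M" for a b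
    proof -
      obtain a' b' where ab: "a' \<in> carrier M" "b' \<in> carrier M" "a = gp_of M a'" "b = gp_of M b'" using A by (elim imageE)
      show ?thesis unfolding ab(3,4) mhom_mult[OF gM ab(1,2), symmetric] by (rule imageI[OF M.m_closed[OF ab(1,2)]])
    qed
    have "\<one>\<^bsub>gp M\<^esub> \<in> gp_of M ` carrier M" unfolding mhom_one[OF gM, symmetric] by (rule imageI[OF M.one_closed])
    then have "mon (gp M) r z d \<in> gp_of M ` carrier M"
      by (rule GM.mon_mem[OF _ mult]) (use n(3) x mhom_closed[OF inr] in \<open>simp_all add: z_def\<close>)
    moreover have "?\<psi> (gp_of W w) \<in> gp_of M ` carrier M" using \<psi>(2)[OF n(2)] mhom_closed[OF inl n(2)] by simp
    ultimately have "q [^]\<^bsub>gp M\<^esub> n \<in> gp_of M ` carrier M" unfolding n(4) by (intro mult)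
    moreover obtain n' where n': "n = int n'" using n(1) by (metis nat_0_le order_trans zero_le_one)
    ultimately have "q [^]\<^bsub>gp M\<^esub> n' \<in> gp_of M ` carrier M" by (simp only: int_pow_int)
    moreover have "n' \<ge> 1" using n(1) unfolding n' by linarith
    ultimately have "\<exists>n'::nat. n' \<ge> 1 \<and> q [^]\<^bsub>gp M\<^esub> n' \<in> gp_of M ` carrier M"
      by (intro exI[of _ n'] conjI)
    then show "q \<in> carrier (saturation M)" using q by (simp add: saturation_def)
  qed
  have rg_ex: "\<exists>n. g = mon (gp V) k (\<lambda>j. gp_of V (v j)) n \<and> (\<forall>i<r. d i = (\<Sum>j<k. n j * c j i))"
    if "g \<in> carrier (gp V)" "?\<phi> g = mon (gp P) r ?X d" for g d
    using rg that unfolding relations_generated_def by simp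
  have rg_rel: "?\<phi> (gp_of V (v i)) = mon (gp P) r ?X (c i)" if "i < k" for i
    using rg that unfolding relations_generated_def by simp
  have rel_gen: "\<exists>n. g = mon (gp W) k (\<lambda>j. \<iota> (gp_of V (v j))) n \<and> (\<forall>i<r. d i = (\<Sum>j<k. n j * c j i))"
    if g: "g \<in> carrier (gp W)" and gd: "?\<psi> g = mon (gp M) r z d" for g d
  proof -
    obtain w1 w2 where w: "w1 \<in> carrier W" "w2 \<in> carrier W" "g = gp_frac W w1 w2" using g by (rule gp_obtain[OF cW])
    have mC: "mon (gp P) r ?X d \<in> carrier (gp P)" using XC by simp
    then obtain p1 p2 where p: "p1 \<in> carrier P" "p2 \<in> carrier P" "mon (gp P) r ?X d = gp_frac P p1 p2"
      by (rule gp_obtain[OF cP])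
    note C = w(1,2)[THEN mhom_closed[OF inl]] p(1,2)[THEN mhom_closed[OF inr]]
    have "gp_frac M (?inl w1) (?inl w2) = gp_frac M (?inr p1) (?inr p2)"
      using gd \<kappa>_mon[of d] w p by (simp add: gp_map_frac[OF cW cM inl] gp_map_frac[OF cP cM inr])
    then obtain T where T: "T \<in> carrier M" "?inl w1 \<otimes>\<^bsub>M\<^esub> ?inr p2 \<otimes>\<^bsub>M\<^esub> T = ?inr p1 \<otimes>\<^bsub>M\<^esub> ?inl w2 \<otimes>\<^bsub>M\<^esub> T"
      using C by (auto simp: Defs.frac_eq[OF cM])
    obtain w0 p0 where T0: "w0 \<in> carrier W" "p0 \<in> carrier P" "T = pushout_cong V W P h \<theta> `` {(w0, p0)}"
      using T(1) unfolding M_def by (rule po_obtain[OF cW cP])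
    have "pushout_cong V W P h \<theta> `` {(w1 \<otimes>\<^bsub>W\<^esub> w0, p2 \<otimes>\<^bsub>P\<^esub> p0)} = pushout_cong V W P h \<theta> `` {(w2 \<otimes>\<^bsub>W\<^esub> w0, p1 \<otimes>\<^bsub>P\<^esub> p0)}"
      using T(2) w(1,2) p(1,2) T0
      by (simp add: M_def pushout_inl_def pushout_inr_def po_mult[OF cW cP])
    then have "linked V W P h \<theta> (w1 \<otimes>\<^bsub>W\<^esub> w0, p2 \<otimes>\<^bsub>P\<^esub> p0) (w2 \<otimes>\<^bsub>W\<^esub> w0, p1 \<otimes>\<^bsub>P\<^esub> p0)"
      using w(1,2) p(1,2) T0(1,2) by (subst (asm) po_eq_linked[OF V iW iP h_hom \<theta>]) simp_all
    then obtain a b where ab: "a \<in> carrier V" "b \<in> carrier V"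
      "w1 \<otimes>\<^bsub>W\<^esub> w0 \<otimes>\<^bsub>W\<^esub> h b = w2 \<otimes>\<^bsub>W\<^esub> w0 \<otimes>\<^bsub>W\<^esub> h a" "p1 \<otimes>\<^bsub>P\<^esub> p0 \<otimes>\<^bsub>P\<^esub> \<theta> b = p2 \<otimes>\<^bsub>P\<^esub> p0 \<otimes>\<^bsub>P\<^esub> \<theta> a"
      by (auto simp: linked_def)
    note abC = ab(1,2)[THEN mhom_closed[OF h_hom]] ab(1,2)[THEN mhom_closed[OF \<theta>]]
    have 1: "w1 \<otimes>\<^bsub>W\<^esub> h b \<otimes>\<^bsub>W\<^esub> w0 = h a \<otimes>\<^bsub>W\<^esub> w2 \<otimes>\<^bsub>W\<^esub> w0" using ab(3) w(1,2) T0(1) abC by (simp add: W.m_ac)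
    have 2: "p1 \<otimes>\<^bsub>P\<^esub> \<theta> b \<otimes>\<^bsub>P\<^esub> p0 = \<theta> a \<otimes>\<^bsub>P\<^esub> p2 \<otimes>\<^bsub>P\<^esub> p0" using ab(4) p(1,2) T0(2) abC by (simp add: P.m_ac)
    have "g = gp_frac W (h a) (h b)" unfolding w(3) Defs.frac_eq[OF cW w(1,2) abC(1,2)] using 1 T0(1) by (rule bexI)
    then have gi: "g = \<iota> (gp_frac V a b)" using ab by (simp add: gp_map_frac[OF cV cW h_hom])
    have "gp_frac P p1 p2 = gp_frac P (\<theta> a) (\<theta> b)" unfolding Defs.frac_eq[OF cP p(1,2) abC(3,4)] using 2 T0(2) by (rule bexI)
    then have "?\<phi> (gp_frac V a b) = mon (gp P) r ?X d" using ab by (simp add: p(3) gp_map_frac[OF cV cP \<theta>])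
    from rg_ex[OF frac_in[OF cV ab(1,2)] this] obtain n where n: "gp_frac V a b = mon (gp V) k (\<lambda>j. gp_of V (v j)) n" "\<forall>i<r. d i = (\<Sum>j<k. n j * c j i)"
      by (elim exE conjE)
    have "g = mon (gp W) k (\<lambda>j. \<iota> (gp_of V (v j))) n"
      unfolding gi n(1) by (rule hom_mon[OF GV.comm_group_axioms GW.comm_group_axioms \<iota>_hom]) (use v mhom_closed[OF gV] in simp)
    then show ?thesis using n(2) by blast
  qed
  have W_mult: "a \<otimes>\<^bsub>gp W\<^esub> b \<in> ?WW" if "a \<in> ?WW" "b \<in> ?WW" for a b using that of_mult by auto
  have rel: "?\<psi> (\<iota> (gp_of V (v i))) = mon (gp M) r z (c i)" if i: "i < k" for i
  proof -
    have "gp_of V (v i) \<in> carrier (gp V)" by (rule mhom_closed[OF gV v[OF i]])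
    from compat[OF this] show ?thesis by (simp add: rg_rel[OF i] \<kappa>_mon)
  qed
  have W_one: "\<one>\<^bsub>gp W\<^esub> \<in> ?WW" unfolding mhom_one[OF W_of, symmetric] by (rule imageI[OF W.one_closed])
  have W_sub: "?WW \<subseteq> carrier (gp W)" using mhom_closed[OF W_of] by auto
  have W_val: "g \<in> ?WW \<or> inv\<^bsub>gp W\<^esub> g \<in> ?WW" if "g \<in> carrier (gp W)" for g
    using valuative_W that by (simp add: valuative_monoid_def)
  have root: "\<iota> (gp_of V (v j)) = \<eta> j [^]\<^bsub>gp W\<^esub> int m" if "j < k" for j using \<eta>_pow[OF that] by (simp add: int_pow_int)
  have m1: "int m \<ge> 1" using m by simp
  have tors': "\<exists>d'. (\<forall>i. i \<notin> I \<longrightarrow> d' i = 0) \<and> (\<exists>n. \<forall>i<r. int m * b i - d' i = (\<Sum>j<k. n j * c j i))"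
    if "N \<ge> (1::int)" "\<And>i. i \<notin> I \<Longrightarrow> d i = 0" "\<exists>n. \<forall>i<r. N * b i - d i = (\<Sum>j<k. n j * c j i)" for I N b d
    using tors[unfolded clears_torsion_def, THEN spec, THEN spec, THEN spec, THEN spec, THEN mp, THEN mp, THEN mp, OF that(1) _ that(3)]
      that(2) by simp
  interpret C: cone_hom "gp W" "gp M" ?\<psi> ?WW "carrier (saturation M)" z r "int m" k
    "\<lambda>j. \<iota> (gp_of V (v j))" \<eta> c
    apply (rule cone_hom.intro[OF GW.comm_group_axioms GM.comm_group_axioms], rule cone_hom_axioms.intro)
    apply (rule \<psi>(1))
    apply (rule W_sub)
    apply (rule W_one)
    apply (erule (1) W_mult)
    apply (erule W_val)
    apply (erule zC)
    apply (rule Q_eq)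
    apply (erule L_gen)
    apply (erule \<eta>_C)
    apply (erule root)
    apply (erule rel)
    apply (erule (1) rel_gen)
    apply (rule m1)
    apply (rule tors', assumption, assumption, assumption)
    done
  have Q: "(gp M)\<lparr>carrier := carrier (saturation M)\<rparr> = saturation M" unfolding saturation_def by simp
  have inj: "inj_on (gp_of W) (carrier W)" using iW unfolding integral_monoid_def by (rule conjunct2)
  have eq: "?\<psi> (gp_of W w) = j w" if "w \<in> carrier W" for w unfolding j_def by (rule \<psi>(2)[OF that])
  have "saturated_hom W (saturation M) (\<lambda>w. ?\<psi> (gp_of W w))"
    by (rule C.saturated[OF valuative_W W_of inj refl, unfolded Q]) (rule saturated_monoid_saturation[OF cM])
  then show "saturated_hom W (saturation M) j" using eq by (rule saturated_hom_cong)
  have "finitely_presented_hom W (saturation M) (\<lambda>w. ?\<psi> (gp_of W w))"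
    by (rule C.finitely_presented[OF cW W_of inj refl, unfolded Q])
  then show "finitely_presented_hom W (saturation M) j" using eq by (rule finitely_presented_hom_cong)
qed

text \<open>Lagrange's theorem in the quotient.\<close>

lemma order_kills_quotient:
  fixes H :: "'h monoid" (structure)
  assumes H: "comm_group H" and I: "subgroup I H" and fin: "finite (carrier (H Mod I))" and X: "X \<in> carrier H"
  shows "X [^] card (carrier (H Mod I)) \<in> I"
proof -
  interpret H: comm_group H by (rule H)
  interpret n: normal I H using I by (rule H.subgroup_imp_normal)
  interpret F: group "H Mod I" by (rule n.factorgroup_is_group)
  have "I #> X \<in> carrier (H Mod I)" using X by (auto simp: carrier_FactGroup)
  then have "(I #> X) [^]\<^bsub>H Mod I\<^esub> card (carrier (H Mod I)) = \<one>\<^bsub>H Mod I\<^esub>"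
    using F.pow_order_eq_1 by (simp add: order_def)
  then have "I #> (X [^] card (carrier (H Mod I))) = I" using n.FactGroup_pow[OF X] by simp
  then show ?thesis using H.rcos_self[OF H.nat_pow_closed[OF X, of "card (carrier (H Mod I))"] I] by simp
qed

text \<open>The order of a finite cokernel turns every monomial in the \<open>X i\<close> into an element of the image of \<open>G\<close>, that
is, \<open>m\<close> times any vector is the exponent vector of a relation, whatever \<open>I\<close> is.\<close>

lemma cokernel_order_clears_torsion:
  fixes G :: "'g monoid" and H :: "'h monoid"
  assumes G: "comm_group G" and H: "comm_group H" and \<phi>: "\<phi> \<in> hom G H" and X: "\<And>i. i < r \<Longrightarrow> X i \<in> carrier H"
    and rg: "relations_generated G H \<phi> r X K \<gamma> c"
    and fin: "finite (carrier (H Mod (\<phi> ` carrier G)))"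
  shows "clears_torsion (card (carrier (H Mod (\<phi> ` carrier G)))) r K c"
proof -
  interpret G: comm_group G by (rule G)
  interpret H: comm_group H by (rule H)
  interpret \<phi>: group_hom G H \<phi> using \<phi> by unfold_locales
  let ?I = "\<phi> ` carrier G" and ?m = "card (carrier (H Mod (\<phi> ` carrier G)))"
  have kill: "\<exists>n. \<forall>i<r. int ?m * b i = (\<Sum>j<K. n j * c j i)" for b
  proof -
    have "mon H r X b \<in> carrier H" using X by simp
    then have "mon H r X b [^]\<^bsub>H\<^esub> ?m \<in> ?I" by (rule order_kills_quotient[OF H \<phi>.img_is_subgroup fin])
    moreover have "mon H r X b [^]\<^bsub>H\<^esub> ?m = mon H r X (\<lambda>i. int ?m * b i)"
      using H.mon_scale[of r X "int ?m" b] X int_pow_int[of H "mon H r X b" ?m] by simp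
    ultimately obtain g where g: "g \<in> carrier G" "\<phi> g = mon H r X (\<lambda>i. int ?m * b i)" by (elim imageE) simp
    from rg[unfolded relations_generated_def, THEN conjunct2, THEN bspec, OF g(1), THEN spec, THEN mp, OF g(2)]
    obtain n where "\<forall>i<r. int ?m * b i = (\<Sum>j<K. n j * c j i)" by (elim exE conjE)
    then show ?thesis by (intro exI[of _ n])
  qed
  have "\<exists>d'. (\<forall>i. i \<notin> I \<longrightarrow> d' i = 0) \<and> (\<exists>n. \<forall>i<r. int ?m * b i - d' i = (\<Sum>j<K. n j * c j i))" for I :: "nat set" and b
    by (rule exI[of _ "\<lambda>_. 0"]) (simp add: kill)
  then show ?thesis unfolding clears_torsion_def by simp
qed

theorem corollary2p5p17:
  fixes \<Sigma> :: "nat set" and V :: "'a monoid" and P :: "'b monoid" and \<theta> :: "'a \<Rightarrow> 'b"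
  assumes "\<forall>l\<in>\<Sigma>. prime l"
    and "valuative_monoid V"
    and "sfp_hom V P \<theta>"
    and "\<Sigma> = {} \<or> etale_hom \<Sigma> V P \<theta>"
  shows "\<exists>(W :: 'a sat_alg monoid) h. kummer_etale_hom \<Sigma> V W h \<and>
    (let Q = saturation (pushout V W P h \<theta>);
         j = (\<lambda>w. gp_of (pushout V W P h \<theta>) (pushout_inl V W P h \<theta> w))
     in saturated_hom W Q j \<and> finitely_presented_hom W Q j)"
proof -
  have \<theta>: "\<theta> \<in> mhom V P" and sP: "saturated_monoid P" using assms(3) by (simp_all add: sfp_hom_def)
  have cV: "comm_monoid V" and cP: "comm_monoid P"
    using assms(2) sP by (simp_all add: valuative_monoid_def saturated_monoid_def integral_monoid_def)
  from sfp_relations[OF assms(2,3)] obtain r x K v c where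
    x: "\<forall>i<r. x i \<in> carrier P" and v: "\<forall>j<K. v j \<in> carrier V"
    and rg: "relations_generated (gp V) (gp P) (gp_map P \<theta>) r (\<lambda>i. gp_of P (x i)) K (\<lambda>j. gp_of V (v j)) c"
    and pow: "\<forall>p\<in>carrier P. \<exists>n\<ge>1. \<exists>u\<in>carrier V. \<exists>e. (\<forall>i. 0 \<le> e i) \<and>
      gp_of P p [^]\<^bsub>gp P\<^esub> (n::int) = gp_map P \<theta> (gp_of V u) \<otimes>\<^bsub>gp P\<^esub> mon (gp P) r (\<lambda>i. gp_of P (x i)) e"
    and gen: "\<forall>p\<in>carrier P. \<exists>g\<in>carrier (gp V). \<exists>e.
      gp_of P p = gp_map P \<theta> g \<otimes>\<^bsub>gp P\<^esub> mon (gp P) r (\<lambda>i. gp_of P (x i)) e"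
    by (elim exE conjE)
  have "\<exists>m\<ge>1. (\<forall>l\<in>\<Sigma>. coprime m l) \<and> clears_torsion m r K c"
  proof (cases "\<Sigma> = {}")
    case True
    then show ?thesis using torsion_exponent[of r K c] by simp
  next
    case False
    then have et: "etale_hom \<Sigma> V P \<theta>" using assms(4) by simp
    define C where "C = carrier (gp_cokernel V P \<theta>)"
    have C: "finite C" "\<forall>l\<in>\<Sigma>. coprime (card C) l"
      using et by (auto simp: etale_hom_def smooth_hom_def finite_order_prime_to_def C_def)
    have \<phi>: "gp_map P \<theta> \<in> hom (gp V) (gp P)" using gp_map_hom(1)[OF cV cP \<theta>] by (simp add: mhom_def)
    interpret GP: comm_group "gp P" by (rule gp_comm_group[OF cP])
    have "C \<noteq> {}" unfolding C_def gp_cokernel_def carrier_FactGroup by (simp add: gp_comm_group[OF cP] ex_in_conv[symmetric]) (rule exI, rule GP.one_closed)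
    then have "card C \<ge> 1" using C(1) by (simp add: Suc_le_eq card_gt_0_iff)
    moreover have "clears_torsion (card C) r K c"
      unfolding C_def gp_cokernel_def
      by (rule cokernel_order_clears_torsion[OF gp_comm_group[OF cV] gp_comm_group[OF cP] \<phi> _ rg])
        (use x mhom_closed[OF gp_of_hom[OF cP]] C(1) in \<open>simp_all add: C_def gp_cokernel_def\<close>)
    ultimately show ?thesis using C(2) by (intro exI[of _ "card C"] conjI)
  qed
  then obtain m where m: "m \<ge> 1" "\<forall>l\<in>\<Sigma>. coprime m l" and tors: "clears_torsion m r K c" by (elim exE conjE)
  interpret E: root_extension V m K v by (rule root_extension.intro) (use assms(2) m(1) v in simp_all)
  show ?thesis unfolding Let_def
  proof (rule exI[of _ E.W], rule exI[of _ E.h], intro conjI)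
    show "kummer_etale_hom \<Sigma> V E.W E.h" using assms(1) m(2) by (intro E.kummer_etale) simp
  qed (rule E.base_change[OF \<theta> sP x rg pow gen tors])+
qed

end
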